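(* Let $p>3$ be prime, $L=L_{2p^2}$ and $\Gamma=\Gamma_{2p^2}$. The boundary of the Baily-Borel compactification $\mathcal{F}_L(\Gamma)^*$ consists of curves $\mathcal{C}_a$ of type $a=1,2,p$ and $2p$, where a curve of type $1$ is isomorphic to $\mathbb{H}^+/\operatorname{PSL}(2,\mathbb{Z})$ and a curve of type $a\in\{2,p,2p\}$ is isomorphic to $\mathbb{H}^+/\Gamma_1(a)$; and of boundary points $p_1$, $p_2$, $p_p(k)$ ($k=1,\dots,p-1$) and $p_{2p}(k)$ ($k=0,\dots,(p-3)/2$). Furthermore, the closure $\overline{\mathcal{C}_a}$ of a boundary curve $\mathcal{C}_a$ of type $a$ contains the point $p_i$ or $p_i(k)$ (where $i\in\{1,2,p,2p\}$) if and only if $i\mid a$.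
   Context: A lattice is a free abelian group of finite rank with a non-degenerate even integral quadratic form $x^2=(x,x)$; $\langle m\rangle$ is the rank 1 lattice generated by an element of length $m$, and $U$ is the hyperbolic plane. $L_{2d}=2U\oplus\langle -2d\rangle\oplus\langle -6\rangle$ (signature $(2,4)$), with $\underline v$, $\underline w$ generators of the $\langle -2d\rangle$ and $\langle -6\rangle$ factors. For non-zero $x\in L$, $\operatorname{div}(x)$ is the positive generator of the ideal $(x,L)\subset\mathbb{Z}$, and $x^*=x/\operatorname{div}(x)\in L^\vee$. The discriminant group is $D(L)=L^\vee/L$; for $L=L_{2p^2}$, $D(L)\cong C_6\oplus C_{2p^2}$ and $(a,b)\in D(L)$ denotes the class of $a\underline w^*+b\underline v^*$, where $\underline w^*=\underline w/6$, $\underline v^*=\underline v/2p^2$. The real spinor norm is normalised so that the reflection $\sigma_w$ in $w$ has spinor norm $-(w,w)/2\in\mathbb{R}^*/(\mathbb{R}^* )^2$; $\operatorname{O}^+(L\otimes\mathbb{R})$ is its kernel and $\operatorname{O}^+(L)=\operatorname{O}(L)\cap \operatorname{O}^+(L\otimes\mathbb{R})$. Put $\Gamma_{2d}=\{g\in \operatorname{O}^+(L_{2d})\mid g\underline v^*\equiv\underline v^*\bmod L_{2d}\}$. $\mathcal{D}_L$ is the component of $\{[x]\in\mathbb{P}(L\otimes\mathbb{C})\mid (x,x)=0,(x,\overline x)>0\}$ preserved by $\operatorname{O}^+(L\otimes\mathbb{R})$, and $\mathcal{F}_L(\Gamma)=\mathcal{D}_L/\Gamma$. Its Baily-Borel compactification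 $\mathcal{F}_L(\Gamma)^*$ decomposes as $\mathcal{F}_L(\Gamma)\sqcup\bigsqcup_E\mathcal{C}_E\sqcup\bigsqcup_l P_l$, where $E$ (resp. $l$) runs over representatives of $\Gamma$-orbits of primitive totally isotropic sublattices of rank 2 (resp. rank 1) of $L$, each $P_l$ is a point and each $\mathcal{C}_E$ is a curve isomorphic to $\mathbb{H}^+/G(E)$, $G(E)=\operatorname{Stab}_\Gamma(E)/\operatorname{Fix}_\Gamma(E)$, with $\mathbb{H}^+$ the upper half plane identified with $\mathbb{P}(E\otimes\mathbb{C})\cap\overline{\mathcal{D}}_L$. $P_l$ lies in the closure of $\mathcal{C}_E$ if and only if representatives can be chosen with $l\subset E$. Type: for every $E$ there is a $\mathbb{Z}$-basis $\{v_1,\dots,v_6\}$ of $L$ with $\{v_1,v_2\}$ a basis of $E$, $\{v_1,\dots,v_4\}$ a basis of $E^\perp$, and $((v_i,v_j))_{i=1,2;\,j=5,6}=\begin{pmatrix}0&a\\1&0\end{pmatrix}$ with $a\in\{1,2,p,2p\}$; $E$ and $\mathcal{C}_E$ are then said to be of type $a$. Boundary points: for a primitive isotropic $v\in L$ (taken up to sign), the point $P_{\langle v\rangle}$ is denoted $p_1$ if $v^*\equiv(0,0)\bmod L$; $p_2$ if $v^*\equiv(3,p^2)\bmod L$; $p_p(k)$ if $v^*\equiv(0,2kp)\bmod L$, $k=1,\dots,p-1$; $p_{2p}(k)$ if $v^*\equiv(3,(2k+1)p)\bmod L$, $k=0,\dots,(p-3)/2$. $\Gamma_1(n)=\{Z\in\operatorname{SL}(2,\mathbb{Z})\mid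 Z\equiv\begin{pmatrix}1&0\\ *&1\end{pmatrix}\bmod n\}$. *)

theory Defs
  imports "HOL-Analysis.Analysis"
begin

section \<open>The lattice and its discriminant group\<close>

text \<open>
  The lattice \<open>L = 2U \<oplus> \<langle>-2d\<rangle> \<oplus> \<langle>-6\<rangle>\<close> is \<open>int ^ 6\<close> with the form below, in coordinates with
  respect to two standard hyperbolic pairs, followed by the generators \<open>v\<close> (length \<open>-2d\<close>) and
  \<open>w\<close> (length \<open>-6\<close>). The same formula over \<open>real ^ 6\<close> and \<open>complex ^ 6\<close> is the (bilinear)
  extension to \<open>L \<otimes> \<real>\<close> and \<open>L \<otimes> \<complex>\<close>.
\<close>

definition bil :: "nat \<Rightarrow> 'a::comm_ring_1 ^ 6 \<Rightarrow> 'a ^ 6 \<Rightarrow> 'a" where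
  "bil d x y = x $ 1 * y $ 2 + x $ 2 * y $ 1 + x $ 3 * y $ 4 + x $ 4 * y $ 3
     - 2 * of_nat d * x $ 5 * y $ 5 - 6 * x $ 6 * y $ 6"

definition emb :: "int ^ 6 \<Rightarrow> 'a::comm_ring_1 ^ 6" where
  "emb x = (\<chi> i. of_int (x $ i))"

definition z_basis :: "(nat \<Rightarrow> int ^ 6) \<Rightarrow> nat set \<Rightarrow> (int ^ 6) set \<Rightarrow> bool" where
  "z_basis b I E \<longleftrightarrow>
     (\<forall>c. (\<Sum>i\<in>I. c i *s b i) = 0 \<longrightarrow> (\<forall>i\<in>I. c i = 0)) \<and>
     E = range (\<lambda>c. \<Sum>i\<in>I. c i *s b i)"

definition lperp :: "nat \<Rightarrow> (int ^ 6) set \<Rightarrow> (int ^ 6) set" where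
  "lperp d E = {x. \<forall>y\<in>E. bil d x y = 0}"

text \<open>Primitive totally isotropic sublattices of rank \<open>r\<close>.\<close>

definition isotropic :: "nat \<Rightarrow> nat \<Rightarrow> (int ^ 6) set set" where
  "isotropic d r = {E. (\<exists>b. z_basis b {1..r} E)
     \<and> (\<forall>n x. n \<noteq> 0 \<longrightarrow> n *s x \<in> E \<longrightarrow> x \<in> E)
     \<and> (\<forall>x\<in>E. \<forall>y\<in>E. bil d x y = 0)}"

definition has_type :: "nat \<Rightarrow> nat \<Rightarrow> (int ^ 6) set \<Rightarrow> bool" where
  "has_type d a E \<longleftrightarrow> (\<exists>v. z_basis v {1..6} UNIV \<and> z_basis v {1..2} E \<and> z_basis v {1..4} (lperp d E)
     \<and> bil d (v 1) (v 5) = 0 \<and> bil d (v 1) (v 6) = int a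
     \<and> bil d (v 2) (v 5) = 1 \<and> bil d (v 2) (v 6) = 0)"

definition ldiv :: "nat \<Rightarrow> int ^ 6 \<Rightarrow> int" where
  "ldiv d x = (THE n. 0 < n \<and> range (bil d x) = range (\<lambda>k. n * k))"

definition lstar :: "nat \<Rightarrow> int ^ 6 \<Rightarrow> real ^ 6" where
  "lstar d x = (1 / of_int (ldiv d x)) *s emb x"

definition cong_L :: "real ^ 6 \<Rightarrow> real ^ 6 \<Rightarrow> bool" where
  "cong_L x y \<longleftrightarrow> x - y \<in> range emb"

definition vstar :: "nat \<Rightarrow> real ^ 6" where
  "vstar d = (1 / (2 * real d)) *s axis 5 1"

definition wstar :: "real ^ 6" where
  "wstar = (1 / 6) *s axis 6 1"

section \<open>Orthogonal groups\<close>

definition reflection :: "nat \<Rightarrow> real ^ 6 \<Rightarrow> real ^ 6 \<Rightarrow> real ^ 6" where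
  "reflection d w x = x - (2 * bil d x w / bil d w w) *s w"

text \<open>
  The kernel of the real spinor norm. The spinor norm of a product of reflections
  \<open>\<sigma>\<^sub>1 \<circ> \<dots> \<circ> \<sigma>\<^sub>k\<close> in vectors \<open>w\<^sub>i\<close> is the class of \<open>\<Prod>\<^sub>i -(w\<^sub>i, w\<^sub>i) / 2\<close> modulo squares;
  it does not depend on the factorisation.
\<close>

definition O_plus_real :: "nat \<Rightarrow> (real ^ 6 ^ 6) set" where
  "O_plus_real d = {g. \<exists>ws. (\<forall>w\<in>set ws. bil d w w \<noteq> 0)
     \<and> (\<forall>x. g *v x = foldr (reflection d) ws x)
     \<and> (\<exists>r. r \<noteq> 0 \<and> (\<Prod>w\<leftarrow>ws. - bil d w w / 2) = r\<^sup>2)}"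

definition O_plus :: "nat \<Rightarrow> (int ^ 6 ^ 6) set" where
  "O_plus d = {g. (\<forall>x y. bil d (g *v x) (g *v y) = bil d x y) \<and> map_matrix of_int g \<in> O_plus_real d}"

definition Gamma_L :: "nat \<Rightarrow> (int ^ 6 ^ 6) set" where
  "Gamma_L d = {g \<in> O_plus d. cong_L (map_matrix of_int g *v vstar d) (vstar d)}"

section \<open>Quotients\<close>

definition orbit_of :: "('a \<Rightarrow> 'a) set \<Rightarrow> 'a \<Rightarrow> 'a set" where
  "orbit_of T x = (\<lambda>t. t x) ` T"

definition quotient_topology :: "'a topology \<Rightarrow> ('a \<Rightarrow> 'b) \<Rightarrow> 'b topology" where
  "quotient_topology X q =
     topology (\<lambda>U. U \<subseteq> q ` topspace X \<and> openin X {x \<in> topspace X. q x \<in> U})"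

lemma openin_quotient_topology:
  "openin (quotient_topology X q) U \<longleftrightarrow>
     U \<subseteq> q ` topspace X \<and> openin X {x \<in> topspace X. q x \<in> U}"
proof -
  have "istopology (\<lambda>U. U \<subseteq> q ` topspace X \<and> openin X {x \<in> topspace X. q x \<in> U})"
    unfolding istopology_def
  proof (intro conjI allI impI)
    fix S T
    assume "S \<subseteq> q ` topspace X \<and> openin X {x \<in> topspace X. q x \<in> S}"
      and "T \<subseteq> q ` topspace X \<and> openin X {x \<in> topspace X. q x \<in> T}"
    moreover have "{x \<in> topspace X. q x \<in> S \<inter> T} =
        {x \<in> topspace X. q x \<in> S} \<inter> {x \<in> topspace X. q x \<in> T}"
      by auto
    ultimately show "S \<inter> T \<subseteq> q ` topspace X" "openin X {x \<in> topspace X. q x \<in> S \<inter> T}"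
      by auto
  next
    fix K
    assume K: "\<forall>U\<in>K. U \<subseteq> q ` topspace X \<and> openin X {x \<in> topspace X. q x \<in> U}"
    then show "\<Union>K \<subseteq> q ` topspace X" by blast
    have "{x \<in> topspace X. q x \<in> \<Union>K} = (\<Union>U\<in>K. {x \<in> topspace X. q x \<in> U})"
      by auto
    then show "openin X {x \<in> topspace X. q x \<in> \<Union>K}"
      using K by auto
  qed
  then show ?thesis
    by (simp add: quotient_topology_def topology_inverse')
qed

lemma topspace_quotient_topology [simp]:
  "topspace (quotient_topology X q) = q ` topspace X"
proof -
  have "{x \<in> topspace X. q x \<in> q ` topspace X} = topspace X" by auto
  then have "openin (quotient_topology X q) (q ` topspace X)"
    by (simp add: openin_quotient_topology)
  then show ?thesis
    by (metis openin_quotient_topology openin_subset openin_topspace subset_antisym)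
qed

lemma quotient_map_quotient_topology: "quotient_map X (quotient_topology X q) q"
  by (auto simp: quotient_map_def openin_quotient_topology)

section \<open>The period domain and its rational boundary components\<close>

text \<open>
  Points of \<open>\<P>(L \<otimes> \<complex>)\<close> are one-dimensional subspaces of \<open>complex ^ 6\<close>. The two components of the
  set of \<open>[x]\<close> with \<open>(x, x) = 0\<close>, \<open>(x, cnj x) > 0\<close> are represented by the components of the
  affine cone over it (the fibres \<open>\<complex> - {0}\<close> are connected). Throughout, \<open>\<Omega>\<close> stands for one of these
  two components; each of them is preserved by \<open>O_plus_real\<close>.
\<close>

definition vcnj :: "complex ^ 6 \<Rightarrow> complex ^ 6" where
  "vcnj z = (\<chi> i. cnj (z $ i))"

definition period_cone :: "nat \<Rightarrow> (complex ^ 6) set" where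
  "period_cone d = {z. bil d z z = 0 \<and> Re (bil d z (vcnj z)) > 0}"

definition line :: "complex ^ 6 \<Rightarrow> (complex ^ 6) set" where
  "line z = vec.span {z}"

definition cspan :: "(int ^ 6) set \<Rightarrow> (complex ^ 6) set" where
  "cspan E = vec.span (emb ` E)"

text \<open>Open subsets of a set \<open>S\<close> of points of projective space, in the classical topology.\<close>

definition proj_openin :: "(complex ^ 6) set set \<Rightarrow> (complex ^ 6) set set \<Rightarrow> bool" where
  "proj_openin S U \<longleftrightarrow> U \<subseteq> S \<and>
     openin (top_of_set {z. z \<noteq> 0 \<and> line z \<in> S}) {z. z \<noteq> 0 \<and> line z \<in> U}"

definition half_plane :: "(complex ^ 6) set \<Rightarrow> (int ^ 6) set \<Rightarrow> (complex ^ 6) set set" where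
  \<comment> \<open>the points of \<open>\<P>(E \<otimes> \<complex>)\<close> in the closure of the domain that are not real; the real ones among
     them with rational coordinates are the zero-dimensional boundary components\<close>
  "half_plane \<Omega> E = {line z | z. z \<in> cspan E \<and> z \<in> closure \<Omega> \<and> vcnj z \<notin> line z}"

definition rational_closure :: "nat \<Rightarrow> (complex ^ 6) set \<Rightarrow> (complex ^ 6) set set" where
  "rational_closure d \<Omega> = line ` \<Omega> \<union> (\<Union>E\<in>isotropic d 2. half_plane \<Omega> E) \<union> cspan ` isotropic d 1"

section \<open>The Satake--Baily--Borel topology\<close>

text \<open>
  The projection of the domain onto the boundary component of \<open>E\<close>. Under the identification of
  \<open>\<P>(E \<otimes> \<complex>)\<close> with the projective space of the dual (a functional corresponds to its kernel)
  it is the linear projection that restricts \<open>(\<cdot>, z)\<close> to \<open>E\<close>.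
\<close>

definition proj_to :: "nat \<Rightarrow> (int ^ 6) set \<Rightarrow> complex ^ 6 \<Rightarrow> (complex ^ 6) set" where
  "proj_to d E z = {x \<in> cspan E. bil d x z = 0}"

text \<open>
  Neighbourhoods of points of a one-dimensional boundary component. In Siegel domain coordinates
  \<open>(\<tau>, \<zeta>, \<omega>)\<close> attached to \<open>E\<close> the inequality reads \<open>Im \<omega> - h\<^sub>\<tau>(\<zeta>, \<zeta>) > C\<close>, up to a factor
  that is locally bounded in \<open>\<tau>\<close>.
\<close>

definition nbhd_curve ::
  "nat \<Rightarrow> (complex ^ 6) set \<Rightarrow> (int ^ 6) set \<Rightarrow> (complex ^ 6) set set \<Rightarrow> int ^ 6 \<Rightarrow> real
     \<Rightarrow> (complex ^ 6) set set" where
  "nbhd_curve d \<Omega> E V v C = V \<union>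
     {line z | z. z \<in> \<Omega> \<and> proj_to d E z \<in> V \<and>
        Re (bil d z (vcnj z)) > C * (cmod (bil d z (emb v)))\<^sup>2}"

text \<open>
  Neighbourhoods of a zero-dimensional boundary component \<open>l\<close>. In a coordinate \<open>s\<close> on the half
  plane of \<open>E \<supset> l\<close> for which \<open>l\<close> lies at infinity, \<open>horoball\<close> is \<open>\<bar>Im s\<bar> > C\<close>; the choice of \<open>v\<close>, \<open>e\<close>
  only changes \<open>s\<close> by a sign and an integral translation. On the tube domain with imaginary part
  \<open>y\<close> in the positive cone of \<open>l\<^sup>\<bottom> / l\<close>, the condition in \<open>nbhd_point\<close> says \<open>(y, e) > C\<close> for all
  primitive isotropic \<open>e\<close> in the closure of the cone.
\<close>

definition horoball :: "(complex ^ 6) set \<Rightarrow> (int ^ 6) set \<Rightarrow> (int ^ 6) set \<Rightarrow> real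
    \<Rightarrow> (complex ^ 6) set set" where
  "horoball \<Omega> l E C = {P \<in> half_plane \<Omega> E. \<exists>b s. z_basis b {1..1} l \<and> z_basis b {1..2} E \<and>
     P = line (s *s emb (b 1) + emb (b 2)) \<and> \<bar>Im s\<bar> > C}"

definition nbhd_point :: "nat \<Rightarrow> (complex ^ 6) set \<Rightarrow> (int ^ 6) set \<Rightarrow> real
    \<Rightarrow> (complex ^ 6) set set" where
  "nbhd_point d \<Omega> l C = {cspan l} \<union>
     (\<Union>E\<in>{E \<in> isotropic d 2. l \<subseteq> E}. horoball \<Omega> l E C) \<union>
     {line z | z. z \<in> \<Omega> \<and> (\<forall>E\<in>isotropic d 2. l \<subseteq> E \<longrightarrow> proj_to d E z \<in> horoball \<Omega> l E C)}"

definition satake_topology :: "nat \<Rightarrow> (complex ^ 6) set \<Rightarrow> (complex ^ 6) set topology" where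
  "satake_topology d \<Omega> = topology_generated_by
     ({U. proj_openin (line ` \<Omega>) U} \<union>
      {nbhd_curve d \<Omega> E V v C | E V v C.
         E \<in> isotropic d 2 \<and> proj_openin (half_plane \<Omega> E) V \<and> v \<in> E \<and> v \<noteq> 0 \<and> C > 0} \<union>
      {nbhd_point d \<Omega> l C | l C. l \<in> isotropic d 1 \<and> C > 0})"

section \<open>The Baily--Borel compactification\<close>

definition line_action :: "(int ^ 6 ^ 6) set \<Rightarrow> ((complex ^ 6) set \<Rightarrow> (complex ^ 6) set) set" where
  "line_action G = (\<lambda>g P. (\<lambda>z. map_matrix of_int g *v z) ` P) ` G"

text \<open>Points of the compactification are \<open>G\<close>-orbits in the rational closure.\<close>

definition bb_orbit :: "(int ^ 6 ^ 6) set \<Rightarrow> (complex ^ 6) set \<Rightarrow> (complex ^ 6) set set" where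
  "bb_orbit G = orbit_of (line_action G)"

definition baily_borel ::
  "nat \<Rightarrow> (complex ^ 6) set \<Rightarrow> (int ^ 6 ^ 6) set \<Rightarrow> (complex ^ 6) set set topology" where
  "baily_borel d \<Omega> G = quotient_topology (satake_topology d \<Omega>) (bb_orbit G)"

definition bb_boundary ::
  "nat \<Rightarrow> (complex ^ 6) set \<Rightarrow> (int ^ 6 ^ 6) set \<Rightarrow> (complex ^ 6) set set set" where
  "bb_boundary d \<Omega> G = topspace (baily_borel d \<Omega> G) - bb_orbit G ` line ` \<Omega>"

definition bb_curve ::
  "(complex ^ 6) set \<Rightarrow> (int ^ 6 ^ 6) set \<Rightarrow> (int ^ 6) set \<Rightarrow> (complex ^ 6) set set set" where
  "bb_curve \<Omega> G E = bb_orbit G ` half_plane \<Omega> E"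

definition bb_point :: "(int ^ 6 ^ 6) set \<Rightarrow> (int ^ 6) set \<Rightarrow> (complex ^ 6) set set" where
  "bb_point G l = bb_orbit G (cspan l)"

text \<open>
  The set of all boundary points \<open>P\<^sub>l\<close>, where \<open>l\<close> is generated by a primitive isotropic \<open>v\<close> whose
  \<open>v\<^sup>*\<close> has class \<open>(a, b)\<close> in the discriminant group. As \<open>v\<close> and \<open>-v\<close> generate the same \<open>l\<close>, a
  point can have the two classes \<open>(a, b)\<close> and \<open>(-a, -b)\<close>.
\<close>

definition bb_points_of_class ::
  "nat \<Rightarrow> (int ^ 6 ^ 6) set \<Rightarrow> int \<Rightarrow> int \<Rightarrow> (complex ^ 6) set set set" where
  "bb_points_of_class d G a b = {bb_point G (range (\<lambda>n. n *s v)) | v.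
     range (\<lambda>n. n *s v) \<in> isotropic d 1 \<and>
     cong_L (lstar d v) (of_int a *s wstar + of_int b *s vstar d)}"

section \<open>Analytic curves\<close>

text \<open>
  A complex curve is given by its topology together with its holomorphic functions: the second
  component says which functions are holomorphic on which open sets. A quotient carries the sheaf
  of functions whose pullback is holomorphic.
\<close>

type_synonym 'a curve = "'a topology \<times> ('a set \<Rightarrow> ('a \<Rightarrow> complex) \<Rightarrow> bool)"

definition curve_iso :: "'a curve \<Rightarrow> 'b curve \<Rightarrow> bool" where
  "curve_iso A B \<longleftrightarrow> (\<exists>\<phi>. homeomorphic_map (fst A) (fst B) \<phi> \<and>
     (\<forall>W f. openin (fst B) W \<longrightarrow>
        (snd B W f \<longleftrightarrow> snd A {x \<in> topspace (fst A). \<phi> x \<in> W} (f \<circ> \<phi>))))"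

definition upper_half_plane :: "complex set" where
  "upper_half_plane = {\<tau>. Im \<tau> > 0}"

definition upper_half_plane_quotient :: "(complex \<Rightarrow> complex) set \<Rightarrow> complex set curve" where
  "upper_half_plane_quotient T =
     (quotient_topology (top_of_set upper_half_plane) (orbit_of T),
      \<lambda>W f. (f \<circ> orbit_of T) holomorphic_on {\<tau> \<in> upper_half_plane. orbit_of T \<tau> \<in> W})"

definition moebius_map :: "int ^ 2 ^ 2 \<Rightarrow> complex \<Rightarrow> complex" where
  "moebius_map Z \<tau> = (of_int (Z $ 1 $ 1) * \<tau> + of_int (Z $ 1 $ 2)) /
     (of_int (Z $ 2 $ 1) * \<tau> + of_int (Z $ 2 $ 2))"

definition SL2Z :: "(int ^ 2 ^ 2) set" where
  "SL2Z = {Z. det Z = 1}"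

text \<open>\<open>PSL(2, \<int>)\<close> as the group of Moebius transformations: \<open>Z\<close> and \<open>-Z\<close> have the same image.\<close>

definition PSL2Z :: "(complex \<Rightarrow> complex) set" where
  "PSL2Z = moebius_map ` SL2Z"

definition Gamma1 :: "nat \<Rightarrow> (int ^ 2 ^ 2) set" where
  "Gamma1 n = {Z \<in> SL2Z. int n dvd Z $ 1 $ 1 - 1 \<and> int n dvd Z $ 1 $ 2 \<and> int n dvd Z $ 2 $ 2 - 1}"

text \<open>
  The boundary curve of \<open>E\<close> as a subspace of the compactification. Its holomorphic functions are
  those with holomorphic pullback to the half plane of \<open>E\<close>, expressed in the affine
  coordinate \<open>\<tau> \<mapsto> [\<tau> b\<^sub>1 + b\<^sub>2]\<close> of \<open>\<P>(E \<otimes> \<complex>)\<close>; the point \<open>[b\<^sub>1]\<close> that it misses is real.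
\<close>

definition bb_curve_structure ::
  "nat \<Rightarrow> (complex ^ 6) set \<Rightarrow> (int ^ 6 ^ 6) set \<Rightarrow> (int ^ 6) set \<Rightarrow> (complex ^ 6) set set curve" where
  "bb_curve_structure d \<Omega> G E =
     (subtopology (baily_borel d \<Omega> G) (bb_curve \<Omega> G E),
      \<lambda>W f. \<forall>b. z_basis b {1..2} E \<longrightarrow>
        (\<lambda>\<tau>. f (bb_orbit G (line (\<tau> *s emb (b 1) + emb (b 2))))) holomorphic_on
          {\<tau>. line (\<tau> *s emb (b 1) + emb (b 2)) \<in> half_plane \<Omega> E \<and>
              bb_orbit G (line (\<tau> *s emb (b 1) + emb (b 2))) \<in> W})"

end

theory Submission
  imports Defs
begin

text \<open>
  On the two hyperbolic planes, which form the integral \<open>2 \<times> 2\<close> matrices with the determinant, Eichler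
  transvections act as row and column operations. Hence Smith normal form brings a primitive isotropic
  \<open>v\<close> of divisor \<open>n\<close> into a shape that depends only on \<open>n\<close> and \<open>v\<^sup>*\<close> modulo \<open>L\<close>. The equation
  \<open>(v, v) = 0\<close> modulo \<open>4\<close> and \<open>p\<^sup>2\<close> leaves \<open>n = 1, 2, p, 2 p\<close>, and the classes up to sign are the points.

  An isotropic plane has a basis \<open>e, f\<close> of divisors \<open>a\<close> and \<open>1\<close>, so \<open>a\<close> is one of these \<open>n\<close>. As \<open>\<Gamma>\<close> fixes
  \<open>v\<^sup>*\<close> modulo \<open>L\<close> for all isotropic \<open>v\<close>, an element of the stabiliser maps \<open>e\<close> to \<open>e\<close> modulo \<open>a\<close>, that is,
  it acts on the plane by a matrix of \<open>\<Gamma>\<^sub>1(a)\<close>; conversely all these matrices extend to \<open>\<Gamma>\<close>. The vector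
  \<open>x e + y f\<close> pairs with \<open>L\<close> to \<open>a x\<close> and \<open>y\<close>, so a primitive vector of the plane has a divisor \<open>i\<close>
  dividing \<open>a\<close>, and for \<open>i\<close> dividing \<open>a\<close> all classes with divisor \<open>i\<close> occur in the plane.

  In the Satake topology a half plane carries its usual topology, and the horoballs at a rational line
  \<open>l\<close> meet exactly the half planes of those \<open>E\<close> that contain \<open>l\<close>. This gives the closure relation.
\<close>

text \<open>Membership in \<open>Gamma_L\<close> asks for a factorisation into reflections with
  square spinor norm. Eichler transvections supply it: each is a product of two reflections in
  vectors of equal length, or of two such products. The elements constructed explicitly act
  trivially on the whole discriminant group, which is more than fixing the class of
  \<open>vstar\<close>. In the other direction only the class of \<open>vstar\<close> is known to be
  fixed, and it suffices: modulo p an isotropic vector with divisor divisible by p is a multiple of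
  the generator behind \<open>vstar\<close>, and modulo 2 the coordinates have forced parities. The
  obstacle in extending \<open>\<Gamma>\<^sub>1(a)\<close> is that a vector e' with (e, e') = a
  cannot in general be made isotropic over the integers, so the natural action on the plane and its
  dual has denominators, which a rational transvection must cancel. Both components of the period
  cone have to be treated. A sign separates them, the orientation of the projection to a fixed
  positive definite plane; the same sign decides which half of the projective line of an isotropic
  plane is its boundary component.\<close>

lemma exhaust_6:
  fixes x :: 6
  shows "x = 1 \<or> x = 2 \<or> x = 3 \<or> x = 4 \<or> x = 5 \<or> x = 6"
proof (induct x)
  case (of_int z)
  then have "0 \<le> z" and "z < 6" by simp_all
  then have "z = 0 \<or> z = 1 \<or> z = 2 \<or> z = 3 \<or> z = 4 \<or> z = 5" by arith
  then show ?case by auto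
qed

lemma forall_6: "(\<forall>i::6. P i) \<longleftrightarrow> P 1 \<and> P 2 \<and> P 3 \<and> P 4 \<and> P 5 \<and> P 6"
  by (metis exhaust_6)

lemma UNIV_6: "UNIV = {1, 2, 3, 4, 5, 6::6}"
  using exhaust_6 by auto

section \<open>The bilinear form and the embedding of the lattice\<close>

lemma bil_add_left: "bil d (x + y) z = bil d x z + bil d y z"
  and bil_add_right: "bil d z (x + y) = bil d z x + bil d z y"
  and bil_diff_left: "bil d (x - y) z = bil d x z - bil d y z"
  and bil_diff_right: "bil d z (x - y) = bil d z x - bil d z y"
  and bil_smult_left: "bil d (c *s x) z = c * bil d x z"
  and bil_smult_right: "bil d z (c *s x) = c * bil d z x"
  and bil_minus_left: "bil d (- x) z = - bil d x z"
  and bil_minus_right: "bil d z (- x) = - bil d z x"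
  and bil_zero_left [simp]: "bil d 0 z = 0"
  and bil_zero_right [simp]: "bil d z 0 = 0"
  by (simp_all add: bil_def algebra_simps)

lemmas bil_linear = bil_add_left bil_add_right bil_diff_left bil_diff_right bil_smult_left
  bil_smult_right bil_minus_left bil_minus_right

lemma bil_commute: "bil d x y = bil d y x"
  by (simp add: bil_def algebra_simps)

lemma bil_axis:
  "bil d x (axis 1 1) = x $ 2" "bil d x (axis 2 1) = x $ 1"
  "bil d x (axis 3 1) = x $ 4" "bil d x (axis 4 1) = x $ 3"
  "bil d x (axis 5 1) = - 2 * of_nat d * x $ 5" "bil d x (axis 6 1) = - 6 * x $ 6"
  by (simp_all add: bil_def axis_def)

lemma emb_add: "emb (x + y) = emb x + emb y"
  and emb_diff: "emb (x - y) = emb x - emb y"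
  and emb_minus: "emb (- x) = - emb x"
  and emb_smult: "emb (n *s x) = of_int n *s emb x"
  and emb_zero [simp]: "emb 0 = 0"
  and emb_axis: "emb (axis i 1) = axis i 1"
  by (simp_all add: emb_def vec_eq_iff axis_def)

lemmas emb_linear = emb_add emb_diff emb_minus emb_smult

lemma emb_eq_iff [simp]: "emb x = (emb y :: 'a::{comm_ring_1,ring_char_0} ^ 6) \<longleftrightarrow> x = y"
  by (simp add: emb_def vec_eq_iff)

lemma bil_emb: "bil d (emb x) (emb y) = of_int (bil d x y)"
  by (simp add: bil_def emb_def)

lemma emb_matrix_vector: "map_matrix of_int g *v emb x = (emb (g *v x) :: 'a::comm_ring_1 ^ 6)"
  by (simp add: vec_eq_iff matrix_vector_mult_def emb_def map_matrix_def)

section \<open>Real spinor norm and Eichler transvections\<close>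

text \<open>Linearity over an arbitrary commutative ring, so that one notion serves integral, real
  and complex coordinates.\<close>

definition lin :: "('a::comm_ring_1 ^ 'n \<Rightarrow> 'a ^ 'm) \<Rightarrow> bool" where
  "lin f \<longleftrightarrow> (\<forall>x y. f (x + y) = f x + f y) \<and> (\<forall>c x. f (c *s x) = c *s f x)"

lemma lin_matrix: "lin ((*v) M)"
  by (simp add: lin_def vec_eq_iff matrix_vector_mult_def sum_distrib_left algebra_simps sum.distrib)

lemma lin_comp: "lin f \<Longrightarrow> lin g \<Longrightarrow> lin (\<lambda>x. f (g x))"
  by (simp add: lin_def)

lemma lin_eq_axis:
  assumes "lin f" "lin g" "\<And>i. f (axis i 1) = g (axis i 1)"
  shows "f x = g x"
proof -
  have sum: "h (\<Sum>i\<in>A. x $ i *s axis i 1) = (\<Sum>i\<in>A. x $ i *s h (axis i 1))"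
    if "lin h" for h :: "'a ^ 'b \<Rightarrow> 'a ^ 'c" and A
  proof -
    have "h 0 = 0" using that by (metis lin_def vector_smult_lzero)
    then show ?thesis using that by (induction A rule: infinite_finite_induct) (auto simp: lin_def)
  qed
  show ?thesis
    using sum[OF assms(1), of UNIV] sum[OF assms(2), of UNIV] assms(3)
    by (simp add: basis_expansion)
qed

lemma matrix_of_lin:
  assumes "lin f"
  shows "matrix f *v x = f x"
  by (rule lin_eq_axis[OF lin_matrix assms])
    (simp add: matrix_def vec_eq_iff matrix_vector_mult_def axis_def if_distrib cong: if_cong)

text \<open>The condition of \<open>O_plus_real\<close> for maps instead of matrices, so that maps
  given by formulas can be composed directly.\<close>

definition spin :: "nat \<Rightarrow> (real ^ 6 \<Rightarrow> real ^ 6) \<Rightarrow> bool" where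
  "spin d f \<longleftrightarrow> (\<exists>ws. (\<forall>w\<in>set ws. bil d w w \<noteq> 0) \<and> (\<forall>x. f x = foldr (reflection d) ws x)
     \<and> (\<exists>r. r \<noteq> 0 \<and> (\<Prod>w\<leftarrow>ws. - bil d w w / 2) = r\<^sup>2))"

lemma O_plus_real_iff: "g \<in> O_plus_real d \<longleftrightarrow> spin d ((*v) g)"
  by (simp add: O_plus_real_def spin_def)

lemma spin_id: "spin d (\<lambda>x. x)"
  unfolding spin_def by (intro exI[of _ "[]"] conjI exI[of _ "1::real"]) simp_all

lemma spin_comp:
  assumes "spin d f" "spin d g"
  shows "spin d (\<lambda>x. f (g x))"
proof -
  from assms obtain ws r vs s where
    *: "\<forall>w\<in>set ws. bil d w w \<noteq> 0" "\<forall>x. f x = foldr (reflection d) ws x" "r \<noteq> 0"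
    "(\<Prod>w\<leftarrow>ws. - bil d w w / 2) = r\<^sup>2"
    "\<forall>w\<in>set vs. bil d w w \<noteq> 0" "\<forall>x. g x = foldr (reflection d) vs x" "s \<noteq> 0"
    "(\<Prod>w\<leftarrow>vs. - bil d w w / 2) = s\<^sup>2"
    unfolding spin_def by blast
  then show ?thesis
    unfolding spin_def
    by (intro exI[of _ "ws @ vs"] conjI exI[of _ "r * s"]) (auto simp: power_mult_distrib)
qed

lemma reflection_lin: "lin (reflection d w)"
  by (simp add: lin_def reflection_def bil_linear vec_eq_iff algebra_simps add_divide_distrib)

lemma reflection_isometry:
  assumes "bil d w w \<noteq> 0"
  shows "bil d (reflection d w x) (reflection d w y) = bil d x y"
proof -
  define q where "q = bil d w w"
  have "q \<noteq> 0" using assms by (simp add: q_def)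
  then show ?thesis
    by (simp add: reflection_def bil_linear bil_commute[of d w x] bil_commute[of d w y] q_def[symmetric] field_simps)
qed

lemma reflection_involution:
  assumes "bil d w w \<noteq> 0"
  shows "reflection d w (reflection d w x) = x"
proof -
  have "bil d (reflection d w x) w = - bil d x w"
    using assms by (simp add: reflection_def bil_linear)
  then show ?thesis
    by (simp add: reflection_def[of d w "reflection d w x"]) (simp add: reflection_def vec_eq_iff)
qed

lemma foldr_reflection_lin: "lin (foldr (reflection d) ws)"
  using reflection_lin by (induction ws) (auto simp: lin_def)

lemma foldr_reflection_isometry:
  "\<forall>w\<in>set ws. bil d w w \<noteq> 0 \<Longrightarrow>
     bil d (foldr (reflection d) ws x) (foldr (reflection d) ws y) = bil d x y"
  by (induction ws) (auto simp: reflection_isometry)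

lemma foldr_reflection_rev:
  "\<forall>w\<in>set ws. bil d w w \<noteq> 0 \<Longrightarrow>
     foldr (reflection d) (rev ws) (foldr (reflection d) ws x) = x"
  by (induction ws arbitrary: x) (auto simp: reflection_involution)

lemma spin_lin: "spin d f \<Longrightarrow> lin f"
  unfolding spin_def using foldr_reflection_lin[of d] by (auto simp: lin_def)

lemma spin_isometry: "spin d f \<Longrightarrow> bil d (f x) (f y) = bil d x y"
  unfolding spin_def by (auto simp: foldr_reflection_isometry)

text \<open>Reflections are involutions, so the reversed list gives the inverse, and the product of
  the lengths does not change.\<close>

lemma spin_inverse:
  assumes "spin d f"
  shows "\<exists>h. spin d h \<and> (\<forall>x. h (f x) = x) \<and> (\<forall>x. f (h x) = x)"
proof -
  from assms obtain ws r where
    *: "\<forall>w\<in>set ws. bil d w w \<noteq> 0" "\<forall>x. f x = foldr (reflection d) ws x" "r \<noteq> 0"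
    "(\<Prod>w\<leftarrow>ws. - bil d w w / 2) = r\<^sup>2"
    unfolding spin_def by blast
  have "spin d (foldr (reflection d) (rev ws))"
    unfolding spin_def using * by (intro exI[of _ "rev ws"] conjI exI[of _ r])
      (auto simp: rev_map[symmetric])
  moreover have "foldr (reflection d) ws (foldr (reflection d) (rev ws) x) = x" for x
    using foldr_reflection_rev[of "rev ws" d x] * by simp
  ultimately show ?thesis
    using * foldr_reflection_rev[of ws d] by (intro exI[of _ "foldr (reflection d) (rev ws)"]) auto
qed

text \<open>The Eichler transvection of u and w. It is an isometry when u is isotropic and w is
  orthogonal to u.\<close>

definition transvection :: "nat \<Rightarrow> real ^ 6 \<Rightarrow> real ^ 6 \<Rightarrow> real ^ 6 \<Rightarrow> real ^ 6" where
  "transvection d u w x =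
     x - bil d w x *s u + bil d u x *s w - (bil d w w / 2 * bil d u x) *s u"

text \<open>For fixed isotropic u this makes the transvections a group isomorphic to the additive
  group they are indexed by; it permits replacing w by a sum of more convenient vectors.\<close>

lemma transvection_add:
  assumes "bil d u u = 0" "bil d u v = 0" "bil d u w = 0"
  shows "transvection d u v (transvection d u w x) = transvection d u (v + w) x"
proof -
  have 1: "bil d v (transvection d u w x) = bil d v x + bil d u x * bil d v w"
    and 2: "bil d u (transvection d u w x) = bil d u x"
    using assms bil_commute[of d v u] by (simp_all add: transvection_def bil_linear)
  have 3: "bil d (v + w) (v + w) = bil d v v + 2 * bil d v w + bil d w w"
    by (simp add: bil_linear bil_commute[of d w v])
  show ?thesis
    unfolding transvection_def[of d u v] 1 2
    unfolding transvection_def 3 bil_add_left[of d v w x] vec_eq_iff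
    by (simp add: algebra_simps add_divide_distrib)
qed

text \<open>The transvection is the product of the reflections in w and in v = w - (q/2) u, where q
  = (w, w). As u is isotropic and orthogonal to w, both vectors have length q, so the spinor norm is
  the square of q/2.\<close>

lemma spin_transvection_anisotropic:
  assumes "bil d u u = 0" "bil d u w = 0" "bil d w w \<noteq> 0"
  shows "spin d (transvection d u w)"
proof -
  define q where "q = bil d w w"
  define v where "v = w - (q / 2) *s u"
  have uw: "bil d w u = 0" using assms by (simp add: bil_commute)
  have v: "bil d v v = q"
    using assms uw by (simp add: v_def q_def bil_linear)
  have "transvection d u w x = reflection d v (reflection d w x)" for x
  proof -
    define A B where "A = bil d w x" and "B = bil d u x"
    have r: "reflection d w x = x - (2 * A / q) *s w"
      by (simp add: reflection_def A_def q_def bil_commute)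
    have "bil d (reflection d w x) v = - A - q / 2 * B"
      using assms uw unfolding r
      by (simp add: v_def q_def bil_linear bil_commute[of d x w] bil_commute[of d x u] A_def B_def)
    then have "reflection d v (reflection d w x) = x - (2 * A / q) *s w - (2 * (- A - q / 2 * B) / q) *s v"
      by (simp add: reflection_def[of d v] v r)
    also have "\<dots> = x - (2 * A / q) *s w + (2 * A / q + B) *s v"
      using assms(3) by (simp add: vec_eq_iff q_def[symmetric] field_simps)
    also have "\<dots> = transvection d u w x"
      using assms(3) unfolding transvection_def A_def[symmetric] B_def[symmetric] q_def[symmetric] v_def
      by (simp add: vec_eq_iff field_simps)
    finally show ?thesis by simp
  qed
  then show ?thesis
    unfolding spin_def using assms v
    by (intro exI[of _ "[v, w]"] conjI exI[of _ "q / 2"]) (auto simp: power2_eq_square q_def)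
qed

text \<open>The last two coordinates span a negative definite plane, and one linear condition on a
  plane leaves a nonzero vector.\<close>

lemma anisotropic_orthogonal:
  assumes "d > 0"
  shows "\<exists>b :: real ^ 6. bil d u b = 0 \<and> bil d b b < 0"
proof (cases "u $ 5 = 0 \<and> u $ 6 = 0")
  case True
  then show ?thesis
    using assms by (intro exI[of _ "axis 5 1"]) (simp add: bil_def axis_def)
next
  case False
  define b :: "real ^ 6" where "b = (6 * u $ 6) *s axis 5 1 - (2 * real d * u $ 5) *s axis 6 1"
  have "bil d u b = 0"
    by (simp add: b_def bil_linear bil_axis)
  moreover have "bil d b b = - 2 * real d * (6 * u $ 6)\<^sup>2 - 6 * (2 * real d * u $ 5)\<^sup>2"
    by (simp add: b_def bil_def axis_def power2_eq_square)
  moreover have "2 * real d * (6 * u $ 6)\<^sup>2 + 6 * (2 * real d * u $ 5)\<^sup>2 > 0"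
    using False assms by (cases "u $ 5 = 0") (auto intro: add_nonneg_pos add_pos_nonneg)
  ultimately show ?thesis by (intro exI[of _ b]) auto
qed

text \<open>For isotropic w there is no reflection in w. It is written as (w + c b) + (- c b) with b
  anisotropic and orthogonal to u, and the two anisotropic transvections are multiplied.\<close>

lemma spin_transvection:
  assumes "d > 0" "bil d u u = 0" "bil d u w = 0"
  shows "spin d (transvection d u w)"
proof (cases "bil d w w = 0")
  case True
  obtain b :: "real ^ 6" where b: "bil d u b = 0" "bil d b b < 0"
    using anisotropic_orthogonal assms(1) by blast
  \<comment> \<open>The length of w + c b is 2 c (w, b) + c^2 (b, b). If (w, b) is not zero, the
    choice c = - (w, b) / (b, b) turns it into - (w, b)^2 / (b, b).\<close>
  obtain c where c: "c \<noteq> 0" "bil d (w + c *s b) (w + c *s b) \<noteq> 0"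
  proof (cases "bil d w b = 0")
    case True
    show ?thesis
      by (rule that[of 1]) (use b True \<open>bil d w w = 0\<close> in \<open>auto simp: bil_linear bil_commute[of d b w]\<close>)
  next
    case False
    show ?thesis
      by (rule that[of "- bil d w b / bil d b b"])
        (use b False \<open>bil d w w = 0\<close> in \<open>auto simp: bil_linear bil_commute[of d b w] field_simps\<close>)
  qed
  have "spin d (transvection d u (w + c *s b))"
    by (rule spin_transvection_anisotropic) (use assms b c in \<open>auto simp: bil_add_right bil_smult_right\<close>)
  moreover have "spin d (transvection d u (- (c *s b)))"
    by (rule spin_transvection_anisotropic) (use assms b c in \<open>auto simp: bil_linear\<close>)
  ultimately have "spin d (\<lambda>x. transvection d u (w + c *s b) (transvection d u (- (c *s b)) x))"
    by (rule spin_comp)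
  moreover have "transvection d u (w + c *s b) (transvection d u (- (c *s b)) x) = transvection d u w x" for x
    using transvection_add[of d u "w + c *s b" "- (c *s b)"] assms b by (simp add: bil_linear)
  ultimately show ?thesis
    by simp
qed (use assms spin_transvection_anisotropic in auto)

section \<open>The group of integral isometries\<close>

lemma bil_dual_lattice_vstar: "d > 0 \<Longrightarrow> bil d (vstar d) (emb y) = - real_of_int (y $ 5)"
  by (simp add: vstar_def bil_def emb_def axis_def)

text \<open>The premise \<open>dual\<close> says that f acts trivially on the discriminant group.
  Applied to lattice vectors it gives an integral matrix, applied to \<open>vstar\<close> the
  defining congruence.\<close>

lemma Gamma_L_intro:
  assumes "d > 0" and f: "spin d f"
    and dual: "\<And>x. (\<And>y. bil d x (emb y) \<in> \<int>) \<Longrightarrow> f x - x \<in> range emb"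
  shows "\<exists>g\<in>Gamma_L d. \<forall>x. map_matrix of_int g *v x = f x"
proof -
  have fl: "lin f" using f by (rule spin_lin)
  have "\<exists>z. f (emb y) = emb z" for y
  proof -
    obtain w where "f (emb y) - emb y = emb w"
      using dual[of "emb y"] by (auto simp: bil_emb)
    then have "f (emb y) = emb (w + y)" by (simp add: emb_add algebra_simps)
    then show ?thesis by blast
  qed
  then obtain h where h: "\<And>y. f (emb y) = emb (h y)" by metis
  have "lin h"
  proof -
    have "(emb (h (x + y)) :: real ^ 6) = emb (h x + h y)" for x y
      using fl by (simp add: h[symmetric] emb_add lin_def)
    moreover have "(emb (h (c *s x)) :: real ^ 6) = emb (c *s h x)" for c x
      using fl by (simp add: h[symmetric] emb_smult lin_def)
    ultimately show ?thesis by (simp add: lin_def)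
  qed
  define g where "g = matrix h"
  have gh: "g *v x = h x" for x
    using matrix_of_lin[OF \<open>lin h\<close>] by (simp add: g_def)
  have gf: "map_matrix of_int g *v x = f x" for x :: "real ^ 6"
  proof (rule lin_eq_axis[OF lin_matrix fl])
    fix i :: 6
    have "map_matrix of_int g *v (emb (axis i 1) :: real ^ 6) = f (emb (axis i 1))"
      by (simp add: emb_matrix_vector gh h)
    then show "map_matrix of_int g *v (axis i 1 :: real ^ 6) = f (axis i 1)"
      by (simp add: emb_axis)
  qed
  have "g \<in> O_plus d"
  proof -
    have "real_of_int (bil d (g *v x) (g *v y)) = real_of_int (bil d x y)" for x y
      by (simp add: bil_emb[symmetric] gh h[symmetric] spin_isometry[OF f])
    moreover have "((*v) (map_matrix real_of_int g)) = f" using gf by auto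
    ultimately show ?thesis
      using f by (simp add: O_plus_def O_plus_real_iff)
  qed
  moreover have "cong_L (map_matrix of_int g *v vstar d) (vstar d)"
    using dual[of "vstar d"] assms(1) by (simp add: gf cong_L_def bil_dual_lattice_vstar)
  ultimately show ?thesis
    using gf by (auto simp: Gamma_L_def)
qed

lemma lin_diff: "lin f \<Longrightarrow> f (x - y) = f x - f y"
  unfolding lin_def by (metis add_diff_cancel_right' diff_add_cancel)

lemma sum_6: "sum f (UNIV :: 6 set) = f 1 + f 2 + f 3 + f 4 + f 5 + f 6"
  unfolding UNIV_6 by (simp add: ac_simps)

lemma of_int_matrix_vector_mult:
  fixes g h :: "int ^ 6 ^ 6"
  shows "map_matrix of_int (g ** h) *v x = map_matrix of_int g *v (map_matrix of_int h *v (x :: 'a::comm_ring_1 ^ 6))"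
proof (rule lin_eq_axis[OF lin_matrix lin_comp[OF lin_matrix lin_matrix]])
  fix i :: 6
  show "map_matrix of_int (g ** h) *v (axis i 1 :: 'a ^ 6) = map_matrix of_int g *v (map_matrix of_int h *v axis i 1 :: 'a ^ 6)"
    by (metis emb_axis emb_matrix_vector matrix_vector_mul_assoc)
qed

lemma of_int_matrix_one: "map_matrix of_int (mat 1) *v x = (x :: 'a::comm_ring_1 ^ 6)"
proof -
  have "map_matrix of_int (mat 1) = (mat 1 :: 'a ^ 6 ^ 6)"
    by (simp add: map_matrix_def vec_eq_iff mat_def)
  then show ?thesis by simp
qed

lemma Gamma_L_isometry: "g \<in> Gamma_L d \<Longrightarrow> bil d (g *v x) (g *v y) = bil d x y"
  by (simp add: Gamma_L_def O_plus_def)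

lemma Gamma_L_spin: "g \<in> Gamma_L d \<Longrightarrow> spin d ((*v) (map_matrix of_int g))"
  by (simp add: Gamma_L_def O_plus_def O_plus_real_iff)

lemma Gamma_L_one: "mat 1 \<in> Gamma_L d"
proof -
  have "((*v) (map_matrix of_int (mat 1 :: int ^ 6 ^ 6))) = (\<lambda>x. x :: real ^ 6)"
    by (rule ext) (simp add: of_int_matrix_one)
  moreover have "0 \<in> range emb" by (metis emb_zero rangeI)
  ultimately show ?thesis
    using spin_id[of d] by (auto simp: Gamma_L_def O_plus_def O_plus_real_iff cong_L_def of_int_matrix_one)
qed

lemma Gamma_L_mult:
  assumes "g \<in> Gamma_L d" "h \<in> Gamma_L d"
  shows "g ** h \<in> Gamma_L d"
proof -
  have "((*v) (map_matrix of_int (g ** h))) = (\<lambda>x. map_matrix of_int g *v (map_matrix of_int h *v x :: real ^ 6))"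
    by (rule ext) (simp add: of_int_matrix_vector_mult)
  then have "spin d ((*v) (map_matrix of_int (g ** h)))"
    using spin_comp[OF Gamma_L_spin[OF assms(1)] Gamma_L_spin[OF assms(2)]] by simp
  moreover have "bil d (g ** h *v x) (g ** h *v y) = bil d x y" for x y
    using assms by (simp add: Gamma_L_isometry matrix_vector_mul_assoc[symmetric])
  moreover have "cong_L (map_matrix of_int (g ** h) *v vstar d) (vstar d)"
  proof -
    obtain x y where x: "map_matrix of_int g *v vstar d - vstar d = emb x"
      and y: "map_matrix of_int h *v vstar d - vstar d = emb y"
      using assms by (auto simp: Gamma_L_def cong_L_def)
    have "map_matrix of_int h *v vstar d = emb y + vstar d"
      using y by (simp add: algebra_simps)
    then have "map_matrix of_int (g ** h) *v vstar d - vstar d = emb (g *v y) + emb x"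
      using x by (simp add: of_int_matrix_vector_mult matrix_vector_right_distrib emb_matrix_vector algebra_simps)
    then show ?thesis by (auto simp: cong_L_def emb_add[symmetric])
  qed
  ultimately show ?thesis
    by (simp add: Gamma_L_def O_plus_def O_plus_real_iff)
qed

text \<open>With the Gram matrix S of the form, \<open>matrix s\<close> below, the isometry
  condition reads transpose G ** S ** G = S, and S is invertible.\<close>

lemma det_isometry:
  assumes "d > 0" and iso: "\<And>x y. bil d (G *v x) (G *v y) = bil d x (y :: real ^ 6)"
  shows "\<bar>det G\<bar> = 1"
proof -
  define s :: "real ^ 6 \<Rightarrow> real ^ 6" where "s y = (\<chi> i. bil d (axis i 1) y)" for y
  have "lin s" by (simp add: s_def lin_def vec_eq_iff bil_linear)
  then have s: "matrix s *v y = s y" for y by (rule matrix_of_lin)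
  have ls: "linear s" using \<open>lin s\<close> by (simp add: lin_def linear_iff scalar_mult_eq_scaleR)
  have inner_s: "x \<bullet> s y = bil d x y" for x y
    by (simp add: inner_vec_def sum_6 s_def bil_commute[of d "axis _ 1" y] bil_axis)
      (simp add: bil_def algebra_simps)
  have "transpose G *v (s (G *v y)) = s y" for y
    using iso by (subst vector_eq_ldot[symmetric])
      (simp add: transpose_matrix_vector dot_lmul_matrix inner_s inner_commute[of _ "_ v* _"]
        inner_commute[of "s _"])
  then have "(transpose G ** matrix s ** G) *v y = matrix s *v y" for y
    by (simp add: matrix_vector_mul_assoc[symmetric] s)
  then have "transpose G ** matrix s ** G = matrix s"
    by (simp add: matrix_eq)
  then have "det G * det (matrix s) * det G = det (matrix s)"
    by (metis det_mul det_transpose)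
  moreover have "det (matrix s) \<noteq> 0"
  proof -
    have "y = 0" if "matrix s *v y = 0" for y
      using that assms(1) by (simp add: s s_def vec_eq_iff forall_6) (simp add: bil_def axis_def)
    then have "invertible (matrix s)"
      by (metis matrix_left_invertible_ker invertible_left_inverse)
    then show ?thesis by (simp add: invertible_det_nz)
  qed
  ultimately have "(det G)\<^sup>2 = 1" by (simp add: power2_eq_square)
  then show ?thesis by (simp add: abs_square_eq_1)
qed

lemma det_of_int_Ints: "(\<And>i j. A $ i $ j \<in> \<int>) \<Longrightarrow> det A \<in> \<int>" for A :: "real ^ 6 ^ 6"
  unfolding det_def by (intro Ints_sum Ints_mult Ints_prod) auto

text \<open>The real inverse comes from reversing the reflections. It is integral by Cramer's rule,
  since the determinant is 1 or -1.\<close>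

lemma Gamma_L_inverse:
  assumes "d > 0" "g \<in> Gamma_L d"
  shows "\<exists>h\<in>Gamma_L d. g ** h = mat 1 \<and> h ** g = mat 1"
proof -
  define G :: "real ^ 6 ^ 6" where "G = map_matrix of_int g"
  have sp: "spin d ((*v) G)" using assms by (simp add: G_def Gamma_L_spin)
  obtain f where f: "spin d f" "\<And>x. f (G *v x) = x" "\<And>x. G *v f x = x"
    using spin_inverse[OF sp] by auto
  have det: "\<bar>det G\<bar> = 1"
    using det_isometry[OF assms(1)] spin_isometry[OF sp] by blast
  have int: "f (emb y) \<in> range emb" for y
  proof -
    have "f (emb y) = (\<chi> k. det (\<chi> i j. if j = k then emb y $ i else G $ i $ j) / det G)"
      using det f(3)[of "emb y"] by (subst cramer[symmetric]) auto
    moreover have "det (\<chi> i j. if j = k then emb y $ i else G $ i $ j) / det G \<in> \<int>" for k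
    proof -
      have "det (\<chi> i j. if j = k then emb y $ i else G $ i $ j) \<in> \<int>"
        by (rule det_of_int_Ints) (simp add: G_def map_matrix_def emb_def)
      moreover have "det G = 1 \<or> det G = -1" using det by (auto simp: abs_if split: if_splits)
      ultimately show ?thesis by auto
    qed
    ultimately have "\<forall>k. \<exists>n. f (emb y) $ k = of_int n" by (auto elim!: Ints_cases)
    then obtain n where "\<forall>k. f (emb y) $ k = of_int (n k)" by metis
    then have "f (emb y) = emb (\<chi> k. n k)" by (simp add: emb_def vec_eq_iff)
    then show ?thesis by blast
  qed
  then have "\<forall>y. \<exists>z. f (emb y) = emb z" by blast
  then obtain k where k: "\<And>y. f (emb y) = emb (k y)" by metis
  have fl: "lin f" using f(1) by (rule spin_lin)
  have "lin k"
  proof -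
    have "(emb (k (x + y)) :: real ^ 6) = emb (k x + k y)" for x y
      using fl by (simp add: k[symmetric] emb_add lin_def)
    moreover have "(emb (k (c *s x)) :: real ^ 6) = emb (c *s k x)" for c x
      using fl by (simp add: k[symmetric] emb_smult lin_def)
    ultimately show ?thesis by (simp add: lin_def)
  qed
  define h where "h = matrix k"
  have hk: "h *v x = k x" for x
    using matrix_of_lin[OF \<open>lin k\<close>] by (simp add: h_def)
  have hf: "map_matrix of_int h *v x = f x" for x :: "real ^ 6"
  proof (rule lin_eq_axis[OF lin_matrix fl])
    fix i :: 6
    show "map_matrix of_int h *v (axis i 1 :: real ^ 6) = f (axis i 1)"
      by (metis emb_axis emb_matrix_vector hk k)
  qed
  have gh: "g *v (h *v x) = x" and hg: "h *v (g *v x) = x" for x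
  proof -
    have "(emb (g *v (h *v x)) :: real ^ 6) = emb x" "(emb (h *v (g *v x)) :: real ^ 6) = emb x"
      using f(2)[of "emb x"] f(3)[of "emb x"] by (simp_all add: emb_matrix_vector[symmetric] hf G_def)
    then show "g *v (h *v x) = x" "h *v (g *v x) = x" by simp_all
  qed
  have "h \<in> Gamma_L d"
  proof -
    have "((*v) (map_matrix of_int h)) = f" using hf by auto
    moreover have "bil d (h *v x) (h *v y) = bil d x y" for x y
      using Gamma_L_isometry[OF assms(2), of "h *v x" "h *v y"] by (simp add: gh)
    moreover have "cong_L (f (vstar d)) (vstar d)"
    proof -
      obtain y where y: "G *v vstar d - vstar d = emb y"
        using assms(2) by (auto simp: Gamma_L_def cong_L_def G_def)
      have "vstar d - f (vstar d) = f (G *v vstar d - vstar d)"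
        by (simp add: lin_diff[OF fl] f(2))
      then have "f (vstar d) - vstar d = emb (- k y)"
        by (simp add: y k emb_minus) (metis minus_diff_eq)
      then show ?thesis by (auto simp: cong_L_def)
    qed
    ultimately show ?thesis
      using f(1) by (simp add: Gamma_L_def O_plus_def O_plus_real_iff hf)
  qed
  moreover have "g ** h = mat 1" "h ** g = mat 1"
  proof -
    have "A = mat 1" if "\<And>x. A *v x = x" for A :: "int ^ 6 ^ 6"
    proof -
      have "A $ i $ j = (mat 1 :: int ^ 6 ^ 6) $ i $ j" for i j
        using that[of "axis j 1"]
        by (simp add: vec_eq_iff matrix_vector_mult_def axis_def mat_def if_distrib cong: if_cong)
      then show ?thesis by (simp add: vec_eq_iff)
    qed
    then show "g ** h = mat 1" "h ** g = mat 1"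
      by (simp_all add: matrix_vector_mul_assoc[symmetric] gh hg)
  qed
  ultimately show ?thesis by blast
qed

section \<open>Orbits of isotropic vectors\<close>

definition equivalent :: "nat \<Rightarrow> int ^ 6 \<Rightarrow> int ^ 6 \<Rightarrow> bool" where
  "equivalent d x y \<longleftrightarrow> (\<exists>g\<in>Gamma_L d. g *v x = y)"

lemma equivalent_refl: "equivalent d x x"
  unfolding equivalent_def using Gamma_L_one[of d] by (intro bexI[of _ "mat 1"]) auto

lemma equivalent_trans [trans]: "equivalent d x y \<Longrightarrow> equivalent d y z \<Longrightarrow> equivalent d x z"
  unfolding equivalent_def by (metis Gamma_L_mult matrix_vector_mul_assoc)

lemma equivalent_sym: "d > 0 \<Longrightarrow> equivalent d x y \<Longrightarrow> equivalent d y x"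
  unfolding equivalent_def
  by (metis Gamma_L_inverse matrix_vector_mul_assoc matrix_vector_mul_lid)

lemma equivalent_range_bil:
  assumes "d > 0" "equivalent d x y"
  shows "range (bil d x) = range (bil d y)"
proof -
  obtain g h where g: "g \<in> Gamma_L d" "g *v x = y" and h: "g ** h = mat 1"
    using assms Gamma_L_inverse unfolding equivalent_def by metis
  have 1: "bil d x z = bil d y (g *v z)" for z
    using g Gamma_L_isometry by metis
  moreover have "bil d y z = bil d x (h *v z)" for z
    using 1[of "h *v z"] h by (simp add: matrix_vector_mul_assoc)
  ultimately show ?thesis by (metis image_subset_iff rangeI subset_antisym)
qed

text \<open>The integral quadratic form (x, x) / 2 of the even lattice.\<close>

definition half_norm :: "nat \<Rightarrow> int ^ 6 \<Rightarrow> int" where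
  "half_norm d x = x $ 1 * x $ 2 + x $ 3 * x $ 4 - int d * (x $ 5)\<^sup>2 - 3 * (x $ 6)\<^sup>2"

lemma bil_self: "bil d x x = 2 * half_norm d x"
  by (simp add: bil_def half_norm_def power2_eq_square algebra_simps)

text \<open>As the lattice is even, (w, w) / 2 is an integer, so a transvection with integral u and
  w moves each dual vector by a lattice vector and \<open>Gamma_L_intro\<close> applies.\<close>

lemma equivalent_transvection:
  assumes "d > 0" "bil d u u = 0" "bil d u w = 0"
  shows "equivalent d x (x + bil d u x *s w - (bil d w x + half_norm d w * bil d u x) *s u)"
proof -
  let ?f = "transvection d (emb u) (emb w)"
  have f: "?f x = x + bil d (emb u) x *s emb w
      - (bil d (emb w) x + of_int (half_norm d w) * bil d (emb u) x) *s emb u" for x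
    by (simp add: transvection_def bil_emb bil_self vec_eq_iff algebra_simps)
  have "\<exists>g\<in>Gamma_L d. \<forall>x. map_matrix of_int g *v x = ?f x"
  proof (rule Gamma_L_intro[OF assms(1)])
    show "spin d ?f"
      by (rule spin_transvection) (use assms in \<open>simp_all add: bil_emb\<close>)
    fix x :: "real ^ 6"
    assume x: "\<And>y. bil d x (emb y) \<in> \<int>"
    obtain m n where "bil d (emb u) x = of_int m" "bil d (emb w) x = of_int n"
      using x[of u] x[of w] by (auto simp: bil_commute elim!: Ints_cases)
    then have "?f x - x = emb (m *s w - (n + half_norm d w * m) *s u)"
      by (simp add: f emb_linear algebra_simps)
    then show "?f x - x \<in> range emb" by blast
  qed
  then obtain g where "g \<in> Gamma_L d" and g: "\<And>x. map_matrix of_int g *v x = ?f x" by blast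
  moreover have "(emb (g *v x) :: real ^ 6) =
      emb (x + bil d u x *s w - (bil d w x + half_norm d w * bil d u x) *s u)"
    by (simp add: emb_matrix_vector[symmetric] g f emb_linear bil_emb)
  ultimately show ?thesis unfolding equivalent_def emb_eq_iff by blast
qed

definition vec6 :: "'a \<Rightarrow> 'a \<Rightarrow> 'a \<Rightarrow> 'a \<Rightarrow> 'a \<Rightarrow> 'a \<Rightarrow> 'a ^ 6" where
  "vec6 a b c e f g = (\<chi> i. if i = 1 then a else if i = 2 then b else if i = 3 then c
     else if i = 4 then e else if i = 5 then f else g)"

lemma vec6_nth [simp]:
  "vec6 a b c e f g $ 1 = a" "vec6 a b c e f g $ 2 = b" "vec6 a b c e f g $ 3 = c"
  "vec6 a b c e f g $ 4 = e" "vec6 a b c e f g $ 5 = f" "vec6 a b c e f g $ 6 = g"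
  by (simp_all add: vec6_def)

lemma vec6_eta: "x = vec6 (x $ 1) (x $ 2) (x $ 3) (x $ 4) (x $ 5) (x $ 6)"
  by (simp add: vec_eq_iff forall_6)

section \<open>Row and column operations on the two hyperbolic planes\<close>

context
  fixes d :: nat
  assumes d: "d > 0"
begin

lemma equivalent_transvectionI:
  assumes "bil d u u = 0" "bil d u w = 0"
    and "y = x + bil d u x *s w - (bil d w x + half_norm d w * bil d u x) *s u"
  shows "equivalent d x y"
  using equivalent_transvection[OF d assms(1,2)] assms(3) by simp

lemma equivalent_row:
  "equivalent d (vec6 a b c e f g) (vec6 (a - k * c) b c (e + k * b) f g)"
  by (rule equivalent_transvectionI[of "vec6 1 0 0 0 0 0" "vec6 0 0 0 k 0 0"])
    (simp_all add: vec_eq_iff forall_6 bil_def half_norm_def)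

lemma equivalent_row':
  "equivalent d (vec6 a b c e f g) (vec6 a (b - k * e) (c + k * a) e f g)"
  by (rule equivalent_transvectionI[of "vec6 0 1 0 0 0 0" "vec6 0 0 k 0 0 0"])
    (simp_all add: vec_eq_iff forall_6 bil_def half_norm_def)

lemma equivalent_col:
  "equivalent d (vec6 a b c e f g) (vec6 (a - k * e) b (c + k * b) e f g)"
  by (rule equivalent_transvectionI[of "vec6 1 0 0 0 0 0" "vec6 0 0 k 0 0 0"])
    (simp_all add: vec_eq_iff forall_6 bil_def half_norm_def)

lemma equivalent_col':
  "equivalent d (vec6 a b c e f g) (vec6 a (b - k * c) c (e + k * a) f g)"
  by (rule equivalent_transvectionI[of "vec6 0 1 0 0 0 0" "vec6 0 0 0 k 0 0"])
    (simp_all add: vec_eq_iff forall_6 bil_def half_norm_def)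

text \<open>The usual product of three elementary matrices; one of the two swapped rows changes its
  sign because the determinant is preserved.\<close>

lemma equivalent_swap_rows: "equivalent d (vec6 a b c e f g) (vec6 c e (- a) (- b) f g)"
proof -
  note equivalent_row[of a b c e f g "-1"]
  also note equivalent_row'[of _ _ _ _ f g "-1"]
  also note equivalent_row[of _ _ _ _ f g "-1"]
  finally show ?thesis by simp
qed

lemma equivalent_swap_cols: "equivalent d (vec6 a b c e f g) (vec6 e c (- b) (- a) f g)"
proof -
  note equivalent_col[of a b c e f g "-1"]
  also note equivalent_col'[of _ _ _ _ f g "-1"]
  also note equivalent_col[of _ _ _ _ f g "-1"]
  finally show ?thesis by simp
qed

text \<open>
  The two hyperbolic planes form the lattice of matrices with rows \<open>(a, -e)\<close> and \<open>(c, b)\<close> and the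
  determinant as quadratic form, on which the transvections above are row and column operations. So
  this is a Smith normal form.
\<close>

lemma equivalent_diagonal:
  assumes "a \<noteq> 0 \<or> b \<noteq> 0 \<or> c \<noteq> 0 \<or> e \<noteq> 0"
  shows "\<exists>m h. m > 0 \<and> equivalent d (vec6 a b c e f g) (vec6 m (m * h) 0 0 f g)"
proof -
  let ?v = "vec6 a b c e f g"
  \<comment> \<open>The least positive upper left entry that occurs in the orbit will be the first
    elementary divisor.\<close>
  define P where "P n \<longleftrightarrow> n > 0 \<and> (\<exists>b' c' e'. equivalent d ?v (vec6 (int n) b' c' e' f g))" for n
  have P: "P (nat \<bar>a'\<bar>)" if eq: "equivalent d ?v (vec6 a' b' c' e' f g)" and "a' \<noteq> 0" for a' b' c' e'
  proof (cases "a' > 0")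
    case True
    then show ?thesis using that by (auto simp: P_def)
  next
    case False
    have "equivalent d (vec6 a' b' c' e' f g) (vec6 (- a') (- b') (- c') (- e') f g)"
      using equivalent_trans[OF equivalent_swap_rows equivalent_swap_rows] by simp
    then have "equivalent d ?v (vec6 (- a') (- b') (- c') (- e') f g)"
      using equivalent_trans[OF eq] by blast
    then show ?thesis using that False by (auto simp: P_def)
  qed
  have "\<exists>n. P n"
  proof -
    have "equivalent d ?v ?v" by (rule equivalent_refl)
    moreover have "equivalent d ?v (vec6 c e (- a) (- b) f g)" by (rule equivalent_swap_rows)
    moreover have "equivalent d ?v (vec6 e c (- b) (- a) f g)" by (rule equivalent_swap_cols)
    moreover have "equivalent d ?v (vec6 (- b) (- a) (- e) (- c) f g)"
      using equivalent_trans[OF equivalent_swap_cols equivalent_swap_rows] by simp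
    ultimately show ?thesis using assms P by (metis neg_equal_0_iff_equal)
  qed
  then have Pm: "P (LEAST n. P n)" by (metis LeastI_ex)
  define m where "m = int (LEAST n. P n)"
  have m0: "m > 0" using Pm by (simp add: P_def m_def)
  have least: "\<bar>a'\<bar> \<ge> m" if "equivalent d ?v (vec6 a' b' c' e' f g)" "a' \<noteq> 0" for a' b' c' e'
    using Least_le[of P, OF P[OF that]] unfolding m_def by linarith
  \<comment> \<open>Otherwise a row operation leaves a nonzero remainder modulo m, and a swap moves
    it to the upper left corner, against minimality.\<close>
  have dvd3: "m dvd c'" if eq: "equivalent d ?v (vec6 m b' c' e' f g)" for b' c' e'
  proof (rule ccontr)
    assume n: "\<not> m dvd c'"
    note eq
    also note equivalent_row'[of m b' c' e' f g "- (c' div m)"]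
    also note equivalent_swap_rows
    finally have "equivalent d ?v (vec6 (c' mod m) e' (- m) (- (b' + c' div m * e')) f g)"
      by (simp add: minus_div_mult_eq_mod)
    then have "\<bar>c' mod m\<bar> \<ge> m"
      by (rule least) (use n in \<open>simp add: dvd_eq_mod_eq_0\<close>)
    then show False using m0 by (metis abs_mod_less not_less abs_of_pos less_irrefl)
  qed
  have dvd4: "m dvd e'" if eq: "equivalent d ?v (vec6 m b' c' e' f g)" for b' c' e'
  proof (rule ccontr)
    assume n: "\<not> m dvd e'"
    note eq
    also note equivalent_col'[of m b' c' e' f g "- (e' div m)"]
    also note equivalent_swap_cols
    finally have "equivalent d ?v (vec6 (e' mod m) c' (- (b' + e' div m * c')) (- m) f g)"
      by (simp add: minus_div_mult_eq_mod)
    then have "\<bar>e' mod m\<bar> \<ge> m"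
      by (rule least) (use n in \<open>simp add: dvd_eq_mod_eq_0\<close>)
    then show False using m0 by (metis abs_mod_less not_less abs_of_pos less_irrefl)
  qed
  obtain b1 c1 e1 where 1: "equivalent d ?v (vec6 m b1 c1 e1 f g)"
    using Pm by (auto simp: P_def m_def)
  obtain k where k: "c1 = m * k" using dvd3[OF 1] by blast
  note 1
  also note equivalent_row'[of m b1 c1 e1 f g "- k"]
  finally have 2: "equivalent d ?v (vec6 m (b1 + k * e1) 0 e1 f g)" by (simp add: k)
  obtain l where l: "e1 = m * l" using dvd4[OF 2] by blast
  note 2
  also note equivalent_col'[of m _ 0 e1 f g "- l"]
  finally have 3: "equivalent d ?v (vec6 m (b1 + k * e1) 0 0 f g)" by (simp add: l)
  \<comment> \<open>Adding the second column of the diagonal matrix to the first moves the second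
    diagonal entry below m, where \<open>dvd3\<close> applies to it.\<close>
  have "equivalent d ?v (vec6 m (b1 + k * e1) (b1 + k * e1) 0 f g)"
    using equivalent_trans[OF 3 equivalent_col[of _ _ _ _ _ _ 1]] by simp
  from dvd3[OF this] obtain h where "b1 + k * e1 = m * h" by blast
  with 3 m0 show ?thesis by auto
qed

text \<open>After diagonalisation the upper left entry is only a multiple of the divisor n. The
  empty second hyperbolic plane gives room to produce n itself; once n is the first coordinate, a
  transvection shifts the last two coordinates by any multiples of n.\<close>

lemma equivalent_canonical:
  assumes iso: "bil d v v = 0" and "n > 0" and range: "range (bil d v) = range (\<lambda>k. n * k)"
    and r: "n dvd r - v $ 5" and s: "n dvd s - v $ 6"
  shows "\<exists>b. equivalent d v (vec6 n b 0 0 r s)"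
proof -
  have nd: "n dvd bil d v y" for y
    using range by (metis dvd_triv_left rangeE rangeI)
  have "v $ 1 \<noteq> 0 \<or> v $ 2 \<noteq> 0 \<or> v $ 3 \<noteq> 0 \<or> v $ 4 \<noteq> 0"
  proof (rule ccontr)
    assume zero: "\<not> ?thesis"
    moreover have "v \<noteq> 0"
    proof
      assume "v = 0"
      then have "n * 1 = 0" using range by (metis (no_types, lifting) bil_zero_left rangeE rangeI)
      then show False using \<open>n > 0\<close> by simp
    qed
    ultimately have "v $ 5 \<noteq> 0 \<or> v $ 6 \<noteq> 0" by (simp add: vec_eq_iff forall_6)
    then have "int d * (v $ 5)\<^sup>2 + 3 * (v $ 6)\<^sup>2 > 0"
      using d by (auto intro: add_pos_nonneg add_nonneg_pos)
    moreover have "int d * (v $ 5)\<^sup>2 + 3 * (v $ 6)\<^sup>2 = 0"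
      using iso zero by (simp add: bil_self half_norm_def)
    ultimately show False by simp
  qed
  then obtain m h where m: "m > 0" and 1: "equivalent d v (vec6 m (m * h) 0 0 (v $ 5) (v $ 6))"
    using equivalent_diagonal[of "v $ 1" "v $ 2" "v $ 3" "v $ 4" "v $ 5" "v $ 6"] vec6_eta[of v] by auto
  let ?w = "vec6 m (m * h) 0 0 (v $ 5) (v $ 6)"
  have rw: "range (bil d ?w) = range (\<lambda>k. n * k)"
    using equivalent_range_bil[OF d 1] range by simp
  have "n dvd m"
  proof -
    have "bil d ?w (vec6 0 1 0 0 0 0) = m" by (simp add: bil_def)
    then show ?thesis using rw by (metis dvd_triv_left rangeE rangeI)
  qed
  then obtain q where q: "m = n * q" by blast
  \<comment> \<open>Solving (w, y) = n expresses n through m and the pairing of the last two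
    coordinates, the two quantities that the next moves can bring into the third coordinate.\<close>
  obtain y where "bil d ?w y = n"
    using rw by (metis mult.right_neutral rangeE rangeI)
  then have y: "m * (y $ 2 + h * y $ 1) = n + 2 * int d * v $ 5 * y $ 5 + 6 * v $ 6 * y $ 6"
    by (simp add: bil_def algebra_simps)
  obtain i where i: "r - v $ 5 = n * i" using r by blast
  obtain j where j: "s - v $ 6 = n * j" using s by blast
  let ?x3 = "- (2 * int d * v $ 5 * y $ 5 + 6 * v $ 6 * y $ 6)"
  note 1
  \<comment> \<open>The vector u is the third basis vector, which is orthogonal to \<open>?w\<close>
    because the fourth coordinate is 0. So the transvection only adds a multiple of u.\<close>
  also have "equivalent d ?w (vec6 m (m * h) ?x3 0 (v $ 5) (v $ 6))"
    by (rule equivalent_transvectionI[of "vec6 0 0 1 0 0 0" "vec6 0 0 0 0 (- y $ 5) (- y $ 6)"])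
      (simp_all add: vec_eq_iff forall_6 bil_def half_norm_def)
  also note equivalent_row'[of _ _ _ _ _ _ "y $ 2 + h * y $ 1"]
  also have "vec6 m (m * h - (y $ 2 + h * y $ 1) * 0) (?x3 + (y $ 2 + h * y $ 1) * m) 0 (v $ 5) (v $ 6)
    = vec6 m (m * h) n 0 (v $ 5) (v $ 6)"
    using y by (simp add: vec_eq_iff forall_6 algebra_simps)
  also note equivalent_swap_rows
  \<comment> \<open>Here (u, x) = n, so n times the chosen w is added. The entries q and q * h
    cancel the third and fourth coordinates since m = n * q, and i, j move the last two to r and
    s.\<close>
  also have "equivalent d (vec6 n 0 (- m) (- (m * h)) (v $ 5) (v $ 6))
     (vec6 n (- (- q * m * h + (q * h) * - m - 2 * int d * i * v $ 5 - 6 * j * v $ 6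
       + n * (q * q * h - int d * i\<^sup>2 - 3 * j\<^sup>2))) 0 0 r s)"
    by (rule equivalent_transvectionI[of "vec6 0 1 0 0 0 0" "vec6 0 0 q (q * h) i j"])
      (use q i j in \<open>simp_all add: vec_eq_iff forall_6 bil_def half_norm_def algebra_simps power2_eq_square\<close>)
  finally show ?thesis by blast
qed

text \<open>Both vectors reach a normal form with the same entries except the second, and length 0
  determines that one because the first entry n is not zero.\<close>

lemma equivalent_isotropic:
  assumes v: "bil d v v = 0" "range (bil d v) = range (\<lambda>k. n * k)"
    and w: "bil d w w = 0" "range (bil d w) = range (\<lambda>k. n * k)"
    and "n > 0" "n dvd v $ 5 - w $ 5" "n dvd v $ 6 - w $ 6"
  shows "equivalent d v w"
proof -
  obtain b where b: "equivalent d v (vec6 n b 0 0 (w $ 5) (w $ 6))"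
    using equivalent_canonical[OF v(1) assms(5) v(2)] assms(6,7) by (metis dvd_diff_commute)
  obtain c where c: "equivalent d w (vec6 n c 0 0 (w $ 5) (w $ 6))"
    using equivalent_canonical[OF w(1) assms(5) w(2), of "w $ 5" "w $ 6"] by auto
  have iso: "bil d (vec6 n x 0 0 (w $ 5) (w $ 6)) (vec6 n x 0 0 (w $ 5) (w $ 6)) = 0"
    if "equivalent d u (vec6 n x 0 0 (w $ 5) (w $ 6))" "bil d u u = 0" for x u
    using that Gamma_L_isometry unfolding equivalent_def by metis
  have "b = c"
  proof -
    have "n * b = n * c"
      using iso[OF b v(1)] iso[OF c w(1)] unfolding bil_def vec6_nth by (simp only: mult.commute)
    then show ?thesis using assms(5) by simp
  qed
  then show ?thesis
    using b c equivalent_trans equivalent_sym[OF d] by metis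
qed

end

lemma int_ideal_principal:
  fixes S :: "int set"
  assumes "\<And>x y. x \<in> S \<Longrightarrow> y \<in> S \<Longrightarrow> x + y \<in> S" "\<And>c x. x \<in> S \<Longrightarrow> c * x \<in> S"
    and "x0 \<in> S" "x0 \<noteq> 0"
  shows "\<exists>n>0. S = range (\<lambda>k. n * k)"
proof -
  define P where "P n \<longleftrightarrow> n > 0 \<and> int n \<in> S" for n
  have "\<bar>x0\<bar> \<in> S"
    using assms(2)[OF assms(3), of "sgn x0"] by (simp add: abs_sgn[of x0] mult.commute)
  then have "P (nat \<bar>x0\<bar>)"
    using assms(4) by (simp add: P_def)
  then have Pn: "P (LEAST n. P n)" by (rule LeastI)
  define n where "n = int (LEAST n. P n)"
  have n: "n > 0" "n \<in> S" using Pn by (auto simp: P_def n_def)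
  have "n dvd x" if "x \<in> S" for x
  proof (rule ccontr)
    assume nd: "\<not> n dvd x"
    have "x + (- (x div n)) * n \<in> S" using assms(1,2) n that by blast
    then have "x mod n \<in> S" by (simp add: minus_div_mult_eq_mod)
    moreover have "x mod n > 0" using nd n by (simp add: dvd_eq_mod_eq_0 order_less_le)
    ultimately have "P (nat (x mod n))" by (simp add: P_def)
    then have "(LEAST n. P n) \<le> nat (x mod n)" by (rule Least_le)
    then have "n \<le> x mod n" using \<open>x mod n > 0\<close> unfolding n_def by linarith
    then show False using n(1) pos_mod_bound[of n x] by linarith
  qed
  moreover have "n * k \<in> S" for k using assms(2)[OF n(2), of k] by (simp add: mult.commute)
  ultimately show ?thesis using n(1) by (intro exI[of _ n]) (auto elim!: dvdE)
qed

section \<open>Divisors and discriminant classes of isotropic vectors\<close>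

definition prim :: "int ^ 6 \<Rightarrow> bool" where
  "prim v \<longleftrightarrow> (\<forall>q. (\<forall>i. q dvd v $ i) \<longrightarrow> q dvd 1)"

lemma prim_nonzero: "prim v \<Longrightarrow> v \<noteq> 0"
  unfolding prim_def by (metis dvd_0_right zero_index zero_neq_one dvd_0_left)

lemma dvd_vecE:
  assumes "\<forall>i. q dvd v $ i"
  obtains x where "v = q *s (x :: int ^ 'n)"
  using assms by (intro that[of "\<chi> i. v $ i div q"]) (simp add: vec_eq_iff)

text \<open>The coefficients c give a functional with value 1 at v. It serves to prove saturation
  and to split v off a larger module, for which pairing with lattice vectors fails when the divisor
  of v exceeds 1.\<close>

lemma prim_bezout:
  assumes "prim v"
  shows "\<exists>c :: int ^ 6. (\<Sum>i\<in>UNIV. c $ i * v $ i) = 1"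
proof -
  let ?S = "range (\<lambda>c :: int ^ 6. \<Sum>i\<in>UNIV. c $ i * v $ i)"
  have comp: "v $ i \<in> ?S" for i
    by (rule range_eqI[of _ _ "axis i 1"]) (simp add: axis_def if_distrib[of "\<lambda>x. x * _"] cong: if_cong)
  obtain i where i: "v $ i \<noteq> 0" using prim_nonzero[OF assms] by (auto simp: vec_eq_iff)
  have "\<exists>n>0. ?S = range (\<lambda>k. n * k)"
  proof (rule int_ideal_principal[OF _ _ comp i])
    fix x y assume "x \<in> ?S" "y \<in> ?S"
    then obtain a b :: "int ^ 6" where "x = (\<Sum>i\<in>UNIV. a $ i * v $ i)" "y = (\<Sum>i\<in>UNIV. b $ i * v $ i)"
      by blast
    then have "x + y = (\<Sum>i\<in>UNIV. (a + b) $ i * v $ i)"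
      by (simp add: sum.distrib algebra_simps)
    then show "x + y \<in> ?S" by blast
  next
    fix k x assume "x \<in> ?S"
    then obtain a :: "int ^ 6" where "x = (\<Sum>i\<in>UNIV. a $ i * v $ i)" by blast
    then have "k * x = (\<Sum>i\<in>UNIV. (k *s a) $ i * v $ i)"
      by (simp add: sum_distrib_left algebra_simps)
    then show "k * x \<in> ?S" by blast
  qed
  then obtain n where n: "n > 0" "?S = range (\<lambda>k. n * k)" by blast
  have "n dvd v $ i" for i using comp[of i] n(2) by auto
  then have "n dvd 1" using assms by (simp add: prim_def)
  then have "1 \<in> ?S" using n by (auto simp: zdvd1_eq)
  then show ?thesis by (metis (no_types, lifting) rangeE)
qed

lemma prim_saturated:
  assumes "prim v" "n \<noteq> 0" "n *s x = m *s v"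
  shows "\<exists>k. m = n * k \<and> x = k *s v"
proof -
  obtain c :: "int ^ 6" where c: "(\<Sum>i\<in>UNIV. c $ i * v $ i) = 1" using prim_bezout assms(1) by blast
  define k where "k = (\<Sum>i\<in>UNIV. c $ i * x $ i)"
  have "m = m * (\<Sum>i\<in>UNIV. c $ i * v $ i)" by (simp add: c)
  also have "\<dots> = (\<Sum>i\<in>UNIV. c $ i * (m *s v) $ i)" by (simp add: sum_distrib_left algebra_simps)
  also have "\<dots> = n * k" by (simp add: assms(3)[symmetric] k_def sum_distrib_left algebra_simps)
  finally have m: "m = n * k" .
  have "n *s x = n *s (k *s v)" using assms(3) m by (metis vector_smult_assoc)
  then have "x = k *s v" using assms(2) by (simp add: vec_eq_iff)
  with m show ?thesis by blast
qed

lemma isotropic_1_iff: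
  "E \<in> isotropic d 1 \<longleftrightarrow> (\<exists>v. E = range (\<lambda>n. n *s v) \<and> prim v \<and> bil d v v = 0)"
proof
  assume "E \<in> isotropic d 1"
  then obtain b where b: "z_basis b {1..1} E"
    and sat: "\<And>n x. n \<noteq> 0 \<Longrightarrow> n *s x \<in> E \<Longrightarrow> x \<in> E"
    and iso: "\<forall>x\<in>E. \<forall>y\<in>E. bil d x y = 0"
    unfolding isotropic_def by blast
  define v where "v = b 1"
  have E: "E = range (\<lambda>n. n *s v)"
  proof -
    have "E = range (\<lambda>c :: nat \<Rightarrow> int. c 1 *s v)" using b by (simp add: z_basis_def v_def del: One_nat_def)
    moreover have "range (\<lambda>c :: nat \<Rightarrow> int. c 1 *s v) = range (\<lambda>n. n *s v)"
      by (auto intro: range_eqI[of _ _ "\<lambda>_. _"])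
    ultimately show ?thesis by simp
  qed
  have ind: "c = 0" if "c *s v = 0" for c
    using b that by (auto simp: z_basis_def v_def dest: spec[of _ "\<lambda>_. c"])
  have vE: "v \<in> E" by (simp add: E range_eqI[of _ _ 1])
  have "prim v"
    unfolding prim_def
  proof (intro allI impI)
    fix q assume "\<forall>i. q dvd v $ i"
    then obtain x where x: "v = q *s x" by (rule dvd_vecE)
    have "q \<noteq> 0" using x ind[of 1] by auto
    then have "x \<in> E" using sat vE x by blast
    then obtain m where "x = m *s v" by (auto simp: E)
    then have "v = (q * m) *s v" using x by (metis vector_smult_assoc)
    then have "(1 - q * m) *s v = 0" by (metis diff_self vector_smult_lid vector_sub_rdistrib)
    then have "q * m = 1" using ind[of "1 - q * m"] by simp
    then show "q dvd 1" by (metis dvd_triv_left)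
  qed
  then show "\<exists>v. E = range (\<lambda>n. n *s v) \<and> prim v \<and> bil d v v = 0"
    using E iso vE by blast
next
  assume "\<exists>v. E = range (\<lambda>n. n *s v) \<and> prim v \<and> bil d v v = 0"
  then obtain v where E: "E = range (\<lambda>n. n *s v)" and v: "prim v" "bil d v v = 0" by blast
  have "z_basis (\<lambda>_. v) {1..1} E"
    unfolding z_basis_def
  proof (intro conjI allI impI ballI)
    fix c :: "nat \<Rightarrow> int" and i :: nat
    assume "(\<Sum>i\<in>{1..1::nat}. c i *s v) = 0" and "i \<in> {1..1}"
    then show "c i = 0" using prim_nonzero[OF v(1)] by (auto simp: vec_eq_iff)
  next
    have "range (\<lambda>c :: nat \<Rightarrow> int. c 1 *s v) = range (\<lambda>n. n *s v)"
      by (auto intro: range_eqI[of _ _ "\<lambda>_. _"])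
    then show "E = range (\<lambda>c. \<Sum>i\<in>{1..1::nat}. c i *s v)" by (simp add: E)
  qed
  moreover have "x \<in> E" if "n \<noteq> 0" "n *s x \<in> E" for n x
    using that prim_saturated[OF v(1) that(1), of x] by (auto simp: E image_iff)
  ultimately show "E \<in> isotropic d 1"
    unfolding isotropic_def using v(2) by (auto simp: E bil_linear)
qed

text \<open>The divisor as a relation, which avoids the definite description in \<open>ldiv\<close>;
  \<open>ldiv_eq\<close> connects the two.\<close>

definition has_div :: "nat \<Rightarrow> int \<Rightarrow> int ^ 6 \<Rightarrow> bool" where
  "has_div d n v \<longleftrightarrow> n > 0 \<and> range (bil d v) = range (\<lambda>k. n * k)"

lemma has_div_exists:
  assumes "d > 0" "v \<noteq> 0"
  shows "\<exists>n. has_div d n v"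
proof -
  obtain i where "bil d v (axis i 1) \<noteq> 0"
  proof (rule ccontr)
    assume "\<not> thesis"
    then have "bil d v (axis i 1) = 0" for i using that by blast
    then have "v = 0" using assms(1) bil_axis[of d v] by (simp add: vec_eq_iff forall_6)
    then show False using assms(2) by simp
  qed
  then have "\<exists>n>0. range (bil d v) = range (\<lambda>k. n * k)"
    by (intro int_ideal_principal[of _ "bil d v (axis i 1)"])
      (auto simp: bil_add_right[symmetric] bil_smult_right[symmetric])
  then show ?thesis by (simp add: has_div_def)
qed

lemma has_div_dvd: "has_div d n v \<Longrightarrow> m dvd n \<longleftrightarrow> (\<forall>y. m dvd bil d v y)"
  unfolding has_div_def
  by (metis (no_types, lifting) dvd_mult2 mult.right_neutral rangeE rangeI)

lemma has_div_unique: "has_div d n v \<Longrightarrow> has_div d m v \<Longrightarrow> n = m"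
  by (metis has_div_def has_div_dvd dvd_refl zdvd_antisym_nonneg less_imp_le)

lemma ldiv_eq: "has_div d n v \<Longrightarrow> ldiv d v = n"
  unfolding ldiv_def by (rule the_equality) (auto simp: has_div_def[symmetric] dest: has_div_unique)

lemma equivalent_has_div: "d > 0 \<Longrightarrow> equivalent d x y \<Longrightarrow> has_div d n x \<longleftrightarrow> has_div d n y"
  by (simp add: has_div_def equivalent_range_bil)

section \<open>Possible divisors of a primitive isotropic vector\<close>

lemma two_prime_divisors:
  fixes n p :: nat
  assumes "prime p" "p > 2" "n > 0"
    and "\<And>q. prime q \<Longrightarrow> q dvd n \<Longrightarrow> q = 2 \<or> q = p" "\<not> 4 dvd n" "\<not> p\<^sup>2 dvd n"
  shows "n \<in> {1, 2, p, 2 * p}"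
proof -
  have odd_case: "m = 1 \<or> m = p" if m: "odd m" "m dvd n" for m
  proof (cases "p dvd m")
    case True
    then obtain k where k: "m = p * k" by blast
    have "k = 1"
    proof (rule ccontr)
      assume "k \<noteq> 1"
      then obtain q where q: "prime q" "q dvd k" using prime_factor_nat by blast
      then have "q = 2 \<or> q = p" using assms(4) m(2) k by (meson dvd_mult dvd_trans)
      moreover have "q \<noteq> 2" using q(2) m(1) k by auto
      moreover have "q \<noteq> p"
      proof
        assume "q = p"
        then have "p\<^sup>2 dvd m" using q(2) k by (simp add: power2_eq_square)
        then show False using m(2) assms(6) dvd_trans by blast
      qed
      ultimately show False by blast
    qed
    then show ?thesis using k by simp
  next
    case False
    have "m = 1"
    proof (rule ccontr)
      assume "m \<noteq> 1"
      then obtain q where q: "prime q" "q dvd m" using prime_factor_nat by blast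
      then have "q = 2 \<or> q = p" using assms(4) m(2) dvd_trans by blast
      then show False using q(2) m(1) False by auto
    qed
    then show ?thesis by simp
  qed
  show ?thesis
  proof (cases "even n")
    case True
    then obtain m where m: "n = 2 * m" by blast
    then have "odd m" using assms(5) by auto
    then show ?thesis using odd_case[of m] m by auto
  qed (use odd_case[of n] in auto)
qed

locale paramodular =
  fixes p d :: nat
  assumes prime_p: "prime p" and p_gt_3: "p > 3" and d_def: "d = p\<^sup>2"
begin

lemma d_pos: "d > 0"
  using p_gt_3 by (simp add: d_def)

lemma odd_p: "odd p"
  using prime_p p_gt_3 prime_odd_nat by auto

lemma prime_int_p: "prime (int p)"
  using prime_p by simp

text \<open>A prime p > 3 is coprime to the coefficient 6 of the last coordinate.\<close>

lemma p_dvd_6_mult: "int p dvd 6 * x \<longleftrightarrow> int p dvd x"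
proof -
  have "\<not> int p dvd 6"
  proof
    assume "int p dvd 6"
    then have "int p dvd 2 * 3" by simp
    then have "int p dvd 2 \<or> int p dvd 3" using prime_int_p prime_dvd_mult_iff by blast
    then show False using p_gt_3 by (auto dest: zdvd_imp_le)
  qed
  then show ?thesis using prime_int_p by (simp add: prime_dvd_mult_iff)
qed

context
  fixes v n
  assumes iso: "bil d v v = 0" and prim: "prim v" and div: "has_div d n v"
begin

lemma div_dvd:
  "n dvd v $ 1" "n dvd v $ 2" "n dvd v $ 3" "n dvd v $ 4" "n dvd 2 * int p ^ 2 * v $ 5" "n dvd 6 * v $ 6"
  using has_div_dvd[OF div, of n] bil_axis[of d v] d_def
  by (auto dest: spec[of _ "axis _ 1"]) (metis dvd_minus_iff of_nat_power)+

lemma isotropic_eq: "v $ 1 * v $ 2 + v $ 3 * v $ 4 = int p ^ 2 * (v $ 5)\<^sup>2 + 3 * (v $ 6)\<^sup>2"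
  using iso by (simp add: bil_self half_norm_def d_def)

lemma not_all_dvd:
  assumes "prime q" "q dvd n" "q dvd v $ 5" "q dvd v $ 6"
  shows False
proof -
  have "\<forall>i. q dvd v $ i"
    using assms div_dvd dvd_trans by (auto simp: forall_6)
  then have "q dvd 1" using prim by (simp add: prim_def)
  then show False using assms(1) not_prime_unit by blast
qed

text \<open>The first four coordinates are divisible by q, and their contribution to the form is
  quadratic.\<close>

lemma square_dvd:
  assumes "q dvd n"
  shows "q\<^sup>2 dvd int p ^ 2 * (v $ 5)\<^sup>2 + 3 * (v $ 6)\<^sup>2"
proof -
  have "q dvd v $ 1" "q dvd v $ 2" "q dvd v $ 3" "q dvd v $ 4"
    using assms div_dvd dvd_trans by blast+
  then have "q * q dvd v $ 1 * v $ 2 + v $ 3 * v $ 4" by (intro dvd_add mult_dvd_mono)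
  then show ?thesis by (simp only: isotropic_eq power2_eq_square)
qed

text \<open>As p is odd, \<open>isotropic_eq\<close> forces the last two coordinates to have equal
  parity, and both even contradicts primitivity.\<close>

lemma odd_if_even_div:
  assumes "even n"
  shows "odd (v $ 5)" "odd (v $ 6)"
proof -
  have 4: "4 dvd int p ^ 2 * (v $ 5)\<^sup>2 + 3 * (v $ 6)\<^sup>2"
    using square_dvd[of 2] assms by simp
  then have "even (int p ^ 2 * (v $ 5)\<^sup>2 + 3 * (v $ 6)\<^sup>2)"
    by (rule dvd_trans[rotated]) simp
  then have "even (v $ 5) \<longleftrightarrow> even (v $ 6)" using odd_p by simp
  then show "odd (v $ 5)" "odd (v $ 6)"
    using not_all_dvd[of 2] assms by auto
qed

lemma p_dvd_6_if_p_dvd_div: "int p dvd n \<Longrightarrow> int p dvd v $ 6"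
  using div_dvd(6) p_dvd_6_mult dvd_trans by blast

lemma p_not_dvd_5: "int p dvd n \<Longrightarrow> \<not> int p dvd v $ 5"
  using p_dvd_6_if_p_dvd_div not_all_dvd prime_int_p by blast

lemma div_cases: "n \<in> {1, 2, int p, 2 * int p}"
proof -
  have n: "n > 0" using div by (simp add: has_div_def)
  have "nat n \<in> {1, 2, p, 2 * p}"
  proof (rule two_prime_divisors)
    show "prime p" "p > 2" "nat n > 0" using prime_p p_gt_3 n by auto
    \<comment> \<open>If 4 divides n, then 4 divides \<open>2 * int p ^ 2 * v $ 5\<close>, so the
      fifth coordinate is even.\<close>
    show "\<not> 4 dvd nat n"
    proof
      assume "4 dvd nat n"
      then have 4: "4 dvd n" using n by (simp add: nat_dvd_iff[symmetric] int_dvd_int_iff[symmetric])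
      then have "2 * 2 dvd 2 * (int p ^ 2 * v $ 5)"
        using dvd_trans[OF _ div_dvd(5)] by (simp add: mult.assoc)
      then have "even (int p ^ 2 * v $ 5)" by (simp only: dvd_times_left_cancel_iff)
      moreover have "even n" using 4 by (rule dvd_trans[rotated]) simp
      ultimately show False using odd_if_even_div(1) odd_p by simp
    qed
    \<comment> \<open>If p^2 divides n, it divides the sixth coordinate, so p^4 divides p^2 times
      the square of the fifth, which is then divisible by p.\<close>
    show "\<not> p\<^sup>2 dvd nat n"
    proof
      assume "p\<^sup>2 dvd nat n"
      then have pn: "int p ^ 2 dvd n" using n by (simp add: int_dvd_int_iff[symmetric])
      then have pn1: "int p dvd n" by (metis dvd_trans dvd_triv_left power2_eq_square)
      have "coprime (int p ^ 2) 6"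
        using p_dvd_6_mult[of 1] p_gt_3 prime_imp_coprime[OF prime_int_p, of 6] by simp
      moreover have "int p ^ 2 dvd 6 * v $ 6" using pn div_dvd(6) dvd_trans by blast
      ultimately have "int p ^ 2 dvd v $ 6" by (metis coprime_dvd_mult_right_iff)
      then have "(int p ^ 2)\<^sup>2 dvd 3 * (v $ 6)\<^sup>2" by (intro dvd_mult dvd_power_same)
      moreover have "(int p ^ 2)\<^sup>2 dvd int p ^ 2 * (v $ 5)\<^sup>2 + 3 * (v $ 6)\<^sup>2"
        using square_dvd[OF pn] .
      ultimately have "int p ^ 2 * int p ^ 2 dvd int p ^ 2 * (v $ 5)\<^sup>2"
        by (metis dvd_add_left_iff power2_eq_square)
      then have "int p ^ 2 dvd (v $ 5)\<^sup>2"
        by (subst (asm) dvd_times_left_cancel_iff) (use p_gt_3 in auto)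
      then have "int p dvd v $ 5" by simp
      then show False using p_not_dvd_5 pn1 by blast
    qed
    fix q :: nat
    assume q: "prime q" "q dvd nat n"
    show "q = 2 \<or> q = p"
    proof (rule ccontr)
      assume ne: "\<not> (q = 2 \<or> q = p)"
      have qn: "int q dvd n" using q(2) n by (simp add: int_dvd_int_iff[symmetric])
      have pq: "prime (int q)" using q(1) by simp
      have q2: "\<not> int q dvd 2" using ne q(1)
        by (metis int_dvd_int_iff of_nat_numeral primes_dvd_imp_eq two_is_prime_nat)
      have qp: "\<not> int q dvd int p" using ne q(1) prime_p primes_dvd_imp_eq by auto
      have "int q dvd 2 * int p ^ 2 * v $ 5" using qn div_dvd(5) dvd_trans by blast
      moreover have "\<not> int q dvd int p ^ 2" using pq qp prime_dvd_power by blast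
      ultimately have q5: "int q dvd v $ 5" using pq q2 prime_dvd_mult_iff by blast
      \<comment> \<open>The square is kept for q = 3: from 9 dividing three times the square of the
        sixth coordinate it still follows that 3 divides that coordinate.\<close>
      have sq: "(int q)\<^sup>2 dvd 3 * (v $ 6)\<^sup>2"
        using square_dvd[OF qn] q5 by (simp add: dvd_add_right_iff dvd_mult)
      have "int q dvd v $ 6"
      proof (cases "q = 3")
        case True
        then have "3 * 3 dvd 3 * (v $ 6)\<^sup>2" using sq by (simp add: power2_eq_square)
        then have "3 dvd (v $ 6)\<^sup>2" by (simp only: dvd_times_left_cancel_iff)
        then have "int q dvd (v $ 6)\<^sup>2" using True by simp
        then show ?thesis by (rule prime_dvd_power[OF pq])
      next
        case False
        have "\<not> q dvd 3"
        proof
          assume "q dvd 3"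
          then have "q = 0 \<or> q = 1 \<or> q = 2" using False dvd_imp_le[of q 3] by linarith
          then show False using ne q(1) by auto
        qed
        then have "\<not> int q dvd 3" by (metis int_dvd_int_iff of_nat_numeral)
        moreover have "int q dvd 3 * (v $ 6)\<^sup>2" using sq
          by (metis dvd_trans dvd_triv_left power2_eq_square)
        ultimately show ?thesis using pq prime_dvd_mult_iff prime_dvd_power by blast
      qed
      then show False using not_all_dvd pq qn q5 by blast
    qed
  qed
  then show ?thesis using n by auto
qed

text \<open>The only possible primes of n are 2 and p, and both were excluded from the fifth
  coordinate. This coordinate modulo n is thus a unit, and it will be the remaining orbit
  invariant.\<close>

lemma coprime_5_div: "coprime (v $ 5) n"
proof (rule coprimeI)
  fix c assume c: "c dvd v $ 5" "c dvd n"
  show "is_unit c"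
  proof (rule ccontr)
    assume "\<not> is_unit c"
    moreover have "c \<noteq> 0" using c(2) div by (auto simp: has_div_def)
    ultimately obtain q where q: "prime q" "q dvd c"
      using prime_divisorE by blast
    then have qd: "q dvd v $ 5" "q dvd n" using c dvd_trans by blast+
    have "n dvd 2 * int p" using div_cases by auto
    then have "q dvd 2 * int p" using qd(2) dvd_trans by blast
    then have "q dvd 2 \<or> q dvd int p" using q(1) prime_dvd_mult_iff by blast
    then have "q = 2 \<or> q = int p"
      using q(1) prime_int_p primes_dvd_imp_eq two_is_prime by blast
    then show False using qd odd_if_even_div(1) p_not_dvd_5 by auto
  qed
qed

end

text \<open>The sixth coordinate is odd when 2 divides n, and 0 modulo p when p divides n. Its class
  modulo n carries no information beyond n.\<close>

lemma div_dvd_diff_6: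
  assumes "bil d v v = 0" "prim v" "has_div d n v" "bil d w w = 0" "prim w" "has_div d n w"
  shows "n dvd v $ 6 - w $ 6"
proof -
  have 2: "2 dvd v $ 6 - w $ 6" if "even n"
    using odd_if_even_div(2)[OF assms(1-3) that] odd_if_even_div(2)[OF assms(4-6) that] by simp
  have p: "int p dvd v $ 6 - w $ 6" if "int p dvd n"
    using p_dvd_6_if_p_dvd_div[OF assms(1-3) that] p_dvd_6_if_p_dvd_div[OF assms(4-6) that] by simp
  have "coprime 2 (int p)" using odd_p by simp
  then show ?thesis
    using div_cases[OF assms(1-3)] 2 p by (auto intro: divides_mult)
qed

lemma equivalent_iff:
  assumes "bil d v v = 0" "prim v" "has_div d n v" "bil d w w = 0" "prim w" "has_div d n w"
    and "n dvd v $ 5 - w $ 5"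
  shows "equivalent d v w"
  using equivalent_isotropic[OF d_pos, of v n w] assms div_dvd_diff_6[OF assms(1-6)]
  by (simp add: has_div_def)

end

section \<open>Classes in the discriminant group\<close>

lemma range_emb_iff: "(z :: real ^ 6) \<in> range emb \<longleftrightarrow> (\<forall>i. z $ i \<in> \<int>)"
proof
  assume "\<forall>i. z $ i \<in> \<int>"
  then have "z = emb (\<chi> i. \<lfloor>z $ i\<rfloor>)" by (simp add: emb_def vec_eq_iff)
  then show "z \<in> range emb" by blast
qed (auto simp: emb_def)

lemma diff_fractions_in_Ints:
  fixes x n b m :: int
  assumes "n > 0" "m > 0"
  shows "real_of_int x / of_int n - of_int b / of_int m \<in> \<int> \<longleftrightarrow> m * n dvd m * x - n * b"
proof -
  have "real_of_int x / of_int n - of_int b / of_int m = of_int k \<longleftrightarrow> m * x - n * b = m * n * k" for k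
  proof -
    have "real_of_int x / of_int n - of_int b / of_int m = of_int k \<longleftrightarrow>
        real_of_int (m * x - n * b) = real_of_int (m * n * k)"
      using assms by (simp add: field_simps)
    then show ?thesis by (simp only: of_int_eq_iff)
  qed
  then show ?thesis by (metis Ints_cases Ints_of_int dvd_def)
qed

lemma mult_dvd_diffD:
  fixes a :: int
  assumes "a * c dvd a * x - y * c"
  shows "a dvd y * c" "c dvd a * x"
proof -
  obtain k where "a * x - y * c = a * c * k" using assms by blast
  then have "y * c = a * (x - c * k)" "a * x = c * (y + a * k)" by (simp_all add: algebra_simps)
  then show "a dvd y * c" "c dvd a * x" by simp_all
qed

context paramodular
begin

context
  fixes v n
  assumes iso: "bil d v v = 0" and prim: "prim v" and div: "has_div d n v"
begin

text \<open>The first four coordinates of v / n are integers, so only the coordinates along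
  \<open>vstar\<close> and \<open>wstar\<close> give conditions.\<close>

lemma cong_L_lstar_iff:
  "cong_L (lstar d v) (of_int a *s wstar + of_int b *s vstar d) \<longleftrightarrow>
     2 * int d * n dvd 2 * int d * v $ 5 - n * b \<and> 6 * n dvd 6 * v $ 6 - n * a"
proof -
  have n: "n > 0" using div by (simp add: has_div_def)
  have "real_of_int (v $ i) / of_int n \<in> \<int>" if "i \<in> {1, 2, 3, 4}" for i
    using div_dvd[OF iso prim div] that n by (auto elim!: dvdE)
  moreover have "real_of_int (v $ 5) / of_int n - of_int b / (2 * real d) \<in> \<int> \<longleftrightarrow>
      2 * int d * n dvd 2 * int d * v $ 5 - n * b"
    using diff_fractions_in_Ints[of n "2 * int d" "v $ 5" b] n d_pos by simp
  moreover have "real_of_int (v $ 6) / of_int n - of_int a / 6 \<in> \<int> \<longleftrightarrow> 6 * n dvd 6 * v $ 6 - n * a"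
    using diff_fractions_in_Ints[of n 6 "v $ 6" a] n by simp
  ultimately show ?thesis
    unfolding cong_L_def range_emb_iff forall_6
    by (simp add: lstar_def ldiv_eq[OF div] emb_def wstar_def vstar_def axis_def)
qed

lemma class_1_iff: "cong_L (lstar d v) (of_int 0 *s wstar + of_int 0 *s vstar d) \<longleftrightarrow> n = 1"
proof
  assume "cong_L (lstar d v) (of_int 0 *s wstar + of_int 0 *s vstar d)"
  then have "n dvd v $ 5"
    unfolding cong_L_lstar_iff using d_pos by simp
  then have "n dvd 1"
    using coprime_5_div[OF iso prim div] by (metis coprime_common_divisor dvd_refl)
  then show "n = 1" using div by (simp add: has_div_def)
next
  assume "n = 1"
  then show "cong_L (lstar d v) (of_int 0 *s wstar + of_int 0 *s vstar d)"
    unfolding cong_L_lstar_iff by simp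
qed

text \<open>The condition along \<open>vstar\<close> says that the fifth coordinate over n is 1/2
  modulo integers. That fraction is in lowest terms, so n = 2.\<close>

lemma class_2_iff:
  "cong_L (lstar d v) (of_int 3 *s wstar + of_int (int (p\<^sup>2)) *s vstar d) \<longleftrightarrow> n = 2"
proof
  assume "cong_L (lstar d v) (of_int 3 *s wstar + of_int (int (p\<^sup>2)) *s vstar d)"
  then have "int d * (2 * n) dvd int d * (2 * v $ 5 - n)"
    unfolding cong_L_lstar_iff by (simp add: d_def algebra_simps)
  then have *: "2 * n dvd 2 * v $ 5 - n" using d_pos by simp
  then have "even n" "n dvd 2 * v $ 5" using mult_dvd_diffD[of 2 n "v $ 5" 1] by simp_all
  moreover have "n dvd 2" using \<open>n dvd 2 * v $ 5\<close> coprime_5_div[OF iso prim div]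
    by (simp add: coprime_commute coprime_dvd_mult_left_iff)
  ultimately show "n = 2" using div by (auto simp: has_div_def dest: zdvd_imp_le elim!: evenE)
next
  assume n: "n = 2"
  then have "odd (v $ 5)" "odd (v $ 6)" using odd_if_even_div[OF iso prim div] by auto
  then obtain i j where "v $ 5 = 2 * i + 1" "v $ 6 = 2 * j + 1" by (auto elim!: oddE)
  then show "cong_L (lstar d v) (of_int 3 *s wstar + of_int (int (p\<^sup>2)) *s vstar d)"
    unfolding cong_L_lstar_iff n by (simp add: d_def algebra_simps)
qed

text \<open>Here the fifth coordinate over n has to equal k/p modulo integers. Both fractions are in
  lowest terms, so n = p and the numerators agree modulo p.\<close>

lemma class_p_iff:
  assumes "\<not> p dvd k"
  shows "cong_L (lstar d v) (of_int 0 *s wstar + of_int (int (2 * k * p)) *s vstar d) \<longleftrightarrow>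
    n = int p \<and> n dvd v $ 5 - int k"
proof -
  have "2 * int d * n dvd 2 * int d * v $ 5 - n * int (2 * k * p) \<longleftrightarrow>
      2 * int p * (int p * n) dvd 2 * int p * (int p * v $ 5 - int k * n)"
    by (simp add: d_def power2_eq_square algebra_simps)
  also have "\<dots> \<longleftrightarrow> int p * n dvd int p * v $ 5 - int k * n"
    using p_gt_3 by simp
  finally have 1: "2 * int d * n dvd 2 * int d * v $ 5 - n * int (2 * k * p) \<longleftrightarrow>
    int p * n dvd int p * v $ 5 - int k * n" .
  show ?thesis
  proof
    assume "cong_L (lstar d v) (of_int 0 *s wstar + of_int (int (2 * k * p)) *s vstar d)"
    then have *: "int p * n dvd int p * v $ 5 - int k * n"
      unfolding cong_L_lstar_iff 1 by simp
    then have "int p dvd int k * n" by (rule mult_dvd_diffD)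
    then have pn: "int p dvd n" using assms prime_int_p by (simp add: prime_dvd_mult_iff)
    have "n dvd int p * v $ 5" using * by (rule mult_dvd_diffD)
    then have "n dvd int p" using coprime_5_div[OF iso prim div]
      by (simp add: coprime_commute coprime_dvd_mult_left_iff)
    then have n: "n = int p"
      using pn div by (metis has_div_def less_imp_le of_nat_0_le_iff zdvd_antisym_nonneg)
    with * have "int p * n dvd int p * (v $ 5 - int k)"
      by (simp add: algebra_simps)
    with n show "n = int p \<and> n dvd v $ 5 - int k" using p_gt_3 by simp
  next
    assume n: "n = int p \<and> n dvd v $ 5 - int k"
    then have "n dvd v $ 6" using p_dvd_6_if_p_dvd_div[OF iso prim div] by simp
    moreover have "int p * n dvd int p * (v $ 5 - int k)" using n by auto
    then have "int p * n dvd int p * v $ 5 - int k * n" using n by (simp add: algebra_simps)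
    ultimately show "cong_L (lstar d v) (of_int 0 *s wstar + of_int (int (2 * k * p)) *s vstar d)"
      unfolding cong_L_lstar_iff 1 by simp
  qed
qed

text \<open>As before with the reduced fraction m/(2p). Along \<open>wstar\<close> the condition
  asks for the sixth coordinate over 2p to be 1/2 modulo integers, which holds since that coordinate
  is odd and divisible by p.\<close>

lemma class_2p_iff:
  assumes "\<not> p dvd m" "odd m"
  shows "cong_L (lstar d v) (of_int 3 *s wstar + of_int (int (m * p)) *s vstar d) \<longleftrightarrow>
    n = 2 * int p \<and> n dvd v $ 5 - int m"
proof -
  have "2 * int d * n dvd 2 * int d * v $ 5 - n * int (m * p) \<longleftrightarrow>
      int p * (2 * int p * n) dvd int p * (2 * int p * v $ 5 - int m * n)"
    by (simp add: d_def power2_eq_square algebra_simps)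
  also have "\<dots> \<longleftrightarrow> 2 * int p * n dvd 2 * int p * v $ 5 - int m * n"
    using p_gt_3 by simp
  finally have 1: "2 * int d * n dvd 2 * int d * v $ 5 - n * int (m * p) \<longleftrightarrow>
    2 * int p * n dvd 2 * int p * v $ 5 - int m * n" .
  show ?thesis
  proof
    assume "cong_L (lstar d v) (of_int 3 *s wstar + of_int (int (m * p)) *s vstar d)"
    then have *: "2 * int p * n dvd 2 * int p * v $ 5 - int m * n"
      unfolding cong_L_lstar_iff 1 by simp
    then have 2: "2 * int p dvd int m * n" by (rule mult_dvd_diffD)
    then have "int p dvd int m * n" "2 dvd int m * n" by (auto dest: dvd_mult_right dvd_mult_left)
    then have "int p dvd n" "2 dvd n" using assms prime_int_p by (auto simp: prime_dvd_mult_iff)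
    then have pn: "2 * int p dvd n" using odd_p by (intro divides_mult) auto
    have "n dvd 2 * int p * v $ 5" using * by (rule mult_dvd_diffD)
    then have "n dvd 2 * int p" using coprime_5_div[OF iso prim div]
      by (simp add: coprime_commute coprime_dvd_mult_left_iff)
    then have n: "n = 2 * int p"
      using pn div by (auto simp: has_div_def intro: zdvd_antisym_nonneg)
    with * have "2 * int p * n dvd 2 * int p * (v $ 5 - int m)"
      by (simp add: algebra_simps)
    then have "n dvd v $ 5 - int m"
      by (subst (asm) dvd_times_left_cancel_iff) (use p_gt_3 in auto)
    with n show "n = 2 * int p \<and> n dvd v $ 5 - int m" by simp
  next
    assume n: "n = 2 * int p \<and> n dvd v $ 5 - int m"
    then have "odd (v $ 6)" "int p dvd v $ 6"
      using odd_if_even_div(2)[OF iso prim div] p_dvd_6_if_p_dvd_div[OF iso prim div] by auto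
    then have "2 dvd v $ 6 - int p" "int p dvd v $ 6 - int p" using odd_p by auto
    then have "2 * int p dvd v $ 6 - int p" using odd_p by (intro divides_mult) auto
    then have "6 * n dvd 6 * (v $ 6 - int p)" using n by (simp only: dvd_times_left_cancel_iff)
    then have "6 * n dvd 6 * v $ 6 - n * 3" using n by (simp add: algebra_simps)
    moreover have "2 * int p * n dvd 2 * int p * (v $ 5 - int m)"
      using n by (intro mult_dvd_mono) auto
    then have "2 * int p * n dvd 2 * int p * v $ 5 - int m * n" using n by (simp add: algebra_simps)
    ultimately show "cong_L (lstar d v) (of_int 3 *s wstar + of_int (int (m * p)) *s vstar d)"
      unfolding cong_L_lstar_iff 1 by simp
  qed
qed

end

lemma four_dvd_square_plus_3: "odd x \<Longrightarrow> 4 dvd x\<^sup>2 + (3 :: int)"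
  by (auto elim!: oddE simp: power2_eq_square algebra_simps)

text \<open>The vector is \<open>vec6 n (n * y) 0 0 u s\<close>, where y is determined by isotropy.
  The zero third and fourth coordinates leave the second hyperbolic plane orthogonal to it, which
  \<open>type_exists\<close> uses.\<close>

lemma exists_isotropic:
  assumes "n \<in> {1, 2, int p, 2 * int p}" "coprime u n"
  shows "\<exists>v. bil d v v = 0 \<and> prim v \<and> has_div d n v \<and> v $ 5 = u \<and> v $ 3 = 0 \<and> v $ 4 = 0"
proof -
  \<comment> \<open>The values 0, 1, 0, p for n = 1, 2, p, 2p make
    \<open>(int p)\<^sup>2 * u\<^sup>2 + 3 * s\<^sup>2\<close> divisible by n^2; for even n this
    rests on x^2 + 3 being divisible by 4 for odd x.\<close>
  define s where "s = (if even n then (if int p dvd n then int p else 1) else 0)"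
  have "\<exists>y. n * (n * y) = (int p)\<^sup>2 * u\<^sup>2 + 3 * s\<^sup>2"
  proof -
    consider "n = 1" | "n = 2" | "n = int p" | "n = 2 * int p" using assms(1) by blast
    then show ?thesis
    proof cases
      case 2
      then have "\<not> int p dvd n" using p_gt_3 by (auto dest: zdvd_imp_le)
      moreover have "odd (int p * u)" using 2 assms(2) odd_p by auto
      then obtain y where "(int p * u)\<^sup>2 + 3 = 4 * y" using four_dvd_square_plus_3 by blast
      ultimately show ?thesis using 2 by (intro exI[of _ y]) (simp add: s_def power_mult_distrib)
    next
      case 3
      then show ?thesis using odd_p by (intro exI[of _ "u\<^sup>2"]) (simp add: s_def power2_eq_square)
    next
      case 4
      then have "odd u" using assms(2) by auto
      then obtain y where "u\<^sup>2 + 3 = 4 * y" using four_dvd_square_plus_3 by blast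
      then have "int p * int p * (u\<^sup>2 + 3) = int p * int p * (4 * y)" by simp
      then show ?thesis using 4
        by (intro exI[of _ y]) (simp add: s_def power2_eq_square algebra_simps)
    qed (simp add: s_def)
  qed
  then obtain y where y: "n * (n * y) = (int p)\<^sup>2 * u\<^sup>2 + 3 * s\<^sup>2" by blast
  define v where "v = vec6 n (n * y) 0 0 u s"
  have n: "n > 0" using assms(1) p_gt_3 by auto
  have "bil d v v = 0"
    using y by (simp add: bil_self half_norm_def v_def d_def)
  moreover have "prim v"
    using assms(2) by (auto simp: prim_def v_def forall_6 dest: coprime_common_divisor)
  moreover have "has_div d n v"
    unfolding has_div_def
  proof (intro conjI n antisym subsetI)
    fix x assume "x \<in> range (bil d v)"
    then obtain z where z: "x = bil d v z" by blast
    have "n dvd 2 * int d" "n dvd 6 * s"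
      using assms(1) by (auto simp: d_def s_def power2_eq_square)
    then have "n dvd x" unfolding z by (simp add: bil_def v_def)
    then show "x \<in> range (\<lambda>k. n * k)" by blast
  next
    fix x assume "x \<in> range (\<lambda>k. n * k)"
    then obtain k where "x = n * k" by blast
    then have "x = bil d v (k *s axis 2 1)" by (simp add: bil_linear bil_axis v_def)
    then show "x \<in> range (bil d v)" by blast
  qed
  ultimately show ?thesis by (intro exI[of _ v]) (simp add: v_def)
qed

end

section \<open>Isotropic planes and their types\<close>

definition has_rank :: "nat \<Rightarrow> (int ^ 6) set \<Rightarrow> bool" where
  "has_rank n M \<longleftrightarrow> (\<exists>b. z_basis b {1..n} M)"

lemma has_rank_0: "has_rank 0 M \<longleftrightarrow> M = {0}"
  by (auto simp: has_rank_def z_basis_def)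

lemma has_rank_SucI:
  assumes "has_rank n N" "M = {y + k *s x | y k. y \<in> N}" "\<And>k. k *s x \<in> N \<Longrightarrow> k = 0"
  shows "has_rank (Suc n) M"
proof -
  obtain b where b: "\<And>c. (\<Sum>i\<in>{1..n}. c i *s b i) = 0 \<Longrightarrow> \<forall>i\<in>{1..n}. c i = 0"
    "N = range (\<lambda>c. \<Sum>i\<in>{1..n}. c i *s b i)"
    using assms(1) unfolding has_rank_def z_basis_def by blast
  let ?b = "b(Suc n := x)"
  have sum: "(\<Sum>i\<in>{1..Suc n}. c i *s ?b i) = (\<Sum>i\<in>{1..n}. c i *s b i) + c (Suc n) *s x" for c
    by simp
  have "z_basis ?b {1..Suc n} M"
    unfolding z_basis_def sum
  proof (intro conjI allI impI)
    fix c :: "nat \<Rightarrow> int"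
    assume z: "(\<Sum>i\<in>{1..n}. c i *s b i) + c (Suc n) *s x = 0"
    moreover have "(\<Sum>i\<in>{1..n}. (- c i) *s b i) = - (\<Sum>i\<in>{1..n}. c i *s b i)"
      by (simp add: vec_eq_iff sum_negf)
    ultimately have "c (Suc n) *s x = (\<Sum>i\<in>{1..n}. (- c i) *s b i)"
      by (metis add.commute eq_neg_iff_add_eq_0)
    then have "c (Suc n) *s x \<in> N" unfolding b(2)
      by (rule range_eqI[where f = "\<lambda>c. \<Sum>i\<in>{1..n}. c i *s b i" and x = "\<lambda>i. - c i"])
    then have "c (Suc n) = 0" by (rule assms(3))
    with z b(1) have "\<forall>i\<in>{1..n}. c i = 0" by simp
    with \<open>c (Suc n) = 0\<close> show "\<forall>i\<in>{1..Suc n}. c i = 0" by (auto simp: le_Suc_eq)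
  next
    show "M = range (\<lambda>c. (\<Sum>i\<in>{1..n}. c i *s b i) + c (Suc n) *s x)"
    proof (intro antisym subsetI)
      fix z assume "z \<in> M"
      then obtain c k where "z = (\<Sum>i\<in>{1..n}. c i *s b i) + k *s x"
        using assms(2) b(2) by auto
      then have "z = (\<Sum>i\<in>{1..n}. (c(Suc n := k)) i *s b i) + (c(Suc n := k)) (Suc n) *s x"
        by simp
      then show "z \<in> range (\<lambda>c. (\<Sum>i\<in>{1..n}. c i *s b i) + c (Suc n) *s x)" by blast
    qed (use assms(2) b(2) in auto)
  qed
  then show ?thesis unfolding has_rank_def by blast
qed

lemma has_rank_SucE:
  assumes "has_rank (Suc n) M"
  obtains N x where "has_rank n N" "M = {y + k *s x | y k. y \<in> N}" "\<And>k. k *s x \<in> N \<Longrightarrow> k = 0"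
proof -
  obtain b where b: "\<And>c. (\<Sum>i\<in>{1..Suc n}. c i *s b i) = 0 \<Longrightarrow> \<forall>i\<in>{1..Suc n}. c i = 0"
    "M = range (\<lambda>c. \<Sum>i\<in>{1..Suc n}. c i *s b i)"
    using assms unfolding has_rank_def z_basis_def by blast
  define N where "N = range (\<lambda>c. \<Sum>i\<in>{1..n}. c i *s b i)"
  have upd: "(\<Sum>i\<in>{1..Suc n}. (c(Suc n := k)) i *s b i) = (\<Sum>i\<in>{1..n}. c i *s b i) + k *s b (Suc n)" for c k
    by simp
  show ?thesis
  proof (rule that[of N "b (Suc n)"])
    have "\<forall>i\<in>{1..n}. c i = 0" if "(\<Sum>i\<in>{1..n}. c i *s b i) = 0" for c
    proof -
      have "\<forall>i\<in>{1..Suc n}. (c(Suc n := 0)) i = 0" by (rule b(1)) (simp only: upd that, simp)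
      then have "(c(Suc n := 0)) i = 0" if "i \<in> {1..n}" for i
        using that by (metis atLeastAtMost_iff le_SucI)
      then show ?thesis by fastforce
    qed
    then show "has_rank n N" unfolding has_rank_def z_basis_def N_def by blast
    show "M = {y + k *s b (Suc n) | y k. y \<in> N}"
    proof (intro antisym subsetI)
      fix z assume "z \<in> {y + k *s b (Suc n) | y k. y \<in> N}"
      then obtain c k where "z = (\<Sum>i\<in>{1..n}. c i *s b i) + k *s b (Suc n)" by (auto simp: N_def)
      then show "z \<in> M" unfolding b(2) upd[symmetric] by blast
    qed (auto simp: b(2) N_def)
    fix k assume "k *s b (Suc n) \<in> N"
    then obtain c where "k *s b (Suc n) = (\<Sum>i\<in>{1..n}. c i *s b i)" by (auto simp: N_def)
    then have "(\<Sum>i\<in>{1..n}. c i *s b i) + (- k) *s b (Suc n) = 0" by (simp add: vec_eq_iff)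
    then have "\<forall>i\<in>{1..Suc n}. (c(Suc n := - k)) i = 0" by (intro b(1)) (simp only: upd)
    then show "k = 0" by (auto dest: bspec[of _ _ "Suc n"])
  qed
qed

lemma has_rank_closed:
  assumes "has_rank n M"
  shows "0 \<in> M" "x \<in> M \<Longrightarrow> y \<in> M \<Longrightarrow> x + y \<in> M" "x \<in> M \<Longrightarrow> k *s x \<in> M"
proof -
  obtain b where b: "M = range (\<lambda>c. \<Sum>i\<in>{1..n}. c i *s b i)"
    using assms unfolding has_rank_def z_basis_def by blast
  show "0 \<in> M" unfolding b by (rule range_eqI[of _ _ "\<lambda>_. 0"]) simp
  show "x + y \<in> M" if xy: "x \<in> M" "y \<in> M"
  proof -
    obtain c c' where "x = (\<Sum>i\<in>{1..n}. c i *s b i)" "y = (\<Sum>i\<in>{1..n}. c' i *s b i)"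
      using xy unfolding b by blast
    then have "x + y = (\<Sum>i\<in>{1..n}. (c i + c' i) *s b i)"
      by (simp add: sum.distrib vector_sadd_rdistrib)
    then show ?thesis unfolding b
      by (rule range_eqI[where f = "\<lambda>c. \<Sum>i\<in>{1..n}. c i *s b i" and x = "\<lambda>i. c i + c' i"])
  qed
  show "k *s x \<in> M" if x: "x \<in> M"
  proof -
    obtain c where "x = (\<Sum>i\<in>{1..n}. c i *s b i)" using x unfolding b by blast
    then have "k *s x = (\<Sum>i\<in>{1..n}. (k * c i) *s b i)"
      by (simp add: vec_eq_iff sum_distrib_left mult.assoc)
    then show ?thesis unfolding b
      by (rule range_eqI[where f = "\<lambda>c. \<Sum>i\<in>{1..n}. c i *s b i" and x = "\<lambda>i. k * c i"])
  qed
qed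

definition functional :: "(int ^ 6 \<Rightarrow> int) \<Rightarrow> bool" where
  "functional \<phi> \<longleftrightarrow> (\<forall>x y. \<phi> (x + y) = \<phi> x + \<phi> y) \<and> (\<forall>c x. \<phi> (c *s x) = c * \<phi> x)"

lemma functional_zero: "functional \<phi> \<Longrightarrow> \<phi> 0 = 0"
  unfolding functional_def by (metis mult_zero_left vector_smult_lzero)

text \<open>Induction on the rank with M = N + Z x. If the functional vanishes on N, its kernel in M
  is N. Otherwise the kernel in M is the kernel in N together with one further generator.\<close>

lemma has_rank_kernel:
  assumes "functional \<phi>" "has_rank (Suc n) M" "\<exists>x\<in>M. \<phi> x \<noteq> 0"
  shows "has_rank n {x \<in> M. \<phi> x = 0}"
  using assms(2,3)
proof (induction n arbitrary: M)
  case (0 M)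
  from 0(1) obtain N x where N: "has_rank 0 N" and M: "M = {y + k *s x | y k. y \<in> N}"
    by (rule has_rank_SucE) blast
  have "\<phi> x \<noteq> 0" using 0(2) N M assms(1) by (auto simp: has_rank_0 functional_def)
  then show ?case using N M assms(1) functional_zero[OF assms(1)]
    by (auto simp: has_rank_0 functional_def intro: exI[of _ 0])
next
  case (Suc n M)
  have \<phi>: "\<phi> (a + b) = \<phi> a + \<phi> b" "\<phi> (c *s a) = c * \<phi> a" for a b c
    using assms(1) by (auto simp: functional_def)
  from Suc(2) obtain N x where N: "has_rank (Suc n) N" and M: "M = {y + k *s x | y k. y \<in> N}"
    and ind: "\<And>k. k *s x \<in> N \<Longrightarrow> k = 0"
    by (rule has_rank_SucE) blast
  note cl = has_rank_closed[OF N]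
  show ?case
  proof (cases "\<exists>y\<in>N. \<phi> y \<noteq> 0")
    case False
    then have "\<phi> x \<noteq> 0" using Suc(3) M by (auto simp: \<phi>)
    then have "{x \<in> M. \<phi> x = 0} = N"
      using False M by (auto simp: \<phi>) (metis add.right_neutral mult_zero_left vector_smult_lzero)+
    then show ?thesis using N by simp
  next
    case True
    then have IH: "has_rank n {y \<in> N. \<phi> y = 0}" using Suc(1) N by blast
    have "\<exists>g>0. \<phi> ` N = range (\<lambda>k. g * k)"
    proof -
      obtain y0 where y0: "y0 \<in> N" "\<phi> y0 \<noteq> 0" using True by blast
      show ?thesis
        by (rule int_ideal_principal[of "\<phi> ` N" "\<phi> y0"])
          (use y0 cl in \<open>auto simp: \<phi>[symmetric]\<close>)
    qed
    then obtain g where g: "g > 0" "\<phi> ` N = range (\<lambda>k. g * k)" by blast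
    then obtain z where z: "z \<in> N" "\<phi> z = g" by (metis imageE mult.right_neutral rangeI)
    define h where "h = \<phi> x"
    define \<gamma> where "\<gamma> = gcd g h"
    obtain g' h' where g': "g = \<gamma> * g'" and h': "h = \<gamma> * h'" and cop: "coprime g' h'"
      using gcd_coprime_exists[of g h] g(1) unfolding \<gamma>_def by (metis gcd_eq_0_iff less_irrefl mult.commute)
    have \<gamma>0: "\<gamma> \<noteq> 0" "g' \<noteq> 0" using g(1) g' by auto
    \<comment> \<open>With g the generator of the values on N, attained at z, and h the value at x,
      this is the smallest integral relation between z and x in the kernel: the coefficients are h
      and g divided by their gcd.\<close>
    define w where "w = h' *s z + (- g') *s x"
    have \<phi>w: "\<phi> w = 0" by (simp add: w_def \<phi> z h_def[symmetric]) (simp add: g' h')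
    show ?thesis
    proof (rule has_rank_SucI[OF IH, of _ w])
      show "{x \<in> M. \<phi> x = 0} = {y + k *s w |y k. y \<in> {y \<in> N. \<phi> y = 0}}"
      proof (intro antisym subsetI)
        fix m assume "m \<in> {x \<in> M. \<phi> x = 0}"
        then obtain y k where m: "m = y + k *s x" "y \<in> N" "\<phi> m = 0" using M by blast
        obtain j where j: "\<phi> y = g * j" using m(2) g(2) by blast
        have "\<gamma> * (g' * j + k * h') = 0" using m(3) j by (simp add: m(1) \<phi> h_def[symmetric] g' h' algebra_simps)
        then have e: "g' * j + k * h' = 0" using \<gamma>0 by simp
        then have "g' dvd k * h'" by (metis dvd_add_right_iff dvd_triv_left dvd_0_right)
        then have "g' dvd k" using cop by (simp add: coprime_dvd_mult_left_iff)
        then obtain l where l: "k = g' * l" by blast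
        have "m = (y + (l * h') *s z) + (- l) *s w"
          by (simp add: m(1) l w_def vec_eq_iff algebra_simps)
        moreover have "y + (l * h') *s z \<in> N" using cl m(2) z(1) by blast
        moreover have "\<phi> (y + (l * h') *s z) = 0"
        proof -
          have "\<phi> (y + (l * h') *s z) = \<phi> m + l * \<phi> w"
            by (simp add: calculation(1) \<phi>)
          then show ?thesis using m(3) \<phi>w by simp
        qed
        ultimately show "m \<in> {y + k *s w |y k. y \<in> {y \<in> N. \<phi> y = 0}}" by blast
      next
        fix m assume "m \<in> {y + k *s w |y k. y \<in> {y \<in> N. \<phi> y = 0}}"
        then obtain y k where m: "m = y + k *s w" "y \<in> N" "\<phi> y = 0" by blast
        have "m = (y + (k * h') *s z) + (- k * g') *s x"
          by (simp add: m(1) w_def vec_eq_iff algebra_simps)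
        moreover have "y + (k * h') *s z \<in> N" using cl m(2) z(1) by blast
        ultimately have "m \<in> M" unfolding M by blast
        then show "m \<in> {x \<in> M. \<phi> x = 0}" using m \<phi>w by (simp add: \<phi>)
      qed
      fix k assume "k *s w \<in> {y \<in> N. \<phi> y = 0}"
      then have "k *s w + (- k * h') *s z \<in> N" using cl z by blast
      moreover have "k *s w + (- k * h') *s z = (- k * g') *s x"
        by (simp add: w_def vec_eq_iff algebra_simps)
      ultimately have "- k * g' = 0" using ind by metis
      then show "k = 0" using \<gamma>0 by simp
    qed
  qed
qed

lemma ivl_2: "{1..2} = {1, 2::nat}" and ivl_4: "{1..4} = {1, 2, 3, 4::nat}"
  and ivl_6: "{1..6} = {1, 2, 3, 4, 5, 6::nat}"
  by auto

text \<open>This and the two lemmas for ranks 4 and 6 turn the coefficient functions of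
  \<open>z_basis\<close> into separate variables.\<close>

lemma z_basis_2_iff:
  "z_basis b {1..2} E \<longleftrightarrow> (\<forall>x y. x *s b 1 + y *s b 2 = 0 \<longrightarrow> x = 0 \<and> y = 0)
     \<and> E = {x *s b 1 + y *s b 2 | x y. True}" (is "_ \<longleftrightarrow> ?I \<and> E = ?S")
proof -
  have f: "\<exists>c :: nat \<Rightarrow> int. c 1 = x \<and> c 2 = y" for x y
    by (rule exI[of _ "\<lambda>i. if i = 1 then x else y"]) simp
  have sum: "(\<Sum>i\<in>{1..2}. c i *s b i) = c 1 *s b 1 + c 2 *s b 2" for c
    by (simp add: ivl_2 del: One_nat_def)
  have "(\<forall>c. (\<Sum>i\<in>{1..2}. c i *s b i) = 0 \<longrightarrow> (\<forall>i\<in>{1..2}. c i = 0)) \<longleftrightarrow> ?I"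
  proof
    assume *: "\<forall>c. (\<Sum>i\<in>{1..2}. c i *s b i) = 0 \<longrightarrow> (\<forall>i\<in>{1..2}. c i = 0)"
    show ?I
    proof (intro allI impI)
      fix x y
      assume **: "x *s b 1 + y *s b 2 = 0"
      obtain c :: "nat \<Rightarrow> int" where c: "c 1 = x \<and> c 2 = y"
        using f by blast
      have "\<forall>i\<in>{1..2}. c i = 0"
        by (rule *[THEN spec, THEN mp]) (unfold sum, simp only: c **)
      then show "x = 0 \<and> y = 0"
        unfolding ivl_2 using c by blast
    qed
  next
    assume ?I
    then show "\<forall>c. (\<Sum>i\<in>{1..2}. c i *s b i) = 0 \<longrightarrow> (\<forall>i\<in>{1..2}. c i = 0)"
      unfolding sum unfolding ivl_2 by blast
  qed
  moreover have "range (\<lambda>c. \<Sum>i\<in>{1..2}. c i *s b i) = ?S"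
  proof (intro antisym subsetI)
    fix x assume "x \<in> ?S"
    then obtain x1 x2 where
      x: "x = x1 *s b 1 + x2 *s b 2" by blast
    obtain c :: "nat \<Rightarrow> int" where "c 1 = x1 \<and> c 2 = x2"
      using f by blast
    then show "x \<in> range (\<lambda>c. \<Sum>i\<in>{1..2}. c i *s b i)"
      unfolding sum x by (intro range_eqI[of _ _ c]) simp
  qed (unfold sum, blast)
  ultimately show ?thesis unfolding z_basis_def by simp
qed

lemma z_basis_4_iff:
  "z_basis b {1..4} E \<longleftrightarrow>
     (\<forall>x y z t. x *s b 1 + y *s b 2 + z *s b 3 + t *s b 4 = 0 \<longrightarrow> x = 0 \<and> y = 0 \<and> z = 0 \<and> t = 0)
     \<and> E = {x *s b 1 + y *s b 2 + z *s b 3 + t *s b 4 | x y z t. True}" (is "_ \<longleftrightarrow> ?I \<and> E = ?S")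
proof -
  have f: "\<exists>c :: nat \<Rightarrow> int. c 1 = x \<and> c 2 = y \<and> c 3 = z \<and> c 4 = t" for x y z t
    by (rule exI[of _ "\<lambda>i. if i = 1 then x else if i = 2 then y else if i = 3 then z else t"]) simp
  have sum: "(\<Sum>i\<in>{1..4}. c i *s b i) = c 1 *s b 1 + c 2 *s b 2 + c 3 *s b 3 + c 4 *s b 4" for c
    by (simp add: ivl_4 add.assoc del: One_nat_def)
  have "(\<forall>c. (\<Sum>i\<in>{1..4}. c i *s b i) = 0 \<longrightarrow> (\<forall>i\<in>{1..4}. c i = 0)) \<longleftrightarrow> ?I"
  proof
    assume *: "\<forall>c. (\<Sum>i\<in>{1..4}. c i *s b i) = 0 \<longrightarrow> (\<forall>i\<in>{1..4}. c i = 0)"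
    show ?I
    proof (intro allI impI)
      fix x y z t
      assume **: "x *s b 1 + y *s b 2 + z *s b 3 + t *s b 4 = 0"
      obtain c :: "nat \<Rightarrow> int" where c: "c 1 = x \<and> c 2 = y \<and> c 3 = z \<and> c 4 = t"
        using f by blast
      have "\<forall>i\<in>{1..4}. c i = 0"
        by (rule *[THEN spec, THEN mp]) (unfold sum, simp only: c **)
      then show "x = 0 \<and> y = 0 \<and> z = 0 \<and> t = 0"
        unfolding ivl_4 using c by blast
    qed
  next
    assume ?I
    then show "\<forall>c. (\<Sum>i\<in>{1..4}. c i *s b i) = 0 \<longrightarrow> (\<forall>i\<in>{1..4}. c i = 0)"
      unfolding sum unfolding ivl_4 by blast
  qed
  moreover have "range (\<lambda>c. \<Sum>i\<in>{1..4}. c i *s b i) = ?S"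
  proof (intro antisym subsetI)
    fix x assume "x \<in> ?S"
    then obtain x1 x2 x3 x4 where
      x: "x = x1 *s b 1 + x2 *s b 2 + x3 *s b 3 + x4 *s b 4" by blast
    obtain c :: "nat \<Rightarrow> int" where "c 1 = x1 \<and> c 2 = x2 \<and> c 3 = x3 \<and> c 4 = x4"
      using f by blast
    then show "x \<in> range (\<lambda>c. \<Sum>i\<in>{1..4}. c i *s b i)"
      unfolding sum x by (intro range_eqI[of _ _ c]) simp
  qed (unfold sum, blast)
  ultimately show ?thesis unfolding z_basis_def by simp
qed

lemma z_basis_6_iff:
  "z_basis b {1..6} E \<longleftrightarrow>
     (\<forall>x y z t u w. x *s b 1 + y *s b 2 + z *s b 3 + t *s b 4 + u *s b 5 + w *s b 6 = 0 \<longrightarrow>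
        x = 0 \<and> y = 0 \<and> z = 0 \<and> t = 0 \<and> u = 0 \<and> w = 0)
     \<and> E = {x *s b 1 + y *s b 2 + z *s b 3 + t *s b 4 + u *s b 5 + w *s b 6 | x y z t u w. True}"
  (is "_ \<longleftrightarrow> ?I \<and> E = ?S")
proof -
  have f: "\<exists>c :: nat \<Rightarrow> int. c 1 = x \<and> c 2 = y \<and> c 3 = z \<and> c 4 = t \<and> c 5 = u \<and> c 6 = w" for x y z t u w
    by (rule exI[of _ "\<lambda>i. if i = 1 then x else if i = 2 then y else if i = 3 then z
      else if i = 4 then t else if i = 5 then u else w"]) simp
  have sum: "(\<Sum>i\<in>{1..6}. c i *s b i) =
      c 1 *s b 1 + c 2 *s b 2 + c 3 *s b 3 + c 4 *s b 4 + c 5 *s b 5 + c 6 *s b 6" for c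
    by (simp add: ivl_6 add.assoc del: One_nat_def)
  have "(\<forall>c. (\<Sum>i\<in>{1..6}. c i *s b i) = 0 \<longrightarrow> (\<forall>i\<in>{1..6}. c i = 0)) \<longleftrightarrow> ?I"
  proof
    assume *: "\<forall>c. (\<Sum>i\<in>{1..6}. c i *s b i) = 0 \<longrightarrow> (\<forall>i\<in>{1..6}. c i = 0)"
    show ?I
    proof (intro allI impI)
      fix x y z t u w
      assume **: "x *s b 1 + y *s b 2 + z *s b 3 + t *s b 4 + u *s b 5 + w *s b 6 = 0"
      obtain c :: "nat \<Rightarrow> int" where c: "c 1 = x \<and> c 2 = y \<and> c 3 = z \<and> c 4 = t \<and> c 5 = u \<and> c 6 = w"
        using f by blast
      have "\<forall>i\<in>{1..6}. c i = 0"
        by (rule *[THEN spec, THEN mp]) (unfold sum, simp only: c **)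
      then show "x = 0 \<and> y = 0 \<and> z = 0 \<and> t = 0 \<and> u = 0 \<and> w = 0"
        unfolding ivl_6 using c by blast
    qed
  next
    assume ?I
    then show "\<forall>c. (\<Sum>i\<in>{1..6}. c i *s b i) = 0 \<longrightarrow> (\<forall>i\<in>{1..6}. c i = 0)"
      unfolding sum unfolding ivl_6 by blast
  qed
  moreover have "range (\<lambda>c. \<Sum>i\<in>{1..6}. c i *s b i) = ?S"
  proof (intro antisym subsetI)
    fix x assume "x \<in> ?S"
    then obtain x1 x2 x3 x4 x5 x6 where
      x: "x = x1 *s b 1 + x2 *s b 2 + x3 *s b 3 + x4 *s b 4 + x5 *s b 5 + x6 *s b 6" by blast
    obtain c :: "nat \<Rightarrow> int" where "c 1 = x1 \<and> c 2 = x2 \<and> c 3 = x3 \<and> c 4 = x4 \<and> c 5 = x5 \<and> c 6 = x6"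
      using f by blast
    then show "x \<in> range (\<lambda>c. \<Sum>i\<in>{1..6}. c i *s b i)"
      unfolding sum x by (intro range_eqI[of _ _ c]) simp
  qed (unfold sum, blast)
  ultimately show ?thesis unfolding z_basis_def by simp
qed

section \<open>Bases adapted to an isotropic plane\<close>

definition plane :: "int ^ 6 \<Rightarrow> int ^ 6 \<Rightarrow> (int ^ 6) set" where
  "plane e f = {x *s e + y *s f | x y. True}"

lemma plane_memberI: "x *s e + y *s f \<in> plane e f"
  by (auto simp: plane_def)

lemma functional_bil: "functional (bil d u)"
  by (simp add: functional_def bil_linear)

lemma has_rank_UNIV: "has_rank 6 UNIV"
proof -
  define b :: "nat \<Rightarrow> int ^ 6" where "b i = axis (of_nat i) 1" for i
  have b: "x *s b 1 + y *s b 2 + z *s b 3 + t *s b 4 + u *s b 5 + w *s b 6 = vec6 x y z t u w" for x y z t u w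
    by (simp add: b_def vec_eq_iff forall_6 axis_def)
  have "z_basis b {1..6} UNIV"
    unfolding z_basis_6_iff b
  proof (intro conjI allI impI antisym subsetI)
    fix x :: "int ^ 6"
    show "x \<in> {vec6 x y z t u w |x y z t u w. True}" using vec6_eta[of x] by blast
  qed (auto simp: vec_eq_iff forall_6)
  then show ?thesis unfolding has_rank_def by blast
qed

text \<open>The basis required by \<open>has_type\<close> is e, f, a basis of a rank 2 complement K,
  then g and w that are dual to f and e up to the factor a. All the work is to show that these six
  vectors generate the lattice.\<close>

lemma plane_types:
  assumes d: "d > 0" and bil: "bil d e e = 0" "bil d e f = 0" "bil d f f = 0" "bil d f f' = 1" "bil d e f' = 0"
    and prim: "prim e" and div: "has_div d a e"
  shows "plane e f \<in> isotropic d 2" "has_type d (nat a) (plane e f)"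
proof -
  have bil': "bil d f e = 0" "bil d f' f = 1" "bil d f' e = 0"
    using bil by (simp_all add: bil_commute)
  have indep: "x = 0 \<and> y = 0" if "x *s e + y *s f = 0" for x y
  proof -
    have "bil d (x *s e + y *s f) f' = 0" using that by simp
    then have "y = 0" using bil by (simp add: bil_linear)
    then show ?thesis using that prim_nonzero[OF prim] by (auto simp: vec_eq_iff)
  qed
  have basis: "z_basis b {1..2} (plane e f)" if "b 1 = e" "b 2 = f" for b
    unfolding z_basis_2_iff using indep that by (auto simp: plane_def)
  have sat: "x \<in> plane e f" if nz: "n \<noteq> 0" and nx: "n *s x \<in> plane e f" for n x
  proof -
    obtain \<alpha> \<beta> where nx: "n *s x = \<alpha> *s e + \<beta> *s f" using nx by (auto simp: plane_def)
    then have "n * bil d x f' = \<beta>" using bil by (metis bil_add_left bil_smult_left mult.right_neutral mult_zero_right add_0)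
    then have "n *s (x - bil d x f' *s f) = \<alpha> *s e"
      using nx by (simp add: vec_eq_iff algebra_simps)
    then obtain k where "x - bil d x f' *s f = k *s e" using prim_saturated[OF prim nz] by blast
    then have "x = k *s e + bil d x f' *s f" by (simp add: algebra_simps)
    then show ?thesis using plane_memberI by metis
  qed
  show "plane e f \<in> isotropic d 2"
    unfolding isotropic_def
  proof (intro CollectI conjI exI allI impI ballI)
    show "z_basis (\<lambda>i. if i = 1 then e else f) {1..2} (plane e f)" by (rule basis) auto
    fix x y assume "x \<in> plane e f" "y \<in> plane e f"
    then show "bil d x y = 0" using bil bil' by (auto simp: plane_def bil_linear)
  qed (rule sat)
  have a: "a > 0" using div by (simp add: has_div_def)
  obtain w0 where w0: "bil d e w0 = a"
    using div unfolding has_div_def by (metis mult.right_neutral rangeE rangeI)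
  \<comment> \<open>Subtracting half the length times f makes f' isotropic without changing its
    pairings with e and f.\<close>
  define g where "g = f' - half_norm d f' *s f"
  have g: "bil d f g = 1" "bil d g f = 1" "bil d e g = 0" "bil d g e = 0" "bil d g g = 0"
    using bil bil' by (simp_all add: g_def bil_linear bil_self[of d f'])
  \<comment> \<open>f and g span a hyperbolic plane, and projecting it away leaves the pairing a
    with e untouched.\<close>
  define w where "w = w0 - bil d w0 f *s g - bil d w0 g *s f"
  have w: "bil d e w = a" "bil d f w = 0" "bil d g w = 0"
    using bil g w0 by (simp_all add: w_def bil_linear bil_commute[of d f w0] bil_commute[of d g w0])
  \<comment> \<open>The vector e need not pair to 1 with any lattice vector, so a general functional
    with value 1 at e is used to split e off.\<close>
  obtain c :: "int ^ 6" where c: "(\<Sum>i\<in>UNIV. c $ i * e $ i) = 1" using prim_bezout[OF prim] by blast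
  define \<phi> where "\<phi> x = (\<Sum>i\<in>UNIV. c $ i * x $ i)" for x :: "int ^ 6"
  have \<phi>: "functional \<phi>" "\<phi> e = 1"
    using c by (simp_all add: functional_def \<phi>_def sum.distrib sum_distrib_left algebra_simps)
  then have \<phi>_simps: "\<phi> (x + y) = \<phi> x + \<phi> y" "\<phi> (k *s x) = k * \<phi> x" for x y k
    by (auto simp: functional_def)
  \<comment> \<open>The conditions on (e, x) and (f, x) cut out the orthogonal complement of the
    plane; the other two remove the components along f and e.\<close>
  define K where "K = {x. bil d g x = 0 \<and> \<phi> x = 0 \<and> bil d f x = 0 \<and> bil d e x = 0}"
  have "has_rank 2 K"
  proof -
    have kernel: "has_rank n {x \<in> M. \<psi> x = 0}"
      if "functional \<psi>" "has_rank m M" "m = Suc n" "x \<in> M" "\<psi> x \<noteq> 0" for \<psi> n m M x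
      using has_rank_kernel[OF that(1), of n M] that by blast
    define K1 where "K1 = {x \<in> UNIV. bil d g x = 0}"
    define K2 where "K2 = {x \<in> K1. \<phi> x = 0}"
    define K3 where "K3 = {x \<in> K2. bil d f x = 0}"
    have "has_rank 5 K1"
      unfolding K1_def by (rule kernel[OF functional_bil has_rank_UNIV, of _ f]) (use g in auto)
    then have "has_rank 4 K2"
      unfolding K2_def by (rule kernel[OF \<phi>(1), of _ _ _ e]) (use g \<phi>(2) in \<open>auto simp: K1_def\<close>)
    \<comment> \<open>The vectors on which the functionals do not vanish, here g and next w, are
      corrected by a multiple of e so that \<phi> vanishes on them.\<close>
    then have "has_rank 3 K3"
      unfolding K3_def by (rule kernel[OF functional_bil, of _ _ _ "g + (- \<phi> g) *s e"])
        (use g bil' \<phi>(2) in \<open>auto simp: K1_def K2_def \<phi>_simps bil_linear\<close>)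
    then have "has_rank 2 {x \<in> K3. bil d e x = 0}"
      by (rule kernel[OF functional_bil, of _ _ _ "w + (- \<phi> w) *s e"])
        (use g bil bil' w a \<phi>(2) in \<open>auto simp: K1_def K2_def K3_def \<phi>_simps bil_linear\<close>)
    then show ?thesis by (simp add: K_def K1_def K2_def K3_def conj_assoc)
  qed
  then obtain b where b: "z_basis b {1..2} K" unfolding has_rank_def by blast
  then have b_indep: "\<And>x y. x *s b 1 + y *s b 2 = 0 \<Longrightarrow> x = 0 \<and> y = 0"
    and K: "\<And>x. x \<in> K \<Longrightarrow> \<exists>s t. x = s *s b 1 + t *s b 2"
    and bK: "\<And>x y. x *s b 1 + y *s b 2 \<in> K"
    unfolding z_basis_2_iff by blast+
  have bilK: "bil d u (s *s b 1 + t *s b 2) = 0" if "u \<in> {e, f, g}" for u s t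
    using bK[of s t] that by (auto simp: K_def)
  have \<phi>K: "\<phi> (s *s b 1 + t *s b 2) = 0" for s t
    using bK[of s t] by (auto simp: K_def)
  define v :: "nat \<Rightarrow> int ^ 6" where
    "v i = (if i = 1 then e else if i = 2 then f else if i = 3 then b 1 else if i = 4 then b 2
      else if i = 5 then g else w)" for i
  have v: "v 1 = e" "v 2 = f" "v 3 = b 1" "v 4 = b 2" "v 5 = g" "v 6 = w" by (simp_all add: v_def)
  have lperp: "x \<in> lperp d (plane e f) \<longleftrightarrow> bil d e x = 0 \<and> bil d f x = 0" for x
  proof
    assume "x \<in> lperp d (plane e f)"
    then show "bil d e x = 0 \<and> bil d f x = 0"
      using plane_memberI[of 1 e 0 f] plane_memberI[of 0 e 1 f]
      by (auto simp: lperp_def bil_commute[of d x])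
  qed (auto simp: lperp_def plane_def bil_linear bil_commute[of d x])
  have span4: "\<exists>x1 x2 x3 x4. x = x1 *s e + x2 *s f + (x3 *s b 1 + x4 *s b 2)"
    if x: "bil d e x = 0" "bil d f x = 0" for x
  proof -
    define x2 where "x2 = bil d g x"
    define x1 where "x1 = \<phi> (x + (- x2) *s f)"
    have "\<phi> (y + (- \<phi> y) *s e) = 0" for y
      by (simp only: \<phi>_simps \<phi>(2))
    then have "\<phi> (x + (- x2) *s f + (- x1) *s e) = 0"
      unfolding x1_def by blast
    then have "x + (- x2) *s f + (- x1) *s e \<in> K"
      using x g bil bil' by (simp add: K_def x2_def bil_linear)
    then obtain s t where st: "x + (- x2) *s f + (- x1) *s e = s *s b 1 + t *s b 2" using K by blast
    have "x = x1 *s e + x2 *s f + (x + (- x2) *s f + (- x1) *s e)"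
      by (simp add: vec_eq_iff)
    then show ?thesis unfolding st by blast
  qed
  have bil4: "bil d r (x1 *s e + x2 *s f + (x3 *s b 1 + x4 *s b 2)) = x1 * bil d r e + x2 * bil d r f"
    if "r \<in> {e, f, g}" for r x1 x2 x3 x4
    using bilK[OF that, of x3 x4] by (simp add: bil_add_right bil_smult_right)
  have indep4: "x1 = 0 \<and> x2 = 0 \<and> x3 = 0 \<and> x4 = 0"
    if z: "x1 *s e + x2 *s f + (x3 *s b 1 + x4 *s b 2) = 0" for x1 x2 x3 x4
  proof -
    have "bil d g (x1 *s e + x2 *s f + (x3 *s b 1 + x4 *s b 2)) = 0" using z by simp
    then have x2: "x2 = 0" using g bil4[of g] by simp
    have "\<phi> (x1 *s e + x2 *s f + (x3 *s b 1 + x4 *s b 2)) = 0" using z functional_zero[OF \<phi>(1)] by simp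
    then have x1: "x1 = 0" using x2 \<phi>(2) \<phi>K[of x3 x4] by (simp add: \<phi>_simps)
    show ?thesis using b_indep[of x3 x4] z x1 x2 by simp
  qed
  have "z_basis v {1..4} (lperp d (plane e f))"
    unfolding z_basis_4_iff v
  proof (intro conjI allI impI)
    fix x y z t assume "x *s e + y *s f + z *s b 1 + t *s b 2 = 0"
    then show "x = 0" "y = 0" "z = 0" "t = 0" using indep4[of x y z t] by (simp_all add: add.assoc)
  next
    show "lperp d (plane e f) = {x *s e + y *s f + z *s b 1 + t *s b 2 | x y z t. True}"
    proof (intro antisym subsetI)
      fix x assume "x \<in> lperp d (plane e f)"
      then show "x \<in> {x *s e + y *s f + z *s b 1 + t *s b 2 | x y z t. True}"
        using span4[of x] lperp by (auto simp: add.assoc)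
    next
      fix x assume "x \<in> {x *s e + y *s f + z *s b 1 + t *s b 2 | x y z t. True}"
      then obtain x1 x2 x3 x4 where "x = x1 *s e + x2 *s f + (x3 *s b 1 + x4 *s b 2)"
        by (auto simp: add.assoc)
      then show "x \<in> lperp d (plane e f)"
        unfolding lperp using bil bil' bil4[of e] bil4[of f] by simp
    qed
  qed
  moreover have "z_basis v {1..6} UNIV"
    unfolding z_basis_6_iff v
  proof (intro conjI)
    show "\<forall>x y z t u s. x *s e + y *s f + z *s b 1 + t *s b 2 + u *s g + s *s w = 0 \<longrightarrow>
        x = 0 \<and> y = 0 \<and> z = 0 \<and> t = 0 \<and> u = 0 \<and> s = 0"
    proof (intro allI impI)
      fix x y z t u s
      assume "x *s e + y *s f + z *s b 1 + t *s b 2 + u *s g + s *s w = 0"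
      then have *: "x *s e + y *s f + (z *s b 1 + t *s b 2) + u *s g + s *s w = 0"
        by (simp add: add.assoc)
      have r: "bil d r (x *s e + y *s f + (z *s b 1 + t *s b 2) + u *s g + s *s w) =
          x * bil d r e + y * bil d r f + u * bil d r g + s * bil d r w" if "r \<in> {e, f, g}" for r
        using bilK[OF that, of z t] by (simp add: bil_add_right bil_smult_right)
      have "u = 0" using r[of f] * g bil bil' w by simp
      moreover have "s = 0" using r[of e] * g bil bil' w a by simp
      ultimately show "x = 0 \<and> y = 0 \<and> z = 0 \<and> t = 0 \<and> u = 0 \<and> s = 0"
        using * indep4[of x y z t] by simp
    qed
    show "UNIV = {x *s e + y *s f + z *s b 1 + t *s b 2 + u *s g + s *s w | x y z t u s. True}"
    proof (intro antisym subsetI)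
      fix x :: "int ^ 6"
      obtain s where s: "bil d e x = a * s" using div unfolding has_div_def by (metis rangeE rangeI)
      define u where "u = bil d f x"
      have "bil d e (x - u *s g - s *s w) = 0" "bil d f (x - u *s g - s *s w) = 0"
        using s g w by (simp_all add: bil_linear u_def)
      then obtain x1 x2 x3 x4 where
        "x - u *s g - s *s w = x1 *s e + x2 *s f + (x3 *s b 1 + x4 *s b 2)" using span4 by metis
      then have "x = x1 *s e + x2 *s f + x3 *s b 1 + x4 *s b 2 + u *s g + s *s w"
        by (simp add: diff_eq_eq add.assoc)
      then show "x \<in> {x *s e + y *s f + z *s b 1 + t *s b 2 + u *s g + s *s w | x y z t u s. True}"
        by blast
    qed simp
  qed
  moreover have "z_basis v {1..2} (plane e f)" by (rule basis) (simp_all only: v)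
  ultimately show "has_type d (nat a) (plane e f)"
    unfolding has_type_def using g w a by (intro exI[of _ v]) (simp add: v del: One_nat_def)
qed

definition adapted :: "nat \<Rightarrow> nat \<Rightarrow> int ^ 6 \<Rightarrow> int ^ 6 \<Rightarrow> int ^ 6 \<Rightarrow> int ^ 6 \<Rightarrow> bool" where
  "adapted d a e f e' f' \<longleftrightarrow> bil d e e = 0 \<and> bil d e f = 0 \<and> bil d f f = 0 \<and> bil d f f' = 1
     \<and> bil d e f' = 0 \<and> bil d f' f' = 0 \<and> bil d e e' = int a \<and> bil d f e' = 0 \<and> bil d e' f' = 0
     \<and> prim e \<and> has_div d (int a) e"

text \<open>The divisor of the first vector is read off from its pairings with the given basis, and
  it is primitive as a member of a basis. The partners are made orthogonal by subtracting multiples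
  of the second vector.\<close>

lemma has_type_adapted:
  assumes E: "E \<in> isotropic d 2" and type: "has_type d a E" and a: "a > 0"
  shows "\<exists>e f e' f'. adapted d a e f e' f' \<and> E = plane e f"
proof -
  obtain v where v: "z_basis v {1..6} UNIV" "z_basis v {1..2} E" "z_basis v {1..4} (lperp d E)"
    "bil d (v 1) (v 5) = 0" "bil d (v 1) (v 6) = int a" "bil d (v 2) (v 5) = 1" "bil d (v 2) (v 6) = 0"
    using type unfolding has_type_def by blast
  have E_eq: "E = plane (v 1) (v 2)" using v(2) unfolding z_basis_2_iff plane_def by blast
  have vE: "v 1 \<in> E" "v 2 \<in> E"
    using plane_memberI[of 1 "v 1" 0 "v 2"] plane_memberI[of 0 "v 1" 1 "v 2"] by (simp_all add: E_eq)
  then have iso: "bil d (v 1) (v 1) = 0" "bil d (v 1) (v 2) = 0" "bil d (v 2) (v 2) = 0"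
    using E unfolding isotropic_def by blast+
  have rep: "\<exists>x1 x2 x3 x4 x5 x6. x = x1 *s v 1 + x2 *s v 2 + x3 *s v 3 + x4 *s v 4 + x5 *s v 5 + x6 *s v 6" for x
  proof -
    have "UNIV = {x1 *s v 1 + x2 *s v 2 + x3 *s v 3 + x4 *s v 4 + x5 *s v 5 + x6 *s v 6 | x1 x2 x3 x4 x5 x6. True}"
      using v(1) unfolding z_basis_6_iff by (rule conjunct2)
    then show ?thesis using UNIV_I[of x] by blast
  qed
  have lp: "x \<in> lperp d E" if "x = x1 *s v 1 + x2 *s v 2 + x3 *s v 3 + x4 *s v 4" for x x1 x2 x3 x4
    using v(3) that unfolding z_basis_4_iff by blast
  have "v 3 \<in> lperp d E" "v 4 \<in> lperp d E"
    by (rule lp[of _ 0 0 1 0], simp) (rule lp[of _ 0 0 0 1], simp)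
  then have 34: "bil d (v 1) (v 3) = 0" "bil d (v 1) (v 4) = 0"
    using vE by (auto simp: lperp_def bil_commute)
  have bil1: "bil d (v 1) (x1 *s v 1 + x2 *s v 2 + x3 *s v 3 + x4 *s v 4 + x5 *s v 5 + x6 *s v 6) = int a * x6"
    for x1 x2 x3 x4 x5 x6
    using iso 34 v by (simp add: bil_linear)
  have "has_div d (int a) (v 1)"
    unfolding has_div_def
  proof (intro conjI antisym subsetI)
    fix y assume "y \<in> range (bil d (v 1))"
    then obtain x where "y = bil d (v 1) x" by blast
    then show "y \<in> range (\<lambda>k. int a * k)" using rep[of x] bil1 by auto
  next
    fix y assume "y \<in> range (\<lambda>k. int a * k)"
    then obtain k where "y = int a * k" by blast
    then have "y = bil d (v 1) (k *s v 6)" by (simp only: bil_smult_right v(5) mult.commute)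
    then show "y \<in> range (bil d (v 1))" by blast
  qed (use a in simp)
  moreover have "prim (v 1)"
    unfolding prim_def
  proof (intro allI impI)
    fix q assume "\<forall>i. q dvd v 1 $ i"
    then obtain x where x: "v 1 = q *s x" by (rule dvd_vecE)
    obtain x1 x2 x3 x4 x5 x6 where
      "x = x1 *s v 1 + x2 *s v 2 + x3 *s v 3 + x4 *s v 4 + x5 *s v 5 + x6 *s v 6" using rep by blast
    then have "(q * x1 - 1) *s v 1 + (q * x2) *s v 2 + (q * x3) *s v 3 + (q * x4) *s v 4
        + (q * x5) *s v 5 + (q * x6) *s v 6 = q *s x - v 1"
      by (simp add: vec_eq_iff algebra_simps)
    also have "\<dots> = 0" using x by simp
    finally have "q * x1 - 1 = 0" using v(1) unfolding z_basis_6_iff by blast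
    then show "q dvd 1" by (metis dvd_triv_left eq_iff_diff_eq_0)
  qed
  moreover define f' where "f' = v 5 - half_norm d (v 5) *s v 2"
  moreover define e' where "e' = v 6 - bil d (v 6) f' *s v 2"
  ultimately have "adapted d a (v 1) (v 2) e' f'"
    unfolding adapted_def using iso v
    by (simp add: bil_linear bil_self[of d "v 5"] bil_commute[of d "v 5" "v 2"] bil_commute[of d "v 2" f'])
  then show ?thesis using E_eq by blast
qed

lemma plane_swap: "plane e f = plane f e"
  by (auto simp: plane_def) (metis add.commute)+

lemma plane_shear: "plane e f = plane (e + k *s f) f"
proof -
  have "x *s e + y *s f = x *s (e + k *s f) + (y - k * x) *s f"
    "x *s (e + k *s f) + y *s f = x *s e + (y + k * x) *s f" for x y
    by (simp_all add: vec_eq_iff algebra_simps)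
  then show ?thesis unfolding plane_def by (metis (lifting))
qed

context paramodular
begin

text \<open>Among b1, b2 and b1 + b2 each of the primes 2 and p divides at most one of the three
  divisors, so some vector of the three escapes both and has divisor 1.\<close>

lemma plane_div_1:
  assumes E: "plane b1 b2 \<in> isotropic d 2"
    and indep: "\<And>x y. x *s b1 + y *s b2 = 0 \<Longrightarrow> x = 0 \<and> y = 0"
  shows "\<exists>e f. plane b1 b2 = plane e f \<and> has_div d 1 f \<and> prim f
     \<and> (\<forall>x y. x *s e + y *s f = 0 \<longrightarrow> x = 0 \<and> y = 0)"
proof -
  have iso: "bil d x y = 0" if "x \<in> plane b1 b2" "y \<in> plane b1 b2" for x y
    using E that unfolding isotropic_def by blast
  have sat: "x \<in> plane b1 b2" if "n \<noteq> 0" "n *s x \<in> plane b1 b2" for n x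
    using E that unfolding isotropic_def by blast
  have gcd1: "q dvd x \<and> q dvd y" if q: "\<forall>i. q dvd (x *s b1 + y *s b2) $ i" for q x y
  proof (cases "q = 0")
    case True
    then have "x *s b1 + y *s b2 = 0" using q by (simp add: vec_eq_iff)
    then show ?thesis using indep by auto
  next
    case False
    obtain z where z: "x *s b1 + y *s b2 = q *s z" using q by (rule dvd_vecE)
    then have "z \<in> plane b1 b2" using sat[OF False] plane_memberI by metis
    then obtain s t where st: "z = s *s b1 + t *s b2" by (auto simp: plane_def)
    have "(x - q * s) *s b1 + (y - q * t) *s b2 = 0"
      using z by (simp add: st vec_eq_iff algebra_simps)
    then have "x - q * s = 0 \<and> y - q * t = 0" by (rule indep)
    then show ?thesis by auto
  qed
  have prim: "prim (x *s b1 + y *s b2)" if "coprime x y" for x y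
    unfolding prim_def using gcd1 that by (meson coprime_def)
  have in_plane: "x *s b1 + y *s b2 \<in> plane b1 b2" for x y by (rule plane_memberI)
  note p1 = prim[of 1 0, simplified] and p2 = prim[of 0 1, simplified] and p3 = prim[of 1 1, simplified]
  note m1 = in_plane[of 1 0, simplified] and m2 = in_plane[of 0 1, simplified]
    and m3 = in_plane[of 1 1, simplified]
  define D where "D q x \<longleftrightarrow> (\<forall>y. q dvd bil d x y)" for q :: int and x
  have div: "\<exists>n. has_div d n x \<and> n \<in> {1, 2, int p, 2 * int p}" if "prim x" "x \<in> plane b1 b2" for x
    using has_div_exists[OF d_pos prim_nonzero] div_cases iso that by meson
  \<comment> \<open>Otherwise b1, b2 and b1 + b2 would all have an odd fifth coordinate.\<close>
  have D2: "\<not> (D 2 b1 \<and> D 2 b2)"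
  proof
    assume D: "D 2 b1 \<and> D 2 b2"
    obtain n1 where n1: "has_div d n1 b1" using div[OF p1 m1] by blast
    obtain n2 where n2: "has_div d n2 b2" using div[OF p2 m2] by blast
    obtain n3 where n3: "has_div d n3 (b1 + b2)" using div[OF p3 m3] by blast
    have "even n1" "even n2" "even n3"
      using D has_div_dvd[OF n1, of 2] has_div_dvd[OF n2, of 2] has_div_dvd[OF n3, of 2]
      by (simp_all add: D_def bil_linear)
    then have "odd (b1 $ 5)" "odd (b2 $ 5)" "odd ((b1 + b2) $ 5)"
      using odd_if_even_div(1)[OF iso[OF m1 m1] p1 n1] odd_if_even_div(1)[OF iso[OF m2 m2] p2 n2]
        odd_if_even_div(1)[OF iso[OF m3 m3] p3 n3] by blast+
    then show False by simp
  qed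
  \<comment> \<open>Otherwise b1 and b2 agree modulo p with multiples of one basis vector, so a
    combination of them is divisible by p. By saturation its coefficients, which are their fifth
    coordinates up to sign, are divisible by p as well.\<close>
  have Dp: "\<not> (D (int p) b1 \<and> D (int p) b2)"
  proof
    assume D: "D (int p) b1 \<and> D (int p) b2"
    obtain n1 where n1: "has_div d n1 b1" using div[OF p1 m1] by blast
    obtain n2 where n2: "has_div d n2 b2" using div[OF p2 m2] by blast
    have pn: "int p dvd n1" "int p dvd n2"
      using D has_div_dvd[OF n1, of "int p"] has_div_dvd[OF n2, of "int p"] by (simp_all add: D_def)
    have "int p dvd b1 $ i \<and> int p dvd b2 $ i" if "i \<noteq> 5" for i
      using div_dvd[OF iso[OF m1 m1] p1 n1] div_dvd[OF iso[OF m2 m2] p2 n2]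
        p_dvd_6_if_p_dvd_div[OF iso[OF m1 m1] p1 n1 pn(1)] p_dvd_6_if_p_dvd_div[OF iso[OF m2 m2] p2 n2 pn(2)]
        pn that exhaust_6[of i] dvd_trans by blast
    then have "\<forall>i. int p dvd (b2 $ 5 *s b1 + (- b1 $ 5) *s b2) $ i"
      by (intro allI, rename_tac i, case_tac "i = 5") (simp_all add: dvd_diff dvd_mult)
    then have "int p dvd b2 $ 5" using gcd1 by blast
    then show False using p_not_dvd_5[OF iso[OF m2 m2] p2 n2 pn(2)] by blast
  qed
  have div1: "has_div d 1 x" if x: "prim x" "x \<in> plane b1 b2" "\<not> D 2 x" "\<not> D (int p) x" for x
  proof -
    obtain n where n: "has_div d n x" "n \<in> {1, 2, int p, 2 * int p}" using div x by blast
    then show ?thesis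
      using x(3,4) has_div_dvd[OF n(1), of 2] has_div_dvd[OF n(1), of "int p"] by (auto simp: D_def)
  qed
  \<comment> \<open>A prime dividing two of the three divisors would divide the pairings of both b1
    and b2, which \<open>D2\<close> and \<open>Dp\<close> exclude.\<close>
  consider "\<not> D 2 b1 \<and> \<not> D (int p) b1" | "\<not> D 2 b2 \<and> \<not> D (int p) b2"
    | "\<not> D 2 (b1 + b2) \<and> \<not> D (int p) (b1 + b2)"
  proof -
    have "D q b2" if "D q b1" "D q (b1 + b2)" for q
      using that by (metis D_def bil_add_left dvd_add_right_iff)
    moreover have "D q b1" if "D q b2" "D q (b1 + b2)" for q
      using that by (metis D_def bil_add_left dvd_add_left_iff)
    ultimately show ?thesis using D2 Dp that by metis
  qed
  then show ?thesis
  proof cases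
    case 1
    then have "has_div d 1 b1" using div1 p1 m1 by blast
    moreover have "\<forall>x y. x *s b2 + y *s b1 = 0 \<longrightarrow> x = 0 \<and> y = 0"
      using indep by (metis add.commute)
    ultimately show ?thesis using p1
      by (intro exI[of _ b2] exI[of _ b1] conjI plane_swap)
  next
    case 2
    then have "has_div d 1 b2" using div1 p2 m2 by blast
    then show ?thesis using p2 indep by blast
  next
    case 3
    then have "has_div d 1 (b1 + b2)" using div1 p3 m3 by blast
    moreover have "plane b1 b2 = plane b1 (b1 + b2)"
      using plane_shear[of b2 b1 1] plane_swap[of b2 b1] plane_swap[of "b2 + b1" b1]
      by (simp add: add.commute)
    moreover have "\<forall>x y. x *s b1 + y *s (b1 + b2) = 0 \<longrightarrow> x = 0 \<and> y = 0"
    proof (intro allI impI)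
      fix x y assume "x *s b1 + y *s (b1 + b2) = 0"
      then have "(x + y) *s b1 + y *s b2 = 0" by (simp add: vec_eq_iff algebra_simps)
      then show "x = 0 \<and> y = 0" using indep by fastforce
    qed
    ultimately show ?thesis using p3 by blast
  qed
qed

text \<open>Starting from a basis vector f of divisor 1, the type is the divisor of the
  complementary basis vector once that is orthogonal to a partner of f.\<close>

lemma has_type_exists:
  assumes E: "E \<in> isotropic d 2"
  shows "\<exists>a\<in>{1, 2, p, 2 * p}. has_type d a E"
proof -
  obtain b where b: "z_basis b {1..2} E" using E unfolding isotropic_def by blast
  then have "E = plane (b 1) (b 2)" "\<And>x y. x *s b 1 + y *s b 2 = 0 \<Longrightarrow> x = 0 \<and> y = 0"
    unfolding z_basis_2_iff plane_def by blast+
  then obtain e0 f where ef: "E = plane e0 f" "has_div d 1 f"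
    "\<And>x y. x *s e0 + y *s f = 0 \<Longrightarrow> x = 0 \<and> y = 0"
    using plane_div_1[of "b 1" "b 2"] E by metis
  obtain f' where f': "bil d f f' = 1"
    using ef(2) unfolding has_div_def by (metis mult_1 rangeE rangeI)
  \<comment> \<open>A multiple of f is subtracted so that e becomes orthogonal to f'.\<close>
  define e where "e = e0 + (- bil d e0 f') *s f"
  have Epl: "E = plane e f" unfolding e_def ef(1) by (rule plane_shear)
  have "e \<in> E" "f \<in> E"
    using plane_memberI[of 1 e 0 f] plane_memberI[of 0 e 1 f] by (simp_all add: Epl)
  then have iso: "bil d e e = 0" "bil d e f = 0" "bil d f f = 0"
    using E unfolding isotropic_def by blast+
  have e0: "e \<noteq> 0" using ef(3)[of 1 "- bil d e0 f'"] by (auto simp: e_def)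
  have prim: "prim e"
    unfolding prim_def
  proof (intro allI impI)
    fix q assume "\<forall>i. q dvd e $ i"
    then obtain x where x: "e = q *s x" by (rule dvd_vecE)
    then have "q \<noteq> 0" "q *s x \<in> E" using e0 \<open>e \<in> E\<close> by auto
    then have "x \<in> E" using E unfolding isotropic_def by blast
    then obtain s t where st: "x = s *s e0 + t *s f" by (auto simp: ef(1) plane_def)
    have "(q * s - 1) *s e0 + (q * t + bil d e0 f') *s f = q *s x - e"
      by (simp add: st e_def vec_eq_iff algebra_simps)
    also have "\<dots> = 0" using x by simp
    finally have "q * s - 1 = 0" using ef(3) by blast
    then show "q dvd 1" by (metis dvd_triv_left eq_iff_diff_eq_0)
  qed
  obtain a where a: "has_div d a e" using has_div_exists[OF d_pos e0] by blast
  have ef': "bil d e f' = 0" using f' by (simp add: e_def bil_linear)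
  have "has_type d (nat a) E"
    unfolding Epl by (rule plane_types[OF d_pos iso f' ef' prim a])
  moreover have "nat a \<in> {1, 2, p, 2 * p}" using div_cases[OF iso(1) prim a] by auto
  ultimately show ?thesis by blast
qed

text \<open>A vector of divisor a supported off the second hyperbolic plane is combined with the
  standard basis of that plane.\<close>

lemma type_exists:
  assumes "a \<in> {1, 2, p, 2 * p}"
  shows "\<exists>E\<in>isotropic d 2. has_type d a E"
proof -
  obtain e where e: "bil d e e = 0" "prim e" "has_div d (int a) e" "e $ 3 = 0" "e $ 4 = 0"
    using exists_isotropic[of "int a" 1] assms by auto
  have "bil d e (axis 3 1) = 0" "bil d (axis 3 1) (axis 3 1) = (0::int)"
    "bil d (axis 3 1) (axis 4 1) = (1::int)" "bil d e (axis 4 1) = 0"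
    using e by (simp_all add: bil_axis) (simp_all add: axis_def)
  from plane_types[OF d_pos e(1) this e(2,3)] show ?thesis by (intro bexI) simp_all
qed

end

section \<open>The components of the period cone\<close>

text \<open>The sums \<open>z $ 1 + z $ 2\<close> and \<open>z $ 3 + z $ 4\<close> are coordinates
  of the projection to a positive definite plane. Up to sign this is the determinant of the
  projected real and imaginary parts of z.\<close>

definition orient :: "complex ^ 6 \<Rightarrow> real" where
  "orient z = Im ((z $ 1 + z $ 2) * cnj (z $ 3 + z $ 4))"

definition cone_part :: "nat \<Rightarrow> real \<Rightarrow> (complex ^ 6) set" where
  "cone_part d s = {z \<in> period_cone d. s * orient z > 0}"

lemma continuous_orient: "continuous_on S orient"
  unfolding orient_def by (intro continuous_intros)

lemma Re_bil_vcnj: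
  "Re (bil d z (vcnj z)) = 2 * (Re (z $ 1) * Re (z $ 2) + Im (z $ 1) * Im (z $ 2))
     + 2 * (Re (z $ 3) * Re (z $ 4) + Im (z $ 3) * Im (z $ 4))
     - 2 * real d * ((Re (z $ 5))\<^sup>2 + (Im (z $ 5))\<^sup>2) - 6 * ((Re (z $ 6))\<^sup>2 + (Im (z $ 6))\<^sup>2)"
  by (simp add: bil_def vcnj_def power2_eq_square algebra_simps)

lemma orient_eq:
  "orient z = (Im (z $ 1) + Im (z $ 2)) * (Re (z $ 3) + Re (z $ 4))
     - (Re (z $ 1) + Re (z $ 2)) * (Im (z $ 3) + Im (z $ 4))"
  by (simp add: orient_def algebra_simps)

text \<open>
  Contraction of the negative definite part. In terms of \<open>a = z\<^sub>1 + z\<^sub>2\<close> and \<open>b = z\<^sub>3 + z\<^sub>4\<close> it fixes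
  \<open>a + s \<i> b\<close> and multiplies \<open>a - s \<i> b\<close> by \<open>t\<^sup>2\<close>, which keeps \<open>(z, z) = 0\<close>.
\<close>

definition contract :: "real \<Rightarrow> real \<Rightarrow> complex ^ 6 \<Rightarrow> complex ^ 6" where
  "contract s t z =
    (let u = of_real ((1 + t\<^sup>2) / 2); v = of_real (s * (1 - t\<^sup>2) / 2); a = z $ 1 + z $ 2; b = z $ 3 + z $ 4;
       A = u * a + v * \<i> * b; B = u * b - v * \<i> * a;
       m = of_real t * (z $ 1 - z $ 2); n = of_real t * (z $ 3 - z $ 4)
     in vec6 ((A + m) / 2) ((A - m) / 2) ((B + n) / 2) ((B - n) / 2) (of_real t * z $ 5) (of_real t * z $ 6))"

text \<open>The positive part of the form is half of a^2 + b^2, and it is scaled by u^2 - v^2. With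
  s^2 = 1 this is (u + s v)(u - s v), whose factors are 1 and t^2.\<close>

lemma bil_contract:
  assumes "s\<^sup>2 = 1"
  shows "bil d (contract s t z) (contract s t z) = of_real (t\<^sup>2) * bil d z z"
proof -
  define u v :: complex where "u = of_real ((1 + t\<^sup>2) / 2)" and "v = of_real (s * (1 - t\<^sup>2) / 2)"
  have "u\<^sup>2 - v\<^sup>2 = of_real (((1 + t\<^sup>2) / 2)\<^sup>2 - (s * (1 - t\<^sup>2) / 2)\<^sup>2)"
    unfolding u_def v_def by (simp only: of_real_diff of_real_power)
  also have "((1 + t\<^sup>2) / 2)\<^sup>2 - (s * (1 - t\<^sup>2) / 2)\<^sup>2 = ((1 + t\<^sup>2)\<^sup>2 - s\<^sup>2 * (1 - t\<^sup>2)\<^sup>2) / 4"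
    by (simp add: power2_eq_square field_simps)
  also have "\<dots> = t\<^sup>2" unfolding assms by (simp add: power2_eq_square field_simps)
  finally have uv: "u * u - v * v = of_real t * of_real t" by (simp add: power2_eq_square)
  define a b where "a = z $ 1 + z $ 2" and "b = z $ 3 + z $ 4"
  define m n where "m = of_real t * (z $ 1 - z $ 2)" and "n = of_real t * (z $ 3 - z $ 4)"
  define A B where "A = u * a + v * \<i> * b" and "B = u * b - v * \<i> * a"
  have c: "contract s t z = vec6 ((A + m) / 2) ((A - m) / 2) ((B + n) / 2) ((B - n) / 2)
      (of_real t * z $ 5) (of_real t * z $ 6)"
    by (simp only: contract_def Let_def u_def[symmetric] v_def[symmetric] a_def[symmetric] b_def[symmetric]
        m_def[symmetric] n_def[symmetric] A_def[symmetric] B_def[symmetric])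
  have "A * A + B * B = (u * u - v * v) * (a * a + b * b)"
  proof -
    have "(v * \<i> * b) * (v * \<i> * b) = - (v * v * (b * b))" "(v * \<i> * a) * (v * \<i> * a) = - (v * v * (a * a))"
      by (simp_all add: algebra_simps)
    then show ?thesis unfolding A_def B_def by (simp add: algebra_simps)
  qed
  then have AB: "A * A + B * B = of_real t * of_real t * (a * a + b * b)" by (simp only: uv)
  have "bil d (contract s t z) (contract s t z) = (A * A + B * B - m * m - n * n) / 2
     - of_real t * of_real t * (2 * of_nat d * z $ 5 * z $ 5 + 6 * z $ 6 * z $ 6)"
    unfolding c bil_def vec6_nth by (simp add: field_simps)
  also have "\<dots> = of_real (t\<^sup>2) * bil d z z"
    unfolding AB m_def n_def a_def b_def bil_def by (simp add: power2_eq_square field_simps)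
  finally show ?thesis .
qed

text \<open>For 0 <= t < 1 all coefficients are nonnegative and those of s * orient z are positive.
  A vector on the boundary of the cone with s * orient z > 0 therefore moves into the open
  cone.\<close>

lemma contract_Re_bil_orient:
  assumes "s\<^sup>2 = 1"
  defines "K z \<equiv> (cmod (z $ 1 + z $ 2))\<^sup>2 + (cmod (z $ 3 + z $ 4))\<^sup>2"
  shows "Re (bil d (contract s t z) (vcnj (contract s t z))) =
      (1 - t\<^sup>2)\<^sup>2 * K z / 4 + (1 - t ^ 4) * (s * orient z) / 2 + t\<^sup>2 * Re (bil d z (vcnj z))" (is ?bil)
    and "s * orient (contract s t z) = (1 + t ^ 4) / 2 * (s * orient z) + (1 - t ^ 4) / 4 * K z" (is ?or)
proof -
  define u v where "u = (1 + t\<^sup>2) / 2" and "v = s * (1 - t\<^sup>2) / 2"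
  define a1 a2 b1 b2 where "a1 = Re (z $ 1 + z $ 2)" and "a2 = Im (z $ 1 + z $ 2)"
    and "b1 = Re (z $ 3 + z $ 4)" and "b2 = Im (z $ 3 + z $ 4)"
  define m1 m2 n1 n2 where "m1 = Re (z $ 1 - z $ 2)" and "m2 = Im (z $ 1 - z $ 2)"
    and "n1 = Re (z $ 3 - z $ 4)" and "n2 = Im (z $ 3 - z $ 4)"
  define Q where "Q = 2 * real d * ((Re (z $ 5))\<^sup>2 + (Im (z $ 5))\<^sup>2) + 6 * ((Re (z $ 6))\<^sup>2 + (Im (z $ 6))\<^sup>2)"
  have K: "K z = a1\<^sup>2 + a2\<^sup>2 + b1\<^sup>2 + b2\<^sup>2"
    by (simp add: K_def cmod_power2 a1_def a2_def b1_def b2_def)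
  have O: "orient z = a2 * b1 - a1 * b2"
    by (simp add: orient_eq a1_def a2_def b1_def b2_def)
  have R: "Re (bil d z (vcnj z)) = (K z - m1\<^sup>2 - m2\<^sup>2 - n1\<^sup>2 - n2\<^sup>2) / 2 - Q"
    unfolding Re_bil_vcnj K Q_def a1_def a2_def b1_def b2_def m1_def m2_def n1_def n2_def
    by (simp add: power2_eq_square field_simps)
  have uv: "u\<^sup>2 + v\<^sup>2 = (1 + t ^ 4) / 2" "s * (u * v) = (1 - t ^ 4) / 4"
  proof -
    have "u\<^sup>2 + v\<^sup>2 = ((1 + t\<^sup>2)\<^sup>2 + s\<^sup>2 * (1 - t\<^sup>2)\<^sup>2) / 4"
      by (simp add: u_def v_def power2_eq_square field_simps)
    also have "\<dots> = (1 + t ^ 4) / 2" unfolding assms(1)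
      by (simp add: power2_eq_square field_simps eval_nat_numeral)
    finally show "u\<^sup>2 + v\<^sup>2 = (1 + t ^ 4) / 2" .
    have "s * (u * v) = s\<^sup>2 * (1 - t ^ 4) / 4"
      by (simp add: u_def v_def power2_eq_square field_simps eval_nat_numeral)
    then show "s * (u * v) = (1 - t ^ 4) / 4" by (simp add: assms(1))
  qed
  have ss: "s * s = 1" using assms(1) by (simp add: power2_eq_square)
  have comps: "Re (contract s t z $ 1) + Re (contract s t z $ 2) = u * a1 - v * b2"
    "Im (contract s t z $ 1) + Im (contract s t z $ 2) = u * a2 + v * b1"
    "Re (contract s t z $ 3) + Re (contract s t z $ 4) = u * b1 + v * a2"
    "Im (contract s t z $ 3) + Im (contract s t z $ 4) = u * b2 - v * a1"
    unfolding contract_def Let_def u_def[symmetric] v_def[symmetric] a1_def a2_def b1_def b2_def vec6_nth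
    by (simp_all add: field_simps)
  have diffs: "Re (contract s t z $ 1) - Re (contract s t z $ 2) = t * m1"
    "Im (contract s t z $ 1) - Im (contract s t z $ 2) = t * m2"
    "Re (contract s t z $ 3) - Re (contract s t z $ 4) = t * n1"
    "Im (contract s t z $ 3) - Im (contract s t z $ 4) = t * n2"
    unfolding contract_def Let_def m1_def m2_def n1_def n2_def vec6_nth
    by (simp_all add: field_simps)
  have last: "contract s t z $ 5 = of_real t * z $ 5" "contract s t z $ 6 = of_real t * z $ 6"
    by (simp_all add: contract_def Let_def)
  have "orient (contract s t z) = (u * a2 + v * b1) * (u * b1 + v * a2) - (u * a1 - v * b2) * (u * b2 - v * a1)"
    unfolding orient_eq comps ..
  also have "\<dots> = (u\<^sup>2 + v\<^sup>2) * orient z + u * v * K z"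
    unfolding O K by (simp add: power2_eq_square algebra_simps)
  finally have "s * orient (contract s t z) = (u\<^sup>2 + v\<^sup>2) * (s * orient z) + s * (u * v) * K z"
    by (simp add: algebra_simps)
  then show ?or unfolding uv .
  have split: "2 * (x * y + x' * y') = ((x + y)\<^sup>2 + (x' + y')\<^sup>2 - (x - y)\<^sup>2 - (x' - y')\<^sup>2) / 2" for x y x' y' :: real
    by (simp add: power2_eq_square field_simps)
  have "Re (bil d (contract s t z) (vcnj (contract s t z))) =
      ((u * a1 - v * b2)\<^sup>2 + (u * a2 + v * b1)\<^sup>2 - (t * m1)\<^sup>2 - (t * m2)\<^sup>2) / 2
      + ((u * b1 + v * a2)\<^sup>2 + (u * b2 - v * a1)\<^sup>2 - (t * n1)\<^sup>2 - (t * n2)\<^sup>2) / 2 - t\<^sup>2 * Q"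
    unfolding Re_bil_vcnj split comps diffs last Q_def
    by (simp add: power_mult_distrib algebra_simps)
  also have "\<dots> = ((u\<^sup>2 + v\<^sup>2) * K z + 4 * (u * v) * orient z) / 2 - t\<^sup>2 * ((m1\<^sup>2 + m2\<^sup>2 + n1\<^sup>2 + n2\<^sup>2) / 2 + Q)"
    unfolding O K by (simp add: power2_eq_square field_simps)
  also have "\<dots> = ((u\<^sup>2 + v\<^sup>2) * K z + 4 * (u * v) * orient z) / 2 - t\<^sup>2 * (K z / 2 - Re (bil d z (vcnj z)))"
    unfolding R by (simp add: field_simps)
  also have "4 * (u * v) * orient z = 4 * (s * (u * v)) * (s * orient z)"
    using ss by (simp add: algebra_simps)
  finally show ?bil unfolding uv by (simp add: power2_eq_square field_simps eval_nat_numeral)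
qed

text \<open>Only (z, cnj z) >= 0 is assumed, so that boundary points are covered too; this yields
  both connectedness and a description of the closure.\<close>

lemma contract_in_cone_part:
  assumes s: "s\<^sup>2 = 1" and z: "bil d z z = 0" "Re (bil d z (vcnj z)) \<ge> 0" "s * orient z > 0"
    and t: "0 \<le> t" "t < 1"
  shows "contract s t z \<in> cone_part d s"
proof -
  have t4: "t ^ 4 < 1" using t by (simp add: power_less_one_iff)
  have "(1 - t ^ 4) * (s * orient z) > 0" using t4 z by simp
  then have "Re (bil d (contract s t z) (vcnj (contract s t z))) > 0"
    unfolding contract_Re_bil_orient(1)[OF s] using z by (intro add_pos_nonneg add_nonneg_pos) auto
  moreover have "s * orient (contract s t z) > 0"
    unfolding contract_Re_bil_orient(2)[OF s] using mult_pos_pos[OF _ z(3), of "(1 + t ^ 4) / 2"] t4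
    by (intro add_pos_nonneg) (auto simp: add_pos_nonneg)
  ultimately show ?thesis
    using bil_contract[OF s, of d t z] z by (simp add: cone_part_def period_cone_def)
qed

lemma contract_1: "contract s 1 z = z"
  by (simp add: contract_def vec_eq_iff forall_6)

lemma continuous_vec6:
  fixes f1 f2 f3 f4 f5 f6 :: "'a::topological_space \<Rightarrow> 'b::real_normed_vector"
  assumes "continuous_on S f1" "continuous_on S f2" "continuous_on S f3"
    "continuous_on S f4" "continuous_on S f5" "continuous_on S f6"
  shows "continuous_on S (\<lambda>t. vec6 (f1 t) (f2 t) (f3 t) (f4 t) (f5 t) (f6 t))"
  unfolding vec6_def
proof (rule continuous_on_vec_lambda)
  fix i :: 6
  show "continuous_on S (\<lambda>t. if i = 1 then f1 t else if i = 2 then f2 t else if i = 3 then f3 t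
      else if i = 4 then f4 t else if i = 5 then f5 t else f6 t)"
    using exhaust_6[of i] assms by (elim disjE) simp_all
qed

lemma continuous_contract: "continuous_on S (\<lambda>t. contract s t z)"
  unfolding contract_def Let_def by (intro continuous_vec6 continuous_intros) auto

lemma in_closure_cone_part:
  assumes s: "s\<^sup>2 = 1" and z: "bil d z z = 0" "Re (bil d z (vcnj z)) \<ge> 0" "s * orient z > 0"
  shows "z \<in> closure (cone_part d s)"
proof -
  have "(\<lambda>t. contract s t z) ` closure {0..<1} \<subseteq> closure ((\<lambda>t. contract s t z) ` {0..<1})"
    by (rule image_closure_subset[OF continuous_contract closed_closure closure_subset])
  moreover have "1 \<in> closure {0..<1::real}" by (simp add: closure_atLeastLessThan)
  ultimately have "contract s 1 z \<in> closure ((\<lambda>t. contract s t z) ` {0..<1})" by blast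
  moreover have "(\<lambda>t. contract s t z) ` {0..<1} \<subseteq> cone_part d s"
    using contract_in_cone_part[OF assms] by auto
  ultimately have "contract s 1 z \<in> closure (cone_part d s)"
    using closure_mono by blast
  then show ?thesis by (simp add: contract_1)
qed

text \<open>The contraction at t = 0 ends on the complex line through this vector: its negative
  definite part is 0 and a - s \<i> b vanishes, in the coordinates a, b of
  \<open>contract\<close>.\<close>

definition base_point :: "real \<Rightarrow> complex ^ 6" where
  "base_point s = vec6 (1 / 2) (1 / 2) (- of_real s * \<i> / 2) (- of_real s * \<i> / 2) 0 0"

lemma base_point_smult_in_cone_part:
  assumes "s\<^sup>2 = 1" "c \<noteq> 0"
  shows "c *s base_point s \<in> cone_part d s"
proof -
  have ss: "s * s = 1" using assms(1) by (simp add: power2_eq_square)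
  then have "of_real s * of_real s = (1 :: complex)" by (metis of_real_1 of_real_mult)
  then have "bil d (c *s base_point s) (c *s base_point s) = 0"
    by (simp add: bil_def base_point_def algebra_simps)
  moreover have c: "(Re c)\<^sup>2 + (Im c)\<^sup>2 > 0"
    using assms(2) by (simp add: complex_neq_0)
  have "Re (bil d (c *s base_point s) (vcnj (c *s base_point s))) = ((Re c)\<^sup>2 + (Im c)\<^sup>2) * (1 + s * s) / 2"
    by (simp add: Re_bil_vcnj base_point_def power2_eq_square algebra_simps)
  then have "Re (bil d (c *s base_point s) (vcnj (c *s base_point s))) > 0" using c ss by simp
  moreover have "s * orient (c *s base_point s) = ((Re c)\<^sup>2 + (Im c)\<^sup>2) * (s * s)"
    by (simp add: orient_eq base_point_def power2_eq_square algebra_simps)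
  then have "s * orient (c *s base_point s) > 0" using c ss by simp
  ultimately show ?thesis by (simp add: cone_part_def period_cone_def)
qed

lemma contract_0: "s\<^sup>2 = 1 \<Longrightarrow>
  contract s 0 z = ((z $ 1 + z $ 2 + of_real s * \<i> * (z $ 3 + z $ 4)) / 2) *s base_point s"
proof -
  assume "s\<^sup>2 = 1"
  then have "of_real s * of_real s = (1 :: complex)" by (metis of_real_1 of_real_mult power2_eq_square)
  then have ssx: "of_real s * (of_real s * x) = x" for x :: complex
    by (simp add: mult.assoc[symmetric])
  show ?thesis
    by (simp add: contract_def Let_def base_point_def vec_eq_iff forall_6 field_simps ssx)
qed

text \<open>The contraction path joins each point to the punctured complex line through
  \<open>base_point\<close>, which is connected.\<close>

lemma connected_cone_part:
  assumes s: "s\<^sup>2 = 1"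
  shows "connected (cone_part d s)"
proof -
  let ?T = "(\<lambda>c. c *s base_point s) ` (- {0})"
  let ?P = "\<lambda>z. (\<lambda>t. contract s t z) ` {0..1}"
  have T: "?T \<subseteq> cone_part d s" using base_point_smult_in_cone_part[OF s] by auto
  have "continuous_on (- {0}) (\<lambda>c :: complex. c *s base_point s)"
    unfolding vector_scalar_mult_def by (intro continuous_intros)
  then have cT: "connected ?T"
    by (intro connected_continuous_image connected_punctured_universe) simp_all
  have sub: "?P z \<subseteq> cone_part d s" if z: "z \<in> cone_part d s" for z
  proof
    fix w assume "w \<in> ?P z"
    then obtain t where t: "0 \<le> t" "t \<le> 1" "w = contract s t z" by auto
    show "w \<in> cone_part d s"
    proof (cases "t = 1")
      case False
      then show ?thesis
        using z t contract_in_cone_part[OF s, of d z t] by (simp add: cone_part_def period_cone_def)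
    qed (use t z contract_1 in simp)
  qed
  have "\<Union>((\<lambda>z. ?T \<union> ?P z) ` cone_part d s) = cone_part d s"
  proof (intro antisym subsetI)
    fix z assume z: "z \<in> cone_part d s"
    have "z \<in> ?P z" using contract_1[of s z] by (intro image_eqI[of _ _ 1]) auto
    then show "z \<in> \<Union>((\<lambda>z. ?T \<union> ?P z) ` cone_part d s)" using z by blast
  qed (use T sub in blast)
  moreover have "connected (\<Union>((\<lambda>z. ?T \<union> ?P z) ` cone_part d s))"
  proof (rule connected_Union)
    fix S assume "S \<in> (\<lambda>z. ?T \<union> ?P z) ` cone_part d s"
    then obtain z where z: "z \<in> cone_part d s" "S = ?T \<union> ?P z" by blast
    have "contract s 0 z \<in> cone_part d s" using sub[OF z(1)] by auto
    then have "contract s 0 z \<noteq> 0" by (auto simp: cone_part_def orient_def)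
    then have "contract s 0 z \<in> ?T" unfolding contract_0[OF s] by (intro imageI) auto
    moreover have "contract s 0 z \<in> ?P z" by (rule imageI) simp
    ultimately have ne: "?T \<inter> ?P z \<noteq> {}" by blast
    have "connected (?P z)"
      by (intro connected_continuous_image continuous_contract) auto
    then show "connected S" unfolding z(2) by (rule connected_Un[OF cT _ ne])
  next
    have "1 *s base_point s \<in> ?T" by (rule imageI) simp
    then show "\<Inter>((\<lambda>z. ?T \<union> ?P z) ` cone_part d s) \<noteq> {}" by blast
  qed
  ultimately show ?thesis by simp
qed

lemma norm_sum_squares:
  assumes "c \<ge> 0" "c' \<ge> 0"
  shows "cmod (m * m / 2 + n * n / 2 + of_real c * x * x + of_real c' * y * y)
    \<le> (cmod m)\<^sup>2 / 2 + (cmod n)\<^sup>2 / 2 + c * (cmod x)\<^sup>2 + c' * (cmod y)\<^sup>2"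
proof -
  let ?A = "m * m / 2" and ?B = "n * n / 2" and ?C = "of_real c * x * x" and ?D = "of_real c' * y * y"
  have "cmod (?A + ?B + ?C + ?D) \<le> cmod ?A + cmod ?B + cmod ?C + cmod ?D"
    using norm_triangle_ineq[of "?A + ?B + ?C" ?D] norm_triangle_ineq[of "?A + ?B" ?C]
      norm_triangle_ineq[of ?A ?B] by linarith
  also have "\<dots> = (cmod m)\<^sup>2 / 2 + (cmod n)\<^sup>2 / 2 + c * (cmod x)\<^sup>2 + c' * (cmod y)\<^sup>2"
    using assms by (simp add: norm_mult norm_divide power2_eq_square)
  finally show ?thesis .
qed

text \<open>Let \<alpha> = a + \<i> b and \<beta> = a - \<i> b. Isotropy bounds |\<alpha> \<beta>|
  by 2H, where H measures the negative part, and (z, cnj z) > 0 makes |\<alpha>|^2 + |\<beta>|^2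
  exceed 4H. If \<open>orient\<close> vanished, the two absolute values would be equal, a
  contradiction.\<close>

lemma orient_nonzero:
  assumes "z \<in> period_cone d"
  shows "orient z \<noteq> 0"
proof
  assume o: "orient z = 0"
  define a b where "a = z $ 1 + z $ 2" and "b = z $ 3 + z $ 4"
  define m n where "m = z $ 1 - z $ 2" and "n = z $ 3 - z $ 4"
  define \<alpha> \<beta> where "\<alpha> = a + \<i> * b" and "\<beta> = a - \<i> * b"
  define H where "H = (cmod m)\<^sup>2 / 2 + (cmod n)\<^sup>2 / 2 + 2 * real d * (cmod (z $ 5))\<^sup>2 + 6 * (cmod (z $ 6))\<^sup>2"
  define X where "X = m * m / 2 + n * n / 2 + of_real (2 * real d) * z $ 5 * z $ 5 + of_real 6 * z $ 6 * z $ 6"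
  have "\<alpha> * \<beta> = 2 * bil d z z + 2 * X"
    by (simp add: \<alpha>_def \<beta>_def a_def b_def m_def n_def X_def bil_def field_simps)
  then have "\<alpha> * \<beta> = 2 * X" using assms by (simp add: period_cone_def)
  then have "cmod \<alpha> * cmod \<beta> = 2 * cmod X" by (metis norm_mult norm_numeral)
  moreover have "cmod X \<le> H" unfolding X_def H_def by (rule norm_sum_squares) simp_all
  moreover have "(cmod \<alpha>)\<^sup>2 - (cmod \<beta>)\<^sup>2 = 4 * orient z"
    unfolding \<alpha>_def \<beta>_def a_def b_def cmod_power2 orient_eq by (simp add: power2_eq_square algebra_simps)
  then have "cmod \<alpha> = cmod \<beta>" using o by simp
  moreover have "(cmod \<alpha>)\<^sup>2 + (cmod \<beta>)\<^sup>2 = 4 * Re (bil d z (vcnj z)) + 4 * H"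
    unfolding \<alpha>_def \<beta>_def a_def b_def m_def n_def H_def cmod_power2 Re_bil_vcnj
    by (simp add: power2_eq_square field_simps)
  moreover have "Re (bil d z (vcnj z)) > 0" using assms by (simp add: period_cone_def)
  ultimately show False by (simp add: power2_eq_square)
qed

lemma connected_subset_cone_part:
  assumes s: "s\<^sup>2 = 1" and "connected T" "T \<subseteq> period_cone d" "z \<in> T" "z \<in> cone_part d s"
  shows "T \<subseteq> cone_part d s"
proof
  fix w assume w: "w \<in> T"
  have "connected (orient ` T)"
    using assms(2) continuous_orient by (rule connected_continuous_image[rotated])
  moreover have "0 \<notin> orient ` T" using assms(3) orient_nonzero by fastforce
  ultimately have "\<not> (orient z \<le> 0 \<and> 0 \<le> orient w)" "\<not> (orient w \<le> 0 \<and> 0 \<le> orient z)"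
    using w assms(4) unfolding connected_iff_interval by blast+
  moreover have "s = 1 \<or> s = -1" using s by (simp add: power2_eq_1_iff)
  ultimately have "s * orient w > 0" using assms(5) by (auto simp: cone_part_def)
  then show "w \<in> cone_part d s" using w assms(3) by (auto simp: cone_part_def)
qed

lemma components_period_cone:
  assumes "\<Omega> \<in> components (period_cone d)"
  shows "\<exists>s. s\<^sup>2 = 1 \<and> \<Omega> = cone_part d s"
proof -
  have \<Omega>: "connected \<Omega>" "\<Omega> \<subseteq> period_cone d" "\<Omega> \<noteq> {}"
    using assms in_components_connected in_components_subset in_components_nonempty by blast+
  then obtain z where z: "z \<in> \<Omega>" "z \<in> period_cone d" by blast
  define s where "s = sgn (orient z)"
  have s: "s\<^sup>2 = 1" "z \<in> cone_part d s"
    using z(2) orient_nonzero[OF z(2)] by (auto simp: s_def cone_part_def sgn_if)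
  have "\<Omega> \<subseteq> cone_part d s"
    by (rule connected_subset_cone_part[OF s(1) \<Omega>(1,2) z(1) s(2)])
  moreover have "cone_part d s \<subseteq> \<Omega>"
    using components_maximal[OF assms connected_cone_part[OF s(1)]] z(1) s(2)
    by (auto simp: cone_part_def)
  ultimately show ?thesis using s(1) by blast
qed

section \<open>Complexified reflections and their effect on the components\<close>

definition of_real_vec :: "real ^ 6 \<Rightarrow> complex ^ 6" where
  "of_real_vec x = (\<chi> i. of_real (x $ i))"

definition creflection :: "nat \<Rightarrow> real ^ 6 \<Rightarrow> complex ^ 6 \<Rightarrow> complex ^ 6" where
  "creflection d w z = z - (2 * bil d z (of_real_vec w) / of_real (bil d w w)) *s of_real_vec w"

lemma bil_of_real_vec: "bil d (of_real_vec x) (of_real_vec y) = of_real (bil d x y)"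
  by (simp add: bil_def of_real_vec_def)

lemma vcnj_simps: "vcnj (x - y) = vcnj x - vcnj y" "vcnj (x + y) = vcnj x + vcnj y"
  "vcnj (c *s x) = cnj c *s vcnj x" "vcnj (of_real_vec r) = of_real_vec r" "vcnj (vcnj x) = x"
  by (simp_all add: vcnj_def vec_eq_iff of_real_vec_def)

lemma cnj_bil: "cnj (bil d x y) = bil d (vcnj x) (vcnj y)"
  by (simp add: bil_def vcnj_def)

lemma creflection_lin: "lin (creflection d w)"
  by (simp add: lin_def creflection_def bil_linear vec_eq_iff algebra_simps add_divide_distrib)

lemma creflection_isometry:
  assumes "bil d w w \<noteq> 0"
  shows "bil d (creflection d w x) (creflection d w y) = bil d x y"
proof -
  define q :: complex where "q = of_real (bil d w w)"
  have "q \<noteq> 0" using assms by (simp add: q_def)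
  then show ?thesis
    by (simp add: creflection_def bil_linear bil_of_real_vec bil_commute[of d "of_real_vec w" x]
        bil_commute[of d "of_real_vec w" y] q_def[symmetric] field_simps)
qed

lemma vcnj_creflection: "vcnj (creflection d w z) = creflection d w (vcnj z)"
  by (simp add: creflection_def vcnj_simps cnj_bil)

lemma creflection_of_real_vec: "creflection d w (of_real_vec x) = of_real_vec (reflection d w x)"
  by (simp add: creflection_def reflection_def bil_of_real_vec) (simp add: of_real_vec_def vec_eq_iff)

lemma continuous_creflection: "continuous_on S (creflection d w)"
  unfolding creflection_def bil_def vector_scalar_mult_def divide_inverse
  by (intro continuous_intros)

text \<open>By connectedness the target component can be read off at \<open>base_point\<close>. A
  reflection in a vector of negative length keeps the component, one in a vector of positive length
  exchanges the two.\<close>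

lemma creflection_cone_part:
  assumes s: "s\<^sup>2 = 1" and w: "bil d w w \<noteq> 0"
  shows "creflection d w ` cone_part d s \<subseteq> cone_part d (s * sgn (- bil d w w))"
proof (rule connected_subset_cone_part)
  let ?q = "bil d w w"
  let ?z = "base_point s"
  show "(s * sgn (- ?q))\<^sup>2 = 1" using s w by (simp add: power_mult_distrib sgn_if)
  show "connected (creflection d w ` cone_part d s)"
    by (intro connected_continuous_image continuous_creflection connected_cone_part[OF s])
  show sub: "creflection d w ` cone_part d s \<subseteq> period_cone d"
    using creflection_isometry[OF w] by (auto simp: cone_part_def period_cone_def vcnj_creflection)
  have z: "?z \<in> cone_part d s" using base_point_smult_in_cone_part[OF s, of 1] by simp
  then show "creflection d w ?z \<in> creflection d w ` cone_part d s" by (rule imageI)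
  define wa wb where "wa = w $ 1 + w $ 2" and "wb = w $ 3 + w $ 4"
  have ss: "s * s = 1" using s by (simp add: power2_eq_square)
  have bz: "2 * bil d ?z (of_real_vec w) = of_real wa - of_real (s * wb) * \<i>"
    by (simp add: bil_def base_point_def of_real_vec_def wa_def wb_def field_simps)
  have 1: "creflection d w ?z = ?z - ((of_real wa - of_real (s * wb) * \<i>) / of_real ?q) *s of_real_vec w"
    unfolding creflection_def bz ..
  have comps: "Re (creflection d w ?z $ 1) + Re (creflection d w ?z $ 2) = 1 - wa * wa / ?q"
    "Im (creflection d w ?z $ 1) + Im (creflection d w ?z $ 2) = s * wb * wa / ?q"
    "Re (creflection d w ?z $ 3) + Re (creflection d w ?z $ 4) = - wa * wb / ?q"
    "Im (creflection d w ?z $ 3) + Im (creflection d w ?z $ 4) = - s + s * wb * wb / ?q"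
    unfolding 1 using w
    by (simp_all add: base_point_def of_real_vec_def Re_divide_of_real Im_divide_of_real field_simps)
      (simp_all add: wa_def wb_def algebra_simps)
  have "orient (creflection d w ?z) = s * (1 - (wa\<^sup>2 + wb\<^sup>2) / ?q)"
    unfolding orient_eq comps using w by (simp add: power2_eq_square field_simps)
  then have or: "s * sgn (- ?q) * orient (creflection d w ?z) = sgn (- ?q) * (1 - (wa\<^sup>2 + wb\<^sup>2) / ?q)"
  proof -
    have "s * sgn (- ?q) * (s * k) = (s * s) * (sgn (- ?q) * k)" for k by (simp only: mult_ac)
    then show ?thesis by (simp only: \<open>orient _ = _\<close> ss mult_1)
  qed
  \<comment> \<open>Up to the factor 1/2, the right side is the positive part of the length of w,
    and the remaining part is negative. So wa^2 + wb^2 > q for either sign of q.\<close>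
  have q: "2 * ?q \<le> wa\<^sup>2 + wb\<^sup>2"
  proof -
    have "2 * ?q = wa\<^sup>2 + wb\<^sup>2 - ((w $ 1 - w $ 2)\<^sup>2 + (w $ 3 - w $ 4)\<^sup>2 + 4 * real d * (w $ 5)\<^sup>2 + 12 * (w $ 6)\<^sup>2)"
      by (simp add: bil_def wa_def wb_def power2_eq_square algebra_simps)
    moreover have "(w $ 1 - w $ 2)\<^sup>2 + (w $ 3 - w $ 4)\<^sup>2 + 4 * real d * (w $ 5)\<^sup>2 + 12 * (w $ 6)\<^sup>2 \<ge> 0"
      by simp
    ultimately show ?thesis by linarith
  qed
  have "sgn (- ?q) * (1 - (wa\<^sup>2 + wb\<^sup>2) / ?q) > 0"
  proof (cases "?q > 0")
    case True
    then have "?q < wa\<^sup>2 + wb\<^sup>2" using q by linarith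
    then show ?thesis using True by simp
  next
    case False
    then have "?q < wa\<^sup>2 + wb\<^sup>2" using w sum_power2_ge_zero[of wa wb] by linarith
    then show ?thesis using False w by simp
  qed
  then have "s * sgn (- ?q) * orient (creflection d w ?z) > 0" by (simp only: or)
  then show "creflection d w ?z \<in> cone_part d (s * sgn (- ?q))"
    using sub z unfolding cone_part_def[of d "s * sgn (- ?q)"] by blast
qed

text \<open>The effect of a product of reflections on the components is the sign of its spinor norm,
  which explains the normalisation by - (w, w) / 2.\<close>

lemma foldr_creflection_cone_part:
  assumes "\<forall>w\<in>set ws. bil d w w \<noteq> 0" "s\<^sup>2 = 1" "z \<in> cone_part d s"
  shows "foldr (creflection d) ws z \<in> cone_part d (s * sgn (\<Prod>w\<leftarrow>ws. - bil d w w / 2))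
    \<and> (s * sgn (\<Prod>w\<leftarrow>ws. - bil d w w / 2))\<^sup>2 = 1"
  using assms(1)
proof (induction ws)
  case (Cons w ws)
  define t where "t = s * sgn (\<Prod>w\<leftarrow>ws. - bil d w w / 2)"
  have "foldr (creflection d) ws z \<in> cone_part d t" "t\<^sup>2 = 1"
    using Cons by (auto simp: t_def)
  then have "foldr (creflection d) (w # ws) z \<in> cone_part d (t * sgn (- bil d w w))"
    using creflection_cone_part[of t d w] Cons(2) by auto
  moreover have "t * sgn (- bil d w w) = s * sgn (\<Prod>w\<leftarrow>w # ws. - bil d w w / 2)"
    by (simp add: t_def sgn_mult sgn_divide)
  moreover have "(t * sgn (- bil d w w))\<^sup>2 = 1"
    using \<open>t\<^sup>2 = 1\<close> Cons(2) by (simp add: power_mult_distrib sgn_if)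
  ultimately show ?case by simp
qed (use assms in simp)

text \<open>Both sides are complex linear and agree on the standard basis, which is real; so the
  real factorisation carries over.\<close>

lemma Gamma_L_complex:
  assumes "g \<in> Gamma_L d"
  shows "\<exists>ws. (\<forall>w\<in>set ws. bil d w w \<noteq> 0) \<and> (\<Prod>w\<leftarrow>ws. - bil d w w / 2) > 0
    \<and> (\<forall>z. map_matrix of_int g *v z = foldr (creflection d) ws z)"
proof -
  from Gamma_L_spin[OF assms] obtain ws r where ws: "\<forall>w\<in>set ws. bil d w w \<noteq> 0"
    "\<forall>x :: real ^ 6. map_matrix of_int g *v x = foldr (reflection d) ws x" "r \<noteq> 0"
    "(\<Prod>w\<leftarrow>ws. - bil d w w / 2) = r\<^sup>2"
    unfolding spin_def by blast
  have lin: "lin (foldr (creflection d) ws)"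
    using creflection_lin by (induction ws) (auto simp: lin_def)
  have real: "foldr (creflection d) ws (of_real_vec x) = of_real_vec (foldr (reflection d) ws x)" for x
    by (induction ws) (auto simp: creflection_of_real_vec)
  have "map_matrix of_int g *v z = foldr (creflection d) ws z" for z
  proof (rule lin_eq_axis[OF lin_matrix lin])
    fix i :: 6
    have "map_matrix of_int g *v (axis i 1 :: complex ^ 6) = of_real_vec (map_matrix of_int g *v axis i 1)"
      by (simp add: vec_eq_iff of_real_vec_def matrix_vector_mult_def map_matrix_def axis_def
          if_distrib cong: if_cong)
    also have "\<dots> = foldr (creflection d) ws (of_real_vec (axis i 1))"
      by (simp add: real ws(2))
    also have "of_real_vec (axis i 1) = axis i 1"
      by (simp add: of_real_vec_def vec_eq_iff axis_def)
    finally show "map_matrix of_int g *v (axis i 1 :: complex ^ 6) = foldr (creflection d) ws (axis i 1)" .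
  qed
  then show ?thesis using ws by (intro exI[of _ ws]) auto
qed

lemma Gamma_L_complex_isometry:
  assumes "g \<in> Gamma_L d"
  shows "bil d (map_matrix of_int g *v x) (map_matrix of_int g *v y) = bil d x (y :: complex ^ 6)"
proof -
  obtain ws where ws: "\<forall>w\<in>set ws. bil d w w \<noteq> 0"
    "\<forall>z. map_matrix of_int g *v z = foldr (creflection d) ws z"
    using Gamma_L_complex[OF assms] by blast
  have "bil d (foldr (creflection d) ws x) (foldr (creflection d) ws y) = bil d x y"
    using ws(1) by (induction ws) (auto simp: creflection_isometry)
  then show ?thesis using ws(2) by simp
qed

lemma Gamma_L_preserves_component:
  assumes "\<Omega> \<in> components (period_cone d)" "g \<in> Gamma_L d" "z \<in> \<Omega>"
  shows "map_matrix of_int g *v z \<in> \<Omega>"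
proof -
  obtain s where s: "s\<^sup>2 = 1" "\<Omega> = cone_part d s" using components_period_cone[OF assms(1)] by blast
  obtain ws where ws: "\<forall>w\<in>set ws. bil d w w \<noteq> 0" "(\<Prod>w\<leftarrow>ws. - bil d w w / 2) > 0"
    "\<forall>z. map_matrix of_int g *v z = foldr (creflection d) ws z"
    using Gamma_L_complex[OF assms(2)] by blast
  then show ?thesis
    using foldr_creflection_cone_part[OF ws(1) s(1), of z] assms(3) by (simp add: s(2))
qed

section \<open>Action on the rational boundary components\<close>

abbreviation gact :: "int ^ 6 ^ 6 \<Rightarrow> complex ^ 6 \<Rightarrow> complex ^ 6" where
  "gact g z \<equiv> map_matrix of_int g *v z"

abbreviation act :: "int ^ 6 ^ 6 \<Rightarrow> (complex ^ 6) set \<Rightarrow> (complex ^ 6) set" where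
  "act g P \<equiv> gact g ` P"

lemma line_eq: "line z = range (\<lambda>c. c *s z)"
  by (simp add: line_def vec.span_singleton)

lemma mem_line: "z \<in> line z"
  unfolding line_eq by (rule range_eqI[of _ _ 1]) simp

lemma gact_linear: "gact g (x + y) = gact g x + gact g y" "gact g (c *s x) = c *s gact g x"
  "gact g (x - y) = gact g x - gact g y"
  using lin_matrix[of "map_matrix of_int g :: complex ^ 6 ^ 6"] lin_diff[OF lin_matrix]
  by (auto simp: lin_def)

lemma act_line: "act g (line z) = line (gact g z)"
  by (auto simp: line_eq image_iff gact_linear)

lemma line_eqD:
  assumes "line z = line w"
  obtains c where "w = c *s z"
  using assms mem_line[of w] by (auto simp: line_eq)

lemma line_smult: "c \<noteq> 0 \<Longrightarrow> line (c *s z) = line z"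
proof (intro antisym subsetI)
  assume c: "c \<noteq> 0"
  fix x assume "x \<in> line z"
  then obtain k where "x = k *s z" by (auto simp: line_eq)
  then have "x = (k / c) *s (c *s z)" using c by (simp add: vector_smult_assoc)
  then show "x \<in> line (c *s z)" unfolding line_eq by (rule range_eqI)
next
  fix x assume "x \<in> line (c *s z)"
  then obtain k where "x = (k * c) *s z" by (auto simp: line_eq vector_smult_assoc)
  then show "x \<in> line z" unfolding line_eq by (rule range_eqI)
qed

lemma continuous_gact: "continuous_on S (gact g)"
  by (rule matrix_vector_mult_linear_continuous_on)

lemma vcnj_gact: "vcnj (gact g z) = gact g (vcnj z)"
  by (simp add: vcnj_def vec_eq_iff matrix_vector_mult_def map_matrix_def)

lemma act_cspan: "act g (cspan E) = cspan ((*v) g ` E)"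
proof -
  have "act g (vec.span (emb ` E)) = vec.span (act g (emb ` E))"
    by (rule vec.linear_span_image[symmetric]) (rule matrix_vector_mul_linear_gen)
  then show ?thesis by (simp add: cspan_def image_image emb_matrix_vector)
qed

lemma cspan_generator: "cspan (range (\<lambda>n. n *s v)) = line (emb v)"
proof -
  have "vec.span (emb ` range (\<lambda>n. n *s v)) = vec.span {emb v :: complex ^ 6}"
  proof (intro antisym vec.span_minimal vec.subspace_span subsetI)
    fix x :: "complex ^ 6" assume "x \<in> emb ` range (\<lambda>n. n *s v)"
    then obtain n where "x = emb (n *s v)" by blast
    then show "x \<in> vec.span {emb v}" by (simp add: emb_smult vec.span_scale vec.span_base)
  next
    fix x :: "complex ^ 6" assume "x \<in> {emb v}"
    moreover have "v \<in> range (\<lambda>n. n *s v)" by (rule range_eqI[of _ _ 1]) simp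
    ultimately show "x \<in> vec.span (emb ` range (\<lambda>n. n *s v))" by (auto intro!: vec.span_base)
  qed
  then show ?thesis by (simp add: cspan_def line_def)
qed

lemma cspan_plane: "cspan (plane e f) = {x *s emb e + y *s emb f | x y. True}"
proof -
  have sp: "vec.span {emb e, emb f :: complex ^ 6} = {x *s emb e + y *s emb f | x y. True}"
  proof (intro antisym subsetI)
    fix z :: "complex ^ 6" assume "z \<in> vec.span {emb e, emb f}"
    then obtain x y where "z - x *s emb e = y *s emb f"
      unfolding vec.span_insert[of "emb e"] vec.span_singleton by blast
    then have "z = x *s emb e + y *s emb f" by (simp add: algebra_simps)
    then show "z \<in> {x *s emb e + y *s emb f | x y. True}" by blast
  next
    fix z :: "complex ^ 6" assume "z \<in> {x *s emb e + y *s emb f | x y. True}"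
    then obtain x y where "z = x *s emb e + y *s emb f" by blast
    then show "z \<in> vec.span {emb e, emb f}"
      by (simp add: vec.span_add vec.span_scale vec.span_base)
  qed
  have "vec.span (emb ` plane e f) = vec.span {emb e, emb f :: complex ^ 6}"
  proof (intro antisym vec.span_minimal vec.subspace_span subsetI)
    fix x :: "complex ^ 6" assume "x \<in> emb ` plane e f"
    then obtain a b where "x = emb (a *s e + b *s f)" unfolding plane_def by blast
    then show "x \<in> vec.span {emb e, emb f}"
      by (simp add: emb_add emb_smult vec.span_add vec.span_scale vec.span_base)
  next
    fix x :: "complex ^ 6" assume "x \<in> {emb e, emb f}"
    moreover have "e \<in> plane e f" "f \<in> plane e f"
      using plane_memberI[of 1 e 0 f] plane_memberI[of 0 e 1 f] by simp_all
    ultimately show "x \<in> vec.span (emb ` plane e f)" by (auto intro!: vec.span_base)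
  qed
  then show ?thesis by (simp add: cspan_def sp)
qed

text \<open>The determinant of the projections of e and f to the positive definite plane that
  defines \<open>orient\<close>.\<close>

definition minor :: "int ^ 6 \<Rightarrow> int ^ 6 \<Rightarrow> int" where
  "minor e f = (e $ 1 + e $ 2) * (f $ 3 + f $ 4) - (e $ 3 + e $ 4) * (f $ 1 + f $ 2)"

lemma orient_plane:
  "orient (x *s emb e + y *s emb f) = of_int (minor e f) * Im (x * cnj y)"
  by (simp add: orient_def minor_def emb_def algebra_simps)

text \<open>The projection has a negative definite kernel, so it is injective on a totally isotropic
  plane.\<close>

lemma minor_nonzero:
  assumes d: "d > 0" and iso: "bil d e e = 0" "bil d e f = 0" "bil d f f = 0"
    and indep: "\<And>x y. x *s e + y *s f = 0 \<Longrightarrow> x = 0 \<and> y = 0"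
  shows "minor e f \<noteq> 0"
proof
  assume m: "minor e f = 0"
  have zero: "x = 0 \<and> y = 0"
    if u: "u = x *s e + y *s f" "u $ 1 + u $ 2 = 0" "u $ 3 + u $ 4 = 0" for u x y
  proof -
    have "bil d u u = 0" using iso bil_commute[of d f e] by (simp add: u(1) bil_linear)
    moreover have "u $ 2 = - u $ 1" "u $ 4 = - u $ 3" using u by simp_all
    ultimately have "(u $ 1)\<^sup>2 + (u $ 3)\<^sup>2 + int d * (u $ 5)\<^sup>2 + 3 * (u $ 6)\<^sup>2 = 0"
      by (simp add: bil_def power2_eq_square)
    moreover have "int d * (u $ 5)\<^sup>2 \<ge> 0" by simp
    ultimately have "(u $ 1)\<^sup>2 = 0" "(u $ 3)\<^sup>2 = 0" "int d * (u $ 5)\<^sup>2 = 0" "(u $ 6)\<^sup>2 = 0"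
      using zero_le_power2[of "u $ 1"] zero_le_power2[of "u $ 3"] zero_le_power2[of "u $ 6"] by linarith+
    then have "u = 0" using d u by (simp add: vec_eq_iff forall_6)
    then show ?thesis using indep u(1) by metis
  qed
  \<comment> \<open>The combination (f1 + f2) e - (e1 + e2) f has first projected coordinate 0, and
    its second one is the minor up to sign, hence 0 as well.\<close>
  have "f $ 1 + f $ 2 = 0 \<and> - (e $ 1 + e $ 2) = 0"
    using m by (intro zero[OF refl]) (simp_all add: minor_def algebra_simps)
  moreover have "f $ 3 + f $ 4 = 0 \<and> - (e $ 3 + e $ 4) = 0"
    using m by (intro zero[OF refl]) (simp_all add: minor_def algebra_simps)
  ultimately have "(1::int) = 0 \<and> (0::int) = 0"
    by (intro zero[of e]) auto
  then show False by simp
qed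

lemma complex_indep:
  assumes "minor e f \<noteq> 0" "x *s emb e + y *s emb f = (0 :: complex ^ 6)"
  shows "x = 0" "y = 0"
proof -
  have c: "x * of_int (e $ i) + y * of_int (f $ i) = 0" for i
    using assms(2) by (simp add: vec_eq_iff emb_def)
  have a: "x * of_int (e $ 1 + e $ 2) + y * of_int (f $ 1 + f $ 2) = 0"
    "x * of_int (e $ 3 + e $ 4) + y * of_int (f $ 3 + f $ 4) = 0"
    using c[of 1] c[of 2] c[of 3] c[of 4] by (simp_all add: algebra_simps)
  have "x * of_int (minor e f) = (x * of_int (e $ 1 + e $ 2) + y * of_int (f $ 1 + f $ 2)) * of_int (f $ 3 + f $ 4)
      - (x * of_int (e $ 3 + e $ 4) + y * of_int (f $ 3 + f $ 4)) * of_int (f $ 1 + f $ 2)"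
    by (simp add: minor_def algebra_simps)
  then have "x * of_int (minor e f) = 0" unfolding a by simp
  then show "x = 0" using assms(1) by simp
  have "y * of_int (minor e f) = (x * of_int (e $ 3 + e $ 4) + y * of_int (f $ 3 + f $ 4)) * of_int (e $ 1 + e $ 2)
      - (x * of_int (e $ 1 + e $ 2) + y * of_int (f $ 1 + f $ 2)) * of_int (e $ 3 + e $ 4)"
    by (simp add: minor_def algebra_simps)
  then have "y * of_int (minor e f) = 0" unfolding a by simp
  then show "y = 0" using assms(1) by simp
qed

lemma vcnj_emb: "vcnj (emb x) = emb x"
  by (simp add: vcnj_def emb_def vec_eq_iff)

text \<open>On the closure s * orient is nonnegative, and on the plane it equals the minor times Im
  (x * cnj y), which vanishes exactly at the real points. Conversely, positivity puts the point into
  the closure by contraction.\<close>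

lemma half_plane_plane:
  assumes d: "d > 0" and iso: "bil d e e = 0" "bil d e f = 0" "bil d f f = 0"
    and indep: "\<And>x y. x *s e + y *s f = 0 \<Longrightarrow> x = 0 \<and> y = 0"
    and s: "s\<^sup>2 = 1"
  shows "half_plane (cone_part d s) (plane e f) =
    {line (x *s emb e + y *s emb f) | x y. s * of_int (minor e f) * Im (x * cnj y) > 0}"
proof (intro antisym subsetI)
  fix P assume "P \<in> half_plane (cone_part d s) (plane e f)"
  then obtain x y where P: "P = line (x *s emb e + y *s emb f)"
    and cl: "x *s emb e + y *s emb f \<in> closure (cone_part d s)"
    and nr: "vcnj (x *s emb e + y *s emb f) \<notin> line (x *s emb e + y *s emb f)"
    unfolding half_plane_def cspan_plane by blast
  have "closed {z. 0 \<le> s * orient z}"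
    by (intro closed_Collect_le continuous_intros continuous_orient)
  then have "closure (cone_part d s) \<subseteq> {z. 0 \<le> s * orient z}"
    by (intro closure_minimal) (auto simp: cone_part_def)
  then have ge: "s * of_int (minor e f) * Im (x * cnj y) \<ge> 0"
    using cl by (auto simp: orient_plane mult.assoc)
  have "Im (x * cnj y) \<noteq> 0"
  proof
    assume im: "Im (x * cnj y) = 0"
    then have eq: "cnj x * y = x * cnj y" by (simp add: complex_eq_iff algebra_simps)
    have "vcnj (x *s emb e + y *s emb f) = cnj x *s emb e + cnj y *s emb f"
      by (simp add: vcnj_simps vcnj_emb)
    also have "\<exists>c. cnj x *s emb e + cnj y *s emb f = c *s (x *s emb e + y *s emb f)"
    proof (cases "y = 0")
      case True
      then show ?thesis
        by (intro exI[of _ "cnj x / x"]) (simp add: vec_eq_iff)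
    next
      case False
      then show ?thesis using eq
        by (intro exI[of _ "cnj y / y"]) (simp add: vec_eq_iff field_simps)
    qed
    finally show False using nr by (auto simp: line_eq)
  qed
  moreover have "s \<noteq> 0" using s by auto
  ultimately have "s * of_int (minor e f) * Im (x * cnj y) \<noteq> 0"
    using minor_nonzero[OF d iso indep] by simp
  then have "s * of_int (minor e f) * Im (x * cnj y) > 0" using ge by linarith
  then show "P \<in> {line (x *s emb e + y *s emb f) | x y. s * of_int (minor e f) * Im (x * cnj y) > 0}"
    using P by blast
next
  fix P assume "P \<in> {line (x *s emb e + y *s emb f) | x y. s * of_int (minor e f) * Im (x * cnj y) > 0}"
  then obtain x y where P: "P = line (x *s emb e + y *s emb f)"
    and pos: "s * of_int (minor e f) * Im (x * cnj y) > 0" by blast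
  let ?z = "x *s emb e + y *s emb f :: complex ^ 6"
  have b: "bil d (emb e) (emb e) = (0 :: complex)" "bil d (emb e) (emb f) = (0 :: complex)"
    "bil d (emb f) (emb e) = (0 :: complex)" "bil d (emb f) (emb f) = (0 :: complex)"
    using iso bil_commute[of d f e] by (simp_all add: bil_emb)
  have "bil d ?z ?z = 0" "bil d ?z (vcnj ?z) = 0"
    by (simp_all add: bil_linear vcnj_simps vcnj_emb b)
  then have "?z \<in> closure (cone_part d s)"
    using pos by (intro in_closure_cone_part[OF s]) (auto simp: orient_plane mult.assoc)
  moreover have "vcnj ?z \<notin> line ?z"
  proof
    assume "vcnj ?z \<in> line ?z"
    then obtain c where "cnj x *s emb e + cnj y *s emb f = c *s ?z"
      by (auto simp: line_eq vcnj_simps vcnj_emb)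
    then have "(cnj x - c * x) *s emb e + (cnj y - c * y) *s emb f = 0"
      by (simp add: vec_eq_iff algebra_simps)
    then have "cnj x = c * x" "cnj y = c * y"
      using complex_indep minor_nonzero[OF d iso indep] by (metis eq_iff_diff_eq_0)+
    then have "cnj x * y = x * cnj y" by simp
    then have "Im (cnj x * y) = Im (x * cnj y)" by (rule arg_cong)
    then have "Im (x * cnj y) = 0" by (simp add: mult.commute)
    then show False using pos by simp
  qed
  moreover have "?z \<in> cspan (plane e f)" unfolding cspan_plane by blast
  ultimately show "P \<in> half_plane (cone_part d s) (plane e f)"
    unfolding half_plane_def P by blast
qed

lemma act_half_plane:
  assumes "\<Omega> \<in> components (period_cone d)" "d > 0" "g \<in> Gamma_L d" "P \<in> half_plane \<Omega> E"
  shows "act g P \<in> half_plane \<Omega> ((*v) g ` E)"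
proof -
  obtain z where z: "P = line z" "z \<in> cspan E" "z \<in> closure \<Omega>" "vcnj z \<notin> line z"
    using assms(4) unfolding half_plane_def by blast
  obtain h where h: "h ** g = mat 1" using Gamma_L_inverse[OF assms(2,3)] by blast
  have "gact g ` closure \<Omega> \<subseteq> closure \<Omega>"
    using Gamma_L_preserves_component[OF assms(1,3)] closure_subset
    by (intro image_closure_subset continuous_gact closed_closure) blast
  then have "gact g z \<in> closure \<Omega>" using z(3) by blast
  moreover have "gact g z \<in> cspan ((*v) g ` E)" using z(2) act_cspan by blast
  moreover have "vcnj (gact g z) \<notin> line (gact g z)"
  proof
    assume "vcnj (gact g z) \<in> line (gact g z)"
    then obtain c where "gact g (vcnj z) = gact g (c *s z)"
      by (auto simp: vcnj_gact line_eq gact_linear)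
    then have "gact h (gact g (vcnj z)) = gact h (gact g (c *s z))" by simp
    then have "vcnj z = c *s z"
      by (simp only: of_int_matrix_vector_mult[symmetric] h of_int_matrix_one)
    then show False using z(4) by (auto simp: line_eq)
  qed
  ultimately show ?thesis unfolding half_plane_def z(1) act_line by blast
qed

lemma gact_inverse: "h ** g = mat 1 \<Longrightarrow> gact h (gact g z) = z"
  by (simp only: of_int_matrix_vector_mult[symmetric] of_int_matrix_one)

lemma act_inverse: "h ** g = mat 1 \<Longrightarrow> act h (act g P) = P"
  by (simp add: image_image gact_inverse)

lemma act_mult: "act (g ** h) P = act g (act h P)"
  by (simp add: image_image of_int_matrix_vector_mult)

lemma bb_orbit_eq: "bb_orbit G P = {act g P | g. g \<in> G}"
  by (auto simp: bb_orbit_def orbit_of_def line_action_def)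

lemma bb_orbit_eq_iff:
  assumes "d > 0"
  shows "bb_orbit (Gamma_L d) P = bb_orbit (Gamma_L d) Q \<longleftrightarrow> (\<exists>g\<in>Gamma_L d. act g P = Q)"
proof
  assume eq: "bb_orbit (Gamma_L d) P = bb_orbit (Gamma_L d) Q"
  have "act (mat 1) Q = Q" by (simp add: of_int_matrix_one)
  then have "Q \<in> bb_orbit (Gamma_L d) Q" using Gamma_L_one[of d] unfolding bb_orbit_eq by force
  then show "\<exists>g\<in>Gamma_L d. act g P = Q" unfolding eq[symmetric] by (auto simp: bb_orbit_eq)
next
  assume "\<exists>g\<in>Gamma_L d. act g P = Q"
  then obtain g where g: "g \<in> Gamma_L d" "act g P = Q" by blast
  obtain h where h: "h \<in> Gamma_L d" "h ** g = mat 1" using Gamma_L_inverse[OF assms g(1)] by blast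
  have sub: "bb_orbit (Gamma_L d) Q' \<subseteq> bb_orbit (Gamma_L d) P'"
    if k: "k \<in> Gamma_L d" "act k P' = Q'" for k P' Q'
  proof
    fix R assume "R \<in> bb_orbit (Gamma_L d) Q'"
    then obtain l where l: "l \<in> Gamma_L d" "R = act l Q'" by (auto simp: bb_orbit_eq)
    then have "R = act (l ** k) P'" using k(2) by (simp only: act_mult)
    then show "R \<in> bb_orbit (Gamma_L d) P'"
      unfolding bb_orbit_eq using Gamma_L_mult[OF l(1) k(1)] by blast
  qed
  have "act h Q = P" using g(2) act_inverse[OF h(2), of P] by simp
  then show "bb_orbit (Gamma_L d) P = bb_orbit (Gamma_L d) Q"
    using sub[OF g] sub[OF h(1)] by blast
qed

lemma image_inverse: "h ** g = mat 1 \<Longrightarrow> (*v) h ` (*v) g ` E = E" for g h :: "int ^ 6 ^ 6"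
  by (simp add: image_image matrix_vector_mul_assoc)

lemma z_basis_image:
  fixes g h :: "int ^ 6 ^ 6"
  assumes "h ** g = mat 1" "z_basis b I E"
  shows "z_basis (\<lambda>i. g *v b i) I ((*v) g ` E)"
proof -
  have sum: "(\<Sum>i\<in>I. c i *s (g *v b i)) = g *v (\<Sum>i\<in>I. c i *s b i)" for c
    using lin_matrix[of g]
    by (induction I rule: infinite_finite_induct) (auto simp: lin_def)
  have "(\<Sum>i\<in>I. c i *s b i) = 0" if "g *v (\<Sum>i\<in>I. c i *s b i) = 0" for c
  proof -
    have "h *v (g *v (\<Sum>i\<in>I. c i *s b i)) = h *v 0" using that by simp
    then show ?thesis by (simp add: matrix_vector_mul_assoc assms(1))
  qed
  then show ?thesis
    using assms(2) unfolding z_basis_def sum by (auto simp: image_image)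
qed

lemma isotropic_image:
  assumes "d > 0" "g \<in> Gamma_L d" "E \<in> isotropic d r"
  shows "(*v) g ` E \<in> isotropic d r"
proof -
  obtain h where h: "h ** g = mat 1" "g ** h = mat 1" using Gamma_L_inverse[OF assms(1,2)] by blast
  have "x \<in> (*v) g ` E" if nx: "n \<noteq> 0" "n *s x \<in> (*v) g ` E" for n x
  proof -
    have "h *v (n *s x) \<in> E" using nx(2) h by (auto simp: matrix_vector_mul_assoc)
    then have "n *s (h *v x) \<in> E" using lin_matrix[of h] by (simp add: lin_def)
    then have "h *v x \<in> E" using assms(3) nx(1) unfolding isotropic_def by blast
    then have "g *v (h *v x) \<in> (*v) g ` E" by blast
    then show ?thesis by (simp add: matrix_vector_mul_assoc h(2))
  qed
  moreover obtain b where "z_basis b {1..r} E" using assms(3) unfolding isotropic_def by blast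
  then have "z_basis (\<lambda>i. g *v b i) {1..r} ((*v) g ` E)" by (rule z_basis_image[OF h(1)])
  moreover have "bil d x y = 0" if "x \<in> (*v) g ` E" "y \<in> (*v) g ` E" for x y
    using that assms(3) unfolding isotropic_def by (auto simp: Gamma_L_isometry[OF assms(2)])
  ultimately show ?thesis unfolding isotropic_def by blast
qed

section \<open>Stabilisers of isotropic planes\<close>

text \<open>The isometry acting on the plane of e, f by a matrix of determinant 1, contragrediently
  on the dual plane of e', f', and trivially on the orthogonal complement.\<close>

definition sl2_action ::
  "nat \<Rightarrow> real ^ 6 \<Rightarrow> real ^ 6 \<Rightarrow> real ^ 6 \<Rightarrow> real ^ 6 \<Rightarrow> real \<Rightarrow> real \<Rightarrow> real \<Rightarrow> real \<Rightarrow> real ^ 6 \<Rightarrow> real ^ 6" where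
  "sl2_action d e f e' f' \<alpha> \<beta> \<gamma> \<delta> x = x
     + bil d x e' *s ((\<alpha> - 1) *s e + \<beta> *s f) + bil d x f' *s (\<gamma> *s e + (\<delta> - 1) *s f)
     + bil d x e *s ((\<delta> - 1) *s e' - \<gamma> *s f') + bil d x f *s ((\<alpha> - 1) *s f' - \<beta> *s e')"

context
  fixes d :: nat and e f e' f' :: "real ^ 6"
  assumes d: "d > 0"
    and gram: "bil d e e = 0" "bil d e f = 0" "bil d f f = 0" "bil d e e' = 1" "bil d e f' = 0"
      "bil d f e' = 0" "bil d f f' = 1" "bil d e' e' = 0" "bil d e' f' = 0" "bil d f' f' = 0"
begin

lemma gram': "bil d f e = 0" "bil d e' e = 1" "bil d f' e = 0" "bil d e' f = 0" "bil d f' f = 1" "bil d f' e' = 0"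
  using gram by (simp_all add: bil_commute)

lemma sl2_action_bil:
  "bil d (sl2_action d e f e' f' \<alpha> \<beta> \<gamma> \<delta> x) e = \<delta> * bil d x e - \<beta> * bil d x f"
  "bil d (sl2_action d e f e' f' \<alpha> \<beta> \<gamma> \<delta> x) f = \<alpha> * bil d x f - \<gamma> * bil d x e"
  "bil d (sl2_action d e f e' f' \<alpha> \<beta> \<gamma> \<delta> x) e' = \<alpha> * bil d x e' + \<gamma> * bil d x f'"
  "bil d (sl2_action d e f e' f' \<alpha> \<beta> \<gamma> \<delta> x) f' = \<beta> * bil d x e' + \<delta> * bil d x f'"
  by (simp_all add: sl2_action_def bil_add_left bil_diff_left bil_smult_left gram gram' algebra_simps)

lemma sl2_action_mult:
  "sl2_action d e f e' f' \<alpha> \<beta> \<gamma> \<delta> (sl2_action d e f e' f' \<alpha>' \<beta>' \<gamma>' \<delta>' x) =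
   sl2_action d e f e' f' (\<alpha> * \<alpha>' + \<gamma> * \<beta>') (\<beta> * \<alpha>' + \<delta> * \<beta>') (\<alpha> * \<gamma>' + \<gamma> * \<delta>') (\<beta> * \<gamma>' + \<delta> * \<delta>') x"
  unfolding sl2_action_def[of d e f e' f' \<alpha> \<beta> \<gamma> \<delta>] sl2_action_bil
  by (simp add: sl2_action_def vec_eq_iff algebra_simps)

text \<open>Elementary matrices act as Eichler transvections; this transfers the spinor norm
  computation to all of SL(2) over the reals.\<close>

lemma spin_sl2_upper: "spin d (sl2_action d e f e' f' 1 0 \<gamma> 1)"
proof -
  have "sl2_action d e f e' f' 1 0 \<gamma> 1 = transvection d e (- \<gamma> *s f')"
  proof
    fix x
    show "sl2_action d e f e' f' 1 0 \<gamma> 1 x = transvection d e (- \<gamma> *s f') x"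
      by (simp add: sl2_action_def transvection_def bil_smult_left bil_smult_right bil_minus_left bil_minus_right
        gram gram' vec_eq_iff bil_commute[of d e x] bil_commute[of d f' x])
  qed
  then show ?thesis
    using spin_transvection[OF d gram(1), of "- \<gamma> *s f'"] gram by (simp add: bil_minus_right bil_smult_right)
qed

lemma spin_sl2_lower: "spin d (sl2_action d e f e' f' 1 \<beta> 0 1)"
proof -
  have "sl2_action d e f e' f' 1 \<beta> 0 1 = transvection d f (- \<beta> *s e')"
  proof
    fix x
    show "sl2_action d e f e' f' 1 \<beta> 0 1 x = transvection d f (- \<beta> *s e') x"
      by (simp add: sl2_action_def transvection_def bil_smult_left bil_smult_right bil_minus_left bil_minus_right
        gram gram' vec_eq_iff bil_commute[of d f x] bil_commute[of d e' x])
  qed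
  then show ?thesis
    using spin_transvection[OF d gram(3), of "- \<beta> *s e'"] gram by (simp add: bil_minus_right bil_smult_right)
qed

text \<open>For \<beta> not 0 the matrix is a product of three elementary ones; the numbers x and y
  come from comparing diagonal entries.\<close>

lemma spin_sl2_action:
  assumes "\<alpha> * \<delta> - \<beta> * \<gamma> = 1"
  shows "spin d (sl2_action d e f e' f' \<alpha> \<beta> \<gamma> \<delta>)"
proof -
  have nonzero: "spin d (sl2_action d e f e' f' \<alpha> \<beta> \<gamma> \<delta>)" if det: "\<alpha> * \<delta> - \<beta> * \<gamma> = 1" and "\<beta> \<noteq> 0" for \<alpha> \<beta> \<gamma> \<delta>
  proof -
    define x y where "x = (\<alpha> - 1) / \<beta>" and "y = (\<delta> - 1) / \<beta>"
    have xy: "1 + x * \<beta> = \<alpha>" "\<beta> * y + 1 = \<delta>" using \<open>\<beta> \<noteq> 0\<close> by (simp_all add: x_def y_def)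
    have "\<beta> * (\<alpha> * y + x) = \<beta> * \<gamma>"
      using det \<open>\<beta> \<noteq> 0\<close> by (simp add: x_def y_def field_simps)
    then have \<gamma>: "\<alpha> * y + x = \<gamma>" using \<open>\<beta> \<noteq> 0\<close> by simp
    have "sl2_action d e f e' f' 1 0 x 1 (sl2_action d e f e' f' 1 \<beta> 0 1 (sl2_action d e f e' f' 1 0 y 1 z))
        = sl2_action d e f e' f' \<alpha> \<beta> \<gamma> \<delta> z" for z
    proof -
      have "y + \<delta> * x = \<alpha> * y + x" unfolding xy[symmetric] by (simp add: algebra_simps)
      then show ?thesis unfolding sl2_action_mult using xy \<gamma> by (simp add: algebra_simps)
    qed
    then show ?thesis
      using spin_comp[OF spin_sl2_upper spin_comp[OF spin_sl2_lower spin_sl2_upper], of x \<beta> y] by simp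
  qed
  show ?thesis
  proof (cases "\<beta> = 0")
    case True
    then have "\<delta> \<noteq> 0" "\<alpha> * \<delta> = 1" using assms by auto
    \<comment> \<open>An elementary factor moves \<delta>, which is not 0, into the place of the
      vanishing \<beta>.\<close>
    then have "spin d (sl2_action d e f e' f' (\<alpha> + \<gamma>) \<delta> \<gamma> \<delta>)"
      by (intro nonzero) (simp_all add: algebra_simps)
    then have "spin d (\<lambda>x. sl2_action d e f e' f' (\<alpha> + \<gamma>) \<delta> \<gamma> \<delta> (sl2_action d e f e' f' 1 (-1) 0 1 x))"
      using spin_sl2_lower by (rule spin_comp)
    then show ?thesis unfolding sl2_action_mult using True by simp
  qed (use nonzero assms in blast)
qed

end

text \<open>
  In the real hyperbolic basis \<open>e, f, e'', f'\<close> with \<open>e'' = (e' - (c / a) e) / a\<close> a matrix of \<open>\<Gamma>\<^sub>1(a)\<close> on the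
  plane acts integrally only after composition with a rational element of the unipotent radical.
\<close>

lemma Gamma_L_extends:
  assumes d: "d > 0" and a: "a > 0" and ad: "adapted d a e f e' f'"
    and det: "\<alpha> * \<delta> - \<beta> * \<gamma> = 1" and cong: "int a dvd \<alpha> - 1" "int a dvd \<delta> - 1" "int a dvd \<beta>"
  shows "\<exists>g\<in>Gamma_L d. g *v e = \<alpha> *s e + \<beta> *s f \<and> g *v f = \<gamma> *s e + \<delta> *s f"
proof -
  obtain \<alpha>1 \<delta>1 b where cs: "\<alpha> = 1 + int a * \<alpha>1" "\<delta> = 1 + int a * \<delta>1" "\<beta> = int a * b"
    using cong by (metis add_diff_cancel_left' diff_add_cancel dvdE add.commute)
  \<comment> \<open>The determinant condition in terms of the quotients by a. This is the identity
    that later cancels the denominator.\<close>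
  have "int a * (b * \<gamma>) = int a * (\<alpha>1 + \<delta>1 + int a * \<alpha>1 * \<delta>1)"
    using det by (simp add: cs algebra_simps)
  then have bg: "b * \<gamma> = \<alpha>1 + \<delta>1 + int a * \<alpha>1 * \<delta>1" using a by simp
  define c where "c = half_norm d e'"
  have gi: "bil d e e = 0" "bil d e f = 0" "bil d f f = 0" "bil d f f' = 1" "bil d e f' = 0" "bil d f' f' = 0"
    "bil d e e' = int a" "bil d f e' = 0" "bil d e' f' = 0" "bil d e' e' = 2 * c"
    using ad by (auto simp: adapted_def bil_self[of d e'] c_def)
  define re rf re' rf' :: "real ^ 6" where "re = emb e" and "rf = emb f" and "re' = emb e'" and "rf' = emb f'"
  note r_def = re_def rf_def re'_def rf'_def
  define A C :: real where "A = real a" and "C = of_int c"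
  have A0: "A \<noteq> 0" using a by (simp add: A_def)
  have gr: "bil d re re = 0" "bil d re rf = 0" "bil d rf rf = 0" "bil d rf rf' = 1" "bil d re rf' = 0"
    "bil d rf' rf' = 0" "bil d re re' = A" "bil d rf re' = 0" "bil d re' rf' = 0" "bil d re' re' = 2 * C"
    "bil d re' re = A" "bil d rf re = 0" "bil d rf' rf = 1" "bil d rf' re = 0" "bil d re' rf = 0" "bil d rf' re' = 0"
    unfolding r_def bil_emb using gi bil_commute[of d e' e] bil_commute[of d f e] bil_commute[of d f' f]
      bil_commute[of d f' e] bil_commute[of d e' f] bil_commute[of d f' e']
    by (simp_all add: A_def C_def)
  \<comment> \<open>Dividing by A makes the pairing with e equal to 1; the correction by C / A makes
    the vector isotropic, since (e', e') = 2C.\<close>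
  define k where "k = (1 / A) *s (re' - (C / A) *s re)"
  have gk: "bil d re k = 1" "bil d rf k = 0" "bil d k k = 0" "bil d k rf' = 0"
    using A0 by (simp_all add: k_def bil_linear gr field_simps)
  \<comment> \<open>Chosen to cancel the denominators A: the two terms in m cancel each other, and
    the terms in n combine to (C / A) (b \<gamma> - \<alpha>1 - \<delta>1), which \<open>bg\<close>
    turns into C \<alpha>1 \<delta>1.\<close>
  define t where "t = - C * of_int b / A"
  define F where "F x = sl2_action d re rf k rf' (of_int \<alpha>) (of_int \<beta>) (of_int \<gamma>) (of_int \<delta>)
      (transvection d rf (t *s re) x)" for x
  have "spin d (sl2_action d re rf k rf' (of_int \<alpha>) (of_int \<beta>) (of_int \<gamma>) (of_int \<delta>))"
  proof (rule spin_sl2_action[OF d])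
    show "real_of_int \<alpha> * of_int \<delta> - of_int \<beta> * of_int \<gamma> = 1"
      using det by (metis of_int_1 of_int_diff of_int_mult)
  qed (use gr gk in simp_all)
  moreover have "spin d (transvection d rf (t *s re))"
    by (rule spin_transvection[OF d]) (simp_all add: bil_smult_right gr)
  ultimately have sF: "spin d F" unfolding F_def by (rule spin_comp)
  \<comment> \<open>F x - x depends only on the four pairings of x and has integral coefficients
    when they are integers, which holds for every x in the dual lattice. So F acts trivially on the
    discriminant group.\<close>
  have F_eq: "F x = x
      + (n' * of_int \<alpha>1 - C * of_int b * m * of_int \<alpha>1 + m' * of_int \<gamma> + C * n * of_int \<alpha>1 * of_int \<delta>1) *s re
      + (n' * of_int b - C * (of_int b)\<^sup>2 * m + m' * A * of_int \<delta>1 + C * of_int b * n * of_int \<delta>1) *s rf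
      + (n * of_int \<delta>1 - m * of_int b) *s re' + (m * A * of_int \<alpha>1 - n * of_int \<gamma>) *s rf'"
    if x: "bil d x re = n" "bil d x re' = n'" "bil d x rf = m" "bil d x rf' = m'" for x n n' m m'
  proof -
    define al de b' g' :: real where "al = of_int \<alpha>1" and "de = of_int \<delta>1" and "b' = of_int b" and "g' = of_int \<gamma>"
    have c': "of_int \<alpha> = 1 + A * al" "of_int \<delta> = 1 + A * de" "of_int \<beta> = A * b'"
      by (simp_all add: cs A_def al_def de_def b'_def)
    have bg': "b' * g' = al + de + A * al * de"
      using arg_cong[OF bg, of real_of_int] by (simp add: A_def al_def de_def b'_def g'_def)
    have x': "bil d re x = n" "bil d rf x = m" using x by (simp_all add: bil_commute)
    have T: "transvection d rf (t *s re) x = x - (t * n) *s rf + (t * m) *s re"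
      by (simp add: transvection_def bil_smult_left bil_smult_right gr x' vec_eq_iff)
    have xk: "bil d x k = (n' - C * n / A) / A"
      using A0 by (simp add: k_def bil_smult_right bil_diff_right x field_simps)
    have F1: "F x = x - (t * n) *s rf + (t * m) *s re
        + ((n' - C * n / A) / A + t * m) *s ((A * al) *s re + (A * b') *s rf)
        + (m' - t * n) *s (g' *s re + (A * de) *s rf)
        + n *s ((A * de) *s k - g' *s rf') + m *s ((A * al) *s rf' - (A * b') *s k)"
      unfolding F_def T sl2_action_def g'_def[symmetric] c'
      by (simp add: bil_add_left bil_diff_left bil_smult_left gr gk x xk)
    have ce: "t * m + ((n' - C * n / A) / A + t * m) * (A * al) + (m' - t * n) * g'
        - (n * (A * de) - m * (A * b')) * (C / A / A)
        = n' * al - C * b' * m * al + m' * g' + C * n * al * de"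
    proof -
      have "t * m + ((n' - C * n / A) / A + t * m) * (A * al) + (m' - t * n) * g'
        - (n * (A * de) - m * (A * b')) * (C / A / A)
        = n' * al - C * b' * m * al + m' * g' + C * n / A * (b' * g' - al - de)"
        using A0 by (simp add: t_def b'_def[symmetric] field_simps)
      also have "\<dots> = n' * al - C * b' * m * al + m' * g' + C * n * al * de"
        using A0 by (simp add: bg')
      finally show ?thesis .
    qed
    have cf: "- t * n + ((n' - C * n / A) / A + t * m) * (A * b') + (m' - t * n) * (A * de)
        = n' * b' - C * b'\<^sup>2 * m + m' * A * de + C * b' * n * de"
      using A0 by (simp add: t_def b'_def[symmetric] power2_eq_square field_simps)
    have "F x = x
        + (t * m + ((n' - C * n / A) / A + t * m) * (A * al) + (m' - t * n) * g'
           - (n * (A * de) - m * (A * b')) * (C / A / A)) *s re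
        + (- t * n + ((n' - C * n / A) / A + t * m) * (A * b') + (m' - t * n) * (A * de)) *s rf
        + (n * de - m * b') *s re' + (m * A * al - n * g') *s rf'"
      unfolding F1 k_def using A0 by (simp add: vec_eq_iff field_simps)
    then show ?thesis unfolding ce cf unfolding al_def de_def b'_def g'_def .
  qed
  have "\<exists>g\<in>Gamma_L d. \<forall>x. map_matrix of_int g *v x = F x"
  proof (rule Gamma_L_intro[OF d sF])
    fix x :: "real ^ 6" assume x: "\<And>y. bil d x (emb y) \<in> \<int>"
    obtain n n' m m' where "bil d x re = of_int n" "bil d x re' = of_int n'"
      "bil d x rf = of_int m" "bil d x rf' = of_int m'"
      using x unfolding r_def by (metis Ints_cases)
    from F_eq[OF this] have "F x - x = emb (
      (n' * \<alpha>1 - c * b * m * \<alpha>1 + m' * \<gamma> + c * n * \<alpha>1 * \<delta>1) *s e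
      + (n' * b - c * b\<^sup>2 * m + m' * int a * \<delta>1 + c * b * n * \<delta>1) *s f
      + (n * \<delta>1 - m * b) *s e' + (m * int a * \<alpha>1 - n * \<gamma>) *s f')"
      by (simp add: emb_linear r_def A_def C_def)
    then show "F x - x \<in> range emb" by blast
  qed
  then obtain g where g: "g \<in> Gamma_L d" "\<And>x. map_matrix of_int g *v x = F x" by blast
  have "(emb (g *v e) :: real ^ 6) = emb (\<alpha> *s e + \<beta> *s f)"
  proof -
    have "F re = re + (A * of_int \<alpha>1) *s re + (A * of_int b) *s rf"
      using F_eq[of re 0 A 0 0] gr by simp
    also have "\<dots> = emb (\<alpha> *s e + \<beta> *s f)"
      by (simp add: emb_linear r_def cs A_def vec_eq_iff algebra_simps)
    finally show ?thesis by (simp add: emb_matrix_vector[symmetric] g(2) re_def)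
  qed
  moreover have "(emb (g *v f) :: real ^ 6) = emb (\<gamma> *s e + \<delta> *s f)"
  proof -
    have "F rf = rf + of_int \<gamma> *s re + (A * of_int \<delta>1) *s rf"
      using F_eq[of rf 0 0 0 1] gr by simp
    also have "\<dots> = emb (\<gamma> *s e + \<delta> *s f)"
      by (simp add: emb_linear r_def cs A_def vec_eq_iff algebra_simps)
    finally show ?thesis by (simp add: emb_matrix_vector[symmetric] g(2) rf_def)
  qed
  ultimately show ?thesis using g(1) unfolding emb_eq_iff by blast
qed

context paramodular
begin

text \<open>This is where the congruence defining the group restricts its action on isotropic
  vectors. The primes 2 and p are treated separately and combined by coprimality.\<close>

lemma Gamma_L_fixes_mod_div:
  assumes g: "g \<in> Gamma_L d" and iso: "bil d v v = 0" and prim: "prim v" and div: "has_div d n v"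
  shows "\<forall>i. n dvd (g *v v - v) $ i"
proof -
  have n: "n \<in> {1, 2, int p, 2 * int p}" using div_cases[OF iso prim div] .
  obtain h where h: "h ** g = mat 1" using Gamma_L_inverse[OF d_pos g] by blast
  have iso': "bil d (g *v v) (g *v v) = 0" using iso by (simp add: Gamma_L_isometry[OF g])
  have "equivalent d v (g *v v)" using g by (auto simp: equivalent_def)
  then have div': "has_div d n (g *v v)" using equivalent_has_div[OF d_pos] div by blast
  have prim': "prim (g *v v)"
    unfolding prim_def
  proof (intro allI impI)
    fix q assume "\<forall>i. q dvd (g *v v) $ i"
    then obtain x where "g *v v = q *s x" by (rule dvd_vecE)
    then have "h *v (g *v v) = q *s (h *v x)" using lin_matrix[of h] by (simp add: lin_def)
    then have "v = q *s (h *v x)" by (simp add: matrix_vector_mul_assoc h)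
    then have "\<forall>i. q dvd v $ i" by (metis dvd_triv_left vector_smult_component)
    then show "q dvd 1" using prim by (simp add: prim_def)
  qed
  have two: "2 dvd (g *v v - v) $ i" if "even n" for i
  proof -
    have e: "2 dvd u $ i" if "has_div d n u" "bil d u u = 0" "prim u" "i \<in> {1, 2, 3, 4}" for u
      using div_dvd[OF that(2,3,1)] that(4) \<open>even n\<close> dvd_trans by blast
    have "odd (v $ 5)" "odd (v $ 6)" "odd ((g *v v) $ 5)" "odd ((g *v v) $ 6)"
      using odd_if_even_div[OF iso prim div that] odd_if_even_div[OF iso' prim' div' that] by blast+
    then show ?thesis using exhaust_6[of i] e[OF div iso prim] e[OF div' iso' prim'] by auto
  qed
  \<comment> \<open>Modulo p only the fifth coordinate of v survives. Since g fixes
    \<open>vstar\<close> modulo the lattice, it fixes the fifth basis vector modulo 2 p^2.\<close>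
  have p: "int p dvd (g *v v - v) $ i" if pn: "int p dvd n" for i
  proof -
    obtain x where x: "map_matrix of_int g *v vstar d - vstar d = emb x"
      using g by (auto simp: Gamma_L_def cong_L_def)
    have ve: "emb (axis 5 1) = (2 * real d) *s vstar d"
      using d_pos by (simp add: vstar_def emb_axis vec_eq_iff)
    have "(emb (g *v axis 5 1 - axis 5 1) :: real ^ 6) = (2 * real d) *s (map_matrix of_int g *v vstar d - vstar d)"
      using lin_matrix[of "map_matrix of_int g :: real ^ 6 ^ 6"]
      by (simp add: emb_diff emb_matrix_vector[symmetric] ve lin_def vec_eq_iff algebra_simps)
    also have "\<dots> = emb ((2 * int d) *s x)" by (simp add: x emb_smult)
    finally have gx: "g *v axis 5 1 - axis 5 1 = (2 * int d) *s x" by (simp only: emb_eq_iff)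
    have "\<forall>i. int p dvd (v - v $ 5 *s axis 5 1) $ i"
      using div_dvd[OF iso prim div] p_dvd_6_if_p_dvd_div[OF iso prim div pn] pn dvd_trans
      unfolding forall_6 by (simp add: axis_def) blast
    then obtain y where y: "v - v $ 5 *s axis 5 1 = int p *s y" by (rule dvd_vecE)
    have "g *v v - v = g *v (v $ 5 *s axis 5 1 + int p *s y) - (v $ 5 *s axis 5 1 + int p *s y)"
      by (simp add: y[symmetric])
    also have "\<dots> = v $ 5 *s (g *v axis 5 1 - axis 5 1) + int p *s (g *v y - y)"
      using lin_matrix[of g] by (simp add: lin_def vec_eq_iff algebra_simps)
    also have "\<dots> = int p *s ((v $ 5 * 2 * int p) *s x + (g *v y - y))"
      unfolding gx by (simp add: vec_eq_iff d_def power2_eq_square algebra_simps)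
    finally show ?thesis by simp
  qed
  have "coprime 2 (int p)" using odd_p by simp
  then show ?thesis using n two p by (auto intro: divides_mult)
qed

end

lemma adapted_indep:
  assumes "adapted d a e f e' f'" "a > 0" "x *s e + y *s f = 0"
  shows "x = 0 \<and> y = 0"
proof -
  have "bil d (x *s e + y *s f) e' = 0" "bil d (x *s e + y *s f) f' = 0" using assms(3) by simp_all
  then show ?thesis using assms(1,2) by (simp add: adapted_def bil_linear)
qed

section \<open>Coordinates on the half planes\<close>

text \<open>The coordinate is \<tau> f + e, with the vector e of divisor a at \<tau> = 0: as e is
  fixed modulo a, the upper right entry of the Moebius matrix is divisible by a, in agreement with
  \<open>Gamma1\<close>. The sign of f is fixed by requiring the upper half plane.\<close>

definition chart :: "nat \<Rightarrow> (complex ^ 6) set \<Rightarrow> (int ^ 6) set \<Rightarrow> nat \<Rightarrow> int ^ 6 \<Rightarrow> int ^ 6 \<Rightarrow> int ^ 6 \<Rightarrow> int ^ 6 \<Rightarrow> bool" where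
  "chart d \<Omega> E a e f e' f' \<longleftrightarrow> a > 0 \<and> adapted d a e f e' f' \<and> E = plane e f
     \<and> (\<forall>\<tau>. line (\<tau> *s emb f + emb e) \<in> half_plane \<Omega> E \<longleftrightarrow> Im \<tau> > 0)"

text \<open>\<open>half_plane_plane\<close> describes a set of lines; another representative of the
  line multiplies Im (x * cnj y) by the positive square of the absolute value of a scalar.\<close>

lemma half_plane_mem_iff:
  assumes "d > 0" "bil d e e = 0" "bil d e f = 0" "bil d f f = 0"
    and "\<And>x y. x *s e + y *s f = 0 \<Longrightarrow> x = 0 \<and> y = 0" "s\<^sup>2 = 1"
  shows "line (x *s emb e + y *s emb f) \<in> half_plane (cone_part d s) (plane e f) \<longleftrightarrow>
    s * of_int (minor e f) * Im (x * cnj y) > 0"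
proof
  assume "line (x *s emb e + y *s emb f) \<in> half_plane (cone_part d s) (plane e f)"
  then have "line (x *s emb e + y *s emb f) \<in>
      {line (x *s emb e + y *s emb f) | x y. s * of_int (minor e f) * Im (x * cnj y) > 0}"
    by (simp only: half_plane_plane[OF assms])
  then obtain x' y' where l: "line (x *s emb e + y *s emb f) = line (x' *s emb e + y' *s emb f)"
    and pos: "s * of_int (minor e f) * Im (x' * cnj y') > 0"
    by blast
  obtain c where c: "x' *s emb e + y' *s emb f = c *s (x *s emb e + y *s emb f :: complex ^ 6)"
    using line_eqD[OF l] by blast
  then have "(x' - c * x) *s emb e + (y' - c * y) *s emb f = (0 :: complex ^ 6)"
    by (simp add: vec_eq_iff algebra_simps)
  then have "x' = c * x" "y' = c * y"
    using complex_indep minor_nonzero[OF assms(1-5)] by (metis eq_iff_diff_eq_0)+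
  then have "Im (x' * cnj y') = ((Re c)\<^sup>2 + (Im c)\<^sup>2) * Im (x * cnj y)"
    by (simp add: power2_eq_square algebra_simps)
  then have "((Re c)\<^sup>2 + (Im c)\<^sup>2) * (s * of_int (minor e f) * Im (x * cnj y)) > 0"
    using pos by (simp add: mult_ac)
  then show "s * of_int (minor e f) * Im (x * cnj y) > 0"
    by (simp add: zero_less_mult_iff) (metis not_sum_power2_lt_zero)
next
  assume "s * of_int (minor e f) * Im (x * cnj y) > 0"
  then have "line (x *s emb e + y *s emb f) \<in>
      {line (x *s emb e + y *s emb f) | x y. s * of_int (minor e f) * Im (x * cnj y) > 0}"
    by blast
  then show "line (x *s emb e + y *s emb f) \<in> half_plane (cone_part d s) (plane e f)"
    by (simp only: half_plane_plane[OF assms])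
qed

text \<open>If the coordinate parametrises the lower half plane, f and its partner f' are replaced
  by their negatives.\<close>

lemma chart_exists:
  assumes d: "d > 0" and \<Omega>: "\<Omega> \<in> components (period_cone d)"
    and E: "E \<in> isotropic d 2" "has_type d a E" "a > 0"
  shows "\<exists>e f e' f'. chart d \<Omega> E a e f e' f'"
proof -
  obtain s where s: "s\<^sup>2 = 1" "\<Omega> = cone_part d s" using components_period_cone[OF \<Omega>] by blast
  obtain e f e' f' where ad: "adapted d a e f e' f'" and Ep: "E = plane e f"
    using has_type_adapted[OF E] by blast
  have iff: "line (\<tau> *s emb f + emb e) \<in> half_plane \<Omega> (plane e f) \<longleftrightarrow> s * of_int (minor e f) * Im \<tau> < 0"
    if ad: "adapted d a e f e' f'" for e f e' f' \<tau>
  proof -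
    have "bil d e e = 0" "bil d e f = 0" "bil d f f = 0" using ad by (auto simp: adapted_def)
    from half_plane_mem_iff[OF d this adapted_indep[OF ad E(3)] s(1), of 1 \<tau>]
    show ?thesis by (simp add: s(2) add.commute)
  qed
  have nz: "s * of_int (minor e f) \<noteq> 0"
    using minor_nonzero[OF d _ _ _ adapted_indep[OF ad E(3)]] ad s(1) by (auto simp: adapted_def)
  have neg: "k * t < 0 \<longleftrightarrow> t > 0" if "k < 0" for k t :: real
    using that by (auto simp: mult_less_0_iff)
  show ?thesis
  proof (cases "s * of_int (minor e f) < 0")
    case True
    then have "chart d \<Omega> E a e f e' f'"
      unfolding chart_def Ep using ad E(3) by (simp only: iff[OF ad] neg simp_thms)
    then show ?thesis by blast
  next
    case False
    have ad': "adapted d a e (- f) e' (- f')"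
      using ad by (simp add: adapted_def bil_linear)
    have pl: "plane e (- f) = plane e f"
    proof -
      have "x *s e + y *s (- f) = x *s e + (- y) *s f" "x *s e + y *s f = x *s e + (- y) *s (- f)" for x y
        by (simp_all add: vec_eq_iff)
      then show ?thesis unfolding plane_def by blast
    qed
    have "minor e (- f) = - minor e f" by (simp add: minor_def algebra_simps)
    moreover have "s * of_int (minor e f) > 0" using False nz by linarith
    ultimately have "s * of_int (minor e (- f)) < 0" by simp
    then have "chart d \<Omega> (plane e (- f)) a e (- f) e' (- f')"
      unfolding chart_def using ad' E(3) by (simp only: iff[OF ad'] neg simp_thms)
    then have "chart d \<Omega> E a e (- f) e' (- f')" by (simp only: pl Ep)
    then show ?thesis by blast
  qed
qed

lemma chart_image:
  assumes d: "d > 0" and \<Omega>: "\<Omega> \<in> components (period_cone d)" and g: "g \<in> Gamma_L d"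
    and ch: "chart d \<Omega> E a e f e' f'"
  shows "chart d \<Omega> ((*v) g ` E) a (g *v e) (g *v f) (g *v e') (g *v f')"
proof -
  obtain h where h: "h \<in> Gamma_L d" "h ** g = mat 1" "g ** h = mat 1" using Gamma_L_inverse[OF d g] by blast
  have lin: "g *v (x + y) = g *v x + g *v y" "g *v (c *s x) = c *s (g *v x)" for x y c
    using lin_matrix[of g] by (auto simp: lin_def)
  have "prim (g *v e)"
    unfolding prim_def
  proof (intro allI impI)
    fix q assume "\<forall>i. q dvd (g *v e) $ i"
    then obtain x where "g *v e = q *s x" by (rule dvd_vecE)
    then have "h *v (g *v e) = q *s (h *v x)" using lin_matrix[of h] by (simp add: lin_def)
    then have "e = q *s (h *v x)" by (simp add: matrix_vector_mul_assoc h)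
    then have "\<forall>i. q dvd e $ i" by (metis dvd_triv_left vector_smult_component)
    then show "q dvd 1" using ch by (simp add: chart_def adapted_def prim_def)
  qed
  moreover have "has_div d (int a) (g *v e)"
    using equivalent_has_div[OF d, of e "g *v e"] g ch by (auto simp: equivalent_def chart_def adapted_def)
  ultimately have "adapted d a (g *v e) (g *v f) (g *v e') (g *v f')"
    using ch by (simp add: chart_def adapted_def Gamma_L_isometry[OF g])
  moreover have "(*v) g ` E = plane (g *v e) (g *v f)"
  proof -
    have "g *v (x *s e + y *s f) = x *s (g *v e) + y *s (g *v f)" for x y by (simp add: lin)
    moreover have "E = plane e f" using ch by (simp add: chart_def)
    ultimately show ?thesis
      unfolding plane_def by (auto simp: image_iff) metis
  qed
  moreover have "line (\<tau> *s emb (g *v f) + emb (g *v e)) \<in> half_plane \<Omega> ((*v) g ` E) \<longleftrightarrow> Im \<tau> > 0" for \<tau>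
  proof -
    have ac: "act g (line (\<tau> *s emb f + emb e)) = line (\<tau> *s emb (g *v f) + emb (g *v e))"
      by (simp add: act_line gact_linear emb_matrix_vector)
    have "act g (line (\<tau> *s emb f + emb e)) \<in> half_plane \<Omega> ((*v) g ` E) \<longleftrightarrow>
        line (\<tau> *s emb f + emb e) \<in> half_plane \<Omega> E"
      using act_half_plane[OF \<Omega> d g, of _ E] act_half_plane[OF \<Omega> d h(1), of _ "(*v) g ` E"]
      by (metis act_inverse[OF h(2)] image_inverse[OF h(2)])
    moreover have "line (\<tau> *s emb f + emb e) \<in> half_plane \<Omega> E \<longleftrightarrow> Im \<tau> > 0"
      using ch unfolding chart_def by blast
    ultimately show ?thesis by (simp only: ac)
  qed
  ultimately show ?thesis using ch by (simp add: chart_def)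
qed

context
  fixes d :: nat and \<Omega> E a e f e' f'
  assumes d: "d > 0" and ch: "chart d \<Omega> E a e f e' f'"
begin

lemma chart_bil:
  "bil d e e = 0" "bil d e f = 0" "bil d f f = 0" "bil d f f' = 1" "bil d e f' = 0" "bil d e e' = int a" "bil d f e' = 0"
  "bil d f e = 0"
  using ch bil_commute[of d f e] by (auto simp: chart_def adapted_def)

lemma chart_a: "a > 0"
  using ch by (simp add: chart_def)

lemma chart_minor: "minor e f \<noteq> 0"
  using minor_nonzero[OF d chart_bil(1-3) adapted_indep] ch by (auto simp: chart_def)

lemma half_plane_chart: "half_plane \<Omega> E = {line (\<tau> *s emb f + emb e) | \<tau>. Im \<tau> > 0}"
proof (intro antisym subsetI)
  fix P assume P: "P \<in> half_plane \<Omega> E"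
  then obtain z where z: "P = line z" "z \<in> cspan E" "vcnj z \<notin> line z"
    unfolding half_plane_def by blast
  have Ep: "E = plane e f" using ch by (simp add: chart_def)
  from z(2) obtain x y where xy: "z = x *s emb e + y *s emb f"
    unfolding Ep cspan_plane by blast
  have "x \<noteq> 0"
  proof
    assume "x = 0"
    then have "vcnj z = (cnj y / y) *s z" by (simp add: xy vcnj_simps vcnj_emb vec_eq_iff)
    then show False using z(3) by (auto simp: line_eq)
  qed
  then have "z = x *s ((y / x) *s emb f + emb e)" by (simp add: xy vec_eq_iff algebra_simps)
  then have "P = line ((y / x) *s emb f + emb e)" using line_smult[OF \<open>x \<noteq> 0\<close>] z(1) by metis
  then show "P \<in> {line (\<tau> *s emb f + emb e) | \<tau>. Im \<tau> > 0}"
    using P ch unfolding chart_def by blast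
qed (use ch in \<open>auto simp: chart_def\<close>)

lemma chart_line_inj:
  assumes "line (x *s emb f + y *s emb e) = line (\<tau> *s emb f + emb e)"
  shows "y \<noteq> 0 \<and> \<tau> = x / y"
proof -
  obtain c where "x *s emb f + y *s emb e = c *s (\<tau> *s emb f + emb e :: complex ^ 6)"
    using line_eqD[OF assms[symmetric]] by blast
  then have "(y - c) *s emb e + (x - c * \<tau>) *s emb f = (0 :: complex ^ 6)"
    by (simp add: vec_eq_iff algebra_simps)
  then have c: "y = c" "x = c * \<tau>"
    using complex_indep[OF chart_minor] by (metis eq_iff_diff_eq_0)+
  obtain c' where "\<tau> *s emb f + emb e = c' *s (x *s emb f + y *s emb e :: complex ^ 6)"
    using line_eqD[OF assms] by blast
  then have "(1 - c' * y) *s emb e + (\<tau> - c' * x) *s emb f = (0 :: complex ^ 6)"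
    by (simp add: vec_eq_iff algebra_simps)
  then have "1 = c' * y" using complex_indep[OF chart_minor] by (metis eq_iff_diff_eq_0)
  then show ?thesis using c by auto
qed

lemma chart_line:
  "y \<noteq> 0 \<Longrightarrow> line (x *s emb f + y *s emb e) = line ((x / y) *s emb f + emb e)"
proof -
  assume y: "y \<noteq> 0"
  then have "x *s emb f + y *s emb e = y *s ((x / y) *s emb f + emb e :: complex ^ 6)"
    by (simp add: vec_eq_iff algebra_simps)
  then show ?thesis using line_smult[OF y] by metis
qed

lemma chart_nonzero: "\<tau> *s emb f + emb e \<noteq> (0 :: complex ^ 6)"
proof
  assume "\<tau> *s emb f + emb e = (0 :: complex ^ 6)"
  then have "1 *s emb e + \<tau> *s emb f = (0 :: complex ^ 6)" by (simp add: add.commute)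
  then show False using complex_indep(1)[OF chart_minor] by fastforce
qed

lemma open_chart_if_proj_openin:
  assumes "proj_openin (half_plane \<Omega> E) V"
  shows "open {\<tau>. Im \<tau> > 0 \<and> line (\<tau> *s emb f + emb e) \<in> V}"
proof -
  let ?k = "\<lambda>\<tau>. \<tau> *s emb f + emb e :: complex ^ 6"
  obtain T where T: "open T" "{z. z \<noteq> 0 \<and> line z \<in> V} = {z. z \<noteq> 0 \<and> line z \<in> half_plane \<Omega> E} \<inter> T"
    using assms unfolding proj_openin_def openin_open by blast
  have "{\<tau>. Im \<tau> > 0 \<and> line (?k \<tau>) \<in> V} = {\<tau>. Im \<tau> > 0} \<inter> ?k -` T"
  proof (intro antisym subsetI)
    fix \<tau> assume "\<tau> \<in> {\<tau>. Im \<tau> > 0 \<and> line (?k \<tau>) \<in> V}"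
    then have "Im \<tau> > 0" "?k \<tau> \<in> {z. z \<noteq> 0 \<and> line z \<in> V}" using chart_nonzero by auto
    then show "\<tau> \<in> {\<tau>. Im \<tau> > 0} \<inter> ?k -` T" unfolding T(2) by simp
  next
    fix \<tau> assume "\<tau> \<in> {\<tau>. Im \<tau> > 0} \<inter> ?k -` T"
    then have "?k \<tau> \<in> {z. z \<noteq> 0 \<and> line z \<in> V}" "Im \<tau> > 0"
      unfolding T(2) using chart_nonzero ch by (auto simp: chart_def)
    then show "\<tau> \<in> {\<tau>. Im \<tau> > 0 \<and> line (?k \<tau>) \<in> V}" by simp
  qed
  moreover have "continuous_on UNIV ?k"
    unfolding vector_scalar_mult_def by (intro continuous_intros)
  then have "open (?k -` T)" by (simp add: T(1) continuous_on_open_vimage)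
  ultimately show ?thesis by (simp add: open_halfspace_Im_gt open_Int)
qed

lemma proj_openin_if_open_chart:
  assumes V: "V \<subseteq> half_plane \<Omega> E" and op: "open {\<tau>. Im \<tau> > 0 \<and> line (\<tau> *s emb f + emb e) \<in> V}"
  shows "proj_openin (half_plane \<Omega> E) V"
proof -
  let ?A = "{z. z \<noteq> 0 \<and> line z \<in> half_plane \<Omega> E}"
  let ?H = "{\<tau>. Im \<tau> > 0 \<and> line (\<tau> *s emb f + emb e) \<in> V}"
  \<comment> \<open>Pairing \<tau> f + e with e' gives a and with f' gives \<tau>, so r recovers the
    coordinate continuously from any representative.\<close>
  define r where "r z = of_nat a * bil d z (emb f') / bil d z (emb e')" for z :: "complex ^ 6"
  have A: "\<exists>\<tau>. Im \<tau> > 0 \<and> bil d z (emb e') \<noteq> 0 \<and> r z = \<tau> \<and> line z = line (\<tau> *s emb f + emb e)"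
    if z: "z \<in> ?A" for z
  proof -
    obtain \<tau> where \<tau>: "Im \<tau> > 0" "line z = line (\<tau> *s emb f + emb e)"
      using z unfolding half_plane_chart by blast
    obtain c where c: "z = c *s (\<tau> *s emb f + emb e)"
      using line_eqD[OF \<tau>(2)[symmetric]] by blast
    have "c \<noteq> 0" using z c by auto
    have "bil d z (emb e') = c * of_nat a" "bil d z (emb f') = c * \<tau>"
      using chart_bil by (simp_all add: c bil_linear bil_emb)
    then show ?thesis using \<tau> \<open>c \<noteq> 0\<close> chart_a by (auto simp: r_def)
  qed
  have "{z. z \<noteq> 0 \<and> line z \<in> V} = ?A \<inter> r -` ?H"
  proof (intro antisym subsetI)
    fix z assume "z \<in> {z. z \<noteq> 0 \<and> line z \<in> V}"
    then have z: "z \<in> ?A" "line z \<in> V" using V by auto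
    then show "z \<in> ?A \<inter> r -` ?H" using A[OF z(1)] by auto
  next
    fix z assume z: "z \<in> ?A \<inter> r -` ?H"
    then have "line (r z *s emb f + emb e) \<in> V" by simp
    moreover have "line z = line (r z *s emb f + emb e)" using A[of z] z by auto
    ultimately show "z \<in> {z. z \<noteq> 0 \<and> line z \<in> V}" using z by simp
  qed
  moreover have cont: "continuous_on ?A r"
    unfolding r_def
  proof (intro continuous_on_divide ballI)
    show "continuous_on ?A (\<lambda>z. of_nat a * bil d z (emb f') :: complex)"
      "continuous_on ?A (\<lambda>z. bil d z (emb e') :: complex)"
      unfolding bil_def by (intro continuous_intros)+
  qed (use A in blast)
  moreover have "openin (top_of_set ?A) (?A \<inter> r -` ?H)"
    by (rule continuous_openin_preimage_gen[OF cont op])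
  ultimately show ?thesis
    unfolding proj_openin_def using V by simp
qed

text \<open>Coordinates from another basis of E are fractional linear functions of \<tau>; for what
  follows a nonzero determinant is enough.\<close>

lemma chart_change:
  assumes b: "z_basis b {1..2} E"
  shows "\<exists>x1 y1 x2 y2 :: int. x1 * y2 - x2 * y1 \<noteq> 0
    \<and> (\<forall>\<sigma> :: complex. \<sigma> *s emb (b 1) + emb (b 2) = (\<sigma> * of_int x1 + of_int x2) *s emb f + (\<sigma> * of_int y1 + of_int y2) *s emb e)"
proof -
  have E: "E = {x *s b 1 + y *s b 2 | x y. True}" "\<And>x y. x *s b 1 + y *s b 2 = 0 \<Longrightarrow> x = 0 \<and> y = 0"
    using b unfolding z_basis_2_iff by blast+
  have "b 1 \<in> E" "b 2 \<in> E"
    unfolding E(1) by (rule CollectI, rule exI[of _ 1], rule exI[of _ 0], simp)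
      (rule CollectI, rule exI[of _ 0], rule exI[of _ 1], simp)
  then obtain x1 y1 x2 y2 where xy: "b 1 = y1 *s e + x1 *s f" "b 2 = y2 *s e + x2 *s f"
    using ch unfolding chart_def plane_def by blast
  have "x1 * y2 - x2 * y1 \<noteq> 0"
  proof
    assume det: "x1 * y2 - x2 * y1 = 0"
    have "x2 *s b 1 + (- x1) *s b 2 = (- (x1 * y2 - x2 * y1)) *s e"
      unfolding xy by (simp add: vec_eq_iff algebra_simps)
    also have "\<dots> = 0" unfolding det by simp
    finally have z: "x2 *s b 1 + (- x1) *s b 2 = 0" .
    from E(2)[OF z] have "x1 = 0" by simp
    have "y2 *s b 1 + (- y1) *s b 2 = (x1 * y2 - x2 * y1) *s f"
      unfolding xy by (simp add: vec_eq_iff algebra_simps)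
    also have "\<dots> = 0" unfolding det by simp
    finally have z': "y2 *s b 1 + (- y1) *s b 2 = 0" .
    from E(2)[OF z'] have "y1 = 0" by simp
    with \<open>x1 = 0\<close> have "1 *s b 1 + 0 *s b 2 = 0" unfolding xy by simp
    from E(2)[OF this] show False by simp
  qed
  moreover have "\<sigma> *s emb (b 1) + emb (b 2) = (\<sigma> * of_int x1 + of_int x2) *s emb f
      + (\<sigma> * of_int y1 + of_int y2) *s (emb e :: complex ^ 6)" for \<sigma>
    unfolding xy by (simp add: emb_linear vec_eq_iff algebra_simps)
  ultimately show ?thesis by blast
qed

text \<open>A horoball is a union over bases b; for each b the condition bounds a continuous
  function of \<tau> from below.\<close>

lemma open_horoball: "open {\<tau>. Im \<tau> > 0 \<and> line (\<tau> *s emb f + emb e) \<in> horoball \<Omega> l E C}"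
proof -
  let ?S = "\<lambda>b. {\<tau>. Im \<tau> > 0 \<and> (\<exists>s. line (\<tau> *s emb f + emb e) = line (s *s emb (b 1) + emb (b 2)) \<and> \<bar>Im s\<bar> > C)}"
  have "open (?S b)" if b: "z_basis b {1..2} E" for b
  proof -
    obtain x1 y1 x2 y2 :: int where det: "x1 * y2 - x2 * y1 \<noteq> 0" and
      eq: "\<And>\<sigma> :: complex. \<sigma> *s emb (b 1) + emb (b 2) = (\<sigma> * of_int x1 + of_int x2) *s emb f + (\<sigma> * of_int y1 + of_int y2) *s emb e"
      using chart_change[OF b] by blast
    \<comment> \<open>The inverse of the fractional linear map of \<open>chart_change\<close>, so
      that s is the coordinate of the same point in the basis b.\<close>
    define N where "N \<tau> = (of_int y2 * \<tau> - of_int x2) / (of_int x1 - of_int y1 * \<tau>)" for \<tau> :: complex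
    have den: "of_int x1 - of_int y1 * \<tau> \<noteq> 0" if "Im \<tau> > 0" for \<tau> :: complex
    proof
      assume z: "of_int x1 - of_int y1 * \<tau> = 0"
      then have "Im (of_int x1 - of_int y1 * \<tau>) = 0" "Re (of_int x1 - of_int y1 * \<tau>) = 0" by simp_all
      then have "y1 = 0" "x1 = 0" using that by auto
      then show False using det by simp
    qed
    have "line (\<tau> *s emb f + emb e) = line (s *s emb (b 1) + emb (b 2)) \<longleftrightarrow> s = N \<tau>" if \<tau>: "Im \<tau> > 0" for \<tau> s
    proof
      assume "line (\<tau> *s emb f + emb e) = line (s *s emb (b 1) + emb (b 2))"
      then have "s * of_int y1 + of_int y2 \<noteq> 0 \<and> \<tau> = (s * of_int x1 + of_int x2) / (s * of_int y1 + of_int y2)"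
        unfolding eq by (intro chart_line_inj) simp
      then have "\<tau> * (s * of_int y1 + of_int y2) = s * of_int x1 + of_int x2" by simp
      then have "s * (of_int x1 - of_int y1 * \<tau>) = of_int y2 * \<tau> - of_int x2" by (simp add: algebra_simps)
      then show "s = N \<tau>" using den[OF \<tau>] by (simp add: N_def field_simps)
    next
      assume s: "s = N \<tau>"
      define D where "D = of_int x1 - of_int y1 * \<tau>"
      have D: "D \<noteq> 0" using den[OF \<tau>] by (simp add: D_def)
      have sD: "s * D = of_int y2 * \<tau> - of_int x2" using D by (simp add: s N_def D_def)
      have 1: "(s * of_int y1 + of_int y2) * D = of_int (x1 * y2 - x2 * y1)"
      proof -
        have "(s * of_int y1 + of_int y2) * D = (s * D) * of_int y1 + of_int y2 * D" by (simp add: algebra_simps)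
        then show ?thesis unfolding sD by (simp add: D_def algebra_simps)
      qed
      have 2: "(s * of_int x1 + of_int x2) * D = \<tau> * of_int (x1 * y2 - x2 * y1)"
      proof -
        have "(s * of_int x1 + of_int x2) * D = (s * D) * of_int x1 + of_int x2 * D" by (simp add: algebra_simps)
        then show ?thesis unfolding sD by (simp add: D_def algebra_simps)
      qed
      have nz: "s * of_int y1 + of_int y2 \<noteq> 0" using 1 det by (metis mult_zero_left of_int_eq_0_iff)
      have "(s * of_int x1 + of_int x2) * D = (\<tau> * (s * of_int y1 + of_int y2)) * D"
        unfolding 2 by (simp only: mult.assoc 1)
      then have "s * of_int x1 + of_int x2 = \<tau> * (s * of_int y1 + of_int y2)" using D by simp
      then have "(s * of_int x1 + of_int x2) / (s * of_int y1 + of_int y2) = \<tau>" using nz by simp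
      then show "line (\<tau> *s emb f + emb e) = line (s *s emb (b 1) + emb (b 2))"
        unfolding eq chart_line[OF nz] by simp
    qed
    then have "?S b = {\<tau>. Im \<tau> > 0} \<inter> (\<lambda>\<tau>. \<bar>Im (N \<tau>)\<bar>) -` {C<..}" by auto
    moreover have "continuous_on {\<tau>. Im \<tau> > 0} (\<lambda>\<tau>. \<bar>Im (N \<tau>)\<bar>)"
      unfolding N_def using den by (intro continuous_intros) auto
    then have "open ({\<tau>. Im \<tau> > 0} \<inter> (\<lambda>\<tau>. \<bar>Im (N \<tau>)\<bar>) -` {C<..})"
      by (rule continuous_open_preimage) (auto simp: open_halfspace_Im_gt)
    ultimately show ?thesis by simp
  qed
  moreover have "{\<tau>. Im \<tau> > 0 \<and> line (\<tau> *s emb f + emb e) \<in> horoball \<Omega> l E C} =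
      (\<Union>b\<in>{b. z_basis b {1..1} l \<and> z_basis b {1..2} E}. ?S b)"
    using ch by (auto simp: horoball_def chart_def)
  ultimately show ?thesis by auto
qed

end

lemma moebius_Im:
  fixes \<alpha> \<beta> \<gamma> \<delta> :: int
  assumes "of_int \<gamma> * \<tau> + of_int \<alpha> \<noteq> 0"
  shows "Im ((of_int \<delta> * \<tau> + of_int \<beta>) / (of_int \<gamma> * \<tau> + of_int \<alpha>)) * (cmod (of_int \<gamma> * \<tau> + of_int \<alpha>))\<^sup>2
    = of_int (\<alpha> * \<delta> - \<beta> * \<gamma>) * Im \<tau>"
proof -
  define n w where "n = of_int \<delta> * \<tau> + of_int \<beta>" and "w = of_int \<gamma> * \<tau> + of_int \<alpha>"
  have "w \<noteq> 0" using assms by (simp add: w_def)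
  then have "n / w * (w * cnj w) = n * cnj w" by simp
  then have "n / w * of_real ((cmod w)\<^sup>2) = n * cnj w" by (simp only: complex_norm_square)
  then have "Im (n / w * of_real ((cmod w)\<^sup>2)) = Im (n * cnj w)" by (rule arg_cong)
  moreover have "Im (q * of_real r) = Im q * r" for q r by simp
  ultimately have "Im (n / w) * (cmod w)\<^sup>2 = Im (n * cnj w)" by (simp only:)
  also have "\<dots> = of_int (\<alpha> * \<delta> - \<beta> * \<gamma>) * Im \<tau>"
    by (simp add: n_def w_def algebra_simps)
  finally show ?thesis by (simp only: n_def w_def)
qed

lemma moebius_denominator:
  fixes \<alpha> \<gamma> :: int
  assumes "Im \<tau> > 0" "\<alpha> * \<delta> - \<beta> * \<gamma> \<noteq> 0"
  shows "of_int \<gamma> * \<tau> + of_int \<alpha> \<noteq> 0"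
proof
  assume "of_int \<gamma> * \<tau> + of_int \<alpha> = 0"
  then have "Im (of_int \<gamma> * \<tau> + of_int \<alpha>) = 0" "Re (of_int \<gamma> * \<tau> + of_int \<alpha>) = 0" by simp_all
  then have "\<gamma> = 0" "\<alpha> = 0" using assms(1) by auto
  then show False using assms(2) by simp
qed

text \<open>Everything in \<open>nbhd_curve\<close> is built from the form, complex conjugation and
  E, and the group respects all three.\<close>

lemma act_nbhd_curve_subset:
  assumes \<Omega>: "\<Omega> \<in> components (period_cone d)" and g: "g \<in> Gamma_L d"
  shows "act g ` nbhd_curve d \<Omega> E V v C \<subseteq> nbhd_curve d \<Omega> ((*v) g ` E) (act g ` V) (g *v v) C"
proof
  fix Q assume "Q \<in> act g ` nbhd_curve d \<Omega> E V v C"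
  then obtain P where P: "Q = act g P" "P \<in> nbhd_curve d \<Omega> E V v C" by blast
  show "Q \<in> nbhd_curve d \<Omega> ((*v) g ` E) (act g ` V) (g *v v) C"
  proof (cases "P \<in> V")
    case True
    then show ?thesis using P(1) by (simp add: nbhd_curve_def)
  next
    case False
    then obtain z where z: "P = line z" "z \<in> \<Omega>" "proj_to d E z \<in> V"
      "Re (bil d z (vcnj z)) > C * (cmod (bil d z (emb v)))\<^sup>2"
      using P(2) unfolding nbhd_curve_def by blast
    have pr: "proj_to d ((*v) g ` E) (gact g z) = act g (proj_to d E z)"
      unfolding proj_to_def act_cspan[symmetric] using Gamma_L_complex_isometry[OF g] by auto
    have "Re (bil d (gact g z) (vcnj (gact g z))) > C * (cmod (bil d (gact g z) (emb (g *v v))))\<^sup>2"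
      using z(4) by (simp add: vcnj_gact emb_matrix_vector[symmetric] Gamma_L_complex_isometry[OF g])
    then have "line (gact g z) \<in> nbhd_curve d \<Omega> ((*v) g ` E) (act g ` V) (g *v v) C"
      using Gamma_L_preserves_component[OF \<Omega> g z(2)] z(3) pr
      unfolding nbhd_curve_def by blast
    then show ?thesis using P(1) z(1) by (simp only: act_line)
  qed
qed

lemma act_nbhd_curve:
  assumes d: "d > 0" and \<Omega>: "\<Omega> \<in> components (period_cone d)" and g: "g \<in> Gamma_L d"
  shows "act g ` nbhd_curve d \<Omega> E V v C = nbhd_curve d \<Omega> ((*v) g ` E) (act g ` V) (g *v v) C"
proof (rule antisym[OF act_nbhd_curve_subset[OF \<Omega> g]])
  obtain h where h: "h \<in> Gamma_L d" "h ** g = mat 1" "g ** h = mat 1" using Gamma_L_inverse[OF d g] by blast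
  have "act h ` nbhd_curve d \<Omega> ((*v) g ` E) (act g ` V) (g *v v) C
      \<subseteq> nbhd_curve d \<Omega> ((*v) h ` (*v) g ` E) (act h ` act g ` V) (h *v (g *v v)) C"
    by (rule act_nbhd_curve_subset[OF \<Omega> h(1)])
  also have "(*v) h ` (*v) g ` E = E" by (rule image_inverse[OF h(2)])
  also have "act h ` act g ` V = V" by (simp only: image_image[of "act h"] act_inverse[OF h(2)] image_ident)
  also have "h *v (g *v v) = v" by (simp add: matrix_vector_mul_assoc h(2))
  finally have "act g ` act h ` nbhd_curve d \<Omega> ((*v) g ` E) (act g ` V) (g *v v) C
      \<subseteq> act g ` nbhd_curve d \<Omega> E V v C" by (rule image_mono)
  then show "nbhd_curve d \<Omega> ((*v) g ` E) (act g ` V) (g *v v) C \<subseteq> act g ` nbhd_curve d \<Omega> E V v C"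
    by (simp only: image_image[of "act g"] act_inverse[OF h(3)] image_ident)
qed

lemma act_proj_openin_half_plane:
  assumes d: "d > 0" and \<Omega>: "\<Omega> \<in> components (period_cone d)" and g: "g \<in> Gamma_L d"
    and ch: "chart d \<Omega> E a e f e' f'" and V: "proj_openin (half_plane \<Omega> E) V"
  shows "proj_openin (half_plane \<Omega> ((*v) g ` E)) (act g ` V)"
proof (rule proj_openin_if_open_chart[OF d chart_image[OF d \<Omega> g ch]])
  obtain h where h: "h \<in> Gamma_L d" "h ** g = mat 1" "g ** h = mat 1" using Gamma_L_inverse[OF d g] by blast
  show "act g ` V \<subseteq> half_plane \<Omega> ((*v) g ` E)"
    using V act_half_plane[OF \<Omega> d g] unfolding proj_openin_def by blast
  have ac: "line (\<tau> *s emb (g *v f) + emb (g *v e)) = act g (line (\<tau> *s emb f + emb e))" for \<tau>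
    by (simp add: act_line gact_linear emb_matrix_vector)
  have "act g P \<in> act g ` V \<longleftrightarrow> P \<in> V" for P
  proof
    assume "act g P \<in> act g ` V"
    then obtain Q where Q: "Q \<in> V" "act g P = act g Q" by blast
    then have "act h (act g P) = act h (act g Q)" by (simp only:)
    then have "P = Q" by (simp only: act_inverse[OF h(2)])
    then show "P \<in> V" using Q(1) by (simp only:)
  qed (rule imageI)
  then show "open {\<tau>. Im \<tau> > 0 \<and> line (\<tau> *s emb (g *v f) + emb (g *v e)) \<in> act g ` V}"
    using open_chart_if_proj_openin[OF d ch V] by (simp only: ac)
qed

section \<open>The Satake topology and its quotient\<close>

lemma z_basis_1: "prim v \<Longrightarrow> b 1 = v \<Longrightarrow> z_basis b {1..1} (range (\<lambda>n. n *s v))"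
proof -
  assume v: "prim v" "b 1 = v"
  have sum: "(\<Sum>i\<in>{1..1}. c i *s b i) = c 1 *s v" for c using v(2) by simp
  have "range (\<lambda>c :: nat \<Rightarrow> int. c 1 *s v) = range (\<lambda>n. n *s v)"
    by (auto intro: range_eqI[of _ _ "\<lambda>_. _"])
  moreover have "c = 0" if "c *s v = 0" for c
    using that prim_nonzero[OF v(1)] by (auto simp: vec_eq_iff)
  ultimately show ?thesis unfolding z_basis_def sum by auto
qed

lemma range_isotropic_iff: "range (\<lambda>n. n *s v) \<in> isotropic d 1 \<longleftrightarrow> prim v \<and> bil d v v = 0"
proof
  assume "range (\<lambda>n. n *s v) \<in> isotropic d 1"
  then obtain w where w: "range (\<lambda>n. n *s v) = range (\<lambda>n. n *s w)" "prim w" "bil d w w = 0"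
    unfolding isotropic_1_iff by blast
  have "w = 1 *s w" "v = 1 *s v" by simp_all
  then have "w \<in> range (\<lambda>n. n *s v)" "v \<in> range (\<lambda>n. n *s w)" unfolding w(1)
    by (metis rangeI, metis rangeI w(1))
  then obtain j k where jk: "w = j *s v" "v = k *s w" by blast
  have "prim v"
    unfolding prim_def
  proof (intro allI impI)
    fix q assume "\<forall>i. q dvd v $ i"
    then have "\<forall>i. q dvd w $ i" using jk(1) by simp
    then show "q dvd 1" using w(2) by (simp add: prim_def)
  qed
  moreover have "bil d v v = 0" unfolding jk(2) by (simp add: bil_linear w(3))
  ultimately show "prim v \<and> bil d v v = 0" by blast
qed (use isotropic_1_iff in blast)

lemma image_range: "(*v) g ` range (\<lambda>n. n *s v) = range (\<lambda>n. n *s (g *v v))" for g :: "int ^ 6 ^ 6"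
  using lin_matrix[of g] by (auto simp: lin_def image_iff)

text \<open>Proportionality over the complex numbers is cleared with a nonzero coordinate and
  becomes an integral relation, to which primitivity applies.\<close>

lemma cspan_inj:
  assumes "l \<in> isotropic d 1" "l' \<in> isotropic d 1" "cspan l = cspan l'"
  shows "l = l'"
proof -
  have sub: "range (\<lambda>n. n *s v) \<subseteq> range (\<lambda>n. n *s w)"
    if v: "prim v" and w: "prim w" and eq: "line (emb v) = line (emb w)" for v w
  proof -
    obtain c where c: "emb v = c *s (emb w :: complex ^ 6)" using line_eqD[OF eq[symmetric]] by blast
    obtain i where i: "w $ i \<noteq> 0" using prim_nonzero[OF w] by (auto simp: vec_eq_iff)
    have "(emb (w $ i *s v) :: complex ^ 6) = emb (v $ i *s w)"
    proof -
      have "\<And>j. of_int (v $ j) = c * of_int (w $ j)" using c by (simp add: vec_eq_iff emb_def)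
      then show ?thesis by (simp add: emb_def vec_eq_iff)
    qed
    then have "w $ i *s v = v $ i *s w" by (simp only: emb_eq_iff)
    then obtain k where "v = k *s w" using prim_saturated[OF w i] by blast
    then show ?thesis by (auto simp: vector_smult_assoc)
  qed
  obtain v w where "l = range (\<lambda>n. n *s v)" "prim v" "l' = range (\<lambda>n. n *s w)" "prim w"
    using assms(1,2) isotropic_1_iff by metis
  then show ?thesis using sub[of v w] sub[of w v] assms(3) by (auto simp: cspan_generator)
qed

context paramodular
begin

context
  fixes \<Omega> :: "(complex ^ 6) set"
  assumes \<Omega>: "\<Omega> \<in> components (period_cone d)"
begin

lemma chart_ex:
  assumes "E \<in> isotropic d 2"
  shows "\<exists>a e f e' f'. chart d \<Omega> E a e f e' f'"
proof -
  obtain a where a: "a \<in> {1, 2, p, 2 * p}" "has_type d a E" using has_type_exists[OF assms] by blast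
  then show ?thesis using chart_exists[OF d_pos \<Omega> assms a(2)] p_gt_3 by auto
qed

text \<open>A non-real point and its conjugate span the complexification of E, so a common point
  places E inside the complexification of E', and saturation returns to the lattice.\<close>

lemma half_plane_subset:
  assumes E: "E \<in> isotropic d 2" "E' \<in> isotropic d 2" and P: "P \<in> half_plane \<Omega> E" "P \<in> half_plane \<Omega> E'"
  shows "E \<subseteq> E'"
proof
  obtain a e f e1 f1 where ch: "chart d \<Omega> E a e f e1 f1" using chart_ex[OF E(1)] by blast
  obtain a' e' f' e2 f2 where ch': "chart d \<Omega> E' a' e' f' e2 f2" using chart_ex[OF E(2)] by blast
  have Ep: "E = plane e f" and Ep': "E' = plane e' f'" using ch ch' by (simp_all add: chart_def)
  have sub: "c *s x + c' *s y \<in> cspan E'" if "x \<in> cspan E'" "y \<in> cspan E'" for c c' x y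
    using that unfolding cspan_def by (intro vec.span_add vec.span_scale)
  have conj: "vcnj x \<in> cspan E'" if x: "x \<in> cspan E'" for x
  proof -
    obtain s t where "x = s *s emb e' + t *s emb f'" using x unfolding Ep' cspan_plane by blast
    then have "vcnj x = cnj s *s emb e' + cnj t *s emb f'" by (simp add: vcnj_simps vcnj_emb)
    then show ?thesis unfolding Ep' cspan_plane by blast
  qed
  obtain \<tau> where \<tau>: "Im \<tau> > 0" "P = line (\<tau> *s emb f + emb e)"
    using P(1) unfolding half_plane_chart[OF d_pos ch] by blast
  let ?k = "\<tau> *s emb f + emb e :: complex ^ 6"
  obtain z where z: "P = line z" "z \<in> cspan E'" using P(2) unfolding half_plane_def by blast
  obtain c where "?k = c *s z" using line_eqD z(1) \<tau>(2) by metis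
  then have k: "?k \<in> cspan E'" using sub[OF z(2) z(2), of c 0] by simp
  have vk: "vcnj ?k = cnj \<tau> *s emb f + emb e" by (simp add: vcnj_simps vcnj_emb)
  have tc: "\<tau> - cnj \<tau> \<noteq> 0" using \<tau>(1) by (auto simp: complex_eq_iff)
  \<comment> \<open>The difference of \<tau> f + e and its conjugate is a nonzero multiple of f, and
    \<kappa> normalises it.\<close>
  define \<kappa> where "\<kappa> = 1 / (\<tau> - cnj \<tau>)"
  have "\<kappa> *s ?k + (- \<kappa>) *s vcnj ?k = (\<kappa> * (\<tau> - cnj \<tau>)) *s emb f"
    unfolding vk by (simp add: vec_eq_iff algebra_simps)
  then have "emb f = \<kappa> *s ?k + (- \<kappa>) *s vcnj ?k" using tc by (simp add: \<kappa>_def)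
  then have f: "emb f \<in> cspan E'" using sub[OF k conj[OF k]] by metis
  have "emb e = 1 *s ?k + (- \<tau>) *s emb f" by (simp add: vec_eq_iff)
  then have e: "emb e \<in> cspan E'" using sub[OF k f] by metis
  fix v assume "v \<in> E"
  then obtain m n where "v = m *s e + n *s f" unfolding Ep plane_def by blast
  then have "emb v \<in> cspan E'" using sub[OF e f] by (simp add: emb_linear)
  then obtain x y where xy: "emb v = x *s emb e' + y *s (emb f' :: complex ^ 6)"
    unfolding Ep' cspan_plane by blast
  have 1: "bil d (emb v) (emb f2) = y" "bil d (emb v) (emb e2) = x * of_nat a'"
    unfolding xy bil_linear bil_emb using chart_bil[OF d_pos ch'] by simp_all
  \<comment> \<open>The complex coordinates of v are recovered by pairing with the partners e2 and
    f2, which makes them integral after multiplication by a'.\<close>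
  have "(emb (int a' *s v) :: complex ^ 6) = emb (bil d v e2 *s e' + (int a' * bil d v f2) *s f')"
    unfolding emb_linear xy
    using 1 by (simp add: bil_emb vec_eq_iff algebra_simps)
  then have "int a' *s v \<in> E'" unfolding emb_eq_iff Ep' using plane_memberI by metis
  moreover have "int a' \<noteq> 0" using chart_a[OF d_pos ch'] by simp
  ultimately show "v \<in> E'" using E(2) unfolding isotropic_def by blast
qed

lemma half_plane_inj:
  "E \<in> isotropic d 2 \<Longrightarrow> E' \<in> isotropic d 2 \<Longrightarrow> P \<in> half_plane \<Omega> E \<Longrightarrow> P \<in> half_plane \<Omega> E' \<Longrightarrow> E = E'"
  using half_plane_subset by (metis subset_antisym)

lemma line_isotropic_not_in_domain:
  assumes "bil d z (vcnj z) = 0"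
  shows "line z \<notin> line ` \<Omega>"
proof
  assume "line z \<in> line ` \<Omega>"
  then obtain w where w: "w \<in> \<Omega>" "line z = line w" by blast
  obtain c where "w = c *s z" using line_eqD[OF w(2)] by blast
  then have "bil d w (vcnj w) = 0" using assms by (simp add: vcnj_simps bil_linear)
  moreover have "w \<in> period_cone d" using w(1) in_components_subset[OF \<Omega>] by blast
  ultimately show False by (simp add: period_cone_def)
qed

lemma half_plane_not_in_domain:
  assumes "E \<in> isotropic d 2" "P \<in> half_plane \<Omega> E"
  shows "P \<notin> line ` \<Omega>"
proof -
  obtain a e f e' f' where ch: "chart d \<Omega> E a e f e' f'" using chart_ex[OF assms(1)] by blast
  obtain \<tau> where "P = line (\<tau> *s emb f + emb e)"
    using assms(2) unfolding half_plane_chart[OF d_pos ch] by blast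
  moreover have "bil d (\<tau> *s emb f + emb e) (vcnj (\<tau> *s emb f + emb e)) = (0 :: complex)"
    using chart_bil[OF d_pos ch] by (simp add: vcnj_simps vcnj_emb bil_linear bil_emb)
  ultimately show ?thesis using line_isotropic_not_in_domain by metis
qed

lemma cspan_not_in_domain:
  assumes "l \<in> isotropic d 1"
  shows "cspan l \<notin> line ` \<Omega>"
proof -
  obtain v where v: "l = range (\<lambda>n. n *s v)" "bil d v v = 0" using assms isotropic_1_iff by blast
  show ?thesis unfolding v(1) cspan_generator
    by (rule line_isotropic_not_in_domain) (simp add: vcnj_emb bil_emb v(2))
qed

lemma cspan_not_in_half_plane:
  assumes "l \<in> isotropic d 1"
  shows "cspan l \<notin> half_plane \<Omega> E"
proof
  obtain v where v: "l = range (\<lambda>n. n *s v)" using assms isotropic_1_iff by blast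
  assume "cspan l \<in> half_plane \<Omega> E"
  then obtain z where z: "line (emb v) = line z" "vcnj z \<notin> line z"
    unfolding half_plane_def v cspan_generator by blast
  obtain c where "z = c *s emb v" using line_eqD[OF z(1)] by blast
  then have "vcnj z = cnj c *s emb v" by (simp add: vcnj_simps vcnj_emb)
  then have "vcnj z \<in> line (emb v)" unfolding line_eq by blast
  then show False using z by simp
qed

abbreviation "satake \<equiv> satake_topology d \<Omega>"

text \<open>On the half plane of E a basic open set leaves the given open set V, a horoball, or
  nothing; the last two cases use that half planes of different E are disjoint.\<close>

lemma open_trace:
  assumes E: "E \<in> isotropic d 2" and ch: "chart d \<Omega> E a e f e' f'" and U: "openin satake U"
  shows "open {\<tau>. Im \<tau> > 0 \<and> line (\<tau> *s emb f + emb e) \<in> U}"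
proof -
  let ?\<psi> = "\<lambda>\<tau>. line (\<tau> *s emb f + emb e)"
  have half: "?\<psi> \<tau> \<in> half_plane \<Omega> E" if "Im \<tau> > 0" for \<tau>
    using ch that unfolding chart_def by blast
  have "generate_topology_on ({U. proj_openin (line ` \<Omega>) U} \<union>
      {nbhd_curve d \<Omega> E V v C | E V v C.
         E \<in> isotropic d 2 \<and> proj_openin (half_plane \<Omega> E) V \<and> v \<in> E \<and> v \<noteq> 0 \<and> C > 0} \<union>
      {nbhd_point d \<Omega> l C | l C. l \<in> isotropic d 1 \<and> C > 0}) U" (is "generate_topology_on ?B U")
    using U unfolding satake_topology_def openin_topology_generated_by_iff .
  then show ?thesis
  proof (induction U rule: generate_topology_on.induct)
    case (Int A B)
    have "{\<tau>. Im \<tau> > 0 \<and> ?\<psi> \<tau> \<in> A \<inter> B} = {\<tau>. Im \<tau> > 0 \<and> ?\<psi> \<tau> \<in> A} \<inter> {\<tau>. Im \<tau> > 0 \<and> ?\<psi> \<tau> \<in> B}" by auto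
    then show ?case using Int by (simp add: open_Int)
  next
    case (UN K)
    have "{\<tau>. Im \<tau> > 0 \<and> ?\<psi> \<tau> \<in> \<Union>K} = (\<Union>k\<in>K. {\<tau>. Im \<tau> > 0 \<and> ?\<psi> \<tau> \<in> k})" by auto
    then show ?case using UN by (simp add: open_UN)
  next
    case (Basis U)
    consider (a) "proj_openin (line ` \<Omega>) U"
      | (b) E' V v C where "U = nbhd_curve d \<Omega> E' V v C" "E' \<in> isotropic d 2" "proj_openin (half_plane \<Omega> E') V"
      | (c) l C where "U = nbhd_point d \<Omega> l C" "l \<in> isotropic d 1"
      using Basis by blast
    then show ?case
    proof cases
      case a
      then have "{\<tau>. Im \<tau> > 0 \<and> ?\<psi> \<tau> \<in> U} = {}"
        using half half_plane_not_in_domain[OF E] unfolding proj_openin_def by blast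
      then show ?thesis by (simp only: open_empty)
    next
      case b
      show ?thesis
      proof (cases "E' = E")
        case True
        have "{\<tau>. Im \<tau> > 0 \<and> ?\<psi> \<tau> \<in> U} = {\<tau>. Im \<tau> > 0 \<and> ?\<psi> \<tau> \<in> V}"
          using half half_plane_not_in_domain[OF E] unfolding b(1) nbhd_curve_def by blast
        then show ?thesis using open_chart_if_proj_openin[OF d_pos ch] b(3) True by simp
      next
        case False
        then have "{\<tau>. Im \<tau> > 0 \<and> ?\<psi> \<tau> \<in> U} = {}"
          using half half_plane_not_in_domain[OF E] half_plane_inj[OF E b(2)] b(3)
          unfolding b(1) nbhd_curve_def proj_openin_def by blast
        then show ?thesis by (simp only: open_empty)
      qed
    next
      case c
      have *: "?\<psi> \<tau> \<in> U \<longleftrightarrow> l \<subseteq> E \<and> ?\<psi> \<tau> \<in> horoball \<Omega> l E C" if \<tau>: "Im \<tau> > 0" for \<tau>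
      proof
        assume "?\<psi> \<tau> \<in> U"
        moreover have "?\<psi> \<tau> \<noteq> cspan l" using half[OF \<tau>] cspan_not_in_half_plane[OF c(2)] by metis
        moreover have "?\<psi> \<tau> \<notin> line ` \<Omega>" using half[OF \<tau>] half_plane_not_in_domain[OF E] by blast
        ultimately obtain E' where E': "E' \<in> isotropic d 2" "l \<subseteq> E'" "?\<psi> \<tau> \<in> horoball \<Omega> l E' C"
          unfolding c(1) nbhd_point_def by blast
        then have "E = E'" using half_plane_inj[OF E E'(1) half[OF \<tau>]] by (simp add: horoball_def)
        then show "l \<subseteq> E \<and> ?\<psi> \<tau> \<in> horoball \<Omega> l E C" using E' by simp
      next
        assume "l \<subseteq> E \<and> ?\<psi> \<tau> \<in> horoball \<Omega> l E C"
        then show "?\<psi> \<tau> \<in> U" using E unfolding c(1) nbhd_point_def by blast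
      qed
      show ?thesis
      proof (cases "l \<subseteq> E")
        case True
        then have "{\<tau>. Im \<tau> > 0 \<and> ?\<psi> \<tau> \<in> U} = {\<tau>. Im \<tau> > 0 \<and> ?\<psi> \<tau> \<in> horoball \<Omega> l E C}" using * by blast
        then show ?thesis using open_horoball[OF d_pos ch] by simp
      next
        case False
        then have "{\<tau>. Im \<tau> > 0 \<and> ?\<psi> \<tau> \<in> U} = {}" using * by blast
        then show ?thesis by (simp only: open_empty)
      qed
    qed
  qed simp
qed

abbreviation "bb \<equiv> baily_borel d \<Omega> (Gamma_L d)"
abbreviation "orb \<equiv> bb_orbit (Gamma_L d)"

lemma orb_act: "g \<in> Gamma_L d \<Longrightarrow> orb (act g P) = orb P"
  using bb_orbit_eq_iff[THEN iffD2, OF d_pos, of P "act g P"] by blast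

lemma orb_eqD: "orb P = orb Q \<Longrightarrow> \<exists>g\<in>Gamma_L d. act g P = Q"
  by (rule bb_orbit_eq_iff[THEN iffD1, OF d_pos])

lemma openin_nbhd_curve:
  assumes "E \<in> isotropic d 2" "proj_openin (half_plane \<Omega> E) V" "v \<in> E" "v \<noteq> 0" "C > 0"
  shows "openin satake (nbhd_curve d \<Omega> E V v C)"
  unfolding satake_topology_def by (rule topology_generated_by_Basis) (use assms in blast)

lemma openin_nbhd_point:
  assumes "l \<in> isotropic d 1" "C > 0"
  shows "openin satake (nbhd_point d \<Omega> l C)"
  unfolding satake_topology_def by (rule topology_generated_by_Basis) (use assms in blast)

lemma topspace_satake:
  "topspace satake = line ` \<Omega> \<union> (\<Union>E\<in>isotropic d 2. half_plane \<Omega> E) \<union> cspan ` isotropic d 1"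
proof (intro antisym subsetI)
  fix P assume "P \<in> topspace satake"
  then obtain U where U: "P \<in> U" "U \<in> {U. proj_openin (line ` \<Omega>) U} \<union>
      {nbhd_curve d \<Omega> E V v C | E V v C.
         E \<in> isotropic d 2 \<and> proj_openin (half_plane \<Omega> E) V \<and> v \<in> E \<and> v \<noteq> 0 \<and> C > 0} \<union>
      {nbhd_point d \<Omega> l C | l C. l \<in> isotropic d 1 \<and> C > 0}"
    unfolding satake_topology_def topology_generated_by_topspace by blast
  then consider "U \<subseteq> line ` \<Omega>"
    | E V v C where "U = nbhd_curve d \<Omega> E V v C" "E \<in> isotropic d 2" "V \<subseteq> half_plane \<Omega> E"
    | l C where "U = nbhd_point d \<Omega> l C" "l \<in> isotropic d 1"
    unfolding proj_openin_def by blast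
  then show "P \<in> line ` \<Omega> \<union> (\<Union>E\<in>isotropic d 2. half_plane \<Omega> E) \<union> cspan ` isotropic d 1"
  proof cases
    case 1
    then show ?thesis using U(1) by blast
  next
    case 2
    then show ?thesis using U(1) unfolding nbhd_curve_def by blast
  next
    case 3
    then show ?thesis using U(1) unfolding nbhd_point_def horoball_def by blast
  qed
next
  fix P assume "P \<in> line ` \<Omega> \<union> (\<Union>E\<in>isotropic d 2. half_plane \<Omega> E) \<union> cspan ` isotropic d 1"
  then consider "P \<in> line ` \<Omega>" | E where "E \<in> isotropic d 2" "P \<in> half_plane \<Omega> E"
    | l where "l \<in> isotropic d 1" "P = cspan l" by blast
  then show "P \<in> topspace satake"
  proof cases
    case 1
    have "proj_openin (line ` \<Omega>) (line ` \<Omega>)" by (simp add: proj_openin_def)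
    then show ?thesis using 1
      unfolding satake_topology_def topology_generated_by_topspace by blast
  next
    case 2
    obtain a e f e' f' where ch: "chart d \<Omega> E a e f e' f'" using chart_ex[OF 2(1)] by blast
    have "proj_openin (half_plane \<Omega> E) (half_plane \<Omega> E)" by (simp add: proj_openin_def)
    moreover have "f \<noteq> 0" "f \<in> E"
      using ch plane_memberI[of 0 e 1 f] by (auto simp: chart_def adapted_def)
    ultimately have "openin satake (nbhd_curve d \<Omega> E (half_plane \<Omega> E) f 1)"
      using 2(1) by (intro openin_nbhd_curve) auto
    then have "nbhd_curve d \<Omega> E (half_plane \<Omega> E) f 1 \<subseteq> topspace satake" by (rule openin_subset)
    then show ?thesis using 2(2) unfolding nbhd_curve_def by blast
  next
    case 3
    have "openin satake (nbhd_point d \<Omega> l 1)"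
      using 3(1) by (rule openin_nbhd_point) simp
    then have "nbhd_point d \<Omega> l 1 \<subseteq> topspace satake" by (rule openin_subset)
    then show ?thesis using 3(2) unfolding nbhd_point_def by blast
  qed
qed

lemma topspace_bb: "topspace bb = orb ` topspace satake"
  by (simp add: baily_borel_def)

lemma openin_bb: "openin bb U \<longleftrightarrow> U \<subseteq> orb ` topspace satake \<and> openin satake {x \<in> topspace satake. orb x \<in> U}"
  by (simp add: baily_borel_def openin_quotient_topology)

text \<open>A family of open sets permuted by the group has a saturated union, so its image in the
  quotient is open and membership can be tested upstairs.\<close>

lemma openin_bb_saturated:
  assumes op: "\<And>g. g \<in> Gamma_L d \<Longrightarrow> openin satake (N g)"
    and inv: "\<And>g h P. g \<in> Gamma_L d \<Longrightarrow> h \<in> Gamma_L d \<Longrightarrow> P \<in> N g \<Longrightarrow> act h P \<in> N (h ** g)"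
  shows "openin bb (orb ` (\<Union>g\<in>Gamma_L d. N g))"
    and "\<And>P. orb P \<in> orb ` (\<Union>g\<in>Gamma_L d. N g) \<longleftrightarrow> P \<in> (\<Union>g\<in>Gamma_L d. N g)"
proof -
  let ?U = "\<Union>g\<in>Gamma_L d. N g"
  show mem: "orb P \<in> orb ` ?U \<longleftrightarrow> P \<in> ?U" for P
  proof
    assume "orb P \<in> orb ` ?U"
    then obtain Q g where Q: "g \<in> Gamma_L d" "Q \<in> N g" "orb Q = orb P" by auto
    obtain h where h: "h \<in> Gamma_L d" "act h Q = P" using orb_eqD[OF Q(3)] by blast
    then have "P \<in> N (h ** g)" using inv[OF Q(1) h(1) Q(2)] by blast
    then show "P \<in> ?U" using Gamma_L_mult[OF h(1) Q(1)] by blast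
  qed blast
  have sub: "?U \<subseteq> topspace satake" using op openin_subset by blast
  have "{x \<in> topspace satake. orb x \<in> orb ` ?U} = ?U" using mem sub by blast
  moreover have "openin satake ?U" using op by blast
  ultimately show "openin bb (orb ` ?U)" unfolding openin_bb using sub by (simp add: image_mono)
qed

section \<open>A boundary curve as a quotient of the upper half plane\<close>

context
  fixes E :: "(int ^ 6) set" and a :: nat and e f e' f' :: "int ^ 6"
  assumes E: "E \<in> isotropic d 2" and ch: "chart d \<Omega> E a e f e' f'"
begin

abbreviation \<psi> :: "complex \<Rightarrow> (complex ^ 6) set" where "\<psi> \<tau> \<equiv> line (\<tau> *s emb f + emb e)"

lemma curve_eq: "bb_curve \<Omega> (Gamma_L d) E = {orb (\<psi> \<tau>) | \<tau>. Im \<tau> > 0}"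
  unfolding bb_curve_def half_plane_chart[OF d_pos ch] by auto

lemma curve_subset_topspace: "bb_curve \<Omega> (Gamma_L d) E \<subseteq> topspace bb"
  unfolding bb_curve_def topspace_bb topspace_satake using E by blast

text \<open>The subspace topology of the quotient could be coarser than the quotient topology of the
  half plane. Equality holds because an invariant open set of the half plane extends to an invariant
  Satake open set that meets the half plane in nothing else.\<close>

lemma openin_curve_iff:
  "openin (subtopology bb (bb_curve \<Omega> (Gamma_L d) E)) W \<longleftrightarrow>
     W \<subseteq> bb_curve \<Omega> (Gamma_L d) E \<and> open {\<tau>. Im \<tau> > 0 \<and> orb (\<psi> \<tau>) \<in> W}"
proof
  assume "openin (subtopology bb (bb_curve \<Omega> (Gamma_L d) E)) W"
  then obtain U where U: "openin bb U" "W = U \<inter> bb_curve \<Omega> (Gamma_L d) E"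
    unfolding openin_subtopology by blast
  have "open {\<tau>. Im \<tau> > 0 \<and> \<psi> \<tau> \<in> {x \<in> topspace satake. orb x \<in> U}}"
    using U(1) unfolding openin_bb by (intro open_trace[OF E ch]) blast
  moreover have "{\<tau>. Im \<tau> > 0 \<and> \<psi> \<tau> \<in> {x \<in> topspace satake. orb x \<in> U}} = {\<tau>. Im \<tau> > 0 \<and> orb (\<psi> \<tau>) \<in> W}"
    unfolding U(2) curve_eq topspace_satake using half_plane_chart[OF d_pos ch] E by blast
  ultimately show "W \<subseteq> bb_curve \<Omega> (Gamma_L d) E \<and> open {\<tau>. Im \<tau> > 0 \<and> orb (\<psi> \<tau>) \<in> W}"
    using U(2) by simp
next
  assume W: "W \<subseteq> bb_curve \<Omega> (Gamma_L d) E \<and> open {\<tau>. Im \<tau> > 0 \<and> orb (\<psi> \<tau>) \<in> W}"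
  define V where "V = {P \<in> half_plane \<Omega> E. orb P \<in> W}"
  have "{\<tau>. Im \<tau> > 0 \<and> \<psi> \<tau> \<in> V} = {\<tau>. Im \<tau> > 0 \<and> orb (\<psi> \<tau>) \<in> W}"
    unfolding V_def half_plane_chart[OF d_pos ch] by blast
  then have V: "proj_openin (half_plane \<Omega> E) V"
    using W by (intro proj_openin_if_open_chart[OF d_pos ch]) (auto simp: V_def)
  have f: "f \<noteq> 0" "f \<in> E"
    using ch plane_memberI[of 0 e 1 f] by (auto simp: chart_def adapted_def)
  \<comment> \<open>The thickenings of V are translated by the whole group. Moving the auxiliary
    vector f along with E keeps the family equivariant.\<close>
  define N where "N g = nbhd_curve d \<Omega> ((*v) g ` E) (act g ` V) (g *v f) 1" for g
  have N_act: "act g ` nbhd_curve d \<Omega> E V f 1 = N g" if "g \<in> Gamma_L d" for g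
    unfolding N_def by (rule act_nbhd_curve[OF d_pos \<Omega> that])
  have op: "openin satake (N g)" if g: "g \<in> Gamma_L d" for g
  proof -
    obtain h where h: "h ** g = mat 1" using Gamma_L_inverse[OF d_pos g] by blast
    have "g *v f \<noteq> 0"
    proof
      assume "g *v f = 0"
      then have "h *v (g *v f) = 0" by simp
      then show False using f(1) by (simp add: matrix_vector_mul_assoc h)
    qed
    moreover have "(*v) g ` E \<in> isotropic d 2" by (rule isotropic_image[OF d_pos g E])
    moreover have "proj_openin (half_plane \<Omega> ((*v) g ` E)) (act g ` V)"
      by (rule act_proj_openin_half_plane[OF d_pos \<Omega> g ch V])
    moreover have "g *v f \<in> (*v) g ` E" using f(2) by blast
    ultimately show ?thesis
      unfolding N_def by (intro openin_nbhd_curve) auto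
  qed
  have inv: "act h P \<in> N (h ** g)" if g: "g \<in> Gamma_L d" and h: "h \<in> Gamma_L d" and P: "P \<in> N g" for g h P
  proof -
    obtain Q where Q: "Q \<in> nbhd_curve d \<Omega> E V f 1" "P = act g Q" using P N_act[OF g] by blast
    have "act h P = act (h ** g) Q" by (simp only: Q(2) act_mult)
    then show ?thesis using N_act[OF Gamma_L_mult[OF h g]] Q(1) by blast
  qed
  let ?U = "\<Union>g\<in>Gamma_L d. N g"
  note sat = openin_bb_saturated[of N, OF op inv]
  \<comment> \<open>A boundary point of a translated thickening lies in the translate of V, hence in
    an orbit that already belongs to W.\<close>
  have "orb P \<in> W" if P: "P \<in> half_plane \<Omega> E" "P \<in> ?U" for P
  proof -
    obtain g where g: "g \<in> Gamma_L d" "P \<in> N g" using P(2) by blast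
    have "P \<notin> line ` \<Omega>" by (rule half_plane_not_in_domain[OF E P(1)])
    then have "P \<in> act g ` V" using g(2) unfolding N_def nbhd_curve_def by blast
    then obtain Q where Q: "Q \<in> V" "P = act g Q" by blast
    then have "orb Q = orb P" using orb_act[OF g(1), of Q] by simp
    then show ?thesis using Q(1) by (simp add: V_def)
  qed
  moreover have "P \<in> ?U" if "P \<in> half_plane \<Omega> E" "orb P \<in> W" for P
  proof -
    have "P \<in> nbhd_curve d \<Omega> E V f 1" using that by (simp add: nbhd_curve_def V_def)
    moreover have "N (mat 1) = nbhd_curve d \<Omega> E V f 1"
      using N_act[OF Gamma_L_one] by (simp add: of_int_matrix_one)
    ultimately show ?thesis using Gamma_L_one[of d] by blast
  qed
  ultimately have mem: "P \<in> ?U \<longleftrightarrow> orb P \<in> W" if "P \<in> half_plane \<Omega> E" for P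
    using that by blast
  have "W = orb ` ?U \<inter> bb_curve \<Omega> (Gamma_L d) E"
  proof (intro antisym subsetI)
    fix w assume w: "w \<in> W"
    then have "w \<in> bb_curve \<Omega> (Gamma_L d) E" using W by blast
    moreover from this obtain P where P: "P \<in> half_plane \<Omega> E" "w = orb P" unfolding bb_curve_def by blast
    then have "P \<in> ?U" using w mem by simp
    ultimately show "w \<in> orb ` ?U \<inter> bb_curve \<Omega> (Gamma_L d) E" using P(2) by blast
  next
    fix w assume w: "w \<in> orb ` ?U \<inter> bb_curve \<Omega> (Gamma_L d) E"
    then obtain P where P: "P \<in> half_plane \<Omega> E" "w = orb P" unfolding bb_curve_def by blast
    then have "orb P \<in> orb ` ?U" using w by (simp only: Int_iff)
    then have "P \<in> ?U" by (simp only: sat(2))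
    then show "w \<in> W" using mem[OF P(1)] P(2) by (simp only:)
  qed
  then show "openin (subtopology bb (bb_curve \<Omega> (Gamma_L d) E)) W"
    unfolding openin_subtopology using sat(1) by blast
qed

text \<open>Positivity of Im \<tau>' is part of the left side, so that the fibre over an orbit of
  points is exactly an orbit of \<open>Gamma1 a\<close> in the upper half plane.\<close>

lemma orbit_eq_iff:
  assumes \<tau>: "Im \<tau> > 0"
  shows "Im \<tau>' > 0 \<and> orb (\<psi> \<tau>) = orb (\<psi> \<tau>') \<longleftrightarrow> \<tau>' \<in> orbit_of (moebius_map ` Gamma1 a) \<tau>"
proof
  have gram: "bil d e e = 0" "bil d e f = 0" "bil d f f = 0" "bil d f f' = 1" "bil d e f' = 0"
    "bil d e e' = int a" "bil d f e' = 0" by (rule chart_bil[OF d_pos ch])+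
  have ad: "adapted d a e f e' f'" and a: "a > 0" and Ep: "E = plane e f" using ch by (auto simp: chart_def)
  have gpsi: "act g (\<psi> \<tau>) = line ((of_int \<delta> * \<tau> + of_int \<beta>) *s emb f + (of_int \<gamma> * \<tau> + of_int \<alpha>) *s emb e)"
    if "g *v e = \<alpha> *s e + \<beta> *s f" "g *v f = \<gamma> *s e + \<delta> *s f" for g \<alpha> \<beta> \<gamma> \<delta>
  proof -
    have "gact g (\<tau> *s emb f + emb e) = \<tau> *s emb (g *v f) + emb (g *v e)"
      by (simp add: gact_linear emb_matrix_vector)
    also have "\<dots> = (of_int \<delta> * \<tau> + of_int \<beta>) *s emb f + (of_int \<gamma> * \<tau> + of_int \<alpha>) *s emb e"
      unfolding that by (simp add: emb_linear vec_eq_iff algebra_simps)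
    finally show ?thesis by (simp only: act_line)
  qed
  {
    assume L: "Im \<tau>' > 0 \<and> orb (\<psi> \<tau>) = orb (\<psi> \<tau>')"
    then obtain g where g: "g \<in> Gamma_L d" "act g (\<psi> \<tau>) = \<psi> \<tau>'" using orb_eqD by blast
    obtain h where h: "h \<in> Gamma_L d" "h ** g = mat 1" using Gamma_L_inverse[OF d_pos g(1)] by blast
    have half: "\<psi> \<tau> \<in> half_plane \<Omega> E" "\<psi> \<tau>' \<in> half_plane \<Omega> E" using \<tau> L ch unfolding chart_def by blast+
    \<comment> \<open>Half planes of distinct isotropic planes are disjoint, so an element linking
      two points of one half plane stabilises E.\<close>
    have gE: "(*v) g ` E = E"
      using half_plane_inj[OF isotropic_image[OF d_pos g(1) E] E] act_half_plane[OF \<Omega> d_pos g(1) half(1)] half(2) g(2)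
      by simp
    then have hE: "(*v) h ` E = E" using image_inverse[OF h(2), of E] by simp
    have mem: "e \<in> E" "f \<in> E"
      using plane_memberI[of 1 e 0 f] plane_memberI[of 0 e 1 f] by (simp_all add: Ep)
    have "g *v e \<in> plane e f" "g *v f \<in> plane e f" "h *v e \<in> plane e f" "h *v f \<in> plane e f"
      using gE hE mem Ep by blast+
    then obtain \<alpha> \<beta> \<gamma> \<delta> \<alpha>' \<beta>' \<gamma>' \<delta>' where co: "g *v e = \<alpha> *s e + \<beta> *s f" "g *v f = \<gamma> *s e + \<delta> *s f"
      "h *v e = \<alpha>' *s e + \<beta>' *s f" "h *v f = \<gamma>' *s e + \<delta>' *s f" unfolding plane_def by blast
    have lin: "h *v (x *s u + y *s w) = x *s (h *v u) + y *s (h *v w)" for x y u w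
      using lin_matrix[of h] by (simp add: lin_def)
    have "h *v (g *v e) = e" "h *v (g *v f) = f" by (simp_all add: matrix_vector_mul_assoc h(2))
    then have "(\<alpha> * \<alpha>' + \<beta> * \<gamma>' - 1) *s e + (\<alpha> * \<beta>' + \<beta> * \<delta>') *s f = 0"
      "(\<gamma> * \<alpha>' + \<delta> * \<gamma>') *s e + (\<gamma> * \<beta>' + \<delta> * \<delta>' - 1) *s f = 0"
      unfolding co lin by (simp_all add: vec_eq_iff algebra_simps)
    from adapted_indep[OF ad a this(1)] adapted_indep[OF ad a this(2)]
    have pr: "\<alpha> * \<alpha>' + \<beta> * \<gamma>' = 1" "\<alpha> * \<beta>' + \<beta> * \<delta>' = 0" "\<gamma> * \<alpha>' + \<delta> * \<gamma>' = 0" "\<gamma> * \<beta>' + \<delta> * \<delta>' = 1" by simp_all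
    have "(\<alpha> * \<delta> - \<beta> * \<gamma>) * (\<alpha>' * \<delta>' - \<beta>' * \<gamma>') =
        (\<alpha> * \<alpha>' + \<beta> * \<gamma>') * (\<gamma> * \<beta>' + \<delta> * \<delta>') - (\<alpha> * \<beta>' + \<beta> * \<delta>') * (\<gamma> * \<alpha>' + \<delta> * \<gamma>')"
      by (simp add: algebra_simps)
    then have "(\<alpha> * \<delta> - \<beta> * \<gamma>) * (\<alpha>' * \<delta>' - \<beta>' * \<gamma>') = 1" unfolding pr by simp
    then have det1: "\<alpha> * \<delta> - \<beta> * \<gamma> = 1 \<or> \<alpha> * \<delta> - \<beta> * \<gamma> = -1" by (auto simp: zmult_eq_1_iff)
    have nz: "of_int \<gamma> * \<tau> + of_int \<alpha> \<noteq> 0" and t': "\<tau>' = (of_int \<delta> * \<tau> + of_int \<beta>) / (of_int \<gamma> * \<tau> + of_int \<alpha>)"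
      using chart_line_inj[OF d_pos ch] g(2) unfolding gpsi[OF co(1,2)] by blast+
    \<comment> \<open>The determinant is a unit, and since both points lie in the upper half plane
      it is positive.\<close>
    have "of_int (\<alpha> * \<delta> - \<beta> * \<gamma>) * Im \<tau> > 0"
      using moebius_Im[OF nz, of \<delta> \<beta>] L nz t' by (metis mult_pos_pos zero_less_norm_iff zero_less_power)
    then have "real_of_int (\<alpha> * \<delta> - \<beta> * \<gamma>) > 0" using \<tau> by (rule zero_less_mult_pos2)
    then have "\<alpha> * \<delta> - \<beta> * \<gamma> > 0" by (simp only: of_int_0_less_iff)
    then have det: "\<alpha> * \<delta> - \<beta> * \<gamma> = 1" using det1 by linarith
    have "prim e" "has_div d (int a) e" using ad by (auto simp: adapted_def)
    then have "\<forall>i. int a dvd (g *v e - e) $ i" by (rule Gamma_L_fixes_mod_div[OF g(1) gram(1)])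
    then obtain z where z: "g *v e - e = int a *s z" by (rule dvd_vecE)
    have ge: "g *v e - e = (\<alpha> - 1) *s e + \<beta> *s f" unfolding co by (simp add: vec_eq_iff algebra_simps)
    then have "int a *s z \<in> E" unfolding z Ep using plane_memberI by metis
    moreover have "int a \<noteq> 0" using a by simp
    ultimately have "z \<in> E" using E unfolding isotropic_def by blast
    then obtain x y where "z = x *s e + y *s f" unfolding Ep plane_def by blast
    then have "(\<alpha> - 1 - int a * x) *s e + (\<beta> - int a * y) *s f = 0"
      using z ge by (simp add: vec_eq_iff algebra_simps)
    from adapted_indep[OF ad a this] have ab: "\<alpha> - 1 = int a * x" "\<beta> = int a * y" by simp_all
    \<comment> \<open>The congruence for \<delta> follows from those for \<alpha> and \<beta> and
      the determinant.\<close>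
    have "\<delta> - 1 = \<beta> * \<gamma> - \<delta> * (\<alpha> - 1)" using det by (simp add: algebra_simps)
    also have "\<dots> = int a * (y * \<gamma> - \<delta> * x)" unfolding ab by (simp add: algebra_simps)
    finally have dd: "int a dvd \<delta> - 1" by simp
    \<comment> \<open>The coordinate belongs to the basis f, e, so the entries of g appear in
      reversed order.\<close>
    define Z :: "int ^ 2 ^ 2" where "Z = (\<chi> i j. if i = 1 then (if j = 1 then \<delta> else \<beta>) else (if j = 1 then \<gamma> else \<alpha>))"
    have Z: "Z $ 1 $ 1 = \<delta>" "Z $ 1 $ 2 = \<beta>" "Z $ 2 $ 1 = \<gamma>" "Z $ 2 $ 2 = \<alpha>" by (simp_all add: Z_def)
    have "Z \<in> Gamma1 a"
      using det dd ab by (simp add: Gamma1_def SL2Z_def det_2 Z algebra_simps)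
    moreover have "moebius_map Z \<tau> = \<tau>'" by (simp add: moebius_map_def Z t')
    ultimately show "\<tau>' \<in> orbit_of (moebius_map ` Gamma1 a) \<tau>" by (auto simp: orbit_of_def)
  }
  {
    assume "\<tau>' \<in> orbit_of (moebius_map ` Gamma1 a) \<tau>"
    then obtain Z where Z: "Z \<in> Gamma1 a" "\<tau>' = moebius_map Z \<tau>" by (auto simp: orbit_of_def)
    define \<alpha> \<beta> \<gamma> \<delta> where "\<alpha> = Z $ 2 $ 2" and "\<beta> = Z $ 1 $ 2" and "\<gamma> = Z $ 2 $ 1" and "\<delta> = Z $ 1 $ 1"
    have det: "\<alpha> * \<delta> - \<beta> * \<gamma> = 1" and cong: "int a dvd \<alpha> - 1" "int a dvd \<delta> - 1" "int a dvd \<beta>"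
      using Z(1) by (simp_all add: Gamma1_def SL2Z_def det_2 \<alpha>_def \<beta>_def \<gamma>_def \<delta>_def algebra_simps)
    obtain g where g: "g \<in> Gamma_L d" "g *v e = \<alpha> *s e + \<beta> *s f" "g *v f = \<gamma> *s e + \<delta> *s f"
      using Gamma_L_extends[OF d_pos a ad det cong] by blast
    have t': "\<tau>' = (of_int \<delta> * \<tau> + of_int \<beta>) / (of_int \<gamma> * \<tau> + of_int \<alpha>)"
      by (simp add: Z(2) moebius_map_def \<alpha>_def \<beta>_def \<gamma>_def \<delta>_def)
    have nz: "of_int \<gamma> * \<tau> + of_int \<alpha> \<noteq> 0"
      by (rule moebius_denominator[OF \<tau>, of \<alpha> \<delta> \<beta>]) (simp add: det)
    have "act g (\<psi> \<tau>) = \<psi> \<tau>'"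
      unfolding gpsi[OF g(2,3)] t' by (rule chart_line[OF d_pos ch nz])
    moreover have "Im \<tau>' * (cmod (of_int \<gamma> * \<tau> + of_int \<alpha>))\<^sup>2 = Im \<tau>"
      using moebius_Im[OF nz, of \<delta> \<beta>] by (simp add: t' det)
    then have "Im \<tau>' > 0" using \<tau> by (metis zero_less_mult_pos2 nz zero_less_norm_iff zero_less_power)
    ultimately show "Im \<tau>' > 0 \<and> orb (\<psi> \<tau>) = orb (\<psi> \<tau>')"
      using orb_act[OF g(1), of "\<psi> \<tau>"] by simp
  }
qed

text \<open>Homeomorphism and agreement of holomorphic functions are both checked on the upper half
  plane, on which each side is defined by pulling back.\<close>

lemma curve_iso_quotient:
  "curve_iso (bb_curve_structure d \<Omega> (Gamma_L d) E) (upper_half_plane_quotient (moebius_map ` Gamma1 a))"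
proof -
  let ?T = "moebius_map ` Gamma1 a"
  let ?X = "subtopology bb (bb_curve \<Omega> (Gamma_L d) E)"
  let ?Y = "quotient_topology (top_of_set upper_half_plane) (orbit_of ?T)"
  \<comment> \<open>A point of the curve is sent to its set of parameters, which by
    \<open>orbit_eq_iff\<close> is a point of the target quotient.\<close>
  define \<phi> where "\<phi> P = {\<tau>. Im \<tau> > 0 \<and> orb (\<psi> \<tau>) = P}" for P
  have \<phi>_orb: "\<phi> (orb (\<psi> \<tau>)) = orbit_of ?T \<tau>" if "Im \<tau> > 0" for \<tau>
    by (rule set_eqI) (simp only: \<phi>_def mem_Collect_eq orbit_eq_iff[OF that, symmetric] eq_commute[of "orb (\<psi> \<tau>)"])
  have topX: "topspace ?X = bb_curve \<Omega> (Gamma_L d) E" using curve_subset_topspace by auto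
  have topY: "topspace ?Y = orbit_of ?T ` {\<tau>. Im \<tau> > 0}" by (simp add: upper_half_plane_def)
  have "homeomorphic_map ?X ?Y \<phi>"
    unfolding homeomorphic_map_def quotient_map_def
  proof (intro conjI allI impI)
    show "\<phi> ` topspace ?X = topspace ?Y"
    proof -
      have "\<phi> ` {orb (\<psi> \<tau>) | \<tau>. Im \<tau> > 0} = (\<lambda>\<tau>. \<phi> (orb (\<psi> \<tau>))) ` {\<tau>. Im \<tau> > 0}" by blast
      also have "\<dots> = orbit_of ?T ` {\<tau>. Im \<tau> > 0}" by (rule image_cong) (simp_all add: \<phi>_orb)
      finally show ?thesis unfolding topX topY unfolding curve_eq .
    qed
    show "inj_on \<phi> (topspace ?X)"
      unfolding topX unfolding curve_eq by (rule inj_onI) (auto simp: \<phi>_def)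
    fix U assume U: "U \<subseteq> topspace ?Y"
    let ?S = "{\<tau>. Im \<tau> > 0 \<and> orbit_of ?T \<tau> \<in> U}"
    have 1: "{\<tau>. Im \<tau> > 0 \<and> orb (\<psi> \<tau>) \<in> {x \<in> topspace ?X. \<phi> x \<in> U}} = ?S"
      unfolding topX unfolding curve_eq using \<phi>_orb by auto
    have "{x \<in> topspace ?X. \<phi> x \<in> U} \<subseteq> bb_curve \<Omega> (Gamma_L d) E" using topX by blast
    then have "openin ?X {x \<in> topspace ?X. \<phi> x \<in> U} \<longleftrightarrow> open ?S"
      unfolding openin_curve_iff 1 by blast
    moreover have "openin ?Y U \<longleftrightarrow> open ?S"
    proof -
      have "{\<tau> \<in> topspace (top_of_set upper_half_plane). orbit_of ?T \<tau> \<in> U} = ?S"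
        by (simp add: upper_half_plane_def)
      moreover have "U \<subseteq> orbit_of ?T ` topspace (top_of_set upper_half_plane)" using U by simp
      moreover have "openin (top_of_set upper_half_plane) ?S \<longleftrightarrow> open ?S"
        by (subst openin_open_eq) (auto simp: upper_half_plane_def open_halfspace_Im_gt)
      ultimately show ?thesis unfolding openin_quotient_topology by simp
    qed
    ultimately show "openin ?X {x \<in> topspace ?X. \<phi> x \<in> U} \<longleftrightarrow> openin ?Y U" by blast
  qed
  moreover have "snd (upper_half_plane_quotient ?T) W F \<longleftrightarrow>
      snd (bb_curve_structure d \<Omega> (Gamma_L d) E) {x \<in> topspace ?X. \<phi> x \<in> W} (F \<circ> \<phi>)" for W F
  proof -
    let ?D = "{\<tau> \<in> upper_half_plane. orbit_of ?T \<tau> \<in> W}"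
    let ?W = "{x \<in> topspace ?X. \<phi> x \<in> W}"
    let ?k = "\<lambda>b \<tau>. line (\<tau> *s emb (b 1) + emb (b 2)) :: (complex ^ 6) set"
    have D: "{\<tau>. \<psi> \<tau> \<in> half_plane \<Omega> E \<and> orb (\<psi> \<tau>) \<in> ?W} = ?D"
    proof -
      have "\<psi> \<tau> \<in> half_plane \<Omega> E \<longleftrightarrow> Im \<tau> > 0" for \<tau> using ch unfolding chart_def by blast
      then show ?thesis
        unfolding topX unfolding curve_eq upper_half_plane_def using \<phi>_orb by auto
    qed
    have "(F \<circ> orbit_of ?T) holomorphic_on ?D \<longleftrightarrow>
      (\<forall>b. z_basis b {1..2} E \<longrightarrow> (\<lambda>\<tau>. (F \<circ> \<phi>) (orb (?k b \<tau>))) holomorphic_on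
          {\<tau>. ?k b \<tau> \<in> half_plane \<Omega> E \<and> orb (?k b \<tau>) \<in> ?W})" (is "?L \<longleftrightarrow> ?R")
    proof
      assume L: ?L
      show ?R
      proof (intro allI impI)
        fix b assume b: "z_basis b {1..2} E"
        obtain x1 y1 x2 y2 :: int where
          eq: "\<And>\<sigma> :: complex. \<sigma> *s emb (b 1) + emb (b 2) = (\<sigma> * of_int x1 + of_int x2) *s emb f + (\<sigma> * of_int y1 + of_int y2) *s emb e"
          using chart_change[OF d_pos ch b] by blast
        define M where "M \<sigma> = (\<sigma> * of_int x1 + of_int x2) / (\<sigma> * of_int y1 + of_int y2)" for \<sigma> :: complex
        let ?S = "{\<tau>. ?k b \<tau> \<in> half_plane \<Omega> E \<and> orb (?k b \<tau>) \<in> ?W}"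
        have M: "\<sigma> * of_int y1 + of_int y2 \<noteq> 0 \<and> ?k b \<sigma> = \<psi> (M \<sigma>) \<and> Im (M \<sigma>) > 0"
          if half: "?k b \<sigma> \<in> half_plane \<Omega> E" for \<sigma>
        proof -
          obtain \<tau> where \<tau>: "Im \<tau> > 0" "?k b \<sigma> = \<psi> \<tau>"
            using half unfolding half_plane_chart[OF d_pos ch] by blast
          then show ?thesis
            using chart_line_inj[OF d_pos ch, of "\<sigma> * of_int x1 + of_int x2" "\<sigma> * of_int y1 + of_int y2" \<tau>]
            unfolding eq M_def by simp
        qed
        have "M holomorphic_on ?S"
          unfolding M_def by (intro holomorphic_intros) (use M in blast)
        moreover have "M ` ?S \<subseteq> ?D"
        proof (rule image_subsetI)
          fix \<sigma> assume "\<sigma> \<in> ?S"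
          then have k: "?k b \<sigma> \<in> half_plane \<Omega> E" "orb (?k b \<sigma>) \<in> ?W" by blast+
          have "?k b \<sigma> = \<psi> (M \<sigma>)" using M[OF k(1)] by (rule conjunct2[THEN conjunct1])
          with k have "\<psi> (M \<sigma>) \<in> half_plane \<Omega> E \<and> orb (\<psi> (M \<sigma>)) \<in> ?W" by (simp only: simp_thms)
          then show "M \<sigma> \<in> ?D" using D by blast
        qed
        ultimately have "((F \<circ> orbit_of ?T) \<circ> M) holomorphic_on ?S"
          using holomorphic_on_compose_gen[OF _ L] by blast
        moreover have "((F \<circ> orbit_of ?T) \<circ> M) \<sigma> = (F \<circ> \<phi>) (orb (?k b \<sigma>))" if "\<sigma> \<in> ?S" for \<sigma>
        proof -
          have "?k b \<sigma> = \<psi> (M \<sigma>)" "Im (M \<sigma>) > 0" using M[of \<sigma>] that by blast+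
          then show ?thesis using \<phi>_orb[of "M \<sigma>"] by (simp only: o_apply)
        qed
        ultimately show "(\<lambda>\<tau>. (F \<circ> \<phi>) (orb (?k b \<tau>))) holomorphic_on ?S"
          by (rule holomorphic_transform)
      qed
    next
      assume R: ?R
      \<comment> \<open>For the converse a single basis suffices: f, e gives back the chart
        itself.\<close>
      let ?b = "\<lambda>i :: nat. if i = 1 then f else e"
      have "z_basis ?b {1..2} E"
        unfolding z_basis_2_iff
      proof (intro conjI allI impI)
        have ad: "adapted d a e f e' f'" "a > 0" using ch by (auto simp: chart_def)
        fix x y :: int assume "x *s ?b 1 + y *s ?b 2 = 0"
        then have "y *s e + x *s f = 0" by (simp add: add.commute)
        from adapted_indep[OF ad this] show "x = 0" "y = 0" by auto
      next
        have "E = plane f e" using ch plane_swap by (simp add: chart_def)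
        then show "E = {x *s ?b 1 + y *s ?b 2 | x y. True}" by (simp add: plane_def)
      qed
      with R have "(\<lambda>\<tau>. (F \<circ> \<phi>) (orb (?k ?b \<tau>))) holomorphic_on
          {\<tau>. ?k ?b \<tau> \<in> half_plane \<Omega> E \<and> orb (?k ?b \<tau>) \<in> ?W}" by blast
      then have "(\<lambda>\<tau>. (F \<circ> \<phi>) (orb (\<psi> \<tau>))) holomorphic_on ?D"
        unfolding D[symmetric] by simp
      then show ?L
        by (rule holomorphic_transform) (use \<phi>_orb in \<open>auto simp: upper_half_plane_def\<close>)
    qed
    then show ?thesis by (simp add: upper_half_plane_quotient_def bb_curve_structure_def)
  qed
  ultimately show ?thesis
    unfolding curve_iso_def by (intro exI[of _ \<phi>]) (simp add: upper_half_plane_quotient_def bb_curve_structure_def)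
qed

end

section \<open>Neighbourhoods of the zero-dimensional boundary components\<close>

lemma act_horoball:
  assumes g: "g \<in> Gamma_L d" and P: "P \<in> horoball \<Omega> l E C"
  shows "act g P \<in> horoball \<Omega> ((*v) g ` l) ((*v) g ` E) C"
proof -
  obtain h where h: "h ** g = mat 1" using Gamma_L_inverse[OF d_pos g] by blast
  obtain b s where b: "z_basis b {1..1} l" "z_basis b {1..2} E"
    "P = line (s *s emb (b 1) + emb (b 2))" "\<bar>Im s\<bar> > C" and half: "P \<in> half_plane \<Omega> E"
    using P unfolding horoball_def by blast
  have "act g P = line (s *s emb (g *v b 1) + emb (g *v b 2))"
    by (simp only: b(3) act_line gact_linear emb_matrix_vector)
  moreover have "act g P \<in> half_plane \<Omega> ((*v) g ` E)" by (rule act_half_plane[OF \<Omega> d_pos g half])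
  moreover note z_basis_image[OF h b(1)] z_basis_image[OF h b(2)] b(4)
  ultimately show ?thesis
    unfolding horoball_def by (intro CollectI conjI exI[of _ "\<lambda>i. g *v b i"] exI[of _ s]) assumption+
qed

lemma act_nbhd_point:
  assumes g: "g \<in> Gamma_L d" and P: "P \<in> nbhd_point d \<Omega> l C"
  shows "act g P \<in> nbhd_point d \<Omega> ((*v) g ` l) C"
proof -
  obtain h where h: "h \<in> Gamma_L d" "h ** g = mat 1" "g ** h = mat 1" using Gamma_L_inverse[OF d_pos g] by blast
  consider "P = cspan l" | E where "E \<in> isotropic d 2" "l \<subseteq> E" "P \<in> horoball \<Omega> l E C"
    | z where "P = line z" "z \<in> \<Omega>" "\<forall>E\<in>isotropic d 2. l \<subseteq> E \<longrightarrow> proj_to d E z \<in> horoball \<Omega> l E C"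
    using P unfolding nbhd_point_def by blast
  then show ?thesis
  proof cases
    case 1
    then have "act g P = cspan ((*v) g ` l)" by (simp only: act_cspan)
    then show ?thesis unfolding nbhd_point_def by blast
  next
    case 2
    have "(*v) g ` l \<subseteq> (*v) g ` E" using 2(2) by (rule image_mono)
    then show ?thesis
      using isotropic_image[OF d_pos g 2(1)] act_horoball[OF g 2(3)] unfolding nbhd_point_def by blast
  next
    case 3
    have "proj_to d E (gact g z) \<in> horoball \<Omega> ((*v) g ` l) E C"
      if E: "E \<in> isotropic d 2" "(*v) g ` l \<subseteq> E" for E
    proof -
      define E' where "E' = (*v) h ` E"
      have E': "(*v) g ` E' = E" unfolding E'_def by (rule image_inverse[OF h(3)])
      have "(*v) h ` (*v) g ` l \<subseteq> E'" unfolding E'_def using E(2) by (rule image_mono)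
      then have "l \<subseteq> E'" by (simp only: image_inverse[OF h(2)])
      moreover have "E' \<in> isotropic d 2" unfolding E'_def by (rule isotropic_image[OF d_pos h(1) E(1)])
      ultimately have "proj_to d E' z \<in> horoball \<Omega> l E' C" using 3(3) by blast
      then have "act g (proj_to d E' z) \<in> horoball \<Omega> ((*v) g ` l) ((*v) g ` E') C" by (rule act_horoball[OF g])
      moreover have "proj_to d ((*v) g ` E') (gact g z) = act g (proj_to d E' z)"
        unfolding proj_to_def act_cspan[symmetric] using Gamma_L_complex_isometry[OF g] by auto
      ultimately show ?thesis by (simp only: E')
    qed
    moreover have "gact g z \<in> \<Omega>" by (rule Gamma_L_preserves_component[OF \<Omega> g 3(2)])
    moreover have "act g P = line (gact g z)" by (simp only: 3(1) act_line)
    ultimately show ?thesis unfolding nbhd_point_def by blast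
  qed
qed

text \<open>Completing v to a basis of E gives a coordinate with the line of v at infinity, in which
  points far up the imaginary axis lie in the horoball.\<close>

lemma horoball_nonempty:
  assumes E: "E \<in> isotropic d 2" and v: "prim v" "range (\<lambda>n. n *s v) \<subseteq> E"
  shows "\<exists>P. P \<in> horoball \<Omega> (range (\<lambda>n. n *s v)) E C"
proof -
  obtain a e f e' f' where ch: "chart d \<Omega> E a e f e' f'" using chart_ex[OF E] by blast
  have Ep: "E = plane e f" and ad: "adapted d a e f e' f'" "a > 0" using ch by (auto simp: chart_def)
  have "1 *s v \<in> range (\<lambda>n. n *s v)" by (rule rangeI)
  then have "v \<in> E" using v(2) by auto
  then obtain m n where mn: "v = m *s e + n *s f" unfolding Ep plane_def by blast
  have "coprime m n"
  proof (rule coprimeI)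
    fix c assume "c dvd m" "c dvd n"
    then have "\<forall>i. c dvd v $ i" by (simp add: mn)
    then show "is_unit c" using v(1) by (simp add: prim_def)
  qed
  then obtain u w where uw: "u * m + w * n = 1" using bezout_int[of m n] by auto
  \<comment> \<open>With u m + w n = 1 the second vector completes v to a basis with transition
    determinant 1, so the upper half plane corresponds to the upper half plane.\<close>
  define b where "b i = (if i = (1::nat) then v else w *s e - u *s f)" for i
  have b: "b 1 = v" "b 2 = w *s e - u *s f" by (simp_all add: b_def)
  have b1: "z_basis b {1..1} (range (\<lambda>n. n *s v))" using v(1) b(1) by (rule z_basis_1)
  have "z_basis b {1..2} E"
    unfolding z_basis_2_iff b
  proof (intro conjI allI impI)
    fix x y
    assume "x *s v + y *s (w *s e - u *s f) = 0"
    then have "(x * m + y * w) *s e + (x * n - y * u) *s f = 0"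
      by (simp add: mn vec_eq_iff algebra_simps)
    from adapted_indep[OF ad this] have xy: "x * m + y * w = 0" "x * n - y * u = 0" by simp_all
    have "x = x * (u * m + w * n)" by (simp add: uw)
    also have "\<dots> = u * (x * m + y * w) + w * (x * n - y * u)" by (simp add: algebra_simps)
    finally show "x = 0" unfolding xy by simp
    have "y = y * (u * m + w * n)" by (simp add: uw)
    also have "\<dots> = n * (x * m + y * w) - m * (x * n - y * u)" by (simp add: algebra_simps)
    finally show "y = 0" unfolding xy by simp
  next
    show "E = {x *s v + y *s (w *s e - u *s f) | x y. True}"
    proof (intro antisym subsetI)
    fix z assume "z \<in> E"
    then obtain x y where z: "z = x *s e + y *s f" unfolding Ep plane_def by blast
    have ef: "e = (u * m + w * n) *s e" "f = (u * m + w * n) *s f" by (simp_all add: uw)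
    obtain B where B: "B = w *s e - u *s f" by blast
    from ef have ef': "u *s v + n *s B = e" "w *s v + (- m) *s B = f"
      unfolding B
      by (simp_all add: mn vec_eq_iff algebra_simps)
    have "z = x *s (u *s v + n *s B) + y *s (w *s v + (- m) *s B)"
      unfolding ef' by (rule z)
    also have "\<dots> = (x * u + y * w) *s v + (x * n - y * m) *s B"
      by (simp add: vec_eq_iff algebra_simps)
    finally show "z \<in> {x *s v + y *s (w *s e - u *s f) | x y. True}" unfolding B by blast
  next
    fix z assume "z \<in> {x *s v + y *s (w *s e - u *s f) | x y. True}"
    then obtain x y where "z = x *s v + y *s (w *s e - u *s f)" by blast
    then have "z = (x * m + y * w) *s e + (x * n - y * u) *s f"
      by (simp add: mn vec_eq_iff algebra_simps)
    then show "z \<in> E" unfolding Ep using plane_memberI by metis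
    qed
  qed
  moreover define s where "s = \<i> * of_real (\<bar>C\<bar> + 1)"
  have s: "Im s > 0" "\<bar>Im s\<bar> > C" by (simp_all add: s_def)
  have nz: "of_int m * s + of_int w \<noteq> 0"
    by (rule moebius_denominator[OF s(1), of w n "- u"]) (use uw in \<open>simp add: algebra_simps\<close>)
  have "Im ((of_int n * s + of_int (- u)) / (of_int m * s + of_int w)) * (cmod (of_int m * s + of_int w))\<^sup>2 = Im s"
  proof -
    have det: "w * n - - u * m = 1" using uw by (simp add: algebra_simps)
    show ?thesis using moebius_Im[OF nz, of n "- u"] unfolding det by simp
  qed
  then have "Im ((of_int n * s + of_int (- u)) / (of_int m * s + of_int w)) > 0"
    using s(1) nz by (metis zero_less_mult_pos2 zero_less_norm_iff zero_less_power)
  then have "line (((of_int n * s + of_int (- u)) / (of_int m * s + of_int w)) *s emb f + emb e) \<in> half_plane \<Omega> E"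
    using ch unfolding chart_def by blast
  then have "line ((of_int n * s + of_int (- u)) *s emb f + (of_int m * s + of_int w) *s emb e) \<in> half_plane \<Omega> E"
    by (simp only: chart_line[OF d_pos ch nz])
  moreover have "(of_int n * s + of_int (- u)) *s emb f + (of_int m * s + of_int w) *s emb e = s *s emb (b 1) + (emb (b 2) :: complex ^ 6)"
    unfolding b mn by (simp add: emb_linear vec_eq_iff algebra_simps)
  ultimately show ?thesis using b1 s(2) unfolding horoball_def by auto
qed

text \<open>Among the basic open sets only those of the form \<open>nbhd_point\<close> at l itself
  contain the point of l, and finite intersections are handled by the larger constant.\<close>

lemma point_neighbourhood:
  assumes E: "E \<in> isotropic d 2" and l: "l \<in> isotropic d 1" "l \<subseteq> E"
    and U: "openin (satake_topology d \<Omega>) U" "cspan l \<in> U"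
  shows "\<exists>C. horoball \<Omega> l E C \<subseteq> U"
proof -
  have mono: "horoball \<Omega> l E C \<subseteq> horoball \<Omega> l E C'" if "C' \<le> C" for C C'
    using that unfolding horoball_def by force
  have not: "cspan l \<notin> line ` \<Omega>" "cspan l \<notin> half_plane \<Omega> E'" for E'
    using cspan_not_in_domain[OF l(1)] cspan_not_in_half_plane[OF l(1)] by blast+
  have "generate_topology_on ({U. proj_openin (line ` \<Omega>) U} \<union>
      {nbhd_curve d \<Omega> E V v C | E V v C.
         E \<in> isotropic d 2 \<and> proj_openin (half_plane \<Omega> E) V \<and> v \<in> E \<and> v \<noteq> 0 \<and> C > 0} \<union>
      {nbhd_point d \<Omega> l C | l C. l \<in> isotropic d 1 \<and> C > 0}) U" (is "generate_topology_on ?B U")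
    using U(1) unfolding satake_topology_def openin_topology_generated_by_iff .
  then show ?thesis using U(2)
  proof (induction U rule: generate_topology_on.induct)
    case (Int A B)
    then obtain C C' where "horoball \<Omega> l E C \<subseteq> A" "horoball \<Omega> l E C' \<subseteq> B" by blast
    then have "horoball \<Omega> l E (max C C') \<subseteq> A \<inter> B"
      using mono[of C "max C C'"] mono[of C' "max C C'"] by auto
    then show ?case by blast
  next
    case (UN K)
    then show ?case by blast
  next
    case (Basis U)
    consider (a) "U \<subseteq> line ` \<Omega>"
      | (b) E' V v C where "U = nbhd_curve d \<Omega> E' V v C" "V \<subseteq> half_plane \<Omega> E'"
      | (c) l' C where "U = nbhd_point d \<Omega> l' C" "l' \<in> isotropic d 1"
      using Basis(1) unfolding proj_openin_def by blast
    then show ?case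
    proof cases
      case a
      then show ?thesis using not Basis(2) by blast
    next
      case b
      then show ?thesis using not Basis(2) unfolding nbhd_curve_def by blast
    next
      case c
      have "cspan l = cspan l'"
        using not Basis(2) unfolding c(1) nbhd_point_def horoball_def by blast
      then have "l = l'" by (rule cspan_inj[OF l(1) c(2)])
      then have "horoball \<Omega> l E C \<subseteq> U" using E l(2) unfolding c(1) nbhd_point_def by blast
      then show ?thesis by blast
    qed
  qed simp
qed

lemma point_in_topspace:
  assumes "l \<in> isotropic d 1"
  shows "bb_point (Gamma_L d) l \<in> topspace (baily_borel d \<Omega> (Gamma_L d))"
  unfolding bb_point_def topspace_bb topspace_satake using assms by blast

text \<open>If a translate of l lies in E, all its horoballs meet the half plane. Otherwise the
  translates of a neighbourhood of l form a saturated open set missing the half plane of E.\<close>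

lemma point_in_closure_iff:
  assumes E: "E \<in> isotropic d 2" and l: "l \<in> isotropic d 1"
  shows "bb_point (Gamma_L d) l \<in> baily_borel d \<Omega> (Gamma_L d) closure_of bb_curve \<Omega> (Gamma_L d) E \<longleftrightarrow>
    (\<exists>g\<in>Gamma_L d. (*v) g ` l \<subseteq> E)"
proof
  assume "\<exists>g\<in>Gamma_L d. (*v) g ` l \<subseteq> E"
  then obtain g where g: "g \<in> Gamma_L d" "(*v) g ` l \<subseteq> E" by blast
  have l': "(*v) g ` l \<in> isotropic d 1" by (rule isotropic_image[OF d_pos g(1) l])
  obtain v where v: "(*v) g ` l = range (\<lambda>n. n *s v)" "prim v" using l' isotropic_1_iff by blast
  have pt: "bb_point (Gamma_L d) l = orb (cspan ((*v) g ` l))"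
    unfolding bb_point_def act_cspan[symmetric] by (rule orb_act[OF g(1), symmetric])
  show "bb_point (Gamma_L d) l \<in> baily_borel d \<Omega> (Gamma_L d) closure_of bb_curve \<Omega> (Gamma_L d) E"
    unfolding in_closure_of
  proof (intro conjI allI impI point_in_topspace[OF l])
    fix T assume T: "bb_point (Gamma_L d) l \<in> T \<and> openin (baily_borel d \<Omega> (Gamma_L d)) T"
    let ?U = "{x \<in> topspace (satake_topology d \<Omega>). orb x \<in> T}"
    have "openin (satake_topology d \<Omega>) ?U" using T unfolding openin_bb by blast
    moreover have "cspan ((*v) g ` l) \<in> ?U"
      using T l' pt unfolding topspace_satake by auto
    ultimately obtain C where C: "horoball \<Omega> ((*v) g ` l) E C \<subseteq> ?U"
      using point_neighbourhood[OF E l' g(2)] by blast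
    obtain P where P: "P \<in> horoball \<Omega> ((*v) g ` l) E C"
      using horoball_nonempty[OF E v(2)] g(2) unfolding v(1) by blast
    then have "orb P \<in> bb_curve \<Omega> (Gamma_L d) E" unfolding bb_curve_def horoball_def by blast
    moreover have "orb P \<in> T" using P C by blast
    ultimately show "\<exists>y. y \<in> bb_curve \<Omega> (Gamma_L d) E \<and> y \<in> T" by blast
  qed
next
  assume cl: "bb_point (Gamma_L d) l \<in> baily_borel d \<Omega> (Gamma_L d) closure_of bb_curve \<Omega> (Gamma_L d) E"
  \<comment> \<open>Any positive constant works, as only the planes containing a translate of l
    matter.\<close>
  define N where "N g = nbhd_point d \<Omega> ((*v) g ` l) 1" for g
  have op: "openin (satake_topology d \<Omega>) (N g)" if "g \<in> Gamma_L d" for g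
    unfolding N_def by (rule openin_nbhd_point[OF isotropic_image[OF d_pos that l]]) simp
  have inv: "act h P \<in> N (h ** g)" if "g \<in> Gamma_L d" "h \<in> Gamma_L d" "P \<in> N g" for g h P
  proof -
    have "(*v) (h ** g) ` l = (*v) h ` (*v) g ` l" by (simp add: image_image matrix_vector_mul_assoc)
    then show ?thesis using act_nbhd_point[OF that(2), of P] that(3) unfolding N_def by simp
  qed
  note sat = openin_bb_saturated[of N, OF op inv]
  have "cspan l \<in> N (mat 1)" by (simp add: N_def nbhd_point_def)
  then have "bb_point (Gamma_L d) l \<in> orb ` (\<Union>g\<in>Gamma_L d. N g)"
    unfolding bb_point_def using Gamma_L_one[of d] by blast
  then have "\<exists>y. y \<in> bb_curve \<Omega> (Gamma_L d) E \<and> y \<in> orb ` (\<Union>g\<in>Gamma_L d. N g)"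
    by (intro cl[unfolded in_closure_of, THEN conjunct2, rule_format] conjI sat(1))
  then obtain y where y: "y \<in> bb_curve \<Omega> (Gamma_L d) E" "y \<in> orb ` (\<Union>g\<in>Gamma_L d. N g)"
    by blast
  obtain P where P: "P \<in> half_plane \<Omega> E" "y = orb P" using y(1) unfolding bb_curve_def by blast
  have "P \<in> (\<Union>g\<in>Gamma_L d. N g)" using y(2) by (simp only: P(2) sat(2))
  then obtain g where g: "g \<in> Gamma_L d" "P \<in> N g" by blast
  have "P \<noteq> cspan ((*v) g ` l)"
    using cspan_not_in_half_plane[OF isotropic_image[OF d_pos g(1) l]] P(1) by blast
  moreover have "P \<notin> line ` \<Omega>" by (rule half_plane_not_in_domain[OF E P(1)])
  ultimately obtain E' where E': "E' \<in> isotropic d 2" "(*v) g ` l \<subseteq> E'" "P \<in> half_plane \<Omega> E'"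
    using g(2) unfolding N_def nbhd_point_def horoball_def by blast
  then have "E' = E" using half_plane_inj[OF E'(1) E E'(3) P(1)] by blast
  then show "\<exists>g\<in>Gamma_L d. (*v) g ` l \<subseteq> E" using E'(2) g(1) by blast
qed

end

section \<open>Cusps\<close>

text \<open>The orbit of such a \<open>v\<close> depends only on \<open>n\<close> and \<open>u\<close> modulo \<open>n\<close>, which determine \<open>v\<^sup>*\<close> modulo \<open>L\<close>.\<close>

definition cusp_vector :: "int \<Rightarrow> int \<Rightarrow> int ^ 6 \<Rightarrow> bool" where
  "cusp_vector n u v \<longleftrightarrow> bil d v v = 0 \<and> prim v \<and> has_div d n v \<and> n dvd v $ 5 - u"

text \<open>The choice of representative does not matter, by \<open>bb_point_cusp\<close>; the name
  by n and u absorbs the different shapes of the four discriminant classes.\<close>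

definition cusp :: "int \<Rightarrow> int \<Rightarrow> (complex ^ 6) set set" where
  "cusp n u = bb_point (Gamma_L d) (range (\<lambda>m. m *s (SOME v. cusp_vector n u v)))"

lemma bb_point_cusp:
  assumes "cusp_vector n u v"
  shows "bb_point (Gamma_L d) (range (\<lambda>m. m *s v)) = cusp n u"
proof -
  define w where "w = (SOME v. cusp_vector n u v)"
  have w: "cusp_vector n u w" unfolding w_def using assms by (rule someI)
  have "n dvd v $ 5 - u" "n dvd w $ 5 - u" using assms w by (auto simp: cusp_vector_def)
  then have "n dvd (v $ 5 - u) - (w $ 5 - u)" by (rule dvd_diff)
  then have "equivalent d v w"
    using assms w by (intro equivalent_iff[of v n w]) (auto simp: cusp_vector_def)
  then obtain g where g: "g \<in> Gamma_L d" "g *v v = w" unfolding equivalent_def by blast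
  have "act g (cspan (range (\<lambda>m. m *s v))) = cspan (range (\<lambda>m. m *s w))"
    unfolding act_cspan image_range g(2) ..
  then have "bb_orbit (Gamma_L d) (cspan (range (\<lambda>m. m *s v))) = bb_orbit (Gamma_L d) (cspan (range (\<lambda>m. m *s w)))"
    using g(1) by (intro bb_orbit_eq_iff[THEN iffD2, OF d_pos]) blast
  then show ?thesis unfolding bb_point_def cusp_def w_def .
qed

lemma cusp_vector_exists:
  assumes "n \<in> {1, 2, int p, 2 * int p}" "coprime u n"
  shows "\<exists>v. cusp_vector n u v"
  using exists_isotropic[OF assms] unfolding cusp_vector_def by auto

text \<open>The premise \<open>iff\<close> translates a discriminant class into a divisor and a
  residue of the fifth coordinate; the class then contains exactly one orbit because these data
  determine it.\<close>

lemma bb_points_of_class_cusp: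
  assumes "n \<in> {1, 2, int p, 2 * int p}" "coprime u n"
    and iff: "\<And>v m. bil d v v = 0 \<Longrightarrow> prim v \<Longrightarrow> has_div d m v \<Longrightarrow>
      cong_L (lstar d v) (of_int a *s wstar + of_int b *s vstar d) \<longleftrightarrow> m = n \<and> m dvd v $ 5 - u"
  shows "bb_points_of_class d (Gamma_L d) a b = {cusp n u}"
proof -
  have *: "(range (\<lambda>n. n *s v) \<in> isotropic d 1 \<and>
      cong_L (lstar d v) (of_int a *s wstar + of_int b *s vstar d)) \<longleftrightarrow> cusp_vector n u v" for v
  proof
    assume L: "range (\<lambda>n. n *s v) \<in> isotropic d 1 \<and>
      cong_L (lstar d v) (of_int a *s wstar + of_int b *s vstar d)"
    then have v: "prim v" "bil d v v = 0" unfolding range_isotropic_iff by blast+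
    obtain m where m: "has_div d m v" using has_div_exists[OF d_pos prim_nonzero[OF v(1)]] by blast
    show "cusp_vector n u v" using iff[OF v(2,1) m] L v m unfolding cusp_vector_def by blast
  next
    assume "cusp_vector n u v"
    then show "range (\<lambda>n. n *s v) \<in> isotropic d 1 \<and>
      cong_L (lstar d v) (of_int a *s wstar + of_int b *s vstar d)"
      unfolding range_isotropic_iff cusp_vector_def using iff by blast
  qed
  show ?thesis
    unfolding bb_points_of_class_def * using bb_point_cusp cusp_vector_exists[OF assms(1,2)] by blast
qed

lemma points_1: "bb_points_of_class d (Gamma_L d) 0 0 = {cusp 1 0}"
  by (rule bb_points_of_class_cusp) (use class_1_iff in auto)

lemma points_2: "bb_points_of_class d (Gamma_L d) 3 (int (p\<^sup>2)) = {cusp 2 1}"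
proof (rule bb_points_of_class_cusp)
  fix v m assume v: "bil d v v = 0" "prim v" "has_div d m v"
  have "2 dvd v $ 5 - 1" if "m = 2" using odd_if_even_div(1)[OF v] that by simp
  then show "cong_L (lstar d v) (of_int 3 *s wstar + of_int (int (p\<^sup>2)) *s vstar d) \<longleftrightarrow> m = 2 \<and> m dvd v $ 5 - 1"
    unfolding class_2_iff[OF v] by blast
qed auto

lemma index_p_not_dvd: "k \<in> {1..p - 1} \<Longrightarrow> \<not> p dvd k"
  using p_gt_3 by (auto dest: dvd_imp_le)

lemma index_2p_not_dvd: "k \<in> {0..(p - 3) div 2} \<Longrightarrow> \<not> p dvd 2 * k + 1"
  using p_gt_3 by (auto dest: dvd_imp_le)

lemma coprime_p: "\<not> p dvd m \<Longrightarrow> coprime (int m) (int p)"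
  using prime_p by (metis coprime_commute coprime_int_iff prime_imp_coprime)

lemma coprime_2p: "odd m \<Longrightarrow> \<not> p dvd m \<Longrightarrow> coprime (int m) (2 * int p)"
  using coprime_p[of m] by simp

lemma points_p:
  assumes k: "k \<in> {1..p - 1}"
  shows "bb_points_of_class d (Gamma_L d) 0 (int (2 * k * p)) = {cusp (int p) (int k)}"
proof (rule bb_points_of_class_cusp)
  show "coprime (int k) (int p)" by (rule coprime_p[OF index_p_not_dvd[OF k]])
  fix v m assume v: "bil d v v = 0" "prim v" "has_div d m v"
  show "cong_L (lstar d v) (of_int 0 *s wstar + of_int (int (2 * k * p)) *s vstar d) \<longleftrightarrow>
      m = int p \<and> m dvd v $ 5 - int k"
    by (rule class_p_iff[OF v index_p_not_dvd[OF k]])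
qed auto

lemma points_2p:
  assumes "k \<in> {0..(p - 3) div 2}"
  shows "bb_points_of_class d (Gamma_L d) 3 (int ((2 * k + 1) * p)) = {cusp (2 * int p) (int (2 * k + 1))}"
proof (rule bb_points_of_class_cusp)
  have k: "\<not> p dvd 2 * k + 1" by (rule index_2p_not_dvd[OF assms])
  show "coprime (int (2 * k + 1)) (2 * int p)" by (rule coprime_2p[OF _ k]) simp
  fix v m assume v: "bil d v v = 0" "prim v" "has_div d m v"
  show "cong_L (lstar d v) (of_int 3 *s wstar + of_int (int ((2 * k + 1) * p)) *s vstar d) \<longleftrightarrow>
      m = 2 * int p \<and> m dvd v $ 5 - int (2 * k + 1)"
    by (rule class_2p_iff[OF v k]) simp
qed auto

lemma all_points:
  "bb_point (Gamma_L d) ` isotropic d 1 =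
    {cusp 1 0, cusp 2 1} \<union> (\<lambda>k. cusp (int p) (int k)) ` {1..p - 1}
      \<union> (\<lambda>k. cusp (2 * int p) (int (2 * k + 1))) ` {0..(p - 3) div 2}" (is "_ = ?R")
proof (intro antisym subsetI)
  fix P assume "P \<in> bb_point (Gamma_L d) ` isotropic d 1"
  then obtain l where "P = bb_point (Gamma_L d) l" "l \<in> isotropic d 1" by blast
  then obtain v where v: "P = bb_point (Gamma_L d) (range (\<lambda>m. m *s v))" "prim v" "bil d v v = 0"
    unfolding isotropic_1_iff by blast
  obtain n where n: "has_div d n v" using has_div_exists[OF d_pos prim_nonzero[OF v(2)]] by blast
  have cv: "cusp_vector n u v" if "n dvd v $ 5 - u" for u
    using v n that by (simp add: cusp_vector_def)
  consider "n = 1" | "n = 2" | "n = int p" | "n = 2 * int p" using div_cases[OF v(3,2) n] by blast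
  then show "P \<in> ?R"
  proof cases
    case 1
    then have "P = cusp 1 0" using bb_point_cusp[OF cv[of 0]] v(1) by simp
    then show ?thesis by blast
  next
    case 2
    then have "n dvd v $ 5 - 1" using odd_if_even_div(1)[OF v(3,2) n] by simp
    from bb_point_cusp[OF cv[OF this]] have "P = cusp 2 1" using v(1) 2 by simp
    then show ?thesis by blast
  next
    case 3
    \<comment> \<open>All nonzero residues modulo p are listed, so the sign of v need not be
      adjusted here; the points for k and p - k may coincide.\<close>
    define k where "k = nat (v $ 5 mod int p)"
    have p0: "int p > 0" using p_gt_3 by simp
    have ik: "int k = v $ 5 mod int p" using p0 by (simp add: k_def)
    have "\<not> int p dvd v $ 5" using p_not_dvd_5[OF v(3,2) n] 3 by simp
    then have "v $ 5 mod int p \<noteq> 0" by (simp add: dvd_eq_mod_eq_0)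
    moreover have "0 \<le> v $ 5 mod int p" "v $ 5 mod int p < int p" using p0 by simp_all
    ultimately have "int k > 0" "int k < int p" unfolding ik by linarith+
    then have "k \<in> {1..p - 1}" by auto
    moreover have "n dvd v $ 5 - int k" unfolding ik 3 by (simp add: mod_eq_dvd_iff[symmetric])
    from bb_point_cusp[OF cv[OF this]] have "P = cusp (int p) (int k)" using v(1) 3 by simp
    ultimately show ?thesis by blast
  next
    case 4
    define m where "m = v $ 5 mod (2 * int p)"
    have p0: "2 * int p > 0" using p_gt_3 by simp
    have m: "0 \<le> m" "m < 2 * int p" unfolding m_def using p0 by simp_all
    have nm: "n dvd v $ 5 - m" unfolding m_def 4 by (simp add: mod_eq_dvd_iff[symmetric])
    then have "2 dvd v $ 5 - m" "int p dvd v $ 5 - m" unfolding 4 by (auto dest: dvd_mult_left dvd_mult_right)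
    moreover have "odd (v $ 5)" "\<not> int p dvd v $ 5"
      using odd_if_even_div(1)[OF v(3,2) n] p_not_dvd_5[OF v(3,2) n] 4 by simp_all
    ultimately have om: "odd m" "\<not> int p dvd m" by (auto simp: dvd_diff_right_iff dvd_diff_left_iff)
    \<comment> \<open>The listed odd numbers 2k + 1 are those below p. A residue m above p is
      replaced by 2p - m, that is, by the residue of -v, and m = p is excluded because p does not
      divide m.\<close>
    have "\<exists>k\<in>{0..(p - 3) div 2}. int (2 * k + 1) = m \<or> int (2 * k + 1) = 2 * int p - m"
    proof -
      obtain j where j: "m = 2 * j + 1" using om(1) by (rule oddE)
      obtain q where q: "int p = 2 * q + 1" using odd_p by (metis even_of_nat oddE)
      have "m \<noteq> int p" using om(2) by auto
      then consider "m < int p" | "m > int p" by linarith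
      then show ?thesis
      proof cases
        case 1
        then have "0 \<le> j" "j \<le> q - 1" using j q m by linarith+
        then show ?thesis using j q by (intro bexI[of _ "nat j"]) auto
      next
        case 2
        define i where "i = 2 * q - j"
        have "0 \<le> i" "i \<le> q - 1" using 2 j q m unfolding i_def by linarith+
        moreover have "2 * i + 1 = 2 * int p - m" unfolding i_def q j by simp
        ultimately show ?thesis using q by (intro bexI[of _ "nat i"]) auto
      qed
    qed
    then obtain k where k: "k \<in> {0..(p - 3) div 2}" "int (2 * k + 1) = m \<or> int (2 * k + 1) = 2 * int p - m" by blast
    have "P = cusp (2 * int p) (int (2 * k + 1))"
      using k(2)
    proof
      assume "int (2 * k + 1) = m"
      then show ?thesis using bb_point_cusp[OF cv[OF nm]] v(1) 4 by simp
    next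
      \<comment> \<open>The vector -v generates the same line and has the required residue.\<close>
      assume e: "int (2 * k + 1) = 2 * int p - m"
      have mv: "(- v) $ 5 - (2 * int p - m) = - (v $ 5 - m) - 2 * int p" by simp
      have "n dvd (- v) $ 5 - (2 * int p - m)"
        unfolding mv using nm 4 by (intro dvd_diff) (simp_all only: dvd_minus_iff dvd_refl)
      moreover have "prim (- v)" "bil d (- v) (- v) = 0"
        using v by (simp_all add: prim_def bil_linear)
      moreover have "has_div d n (- v)"
      proof -
        have "bil d (- v) z = bil d v (- z)" "bil d v z = bil d (- v) (- z)" for z by (simp_all add: bil_linear)
        then have "range (bil d (- v)) = range (bil d v)"
          by (intro antisym image_subsetI) (blast intro: range_eqI)+
        then show ?thesis using n by (simp add: has_div_def)
      qed
      ultimately have "cusp_vector n (int (2 * k + 1)) (- v)" unfolding cusp_vector_def e by blast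
      from bb_point_cusp[OF this] have "bb_point (Gamma_L d) (range (\<lambda>m. m *s (- v))) = cusp n (int (2 * k + 1))" .
      moreover have "range (\<lambda>m. m *s (- v)) = range (\<lambda>m. m *s v)"
      proof -
        have "m *s (- v) = (- m) *s v" "m *s v = (- m) *s (- v)" for m by (simp_all add: vec_eq_iff)
        then show ?thesis by (intro antisym image_subsetI) (blast intro: range_eqI)+
      qed
      ultimately show ?thesis using v(1) 4 by simp
    qed
    then show ?thesis using k(1) by blast
  qed
next
  have pt: "cusp n u \<in> bb_point (Gamma_L d) ` isotropic d 1"
    if nu: "n \<in> {1, 2, int p, 2 * int p}" "coprime u n" for n u
  proof -
    obtain v where v: "cusp_vector n u v" using cusp_vector_exists[OF nu] by blast
    then have "range (\<lambda>m. m *s v) \<in> isotropic d 1" unfolding range_isotropic_iff cusp_vector_def by blast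
    then show ?thesis using bb_point_cusp[OF v] by blast
  qed
  have kp: "coprime (int k) (int p)" if "k \<in> {1..p - 1}" for k
    by (rule coprime_p[OF index_p_not_dvd[OF that]])
  have k2p: "coprime (int (2 * k + 1)) (2 * int p)" if "k \<in> {0..(p - 3) div 2}" for k
    by (rule coprime_2p[OF _ index_2p_not_dvd[OF that]]) simp
  fix P assume "P \<in> ?R"
  then consider "P = cusp 1 0" | "P = cusp 2 1" | k where "k \<in> {1..p - 1}" "P = cusp (int p) (int k)"
    | k where "k \<in> {0..(p - 3) div 2}" "P = cusp (2 * int p) (int (2 * k + 1))" by blast
  then show "P \<in> bb_point (Gamma_L d) ` isotropic d 1"
  proof cases
    case 1
    then show ?thesis using pt[of 1 0] by simp
  next
    case 2
    then show ?thesis using pt[of 2 1] by simp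
  next
    case 3
    then show ?thesis using pt[OF _ kp[OF 3(1)]] by simp
  next
    case 4
    then show ?thesis using pt[OF _ k2p[OF 4(1)]] by simp
  qed
qed

section \<open>Incidence of boundary points and boundary curves\<close>

context
  fixes \<Omega> :: "(complex ^ 6) set"
  assumes \<Omega>: "\<Omega> \<in> components (period_cone d)"
begin

lemma cusp_in_closure_iff:
  assumes E: "E \<in> isotropic d 2" and a: "has_type d a E" "a > 0"
    and i: "int i \<in> {1, 2, int p, 2 * int p}" "coprime u (int i)"
  shows "cusp (int i) u \<in> baily_borel d \<Omega> (Gamma_L d) closure_of bb_curve \<Omega> (Gamma_L d) E \<longleftrightarrow> i dvd a"
proof -
  obtain v where v: "cusp_vector (int i) u v" using cusp_vector_exists[OF i] by blast
  have l: "range (\<lambda>m. m *s v) \<in> isotropic d 1" using v unfolding range_isotropic_iff cusp_vector_def by blast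
  obtain e f e' f' where ad: "adapted d a e f e' f'" and Ep: "E = plane e f"
    using has_type_adapted[OF E a] by blast
  have gram: "bil d e e = 0" "bil d e f = 0" "bil d f f = 0" "bil d f f' = 1" "bil d e f' = 0"
    "bil d e e' = int a" "bil d f e' = 0" "bil d f e = 0" "prim e" "has_div d (int a) e"
    using ad bil_commute[of d f e] by (auto simp: adapted_def)
  have "i dvd a" if g: "g \<in> Gamma_L d" "(*v) g ` range (\<lambda>m. m *s v) \<subseteq> E" for g
  proof -
    have "range (\<lambda>m. m *s (g *v v)) \<in> isotropic d 1"
      using isotropic_image[OF d_pos g(1) l] by (simp only: image_range)
    then have prim: "prim (g *v v)" unfolding range_isotropic_iff by blast
    have "equivalent d v (g *v v)" using g(1) by (auto simp: equivalent_def)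
    then have div: "has_div d (int i) (g *v v)"
      using v equivalent_has_div[OF d_pos] by (auto simp: cusp_vector_def)
    have "1 *s (g *v v) \<in> (*v) g ` range (\<lambda>m. m *s v)" unfolding image_range by (rule rangeI)
    then have "g *v v \<in> plane e f" using g(2) Ep by auto
    then obtain x y where xy: "g *v v = x *s e + y *s f" unfolding plane_def by blast
    have "\<forall>z. int i dvd bil d (g *v v) z" using has_div_dvd[OF div, of "int i"] by simp
    then have "int i dvd bil d (g *v v) f'" "int i dvd bil d (g *v v) e'" by blast+
    then have d: "int i dvd y" "int i dvd x * int a" using gram by (simp_all add: xy bil_linear)
    \<comment> \<open>Since i divides y, a common divisor of i and x would divide the whole
      primitive vector.\<close>
    have "coprime (int i) x"
    proof (rule coprimeI)
      fix c assume c: "c dvd int i" "c dvd x"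
      then have "c dvd y" using d(1) dvd_trans by blast
      then have "\<forall>j. c dvd (g *v v) $ j" using c(2) by (simp add: xy)
      then show "is_unit c" using prim by (simp add: prim_def)
    qed
    then have "int i dvd int a" using d(2) by (simp add: coprime_dvd_mult_right_iff)
    then show ?thesis by simp
  qed
  moreover have "\<exists>w. cusp_vector (int i) u w \<and> range (\<lambda>m. m *s w) \<subseteq> E" if ia: "i dvd a"
  proof -
    have "coprime (e $ 5) (int i)"
      using coprime_5_div[OF gram(1,9,10)] ia by (meson coprime_divisors dvd_refl int_dvd_int_iff)
    \<comment> \<open>r inverts the fifth coordinate of e modulo i. With j = u r the vector w = j e
      + i f has fifth coordinate u modulo i, and its pairings generate the multiples of i because
      (w, f') = i.\<close>
    then obtain r s where rs: "r * e $ 5 + s * int i = 1" using bezout_int[of "e $ 5" "int i"] by auto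
    define j where "j = u * r"
    define w where "w = j *s e + int i *s f"
    have "coprime r (int i)"
    proof (rule coprimeI)
      fix c assume "c dvd r" "c dvd int i"
      then have "c dvd r * e $ 5 + s * int i" by simp
      then show "is_unit c" by (simp only: rs)
    qed
    then have cop: "coprime j (int i)" using i(2) by (simp add: j_def)
    have i0: "int i > 0" using i(1) p_gt_3 by auto
    have "bil d w w = 0" using gram by (simp add: w_def bil_linear)
    moreover have "prim w"
      unfolding prim_def
    proof (intro allI impI)
      fix q assume "\<forall>k. q dvd w $ k"
      then obtain z where z: "w = q *s z" by (rule dvd_vecE)
      have wE: "w \<in> E" unfolding w_def Ep by (rule plane_memberI)
      have "w \<noteq> 0"
      proof
        assume "w = 0"
        then have "int i = 0" using adapted_indep[OF ad a(2), of j "int i"] by (simp add: w_def)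
        then show False using i0 by simp
      qed
      then have "q \<noteq> 0" using z by auto
      then have "z \<in> E" using E wE z unfolding isotropic_def by blast
      then obtain x y where "z = x *s e + y *s f" unfolding Ep plane_def by blast
      then have "(j - q * x) *s e + (int i - q * y) *s f = 0"
        using z by (simp add: w_def vec_eq_iff algebra_simps)
      from adapted_indep[OF ad a(2) this] have "j = q * x" "int i = q * y" by simp_all
      then show "q dvd 1" using cop by (metis coprime_common_divisor dvd_triv_left)
    qed
    moreover have "has_div d (int i) w"
      unfolding has_div_def
    proof (intro conjI i0 antisym subsetI)
      fix x assume "x \<in> range (bil d w)"
      then obtain z where z: "x = j * bil d e z + int i * bil d f z" by (auto simp: w_def bil_linear)
      have "int a dvd bil d e z" using has_div_dvd[OF gram(10), of "int a"] by simp
      then have "int i dvd bil d e z" using ia dvd_trans int_dvd_int_iff by blast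
      then have "int i dvd x" unfolding z by simp
      then show "x \<in> range (\<lambda>k. int i * k)" by blast
    next
      fix x assume "x \<in> range (\<lambda>k. int i * k)"
      then obtain k where "x = int i * k" by blast
      then have "x = bil d w (k *s f')" using gram by (simp add: w_def bil_linear)
      then show "x \<in> range (bil d w)" by blast
    qed
    moreover have "int i dvd w $ 5 - u"
    proof -
      have "u * (r * e $ 5 + s * int i) = u" by (simp add: rs)
      then have "w $ 5 - u = int i * (f $ 5 - u * s)" by (simp add: w_def j_def algebra_simps)
      then show ?thesis by simp
    qed
    ultimately have "cusp_vector (int i) u w" unfolding cusp_vector_def by blast
    moreover have "range (\<lambda>m. m *s w) \<subseteq> E"
    proof
      fix z assume "z \<in> range (\<lambda>m. m *s w)"
      then obtain m where "z = m *s w" by blast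
      then have "z = (m * j) *s e + (m * int i) *s f"
        by (simp add: w_def vec_eq_iff algebra_simps)
      then show "z \<in> E" unfolding Ep using plane_memberI by metis
    qed
    ultimately show ?thesis by blast
  qed
  ultimately show ?thesis
  proof -
    assume 1: "\<And>g. g \<in> Gamma_L d \<Longrightarrow> (*v) g ` range (\<lambda>m. m *s v) \<subseteq> E \<Longrightarrow> i dvd a"
      and 2: "i dvd a \<Longrightarrow> \<exists>w. cusp_vector (int i) u w \<and> range (\<lambda>m. m *s w) \<subseteq> E"
    show ?thesis
    proof
      assume "cusp (int i) u \<in> baily_borel d \<Omega> (Gamma_L d) closure_of bb_curve \<Omega> (Gamma_L d) E"
      then have "\<exists>g\<in>Gamma_L d. (*v) g ` range (\<lambda>m. m *s v) \<subseteq> E"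
        unfolding bb_point_cusp[OF v, symmetric] point_in_closure_iff[OF \<Omega> E l] .
      then show "i dvd a" using 1 by blast
    next
      assume "i dvd a"
      then obtain w where w: "cusp_vector (int i) u w" "range (\<lambda>m. m *s w) \<subseteq> E" using 2 by blast
      have l': "range (\<lambda>m. m *s w) \<in> isotropic d 1"
        using w(1) unfolding range_isotropic_iff cusp_vector_def by blast
      have "(*v) (mat 1) ` range (\<lambda>m. m *s w) \<subseteq> E" using w(2) by simp
      then show "cusp (int i) u \<in> baily_borel d \<Omega> (Gamma_L d) closure_of bb_curve \<Omega> (Gamma_L d) E"
        unfolding bb_point_cusp[OF w(1), symmetric] point_in_closure_iff[OF \<Omega> E l'] using Gamma_L_one by blast
    qed
  qed
qed

text \<open>The group preserves boundary components of either dimension, and on them (z, cnj z) = 0,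
  so their orbits never meet orbits of the domain.\<close>

lemma boundary_eq:
  "bb_boundary d \<Omega> (Gamma_L d) =
     \<Union> (bb_curve \<Omega> (Gamma_L d) ` isotropic d 2) \<union> bb_point (Gamma_L d) ` isotropic d 1"
proof -
  have "bb_orbit (Gamma_L d) P \<notin> bb_orbit (Gamma_L d) ` line ` \<Omega>"
    if P: "\<And>g. g \<in> Gamma_L d \<Longrightarrow> act g P \<notin> line ` \<Omega>" for P
  proof
    assume "bb_orbit (Gamma_L d) P \<in> bb_orbit (Gamma_L d) ` line ` \<Omega>"
    then obtain Q where Q: "Q \<in> line ` \<Omega>" "bb_orbit (Gamma_L d) P = bb_orbit (Gamma_L d) Q" by blast
    then show False using orb_eqD[OF \<Omega> Q(2)] P by blast
  qed
  note notin = this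
  have 1: "bb_orbit (Gamma_L d) P \<notin> bb_orbit (Gamma_L d) ` line ` \<Omega>"
    if "E \<in> isotropic d 2" "P \<in> half_plane \<Omega> E" for E P
    using half_plane_not_in_domain[OF \<Omega> isotropic_image[OF d_pos _ that(1)] act_half_plane[OF \<Omega> d_pos _ that(2)]]
    by (intro notin)
  have 2: "bb_orbit (Gamma_L d) (cspan l) \<notin> bb_orbit (Gamma_L d) ` line ` \<Omega>"
    if "l \<in> isotropic d 1" for l
    using cspan_not_in_domain[OF \<Omega> isotropic_image[OF d_pos _ that]] by (intro notin) (simp add: act_cspan)
  have "(\<Union>E\<in>isotropic d 2. bb_curve \<Omega> (Gamma_L d) E) \<inter> bb_orbit (Gamma_L d) ` line ` \<Omega> = {}"
    unfolding bb_curve_def using 1 by blast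
  moreover have "bb_point (Gamma_L d) ` isotropic d 1 \<inter> bb_orbit (Gamma_L d) ` line ` \<Omega> = {}"
    unfolding bb_point_def using 2 by blast
  moreover have "topspace (baily_borel d \<Omega> (Gamma_L d)) = bb_orbit (Gamma_L d) ` line ` \<Omega>
      \<union> (\<Union>E\<in>isotropic d 2. bb_curve \<Omega> (Gamma_L d) E) \<union> bb_point (Gamma_L d) ` isotropic d 1"
    unfolding topspace_bb[OF \<Omega>] topspace_satake[OF \<Omega>] bb_curve_def bb_point_def
    by (simp only: image_Un image_UN image_image)
  moreover have "T - D = C \<union> B" if "C \<inter> D = {}" "B \<inter> D = {}" "T = D \<union> C \<union> B"
    for T D C B :: "(complex ^ 6) set set set"
    using that by blast
  ultimately show ?thesis unfolding bb_boundary_def by (simp only:)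
qed

end

end

theorem theorem3p17:
  fixes p d :: nat and \<Omega> :: "(complex ^ 6) set" and G :: "(int ^ 6 ^ 6) set"
  assumes "prime p" "p > 3"
    and "d = p\<^sup>2"
    and "G = Gamma_L d"
    and "\<Omega> \<in> components (period_cone d)"
  shows "(\<forall>E\<in>isotropic d 2. \<exists>a\<in>{1, 2, p, 2 * p}. has_type d a E)
       \<and> (\<forall>a\<in>{1, 2, p, 2 * p}. \<exists>E\<in>isotropic d 2. has_type d a E)
       \<and> (\<forall>E\<in>isotropic d 2. has_type d 1 E \<longrightarrow>
            curve_iso (bb_curve_structure d \<Omega> G E) (upper_half_plane_quotient PSL2Z))
       \<and> (\<forall>a\<in>{2, p, 2 * p}. \<forall>E\<in>isotropic d 2. has_type d a E \<longrightarrow>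
            curve_iso (bb_curve_structure d \<Omega> G E) (upper_half_plane_quotient (moebius_map ` Gamma1 a)))
       \<and> (\<exists>p1 p2 pp p2p.
            bb_points_of_class d G 0 0 = {p1}
          \<and> bb_points_of_class d G 3 (int (p\<^sup>2)) = {p2}
          \<and> (\<forall>k\<in>{1..p - 1}. bb_points_of_class d G 0 (int (2 * k * p)) = {pp k})
          \<and> (\<forall>k\<in>{0..(p - 3) div 2}. bb_points_of_class d G 3 (int ((2 * k + 1) * p)) = {p2p k})
          \<and> bb_point G ` isotropic d 1 = {p1, p2} \<union> pp ` {1..p - 1} \<union> p2p ` {0..(p - 3) div 2}
          \<and> bb_boundary d \<Omega> G =
              \<Union> (bb_curve \<Omega> G ` isotropic d 2) \<union>
              ({p1, p2} \<union> pp ` {1..p - 1} \<union> p2p ` {0..(p - 3) div 2})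
          \<and> (\<forall>a\<in>{1, 2, p, 2 * p}. \<forall>E\<in>isotropic d 2. has_type d a E \<longrightarrow>
               (p1 \<in> baily_borel d \<Omega> G closure_of bb_curve \<Omega> G E \<longleftrightarrow> 1 dvd a)
             \<and> (p2 \<in> baily_borel d \<Omega> G closure_of bb_curve \<Omega> G E \<longleftrightarrow> 2 dvd a)
             \<and> (\<forall>k\<in>{1..p - 1}.
                  pp k \<in> baily_borel d \<Omega> G closure_of bb_curve \<Omega> G E \<longleftrightarrow> p dvd a)
             \<and> (\<forall>k\<in>{0..(p - 3) div 2}.
                  p2p k \<in> baily_borel d \<Omega> G closure_of bb_curve \<Omega> G E \<longleftrightarrow> 2 * p dvd a)))"
proof -
  interpret paramodular p d by unfold_locales (rule assms)+
  have \<Omega>: "\<Omega> \<in> components (period_cone d)" by fact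
  have G: "G = Gamma_L d" by fact
  have iso: "curve_iso (bb_curve_structure d \<Omega> G E) (upper_half_plane_quotient (moebius_map ` Gamma1 a))"
    if E: "E \<in> isotropic d 2" "has_type d a E" "a \<in> {1, 2, p, 2 * p}" for a E
  proof -
    have "a > 0" using E(3) p_gt_3 by auto
    then obtain e f e' f' where "chart d \<Omega> E a e f e' f'" using chart_exists[OF d_pos \<Omega> E(1,2)] by blast
    then show ?thesis unfolding G by (rule curve_iso_quotient[OF \<Omega> E(1)])
  qed
  \<comment> \<open>Type 1 is the general case with vacuous congruences; on transformations the
    group is then \<open>PSL2Z\<close>.\<close>
  have "Gamma1 1 = SL2Z" by (simp add: Gamma1_def)
  then have "moebius_map ` Gamma1 1 = PSL2Z" by (simp add: PSL2Z_def)
  then have iso1: "curve_iso (bb_curve_structure d \<Omega> G E) (upper_half_plane_quotient PSL2Z)"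
    if "E \<in> isotropic d 2" "has_type d 1 E" for E
    using iso[OF that] by simp
  have closure: "cusp (int i) u \<in> baily_borel d \<Omega> G closure_of bb_curve \<Omega> G E \<longleftrightarrow> i dvd a"
    if "E \<in> isotropic d 2" "has_type d a E" "a \<in> {1, 2, p, 2 * p}"
      "int i \<in> {1, 2, int p, 2 * int p}" "coprime u (int i)" for E a i u
    unfolding G using cusp_in_closure_iff[OF \<Omega> that(1,2) _ that(4,5)] that(3) p_gt_3 by auto
  have kp: "coprime (int k) (int p)" if "k \<in> {1..p - 1}" for k
    by (rule coprime_p[OF index_p_not_dvd[OF that]])
  have k2p: "coprime (int (2 * k + 1)) (int (2 * p))" if "k \<in> {0..(p - 3) div 2}" for k
    using coprime_2p[OF _ index_2p_not_dvd[OF that]] by simp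
  let ?p = "\<lambda>k. cusp (int p) (int k)" and ?q = "\<lambda>k. cusp (int (2 * p)) (int (2 * k + 1))"
  have q: "int (2 * p) = 2 * int p" by simp
  show ?thesis
  proof (intro conjI, goal_cases)
    case 5
    show ?case
    proof (rule exI[of _ "cusp (int 1) 0"], rule exI[of _ "cusp (int 2) 1"], rule exI[of _ ?p],
        rule exI[of _ ?q], intro conjI ballI impI)
      show points: "bb_point G ` isotropic d 1 =
          {cusp (int 1) 0, cusp (int 2) 1} \<union> ?p ` {1..p - 1} \<union> ?q ` {0..(p - 3) div 2}"
        unfolding G q using all_points by simp
      show "bb_boundary d \<Omega> G = \<Union> (bb_curve \<Omega> G ` isotropic d 2) \<union>
          ({cusp (int 1) 0, cusp (int 2) 1} \<union> ?p ` {1..p - 1} \<union> ?q ` {0..(p - 3) div 2})"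
        unfolding points[symmetric] unfolding G by (rule boundary_eq[OF \<Omega>])
    next
      fix a E assume aE: "a \<in> {1, 2, p, 2 * p}" "E \<in> isotropic d 2" "has_type d a E"
      note cl = closure[OF aE(2,3,1)]
      show "cusp (int 1) 0 \<in> baily_borel d \<Omega> G closure_of bb_curve \<Omega> G E \<longleftrightarrow> 1 dvd a"
        by (rule cl) simp_all
      show "cusp (int 2) 1 \<in> baily_borel d \<Omega> G closure_of bb_curve \<Omega> G E \<longleftrightarrow> 2 dvd a"
        by (rule cl) simp_all
      show "?p k \<in> baily_borel d \<Omega> G closure_of bb_curve \<Omega> G E \<longleftrightarrow> p dvd a" if "k \<in> {1..p - 1}" for k
        by (rule cl[OF _ kp[OF that]]) simp
      show "?q k \<in> baily_borel d \<Omega> G closure_of bb_curve \<Omega> G E \<longleftrightarrow> 2 * p dvd a"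
        if "k \<in> {0..(p - 3) div 2}" for k
        by (rule cl[OF _ k2p[OF that]]) simp
    qed (simp_all only: G of_nat_1 of_nat_numeral q points_1 points_2 points_p points_2p)
  qed (use has_type_exists type_exists iso iso1 in auto)
qed

end
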